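(* Let $\mathcal A$ be a finite multitensor category. Then there are isomorphisms $$\mathrm N^{\rm l}_{\mathcal A}\;\cong\;D_{\mathcal A}\otimes{}^{\vee\vee}{-}\;\cong\;{-}^{\vee\vee}\otimes D_{\mathcal A}\qquad\text{and}\qquad \mathrm N^{\rm r}_{\mathcal A}\;\cong\;\widetilde D_{\mathcal A}\otimes{-}^{\vee\vee}\;\cong\;{}^{\vee\vee}{-}\otimes\widetilde D_{\mathcal A}$$ of functors, with $$D_{\mathcal A}:=\mathrm N^{\rm l}_{\mathcal A}(\mathbf 1)=\int_{a\in\mathcal A}\mathrm{Hom}_{\mathcal A}(a,\mathbf 1)\otimes a\qquad\text{and}\qquad\widetilde D_{\mathcal A}:=\mathrm N^{\rm r}_{\mathcal A}(\mathbf 1)=\int^{a\in\mathcal A}\mathrm{Hom}_{\mathcal A}(\mathbf 1,a)^*\otimes a.$$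
   Context: $\Bbbk$ is an algebraically closed field; all categories and functors are $\Bbbk$-linear. A finite linear category is one equivalent to the category of finite-dimensional modules over a finite-dimensional $\Bbbk$-algebra. A finite multitensor category is a finite linear category that is rigid monoidal with bilinear tensor product (no condition $\mathrm{End}(\mathbf 1)\cong\Bbbk$ is imposed). The right dual $c^\vee$ comes with $c^\vee\otimes c\to\mathbf 1$, $\mathbf 1\to c\otimes c^\vee$; the left dual ${}^\vee c$ with $c\otimes{}^\vee c\to\mathbf 1$, $\mathbf 1\to{}^\vee c\otimes c$. The Nakayama functor and its left exact analogue for a finite linear category $\mathcal X$ are $\mathrm N^{\rm r}_{\mathcal X}=\int^{x\in\mathcal X}\mathrm{Hom}_{\mathcal X}(-,x)^*\otimes x$ (coend) and $\mathrm N^{\rm l}_{\mathcal X}=\int_{x\in\mathcal X}\mathrm{Hom}_{\mathcal X}(x,-)\otimes x$ (end), where for a finite-dimensional vector space $v$, $v\otimes x$ is the object with $\mathrm{Hom}_{\mathcal X}(-,v\otimes x)\cong v\otimes_{\Bbbk}\mathrm{Hom}_{\mathcal X}(-,x)$ and $v^*$ is the dual. *)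

theory Defs
  imports
    "Jordan_Normal_Form.VS_Connect"
    "HOL-Library.Poly_Mapping"
    "HOL-Library.FuncSet"
begin

section \<open>Categories and functors\<close>

record ('o, 'm) cat =
  Obj :: "'o set"
  Arr :: "'m set"
  Dom :: "'m \<Rightarrow> 'o"
  Cod :: "'m \<Rightarrow> 'o"
  Idt :: "'o \<Rightarrow> 'm"
  Comp :: "'m \<Rightarrow> 'm \<Rightarrow> 'm" (infixl "\<cdot>\<index>" 70)

definition Hom :: "('o, 'm, 'z) cat_scheme \<Rightarrow> 'o \<Rightarrow> 'o \<Rightarrow> 'm set" where
  "Hom C a b = {f \<in> Arr C. Dom C f = a \<and> Cod C f = b}"

locale category =
  fixes C :: "('o, 'm, 'z) cat_scheme" (structure)
  assumes dom_cod: "f \<in> Arr C \<Longrightarrow> Dom C f \<in> Obj C \<and> Cod C f \<in> Obj C"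
    and id_in_hom: "a \<in> Obj C \<Longrightarrow> Idt C a \<in> Hom C a a"
    and comp_in_hom: "f \<in> Hom C a b \<Longrightarrow> g \<in> Hom C b c \<Longrightarrow> g \<cdot> f \<in> Hom C a c"
    and comp_id_right: "f \<in> Hom C a b \<Longrightarrow> f \<cdot> Idt C a = f"
    and comp_id_left: "f \<in> Hom C a b \<Longrightarrow> Idt C b \<cdot> f = f"
    and comp_assoc: "f \<in> Hom C a b \<Longrightarrow> g \<in> Hom C b c \<Longrightarrow> h \<in> Hom C c d \<Longrightarrow>
      (h \<cdot> g) \<cdot> f = h \<cdot> (g \<cdot> f)"

definition inverse_arrows ::
  "('o, 'm, 'z) cat_scheme \<Rightarrow> 'm \<Rightarrow> 'm \<Rightarrow> bool" where
  "inverse_arrows C f g \<longleftrightarrow>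
     f \<in> Hom C (Dom C f) (Cod C f) \<and> g \<in> Hom C (Cod C f) (Dom C f) \<and>
     g \<cdot>\<^bsub>C\<^esub> f = Idt C (Dom C f) \<and> f \<cdot>\<^bsub>C\<^esub> g = Idt C (Cod C f)"

definition iso_arrow :: "('o, 'm, 'z) cat_scheme \<Rightarrow> 'm \<Rightarrow> bool" where
  "iso_arrow C f \<longleftrightarrow> (\<exists>g. inverse_arrows C f g)"

definition inv_arrow :: "('o, 'm, 'z) cat_scheme \<Rightarrow> 'm \<Rightarrow> 'm" where
  "inv_arrow C f = (THE g. inverse_arrows C f g)"

definition op_cat :: "('o, 'm, 'z) cat_scheme \<Rightarrow> ('o, 'm) cat" where
  "op_cat C = \<lparr>Obj = Obj C, Arr = Arr C, Dom = Cod C, Cod = Dom C, Idt = Idt C,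
     Comp = (\<lambda>g f. f \<cdot>\<^bsub>C\<^esub> g)\<rparr>"

definition prod_cat ::
  "('o, 'm, 'z) cat_scheme \<Rightarrow> ('p, 'n, 'y) cat_scheme \<Rightarrow> ('o \<times> 'p, 'm \<times> 'n) cat" where
  "prod_cat C D = \<lparr>Obj = Obj C \<times> Obj D, Arr = Arr C \<times> Arr D,
     Dom = map_prod (Dom C) (Dom D), Cod = map_prod (Cod C) (Cod D),
     Idt = map_prod (Idt C) (Idt D),
     Comp = (\<lambda>(g, g') (f, f'). (g \<cdot>\<^bsub>C\<^esub> f, g' \<cdot>\<^bsub>D\<^esub> f'))\<rparr>"

record ('o, 'm, 'p, 'n) fun_data =
  on_obj :: "'o \<Rightarrow> 'p"
  on_arr :: "'m \<Rightarrow> 'n"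

locale is_functor = C: category C + D: category D
  for C :: "('o, 'm, 'z) cat_scheme" and D :: "('p, 'n, 'y) cat_scheme" +
  fixes F :: "('o, 'm, 'p, 'n) fun_data"
  assumes obj_map: "a \<in> Obj C \<Longrightarrow> on_obj F a \<in> Obj D"
    and arr_map: "f \<in> Hom C a b \<Longrightarrow> on_arr F f \<in> Hom D (on_obj F a) (on_obj F b)"
    and id_map: "a \<in> Obj C \<Longrightarrow> on_arr F (Idt C a) = Idt D (on_obj F a)"
    and comp_map: "f \<in> Hom C a b \<Longrightarrow> g \<in> Hom C b c \<Longrightarrow>
      on_arr F (g \<cdot>\<^bsub>C\<^esub> f) = on_arr F g \<cdot>\<^bsub>D\<^esub> on_arr F f"

definition id_functor :: "('o, 'm, 'o, 'm) fun_data" where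
  "id_functor = \<lparr>on_obj = (\<lambda>a. a), on_arr = (\<lambda>f. f)\<rparr>"

definition comp_functor ::
  "('p, 'n, 'q, 'l) fun_data \<Rightarrow> ('o, 'm, 'p, 'n) fun_data \<Rightarrow> ('o, 'm, 'q, 'l) fun_data" where
  "comp_functor G F = \<lparr>on_obj = on_obj G \<circ> on_obj F, on_arr = on_arr G \<circ> on_arr F\<rparr>"

definition natural_isomorphism ::
  "('o, 'm, 'z) cat_scheme \<Rightarrow> ('p, 'n, 'y) cat_scheme \<Rightarrow>
   ('o, 'm, 'p, 'n) fun_data \<Rightarrow> ('o, 'm, 'p, 'n) fun_data \<Rightarrow> ('o \<Rightarrow> 'n) \<Rightarrow> bool" where
  "natural_isomorphism C D F G \<eta> \<longleftrightarrow> is_functor C D F \<and> is_functor C D G \<and>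
     (\<forall>a\<in>Obj C. \<eta> a \<in> Hom D (on_obj F a) (on_obj G a) \<and> iso_arrow D (\<eta> a)) \<and>
     (\<forall>a\<in>Obj C. \<forall>b\<in>Obj C. \<forall>f\<in>Hom C a b.
        \<eta> b \<cdot>\<^bsub>D\<^esub> on_arr F f = on_arr G f \<cdot>\<^bsub>D\<^esub> \<eta> a)"

definition isomorphic_functors ::
  "('o, 'm, 'z) cat_scheme \<Rightarrow> ('p, 'n, 'y) cat_scheme \<Rightarrow>
   ('o, 'm, 'p, 'n) fun_data \<Rightarrow> ('o, 'm, 'p, 'n) fun_data \<Rightarrow> bool" where
  "isomorphic_functors C D F G \<longleftrightarrow> (\<exists>\<eta>. natural_isomorphism C D F G \<eta>)"


section \<open>Ends and coends\<close>

text \<open>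
  A bifunctor \<open>F\<close> from \<open>prod_cat (op_cat C) C\<close> to \<open>D\<close> acts on a pair of arrows
  \<open>(f, g)\<close> of \<open>C\<close>, contravariantly in \<open>f\<close>.
\<close>

definition dinatural_to ::
  "('o, 'm, 'z) cat_scheme \<Rightarrow> ('p, 'n, 'y) cat_scheme \<Rightarrow>
   ('o \<times> 'o, 'm \<times> 'm, 'p, 'n) fun_data \<Rightarrow> 'p \<Rightarrow> ('o \<Rightarrow> 'n) \<Rightarrow> bool" where
  "dinatural_to C D F e \<pi> \<longleftrightarrow> e \<in> Obj D \<and>
     (\<forall>a\<in>Obj C. \<pi> a \<in> Hom D e (on_obj F (a, a))) \<and>
     (\<forall>a\<in>Obj C. \<forall>b\<in>Obj C. \<forall>f\<in>Hom C a b.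
        on_arr F (Idt C a, f) \<cdot>\<^bsub>D\<^esub> \<pi> a = on_arr F (f, Idt C b) \<cdot>\<^bsub>D\<^esub> \<pi> b)"

definition is_end ::
  "('o, 'm, 'z) cat_scheme \<Rightarrow> ('p, 'n, 'y) cat_scheme \<Rightarrow>
   ('o \<times> 'o, 'm \<times> 'm, 'p, 'n) fun_data \<Rightarrow> 'p \<Rightarrow> ('o \<Rightarrow> 'n) \<Rightarrow> bool" where
  "is_end C D F e \<pi> \<longleftrightarrow> is_functor (prod_cat (op_cat C) C) D F \<and> dinatural_to C D F e \<pi> \<and>
     (\<forall>d \<sigma>. dinatural_to C D F d \<sigma> \<longrightarrow>
        (\<exists>!t. t \<in> Hom D d e \<and> (\<forall>a\<in>Obj C. \<pi> a \<cdot>\<^bsub>D\<^esub> t = \<sigma> a)))"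

definition dinatural_from ::
  "('o, 'm, 'z) cat_scheme \<Rightarrow> ('p, 'n, 'y) cat_scheme \<Rightarrow>
   ('o \<times> 'o, 'm \<times> 'm, 'p, 'n) fun_data \<Rightarrow> 'p \<Rightarrow> ('o \<Rightarrow> 'n) \<Rightarrow> bool" where
  "dinatural_from C D F e \<iota> \<longleftrightarrow> e \<in> Obj D \<and>
     (\<forall>a\<in>Obj C. \<iota> a \<in> Hom D (on_obj F (a, a)) e) \<and>
     (\<forall>a\<in>Obj C. \<forall>b\<in>Obj C. \<forall>f\<in>Hom C a b.
        \<iota> a \<cdot>\<^bsub>D\<^esub> on_arr F (f, Idt C a) = \<iota> b \<cdot>\<^bsub>D\<^esub> on_arr F (Idt C b, f))"

definition is_coend ::
  "('o, 'm, 'z) cat_scheme \<Rightarrow> ('p, 'n, 'y) cat_scheme \<Rightarrow>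
   ('o \<times> 'o, 'm \<times> 'm, 'p, 'n) fun_data \<Rightarrow> 'p \<Rightarrow> ('o \<Rightarrow> 'n) \<Rightarrow> bool" where
  "is_coend C D F e \<iota> \<longleftrightarrow> is_functor (prod_cat (op_cat C) C) D F \<and> dinatural_from C D F e \<iota> \<and>
     (\<forall>d \<sigma>. dinatural_from C D F d \<sigma> \<longrightarrow>
        (\<exists>!t. t \<in> Hom D e d \<and> (\<forall>a\<in>Obj C. t \<cdot>\<^bsub>D\<^esub> \<iota> a = \<sigma> a)))"


section \<open>Vector spaces\<close>

text \<open>
  Vector spaces are records of type \<open>('k, 'v) module\<close> satisfying
  \<open>vectorspace class_ring\<close>, where \<open>class_ring\<close> is the ground field given by the type \<open>'k\<close>.
  The \<open>mult\<close> and \<open>one\<close> fields of such a record are irrelevant, except for algebras.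
\<close>

definition fd_space :: "('k::field, 'v) module \<Rightarrow> bool" where
  "fd_space V \<longleftrightarrow> vectorspace class_ring V \<and> vectorspace.fin_dim class_ring V"

abbreviation linear_maps ::
  "('k::field, 'v, 'y) module_scheme \<Rightarrow> ('k, 'w, 'z) module_scheme \<Rightarrow> ('v \<Rightarrow> 'w) set" where
  "linear_maps V W \<equiv> LinearCombinations.module_hom class_ring V W"

definition ground_space :: "('k::field, 'k) module" where
  "ground_space = \<lparr>carrier = UNIV, mult = (*), one = 1, zero = 0, add = (+), smult = (*)\<rparr>"

definition dual_space :: "('k::field, 'v) module \<Rightarrow> ('k, 'v \<Rightarrow> 'k) module" where
  "dual_space V = \<lparr>carrier = linear_maps V ground_space \<inter> extensional (carrier V),
     mult = undefined, one = undefined,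
     zero = (\<lambda>v\<in>carrier V. 0),
     add = (\<lambda>\<xi> \<zeta>. \<lambda>v\<in>carrier V. \<xi> v + \<zeta> v),
     smult = (\<lambda>c \<xi>. \<lambda>v\<in>carrier V. c * \<xi> v)\<rparr>"

definition dual_map :: "('k::field, 'v) module \<Rightarrow> ('v \<Rightarrow> 'w) \<Rightarrow> ('w \<Rightarrow> 'k) \<Rightarrow> ('v \<Rightarrow> 'k)" where
  "dual_map V \<phi> \<xi> = (\<lambda>v\<in>carrier V. \<xi> (\<phi> v))"

text \<open>
  The tensor product of \<open>V\<close> and \<open>W\<close> is the free vector space on
  \<open>carrier V \<times> carrier W\<close> modulo the subspace \<open>tensor_null V W\<close> spanned by the
  bilinearity relations.
\<close>

definition free_space :: "('k::field, 'v) module \<Rightarrow> ('k, 'w) module \<Rightarrow> (('v \<times> 'w) \<Rightarrow>\<^sub>0 'k) set" where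
  "free_space V W = {p. Poly_Mapping.keys p \<subseteq> carrier V \<times> carrier W}"

inductive_set tensor_null ::
  "('k::field, 'v) module \<Rightarrow> ('k, 'w) module \<Rightarrow> (('v \<times> 'w) \<Rightarrow>\<^sub>0 'k) set"
  for V :: "('k::field, 'v) module" and W :: "('k, 'w) module" where
  zero: "0 \<in> tensor_null V W"
| add: "p \<in> tensor_null V W \<Longrightarrow> q \<in> tensor_null V W \<Longrightarrow> p + q \<in> tensor_null V W"
| scale: "p \<in> tensor_null V W \<Longrightarrow> Poly_Mapping.map ((*) c) p \<in> tensor_null V W"
| add_left: "v \<in> carrier V \<Longrightarrow> v' \<in> carrier V \<Longrightarrow> w \<in> carrier W \<Longrightarrow>
    Poly_Mapping.single (v \<oplus>\<^bsub>V\<^esub> v', w) 1 - Poly_Mapping.single (v, w) 1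
      - Poly_Mapping.single (v', w) 1 \<in> tensor_null V W"
| add_right: "v \<in> carrier V \<Longrightarrow> w \<in> carrier W \<Longrightarrow> w' \<in> carrier W \<Longrightarrow>
    Poly_Mapping.single (v, w \<oplus>\<^bsub>W\<^esub> w') 1 - Poly_Mapping.single (v, w) 1
      - Poly_Mapping.single (v, w') 1 \<in> tensor_null V W"
| scale_left: "v \<in> carrier V \<Longrightarrow> w \<in> carrier W \<Longrightarrow>
    Poly_Mapping.single (c \<odot>\<^bsub>V\<^esub> v, w) 1 - Poly_Mapping.single (v, w) c \<in> tensor_null V W"
| scale_right: "v \<in> carrier V \<Longrightarrow> w \<in> carrier W \<Longrightarrow>
    Poly_Mapping.single (v, c \<odot>\<^bsub>W\<^esub> w) 1 - Poly_Mapping.single (v, w) c \<in> tensor_null V W"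

definition tensor_rel ::
  "('k::field, 'v) module \<Rightarrow> ('k, 'w) module \<Rightarrow>
   ((('v \<times> 'w) \<Rightarrow>\<^sub>0 'k) \<times> (('v \<times> 'w) \<Rightarrow>\<^sub>0 'k)) set" where
  "tensor_rel V W =
     {(p, q). p \<in> free_space V W \<and> q \<in> free_space V W \<and> p - q \<in> tensor_null V W}"

definition tensor_space ::
  "('k::field, 'v) module \<Rightarrow> ('k, 'w) module \<Rightarrow> ('k, (('v \<times> 'w) \<Rightarrow>\<^sub>0 'k) set) module" where
  "tensor_space V W = \<lparr>carrier = free_space V W // tensor_rel V W,
     mult = undefined, one = undefined,
     zero = tensor_rel V W `` {0},
     add = (\<lambda>X Y. \<Union>p\<in>X. \<Union>q\<in>Y. tensor_rel V W `` {p + q}),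
     smult = (\<lambda>c X. \<Union>p\<in>X. tensor_rel V W `` {Poly_Mapping.map ((*) c) p})\<rparr>"

definition pure_tensor ::
  "('k::field, 'v) module \<Rightarrow> ('k, 'w) module \<Rightarrow> 'v \<Rightarrow> 'w \<Rightarrow> (('v \<times> 'w) \<Rightarrow>\<^sub>0 'k) set" where
  "pure_tensor V W v w = tensor_rel V W `` {Poly_Mapping.single (v, w) 1}"


section \<open>Finite linear categories\<close>

record ('k, 'o, 'm) lin_cat = "('o, 'm) cat" +
  add_arr :: "'m \<Rightarrow> 'm \<Rightarrow> 'm"
  zero_arr :: "'o \<Rightarrow> 'o \<Rightarrow> 'm"
  scale_arr :: "'k \<Rightarrow> 'm \<Rightarrow> 'm"

definition hom_space ::
  "('k, 'o, 'm, 'z) lin_cat_scheme \<Rightarrow> 'o \<Rightarrow> 'o \<Rightarrow> ('k, 'm) module" where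
  "hom_space C a b = \<lparr>carrier = Hom C a b, mult = undefined, one = undefined,
     zero = zero_arr C a b, add = add_arr C, smult = scale_arr C\<rparr>"

locale linear_category = category C
  for C :: "('k::field, 'o, 'm, 'z) lin_cat_scheme" (structure) +
  assumes hom_vectorspace: "a \<in> Obj C \<Longrightarrow> b \<in> Obj C \<Longrightarrow> vectorspace class_ring (hom_space C a b)"
    and comp_linear_right: "a \<in> Obj C \<Longrightarrow> g \<in> Hom C b c \<Longrightarrow>
      (\<lambda>f. g \<cdot> f) \<in> linear_maps (hom_space C a b) (hom_space C a c)"
    and comp_linear_left: "c \<in> Obj C \<Longrightarrow> f \<in> Hom C a b \<Longrightarrow>
      (\<lambda>g. g \<cdot> f) \<in> linear_maps (hom_space C b c) (hom_space C a c)"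

definition linear_functor ::
  "('k::field, 'o, 'm, 'z) lin_cat_scheme \<Rightarrow> ('k, 'p, 'n, 'y) lin_cat_scheme \<Rightarrow>
   ('o, 'm, 'p, 'n) fun_data \<Rightarrow> bool" where
  "linear_functor C D F \<longleftrightarrow> is_functor C D F \<and>
     (\<forall>a\<in>Obj C. \<forall>b\<in>Obj C.
        on_arr F \<in> linear_maps (hom_space C a b) (hom_space D (on_obj F a) (on_obj F b)))"

definition linearly_equivalent ::
  "('k::field, 'o, 'm, 'z) lin_cat_scheme \<Rightarrow> ('k, 'p, 'n, 'y) lin_cat_scheme \<Rightarrow> bool" where
  "linearly_equivalent C D \<longleftrightarrow>
     (\<exists>F G. linear_functor C D F \<and> linear_functor D C G \<and>
        isomorphic_functors C C (comp_functor G F) id_functor \<and>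
        isomorphic_functors D D (comp_functor F G) id_functor)"

locale fd_algebra = ring A
  for A :: "('k::field, 'a) module" (structure) +
  assumes fd: "fd_space A"
    and smult_mult_left: "x \<in> carrier A \<Longrightarrow> y \<in> carrier A \<Longrightarrow> (c \<odot> x) \<otimes> y = c \<odot> (x \<otimes> y)"
    and smult_mult_right: "x \<in> carrier A \<Longrightarrow> y \<in> carrier A \<Longrightarrow> x \<otimes> (c \<odot> y) = c \<odot> (x \<otimes> y)"

definition fd_module ::
  "('k::field, 'a) module \<Rightarrow> ('k, 'v) module \<times> ('a \<Rightarrow> 'v \<Rightarrow> 'v) \<Rightarrow> bool" where
  "fd_module A = (\<lambda>(M, act). fd_space M \<and>
     (\<forall>x\<in>carrier A. act x \<in> linear_maps M M) \<and>
     (\<forall>m\<in>carrier M. (\<lambda>x. act x m) \<in> linear_maps A M) \<and>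
     (\<forall>x\<in>carrier A. \<forall>y\<in>carrier A. \<forall>m\<in>carrier M. act (x \<otimes>\<^bsub>A\<^esub> y) m = act x (act y m)) \<and>
     (\<forall>m\<in>carrier M. act \<one>\<^bsub>A\<^esub> m = m))"

text \<open>
  The category of finite-dimensional left \<open>A\<close>-modules whose carriers are subsets of the type
  \<open>'v\<close>. An arrow is a triple of source, \<open>A\<close>-linear map and target.
\<close>

definition module_cat ::
  "('k::field, 'a) module \<Rightarrow>
   ('k, ('k, 'v) module \<times> ('a \<Rightarrow> 'v \<Rightarrow> 'v),
    (('k, 'v) module \<times> ('a \<Rightarrow> 'v \<Rightarrow> 'v)) \<times> ('v \<Rightarrow> 'v) \<times> (('k, 'v) module \<times> ('a \<Rightarrow> 'v \<Rightarrow> 'v)))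
   lin_cat" where
  "module_cat A = \<lparr>
     Obj = {X. fd_module A X},
     Arr = {(X, f, Y). fd_module A X \<and> fd_module A Y \<and>
       f \<in> linear_maps (fst X) (fst Y) \<inter> extensional (carrier (fst X)) \<and>
       (\<forall>x\<in>carrier A. \<forall>m\<in>carrier (fst X). f (snd X x m) = snd Y x (f m))},
     Dom = (\<lambda>(X, f, Y). X),
     Cod = (\<lambda>(X, f, Y). Y),
     Idt = (\<lambda>X. (X, \<lambda>m\<in>carrier (fst X). m, X)),
     Comp = (\<lambda>(Y', g, Z) (X, f, Y). (X, \<lambda>m\<in>carrier (fst X). g (f m), Z)),
     add_arr = (\<lambda>(X, f, Y) (X', g, Y'). (X, \<lambda>m\<in>carrier (fst X). f m \<oplus>\<^bsub>fst Y\<^esub> g m, Y)),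
     zero_arr = (\<lambda>X Y. (X, \<lambda>m\<in>carrier (fst X). \<zero>\<^bsub>fst Y\<^esub>, Y)),
     scale_arr = (\<lambda>c (X, f, Y). (X, \<lambda>m\<in>carrier (fst X). c \<odot>\<^bsub>fst Y\<^esub> f m, Y))\<rparr>"

text \<open>
  The type \<open>'k vec\<close> contains coordinate spaces of every finite dimension, so up to
  isomorphism every finite-dimensional algebra has its carrier in \<open>'k vec\<close>, and for each such
  algebra the category of modules carried by subsets of \<open>'k vec\<close> is equivalent to the category
  of all finite-dimensional modules.
\<close>

definition finite_linear_category :: "('k::field, 'o, 'm, 'z) lin_cat_scheme \<Rightarrow> bool" where
  "finite_linear_category C \<longleftrightarrow> linear_category C \<and>
     (\<exists>A :: ('k, 'k vec) module. fd_algebra A \<and>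
        linearly_equivalent C
          (module_cat A :: ('k, ('k, 'k vec) module \<times> ('k vec \<Rightarrow> 'k vec \<Rightarrow> 'k vec), _) lin_cat))"


section \<open>Tensoring with vector spaces and the Nakayama functors\<close>

text \<open>
  A tensoring chooses, for all finite-dimensional vector spaces \<open>V\<close> and objects \<open>x\<close>, an object
  \<open>V \<otimes> x\<close> together with linear isomorphisms from the tensor product of \<open>V\<close> and \<open>Hom(y, x)\<close>
  to \<open>Hom(y, V \<otimes> x)\<close> that are natural in \<open>y\<close>. Since pure tensors span, it is enough to
  state naturality for them.
\<close>

record (overloaded) ('k, 'v, 'o, 'm) tensoring =
  tens_obj :: "('k, 'v) module \<Rightarrow> 'o \<Rightarrow> 'o"
  tens_iso :: "('k, 'v) module \<Rightarrow> 'o \<Rightarrow> 'o \<Rightarrow> (('v \<times> 'm) \<Rightarrow>\<^sub>0 'k::zero) set \<Rightarrow> 'm"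

definition is_tensoring ::
  "('k::field, 'o, 'm, 'z) lin_cat_scheme \<Rightarrow> ('k, 'v, 'o, 'm) tensoring \<Rightarrow> bool" where
  "is_tensoring C \<Theta> \<longleftrightarrow> (\<forall>V x. fd_space V \<and> x \<in> Obj C \<longrightarrow>
     tens_obj \<Theta> V x \<in> Obj C \<and>
     (\<forall>y\<in>Obj C.
        tens_iso \<Theta> V x y
          \<in> linear_maps (tensor_space V (hom_space C y x)) (hom_space C y (tens_obj \<Theta> V x)) \<and>
        bij_betw (tens_iso \<Theta> V x y)
          (carrier (tensor_space V (hom_space C y x))) (Hom C y (tens_obj \<Theta> V x))) \<and>
     (\<forall>y\<in>Obj C. \<forall>y'\<in>Obj C. \<forall>h\<in>Hom C y' y. \<forall>v\<in>carrier V. \<forall>k\<in>Hom C y x.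
        tens_iso \<Theta> V x y' (pure_tensor V (hom_space C y' x) v (k \<cdot>\<^bsub>C\<^esub> h)) =
        tens_iso \<Theta> V x y (pure_tensor V (hom_space C y x) v k) \<cdot>\<^bsub>C\<^esub> h))"

text \<open>
  The arrow from \<open>V \<otimes> x\<close> to \<open>W \<otimes> x'\<close> induced by a linear map \<open>\<phi>\<close> from \<open>V\<close> to \<open>W\<close> and an
  arrow \<open>g\<close> from \<open>x\<close> to \<open>x'\<close>; by the Yoneda lemma it is the unique one representing
  the map \<open>v \<otimes> k \<mapsto> \<phi> v \<otimes> (g \<cdot> k)\<close>.
\<close>

definition tens_arr ::
  "('k::field, 'o, 'm, 'z) lin_cat_scheme \<Rightarrow> ('k, 'v, 'o, 'm) tensoring \<Rightarrow>
   ('k, 'v) module \<Rightarrow> ('k, 'v) module \<Rightarrow> ('v \<Rightarrow> 'v) \<Rightarrow> 'm \<Rightarrow> 'm" where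
  "tens_arr C \<Theta> V W \<phi> g = (THE t.
     t \<in> Hom C (tens_obj \<Theta> V (Dom C g)) (tens_obj \<Theta> W (Cod C g)) \<and>
     (\<forall>y\<in>Obj C. \<forall>v\<in>carrier V. \<forall>k\<in>Hom C y (Dom C g).
        t \<cdot>\<^bsub>C\<^esub> tens_iso \<Theta> V (Dom C g) y (pure_tensor V (hom_space C y (Dom C g)) v k) =
        tens_iso \<Theta> W (Cod C g) y
          (pure_tensor W (hom_space C y (Cod C g)) (\<phi> v) (g \<cdot>\<^bsub>C\<^esub> k))))"

text \<open>The bifunctor sending \<open>(a, b)\<close> to \<open>Hom(a, c) \<otimes> b\<close>.\<close>

definition left_nakayama_bifunctor ::
  "('k::field, 'o, 'm, 'z) lin_cat_scheme \<Rightarrow> ('k, 'm, 'o, 'm) tensoring \<Rightarrow> 'o \<Rightarrow>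
   ('o \<times> 'o, 'm \<times> 'm, 'o, 'm) fun_data" where
  "left_nakayama_bifunctor C \<Theta> c = \<lparr>
     on_obj = (\<lambda>(a, b). tens_obj \<Theta> (hom_space C a c) b),
     on_arr = (\<lambda>(f, g). tens_arr C \<Theta>
       (hom_space C (Cod C f) c) (hom_space C (Dom C f) c) (\<lambda>h. h \<cdot>\<^bsub>C\<^esub> f) g)\<rparr>"

text \<open>
  \<open>N\<close> is the functor sending \<open>c\<close> to the end over \<open>a\<close> of \<open>Hom(a, c) \<otimes> a\<close>: its values are
  ends, and its action on arrows is the one induced by their universal property.
  The end and the tensoring are only determined up to unique isomorphism.
\<close>

definition left_nakayama ::
  "('k::field, 'o, 'm, 'z) lin_cat_scheme \<Rightarrow> ('o, 'm, 'o, 'm) fun_data \<Rightarrow> bool" where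
  "left_nakayama C N \<longleftrightarrow> is_functor C C N \<and> (\<exists>\<Theta> \<pi>. is_tensoring C \<Theta> \<and>
     (\<forall>c\<in>Obj C. is_end C C (left_nakayama_bifunctor C \<Theta> c) (on_obj N c) (\<pi> c)) \<and>
     (\<forall>c\<in>Obj C. \<forall>c'\<in>Obj C. \<forall>f\<in>Hom C c c'. \<forall>a\<in>Obj C.
        \<pi> c' a \<cdot>\<^bsub>C\<^esub> on_arr N f =
        tens_arr C \<Theta> (hom_space C a c) (hom_space C a c') (\<lambda>h. f \<cdot>\<^bsub>C\<^esub> h) (Idt C a) \<cdot>\<^bsub>C\<^esub> \<pi> c a))"

text \<open>The bifunctor sending \<open>(a, b)\<close> to \<open>Hom(c, a)* \<otimes> b\<close>.\<close>

definition right_nakayama_bifunctor ::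
  "('k::field, 'o, 'm, 'z) lin_cat_scheme \<Rightarrow> ('k, 'm \<Rightarrow> 'k, 'o, 'm) tensoring \<Rightarrow> 'o \<Rightarrow>
   ('o \<times> 'o, 'm \<times> 'm, 'o, 'm) fun_data" where
  "right_nakayama_bifunctor C \<Theta> c = \<lparr>
     on_obj = (\<lambda>(a, b). tens_obj \<Theta> (dual_space (hom_space C c a)) b),
     on_arr = (\<lambda>(f, g). tens_arr C \<Theta>
       (dual_space (hom_space C c (Cod C f))) (dual_space (hom_space C c (Dom C f)))
       (dual_map (hom_space C c (Dom C f)) (\<lambda>h. f \<cdot>\<^bsub>C\<^esub> h)) g)\<rparr>"

definition right_nakayama ::
  "('k::field, 'o, 'm, 'z) lin_cat_scheme \<Rightarrow> ('o, 'm, 'o, 'm) fun_data \<Rightarrow> bool" where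
  "right_nakayama C N \<longleftrightarrow> is_functor C C N \<and> (\<exists>\<Theta> \<iota>. is_tensoring C \<Theta> \<and>
     (\<forall>c\<in>Obj C. is_coend C C (right_nakayama_bifunctor C \<Theta> c) (on_obj N c) (\<iota> c)) \<and>
     (\<forall>c\<in>Obj C. \<forall>c'\<in>Obj C. \<forall>f\<in>Hom C c c'. \<forall>a\<in>Obj C.
        on_arr N f \<cdot>\<^bsub>C\<^esub> \<iota> c a =
        \<iota> c' a \<cdot>\<^bsub>C\<^esub> tens_arr C \<Theta>
          (dual_space (hom_space C c a)) (dual_space (hom_space C c' a))
          (dual_map (hom_space C c' a) (\<lambda>h. h \<cdot>\<^bsub>C\<^esub> f)) (Idt C a)))"


section \<open>Finite multitensor categories\<close>

text \<open>
  A choice of right dual \<open>rdual c\<close> and left dual \<open>ldual c\<close> of every object, with evaluations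
  \<open>rev_arr\<close>, \<open>lev_arr\<close> and coevaluations \<open>rcoev_arr\<close>, \<open>lcoev_arr\<close>, is part of the data. Nothing
  is assumed about the endomorphisms of the unit object.
\<close>

record ('k, 'o, 'm) rigid_cat = "('k, 'o, 'm) lin_cat" +
  unit_obj :: "'o" ("\<I>\<index>")
  tensor_obj :: "'o \<Rightarrow> 'o \<Rightarrow> 'o" (infixr "\<otimes>\<^sub>o\<index>" 75)
  tensor_arr :: "'m \<Rightarrow> 'm \<Rightarrow> 'm" (infixr "\<otimes>\<^sub>a\<index>" 75)
  assoc :: "'o \<Rightarrow> 'o \<Rightarrow> 'o \<Rightarrow> 'm"
  lunit :: "'o \<Rightarrow> 'm"
  runit :: "'o \<Rightarrow> 'm"
  rdual :: "'o \<Rightarrow> 'o"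
  rev_arr :: "'o \<Rightarrow> 'm"
  rcoev_arr :: "'o \<Rightarrow> 'm"
  ldual :: "'o \<Rightarrow> 'o"
  lev_arr :: "'o \<Rightarrow> 'm"
  lcoev_arr :: "'o \<Rightarrow> 'm"

locale linear_monoidal_category = linear_category A
  for A :: "('k::field, 'o, 'm, 'z) rigid_cat_scheme" (structure) +
  assumes unit_obj: "\<I> \<in> Obj A"
    and tensor_functor: "is_functor (prod_cat A A) A
      \<lparr>on_obj = (\<lambda>(a, b). a \<otimes>\<^sub>o b), on_arr = (\<lambda>(f, g). f \<otimes>\<^sub>a g)\<rparr>"
    and tensor_linear_right: "c \<in> Obj A \<Longrightarrow> d \<in> Obj A \<Longrightarrow> f \<in> Hom A a b \<Longrightarrow>
      (\<lambda>g. f \<otimes>\<^sub>a g) \<in> linear_maps (hom_space A c d) (hom_space A (a \<otimes>\<^sub>o c) (b \<otimes>\<^sub>o d))"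
    and tensor_linear_left: "a \<in> Obj A \<Longrightarrow> b \<in> Obj A \<Longrightarrow> g \<in> Hom A c d \<Longrightarrow>
      (\<lambda>f. f \<otimes>\<^sub>a g) \<in> linear_maps (hom_space A a b) (hom_space A (a \<otimes>\<^sub>o c) (b \<otimes>\<^sub>o d))"
    and assoc_iso: "a \<in> Obj A \<Longrightarrow> b \<in> Obj A \<Longrightarrow> c \<in> Obj A \<Longrightarrow>
      assoc A a b c \<in> Hom A ((a \<otimes>\<^sub>o b) \<otimes>\<^sub>o c) (a \<otimes>\<^sub>o (b \<otimes>\<^sub>o c)) \<and> iso_arrow A (assoc A a b c)"
    and assoc_natural: "f \<in> Hom A a a' \<Longrightarrow> g \<in> Hom A b b' \<Longrightarrow> h \<in> Hom A c c' \<Longrightarrow>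
      assoc A a' b' c' \<cdot> ((f \<otimes>\<^sub>a g) \<otimes>\<^sub>a h) = (f \<otimes>\<^sub>a (g \<otimes>\<^sub>a h)) \<cdot> assoc A a b c"
    and lunit_iso: "a \<in> Obj A \<Longrightarrow> lunit A a \<in> Hom A (\<I> \<otimes>\<^sub>o a) a \<and> iso_arrow A (lunit A a)"
    and lunit_natural: "f \<in> Hom A a b \<Longrightarrow> lunit A b \<cdot> (Idt A \<I> \<otimes>\<^sub>a f) = f \<cdot> lunit A a"
    and runit_iso: "a \<in> Obj A \<Longrightarrow> runit A a \<in> Hom A (a \<otimes>\<^sub>o \<I>) a \<and> iso_arrow A (runit A a)"
    and runit_natural: "f \<in> Hom A a b \<Longrightarrow> runit A b \<cdot> (f \<otimes>\<^sub>a Idt A \<I>) = f \<cdot> runit A a"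
    and pentagon: "a \<in> Obj A \<Longrightarrow> b \<in> Obj A \<Longrightarrow> c \<in> Obj A \<Longrightarrow> d \<in> Obj A \<Longrightarrow>
      (Idt A a \<otimes>\<^sub>a assoc A b c d) \<cdot> assoc A a (b \<otimes>\<^sub>o c) d \<cdot> (assoc A a b c \<otimes>\<^sub>a Idt A d) =
      assoc A a b (c \<otimes>\<^sub>o d) \<cdot> assoc A (a \<otimes>\<^sub>o b) c d"
    and triangle: "a \<in> Obj A \<Longrightarrow> b \<in> Obj A \<Longrightarrow>
      (Idt A a \<otimes>\<^sub>a lunit A b) \<cdot> assoc A a \<I> b = runit A a \<otimes>\<^sub>a Idt A b"

text \<open>\<open>d\<close> is a right dual of \<open>c\<close>; equivalently, \<open>c\<close> is a left dual of \<open>d\<close>.\<close>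

definition duality ::
  "('k::field, 'o, 'm, 'z) rigid_cat_scheme \<Rightarrow> 'o \<Rightarrow> 'o \<Rightarrow> 'm \<Rightarrow> 'm \<Rightarrow> bool" where
  "duality A c d ev coev \<longleftrightarrow> c \<in> Obj A \<and> d \<in> Obj A \<and>
     ev \<in> Hom A (d \<otimes>\<^sub>o\<^bsub>A\<^esub> c) \<I>\<^bsub>A\<^esub> \<and> coev \<in> Hom A \<I>\<^bsub>A\<^esub> (c \<otimes>\<^sub>o\<^bsub>A\<^esub> d) \<and>
     runit A c \<cdot>\<^bsub>A\<^esub> (Idt A c \<otimes>\<^sub>a\<^bsub>A\<^esub> ev) \<cdot>\<^bsub>A\<^esub> assoc A c d c \<cdot>\<^bsub>A\<^esub> (coev \<otimes>\<^sub>a\<^bsub>A\<^esub> Idt A c) = lunit A c \<and>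
     lunit A d \<cdot>\<^bsub>A\<^esub> (ev \<otimes>\<^sub>a\<^bsub>A\<^esub> Idt A d) \<cdot>\<^bsub>A\<^esub> inv_arrow A (assoc A d c d) \<cdot>\<^bsub>A\<^esub> (Idt A d \<otimes>\<^sub>a\<^bsub>A\<^esub> coev)
       = runit A d"

locale rigid_linear_monoidal_category = linear_monoidal_category A
  for A :: "('k::field, 'o, 'm, 'z) rigid_cat_scheme" (structure) +
  assumes right_dual: "c \<in> Obj A \<Longrightarrow> duality A c (rdual A c) (rev_arr A c) (rcoev_arr A c)"
    and left_dual: "c \<in> Obj A \<Longrightarrow> duality A (ldual A c) c (lev_arr A c) (lcoev_arr A c)"

definition finite_multitensor_category ::
  "('k::field, 'o, 'm, 'z) rigid_cat_scheme \<Rightarrow> bool" where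
  "finite_multitensor_category A \<longleftrightarrow>
     finite_linear_category A \<and> rigid_linear_monoidal_category A"

text \<open>The duals of an arrow \<open>f\<close> from \<open>c\<close> to \<open>d\<close> go from the dual of \<open>d\<close> to the dual of \<open>c\<close>.\<close>

definition rdual_arr :: "('k::field, 'o, 'm, 'z) rigid_cat_scheme \<Rightarrow> 'm \<Rightarrow> 'm" where
  "rdual_arr A f = (let c = Dom A f; d = Cod A f; c' = rdual A c; d' = rdual A d in
     lunit A c' \<cdot>\<^bsub>A\<^esub> (rev_arr A d \<otimes>\<^sub>a\<^bsub>A\<^esub> Idt A c') \<cdot>\<^bsub>A\<^esub> inv_arrow A (assoc A d' d c') \<cdot>\<^bsub>A\<^esub>
     (Idt A d' \<otimes>\<^sub>a\<^bsub>A\<^esub> (f \<otimes>\<^sub>a\<^bsub>A\<^esub> Idt A c')) \<cdot>\<^bsub>A\<^esub>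
     (Idt A d' \<otimes>\<^sub>a\<^bsub>A\<^esub> rcoev_arr A c) \<cdot>\<^bsub>A\<^esub> inv_arrow A (runit A d'))"

definition ldual_arr :: "('k::field, 'o, 'm, 'z) rigid_cat_scheme \<Rightarrow> 'm \<Rightarrow> 'm" where
  "ldual_arr A f = (let c = Dom A f; d = Cod A f; c' = ldual A c; d' = ldual A d in
     runit A c' \<cdot>\<^bsub>A\<^esub> (Idt A c' \<otimes>\<^sub>a\<^bsub>A\<^esub> lev_arr A d) \<cdot>\<^bsub>A\<^esub> assoc A c' d d' \<cdot>\<^bsub>A\<^esub>
     ((Idt A c' \<otimes>\<^sub>a\<^bsub>A\<^esub> f) \<otimes>\<^sub>a\<^bsub>A\<^esub> Idt A d') \<cdot>\<^bsub>A\<^esub>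
     (lcoev_arr A c \<otimes>\<^sub>a\<^bsub>A\<^esub> Idt A d') \<cdot>\<^bsub>A\<^esub> inv_arrow A (lunit A d'))"

definition right_double_dual ::
  "('k::field, 'o, 'm, 'z) rigid_cat_scheme \<Rightarrow> ('o, 'm, 'o, 'm) fun_data" where
  "right_double_dual A = \<lparr>on_obj = (\<lambda>c. rdual A (rdual A c)),
     on_arr = (\<lambda>f. rdual_arr A (rdual_arr A f))\<rparr>"

definition left_double_dual ::
  "('k::field, 'o, 'm, 'z) rigid_cat_scheme \<Rightarrow> ('o, 'm, 'o, 'm) fun_data" where
  "left_double_dual A = \<lparr>on_obj = (\<lambda>c. ldual A (ldual A c)),
     on_arr = (\<lambda>f. ldual_arr A (ldual_arr A f))\<rparr>"

definition tensor_on_left ::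
  "('k::field, 'o, 'm, 'z) rigid_cat_scheme \<Rightarrow> 'o \<Rightarrow> ('o, 'm, 'o, 'm) fun_data \<Rightarrow>
   ('o, 'm, 'o, 'm) fun_data" where
  "tensor_on_left A d F = \<lparr>on_obj = (\<lambda>c. d \<otimes>\<^sub>o\<^bsub>A\<^esub> on_obj F c),
     on_arr = (\<lambda>f. Idt A d \<otimes>\<^sub>a\<^bsub>A\<^esub> on_arr F f)\<rparr>"

definition tensor_on_right ::
  "('k::field, 'o, 'm, 'z) rigid_cat_scheme \<Rightarrow> ('o, 'm, 'o, 'm) fun_data \<Rightarrow> 'o \<Rightarrow>
   ('o, 'm, 'o, 'm) fun_data" where
  "tensor_on_right A F d = \<lparr>on_obj = (\<lambda>c. on_obj F c \<otimes>\<^sub>o\<^bsub>A\<^esub> d),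
     on_arr = (\<lambda>f. on_arr F f \<otimes>\<^sub>a\<^bsub>A\<^esub> Idt A d)\<rparr>"

end

theory Submission
  imports Defs
begin

text \<open>
  A dinatural family out of \<open>Hom(c, a)* \<otimes> a\<close> is the same as a natural transformation from
  \<open>Hom(c, -)*\<close> to \<open>Hom(-, d)\<close>, so the right Nakayama functor has a universal property that does
  not mention the tensoring, and the left one has the same property in the opposite category.
  For left duals \<open>ld c\<close>, the adjunctions of \<open>c \<otimes> -\<close> with \<open>ld c \<otimes> -\<close> and of \<open>ld c \<otimes> -\<close> with
  \<open>ld (ld c) \<otimes> -\<close> turn a universal family for the unit, with value \<open>D\<close>, into one for \<open>c\<close>, with
  value \<open>ld (ld c) \<otimes> D\<close>. This is one of the four isomorphisms; the other three are the same
  statement for the reversed tensor product, the opposite category, and both.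
  For existence, let \<open>P\<close> correspond to the regular module. Every right \<open>End(P)\<close>-module of finite
  dimension is some \<open>Hom(P, n)\<close>, and the value at \<open>c\<close> is the \<open>n\<close> belonging to \<open>Hom(c, P)*\<close>.
  Duality makes the opposite category equivalent to the same module category.
\<close>


section \<open>Linear algebra\<close>

text \<open>The two functors use tensorings by different spaces, Hom-spaces for the end and their
  duals for the coend, and a tensoring describes arrows into \<open>V \<otimes> x\<close>, which is
  of no direct use in the opposite category. The exchange of left and right therefore takes place at
  the level of the universal property. The reduction rests on one fact: for finite-dimensional
  \<open>V\<close>, the object \<open>V \<otimes> x\<close> is at once the copower of
  \<open>x\<close> by \<open>V\<close>, which a coend needs, and the power of \<open>x\<close> by
  the dual of \<open>V\<close>, which an end needs. Both structures are extracted from the single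
  tensor that represents the identity of \<open>V \<otimes> x\<close>. Frames carry this through:
  they give resolutions of the identity, pass to duals and to spaces of linear maps, and ask for no
  linear independence. The comparison is natural in \<open>c\<close> because evaluation and
  coevaluation are dinatural in \<open>c\<close>: this turns an arrow \<open>f\<close> first into
  its dual and then into its double dual.\<close>

abbreviation is_vs :: "('k::field, 'v) module \<Rightarrow> bool" where
  "is_vs V \<equiv> vectorspace class_ring V"

text \<open>Negatives are supplied as \<open>(-1) \<odot> v\<close>, so every obligation is a
  closure statement or an equation, and concrete spaces are settled by simplification.\<close>

lemma is_vsI:
  fixes V :: "('k::field, 'v) module"
  assumes "\<zero>\<^bsub>V\<^esub> \<in> carrier V"
    and "\<And>v w. v \<in> carrier V \<Longrightarrow> w \<in> carrier V \<Longrightarrow> v \<oplus>\<^bsub>V\<^esub> w \<in> carrier V"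
    and "\<And>c v. v \<in> carrier V \<Longrightarrow> c \<odot>\<^bsub>V\<^esub> v \<in> carrier V"
    and "\<And>v w. v \<in> carrier V \<Longrightarrow> w \<in> carrier V \<Longrightarrow> v \<oplus>\<^bsub>V\<^esub> w = w \<oplus>\<^bsub>V\<^esub> v"
    and "\<And>u v w. u \<in> carrier V \<Longrightarrow> v \<in> carrier V \<Longrightarrow> w \<in> carrier V \<Longrightarrow>
      (u \<oplus>\<^bsub>V\<^esub> v) \<oplus>\<^bsub>V\<^esub> w = u \<oplus>\<^bsub>V\<^esub> (v \<oplus>\<^bsub>V\<^esub> w)"
    and "\<And>v. v \<in> carrier V \<Longrightarrow> v \<oplus>\<^bsub>V\<^esub> \<zero>\<^bsub>V\<^esub> = v"
    and "\<And>v. v \<in> carrier V \<Longrightarrow> v \<oplus>\<^bsub>V\<^esub> ((-1) \<odot>\<^bsub>V\<^esub> v) = \<zero>\<^bsub>V\<^esub>"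
    and "\<And>a b v. v \<in> carrier V \<Longrightarrow> (a * b) \<odot>\<^bsub>V\<^esub> v = a \<odot>\<^bsub>V\<^esub> (b \<odot>\<^bsub>V\<^esub> v)"
    and "\<And>v. v \<in> carrier V \<Longrightarrow> 1 \<odot>\<^bsub>V\<^esub> v = v"
    and "\<And>a b v. v \<in> carrier V \<Longrightarrow> (a + b) \<odot>\<^bsub>V\<^esub> v = a \<odot>\<^bsub>V\<^esub> v \<oplus>\<^bsub>V\<^esub> b \<odot>\<^bsub>V\<^esub> v"
    and "\<And>a v w. v \<in> carrier V \<Longrightarrow> w \<in> carrier V \<Longrightarrow>
      a \<odot>\<^bsub>V\<^esub> (v \<oplus>\<^bsub>V\<^esub> w) = a \<odot>\<^bsub>V\<^esub> v \<oplus>\<^bsub>V\<^esub> a \<odot>\<^bsub>V\<^esub> w"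
  shows "is_vs V"
proof (rule vs_criteria)
  show "\<forall>v\<in>carrier V. \<exists>neg_v\<in>carrier V. v \<oplus>\<^bsub>V\<^esub> neg_v = \<zero>\<^bsub>V\<^esub>"
    using assms(3,7) by blast
qed (auto simp: class_field assms(1,2,3,5,6,8,9,10,11) intro: assms(4))

context
  fixes V :: "('k::field, 'v) module"
  assumes vs: "is_vs V"
begin

interpretation V: vectorspace class_ring V by (rule vs)

lemma vs_zero [intro, simp]: "\<zero>\<^bsub>V\<^esub> \<in> carrier V" by simp

lemma vs_add [intro, simp]: "v \<in> carrier V \<Longrightarrow> w \<in> carrier V \<Longrightarrow> v \<oplus>\<^bsub>V\<^esub> w \<in> carrier V" by simp

lemma vs_smult [intro, simp]: "v \<in> carrier V \<Longrightarrow> c \<odot>\<^bsub>V\<^esub> v \<in> carrier V" by simp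

lemma vs_add_assoc:
  "u \<in> carrier V \<Longrightarrow> v \<in> carrier V \<Longrightarrow> w \<in> carrier V \<Longrightarrow>
    (u \<oplus>\<^bsub>V\<^esub> v) \<oplus>\<^bsub>V\<^esub> w = u \<oplus>\<^bsub>V\<^esub> (v \<oplus>\<^bsub>V\<^esub> w)" by (rule V.a_assoc)

lemma vs_add_comm: "v \<in> carrier V \<Longrightarrow> w \<in> carrier V \<Longrightarrow> v \<oplus>\<^bsub>V\<^esub> w = w \<oplus>\<^bsub>V\<^esub> v"
  by (rule V.a_comm)

lemma vs_add_left_comm:
  "u \<in> carrier V \<Longrightarrow> v \<in> carrier V \<Longrightarrow> w \<in> carrier V \<Longrightarrow>
    u \<oplus>\<^bsub>V\<^esub> (v \<oplus>\<^bsub>V\<^esub> w) = v \<oplus>\<^bsub>V\<^esub> (u \<oplus>\<^bsub>V\<^esub> w)" by (rule V.a_lcomm)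

lemma vs_add_zero [simp]: "v \<in> carrier V \<Longrightarrow> v \<oplus>\<^bsub>V\<^esub> \<zero>\<^bsub>V\<^esub> = v" by simp

lemma vs_zero_add [simp]: "v \<in> carrier V \<Longrightarrow> \<zero>\<^bsub>V\<^esub> \<oplus>\<^bsub>V\<^esub> v = v" by simp

lemma vs_smult_add:
  "v \<in> carrier V \<Longrightarrow> w \<in> carrier V \<Longrightarrow> a \<odot>\<^bsub>V\<^esub> (v \<oplus>\<^bsub>V\<^esub> w) = a \<odot>\<^bsub>V\<^esub> v \<oplus>\<^bsub>V\<^esub> a \<odot>\<^bsub>V\<^esub> w"
  using V.smult_r_distr by simp

lemma vs_add_smult: "v \<in> carrier V \<Longrightarrow> (a + b) \<odot>\<^bsub>V\<^esub> v = a \<odot>\<^bsub>V\<^esub> v \<oplus>\<^bsub>V\<^esub> b \<odot>\<^bsub>V\<^esub> v"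
  using V.smult_l_distr[of a b v] by simp

lemma vs_smult_smult: "v \<in> carrier V \<Longrightarrow> a \<odot>\<^bsub>V\<^esub> (b \<odot>\<^bsub>V\<^esub> v) = (a * b) \<odot>\<^bsub>V\<^esub> v"
  using V.smult_assoc1[of a b v] by simp

lemma vs_one_smult [simp]: "v \<in> carrier V \<Longrightarrow> 1 \<odot>\<^bsub>V\<^esub> v = v"
  using V.smult_one[of v] by simp

lemma vs_zero_smult [simp]: "v \<in> carrier V \<Longrightarrow> 0 \<odot>\<^bsub>V\<^esub> v = \<zero>\<^bsub>V\<^esub>"
  using V.lmult_0[of v] by simp

lemma vs_smult_zero [simp]: "c \<odot>\<^bsub>V\<^esub> \<zero>\<^bsub>V\<^esub> = \<zero>\<^bsub>V\<^esub>"
  using V.rmult_0[of c] by simp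

lemma vs_add_neg: "v \<in> carrier V \<Longrightarrow> v \<oplus>\<^bsub>V\<^esub> ((-1) \<odot>\<^bsub>V\<^esub> v) = \<zero>\<^bsub>V\<^esub>"
  using vs_add_smult[of v 1 "-1"] by simp

end

lemma lin_mapI:
  fixes V :: "('k::field, 'v, 'y) module_scheme" and W :: "('k, 'w, 'z) module_scheme"
  assumes "\<And>v. v \<in> carrier V \<Longrightarrow> f v \<in> carrier W"
    and "\<And>v v'. v \<in> carrier V \<Longrightarrow> v' \<in> carrier V \<Longrightarrow> f (v \<oplus>\<^bsub>V\<^esub> v') = f v \<oplus>\<^bsub>W\<^esub> f v'"
    and "\<And>c v. v \<in> carrier V \<Longrightarrow> f (c \<odot>\<^bsub>V\<^esub> v) = c \<odot>\<^bsub>W\<^esub> f v"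
  shows "f \<in> linear_maps V W"
  using assms by (auto simp: LinearCombinations.module_hom_def)

context
  fixes V :: "('k::field, 'v, 'y) module_scheme" and W :: "('k, 'w, 'z) module_scheme" and f
  assumes lin: "f \<in> linear_maps V W"
begin

lemma lin_closed: "v \<in> carrier V \<Longrightarrow> f v \<in> carrier W"
  using lin by (auto simp: LinearCombinations.module_hom_def)

lemma lin_add: "v \<in> carrier V \<Longrightarrow> v' \<in> carrier V \<Longrightarrow> f (v \<oplus>\<^bsub>V\<^esub> v') = f v \<oplus>\<^bsub>W\<^esub> f v'"
  using lin by (auto simp: LinearCombinations.module_hom_def)

lemma lin_smult: "v \<in> carrier V \<Longrightarrow> f (c \<odot>\<^bsub>V\<^esub> v) = c \<odot>\<^bsub>W\<^esub> f v"
  using lin by (auto simp: LinearCombinations.module_hom_def)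

end

lemma lin_zero:
  assumes "is_vs V" "is_vs W" "f \<in> linear_maps V W"
  shows "f \<zero>\<^bsub>V\<^esub> = \<zero>\<^bsub>W\<^esub>"
  using lin_smult[OF assms(3) vs_zero[OF assms(1)], of 0] assms(1,2)
    lin_closed[OF assms(3) vs_zero[OF assms(1)]] by simp

lemma lin_comp: "f \<in> linear_maps U V \<Longrightarrow> g \<in> linear_maps V W \<Longrightarrow> (\<lambda>u. g (f u)) \<in> linear_maps U W"
  by (rule lin_mapI) (simp_all add: lin_closed lin_add[of f U V] lin_add[of g V W] lin_smult[of f U V] lin_smult[of g V W])

lemma lin_cong:
  assumes "f \<in> linear_maps V W" "is_vs V" "\<And>v. v \<in> carrier V \<Longrightarrow> f v = g v"
  shows "g \<in> linear_maps V W"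
  using assms by (auto simp: LinearCombinations.module_hom_def Pi_iff)

lemma lin_inv:
  assumes "is_vs V" "f \<in> linear_maps V W" "bij_betw f (carrier V) (carrier W)"
  shows "inv_into (carrier V) f \<in> linear_maps W V"
proof (rule lin_mapI)
  let ?g = "inv_into (carrier V) f"
  have g: "?g w \<in> carrier V" "f (?g w) = w" if "w \<in> carrier W" for w
    using assms(3) that by (auto simp: bij_betw_def intro: inv_into_into f_inv_into_f)
  have inj: "inj_on f (carrier V)" using assms(3) by (simp add: bij_betw_def)
  show "?g w \<in> carrier V" if "w \<in> carrier W" for w by (rule g[OF that])
  show "?g (w \<oplus>\<^bsub>W\<^esub> w') = ?g w \<oplus>\<^bsub>V\<^esub> ?g w'" if "w \<in> carrier W" "w' \<in> carrier W" for w w'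
    by (rule inv_into_f_eq[OF inj]) (auto simp: g that lin_add[OF assms(2)] vs_add[OF assms(1)])
  show "?g (c \<odot>\<^bsub>W\<^esub> w) = c \<odot>\<^bsub>V\<^esub> ?g w" if "w \<in> carrier W" for c w
    by (rule inv_into_f_eq[OF inj]) (auto simp: g that lin_smult[OF assms(2)] vs_smult[OF assms(1)])
qed


subsection \<open>Finite sums and frames\<close>

text \<open>Sums run over lists instead of sets: a frame may repeat its vectors, and two sums are
  compared term by term through \<open>map\<close>.\<close>

definition vsum :: "('k::field, 'v) module \<Rightarrow> 'v list \<Rightarrow> 'v" where
  "vsum V vs = foldr (\<lambda>v w. v \<oplus>\<^bsub>V\<^esub> w) vs \<zero>\<^bsub>V\<^esub>"

lemma vsum_simps [simp]: "vsum V [] = \<zero>\<^bsub>V\<^esub>" "vsum V (v # vs) = v \<oplus>\<^bsub>V\<^esub> vsum V vs"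
  by (simp_all add: vsum_def)

lemma vsum_closed: "is_vs V \<Longrightarrow> set vs \<subseteq> carrier V \<Longrightarrow> vsum V vs \<in> carrier V"
  by (induction vs) auto

lemma vsum_append:
  "is_vs V \<Longrightarrow> set vs \<subseteq> carrier V \<Longrightarrow> set ws \<subseteq> carrier V \<Longrightarrow>
    vsum V (vs @ ws) = vsum V vs \<oplus>\<^bsub>V\<^esub> vsum V ws"
  by (induction vs) (auto simp: vsum_closed vs_add_assoc)

lemma vsum_concat:
  "is_vs V \<Longrightarrow> \<forall>vs\<in>set vss. set vs \<subseteq> carrier V \<Longrightarrow> vsum V (concat vss) = vsum V (map (vsum V) vss)"
proof (induction vss)
  case (Cons vs vss)
  then show ?case by (subst concat.simps, subst vsum_append) auto
qed simp

lemma vsum_add: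
  assumes "is_vs V" "\<And>i. i \<in> set is \<Longrightarrow> f i \<in> carrier V" "\<And>i. i \<in> set is \<Longrightarrow> g i \<in> carrier V"
  shows "vsum V (map (\<lambda>i. f i \<oplus>\<^bsub>V\<^esub> g i) is) = vsum V (map f is) \<oplus>\<^bsub>V\<^esub> vsum V (map g is)"
  using assms(2,3)
proof (induction "is")
  case (Cons i js)
  have c: "vsum V (map f js) \<in> carrier V" "vsum V (map g js) \<in> carrier V"
    using Cons.prems by (auto intro!: vsum_closed assms(1))
  show ?case using Cons c assms(1) by (simp add: vs_add_assoc[OF assms(1)] vs_add_left_comm[OF assms(1)])
qed (simp add: assms(1))

lemma lin_vsum:
  assumes "is_vs V" "is_vs W" "f \<in> linear_maps V W" "set vs \<subseteq> carrier V"
  shows "f (vsum V vs) = vsum W (map f vs)"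
  using assms(4)
  by (induction vs)
    (auto simp: lin_zero[OF assms(1-3)] lin_add[OF assms(3)] vsum_closed[OF assms(1)])

lemma ground_space_simps [simp]:
  "carrier ground_space = UNIV" "\<zero>\<^bsub>ground_space\<^esub> = 0"
  "x \<oplus>\<^bsub>ground_space\<^esub> y = x + y" "c \<odot>\<^bsub>ground_space\<^esub> x = c * x"
  by (simp_all add: ground_space_def)

lemma ground_space_vs: "is_vs (ground_space :: ('k::field, 'k) module)"
  by (rule is_vsI) (auto simp: algebra_simps)

lemma fd_vs: "fd_space V \<Longrightarrow> is_vs V"
  by (simp add: fd_space_def)

text \<open>Values outside the carrier are fixed by \<open>extensional\<close>, so that two vectors
  are equal as soon as they agree on \<open>V\<close>. The choice matches \<open>dual_space\<close>,
  which is the case of the ground field.\<close>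

definition lin_space :: "('k::field, 'v) module \<Rightarrow> ('k, 'w) module \<Rightarrow> ('k, 'v \<Rightarrow> 'w) module" where
  "lin_space V W = \<lparr>carrier = linear_maps V W \<inter> extensional (carrier V),
     mult = undefined, one = undefined,
     zero = (\<lambda>v\<in>carrier V. \<zero>\<^bsub>W\<^esub>),
     add = (\<lambda>f g. \<lambda>v\<in>carrier V. f v \<oplus>\<^bsub>W\<^esub> g v),
     smult = (\<lambda>c f. \<lambda>v\<in>carrier V. c \<odot>\<^bsub>W\<^esub> f v)\<rparr>"

lemma dual_space_eq: "dual_space V = lin_space V ground_space"
  by (simp add: dual_space_def lin_space_def)

lemma lin_space_simps:
  "f \<in> carrier (lin_space V W) \<longleftrightarrow> f \<in> linear_maps V W \<and> f \<in> extensional (carrier V)"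
  "\<zero>\<^bsub>lin_space V W\<^esub> = (\<lambda>v\<in>carrier V. \<zero>\<^bsub>W\<^esub>)"
  "f \<oplus>\<^bsub>lin_space V W\<^esub> g = (\<lambda>v\<in>carrier V. f v \<oplus>\<^bsub>W\<^esub> g v)"
  "c \<odot>\<^bsub>lin_space V W\<^esub> f = (\<lambda>v\<in>carrier V. c \<odot>\<^bsub>W\<^esub> f v)"
  by (simp_all add: lin_space_def)

lemma lin_space_lin: "f \<in> carrier (lin_space V W) \<Longrightarrow> f \<in> linear_maps V W"
  by (simp add: lin_space_simps)

lemma lin_space_eqI:
  "f \<in> carrier (lin_space V W) \<Longrightarrow> g \<in> carrier (lin_space V W) \<Longrightarrow>
    (\<And>v. v \<in> carrier V \<Longrightarrow> f v = g v) \<Longrightarrow> f = g"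
  by (auto simp: lin_space_simps intro: extensionalityI)

lemma restrict_lin_space:
  "is_vs V \<Longrightarrow> f \<in> linear_maps V W \<Longrightarrow> (\<lambda>v\<in>carrier V. f v) \<in> carrier (lin_space V W)"
  by (auto simp: lin_space_simps intro: lin_cong)

lemma restrict_dual_space:
  "is_vs V \<Longrightarrow> f \<in> linear_maps V ground_space \<Longrightarrow> (\<lambda>v\<in>carrier V. f v) \<in> carrier (dual_space V)"
  by (simp add: dual_space_eq restrict_lin_space)

lemma lin_space_vs:
  assumes V: "is_vs V" and W: "is_vs W"
  shows "is_vs (lin_space V W)"
proof (rule is_vsI)
  note l = lin_space_lin[THEN lin_closed]
  note lin = lin_space_lin[THEN lin_add] lin_space_lin[THEN lin_smult]
  note vs = V[THEN vs_add] V[THEN vs_smult] W[THEN vs_zero] W[THEN vs_add] W[THEN vs_smult]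
    W[THEN vs_add_zero] W[THEN vs_zero_add] W[THEN vs_add_neg] W[THEN vs_one_smult]
  show "\<zero>\<^bsub>lin_space V W\<^esub> \<in> carrier (lin_space V W)"
    unfolding lin_space_simps(2) by (rule restrict_lin_space[OF V], rule lin_mapI) (auto simp: vs vs_smult_zero[OF W])
  show "f \<oplus>\<^bsub>lin_space V W\<^esub> g \<in> carrier (lin_space V W)"
    if fg: "f \<in> carrier (lin_space V W)" "g \<in> carrier (lin_space V W)" for f g
    unfolding lin_space_simps(3) using fg
    by (intro restrict_lin_space[OF V], intro lin_mapI)
      (simp_all add: vs l lin W[THEN vs_smult_add] W[THEN vs_add_assoc] W[THEN vs_add_left_comm])
  show "c \<odot>\<^bsub>lin_space V W\<^esub> f \<in> carrier (lin_space V W)" if f: "f \<in> carrier (lin_space V W)" for c f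
    unfolding lin_space_simps(4) using f
    by (intro restrict_lin_space[OF V], intro lin_mapI)
      (simp_all add: vs l lin W[THEN vs_smult_add] W[THEN vs_smult_smult] mult.commute)
  show "f \<oplus>\<^bsub>lin_space V W\<^esub> \<zero>\<^bsub>lin_space V W\<^esub> = f" if "f \<in> carrier (lin_space V W)" for f
    using that l[OF that]
    by (auto simp: lin_space_simps(2-) vs lin_space_simps(1) intro!: extensionalityI[of _ "carrier V"])
  show "1 \<odot>\<^bsub>lin_space V W\<^esub> f = f" if "f \<in> carrier (lin_space V W)" for f
    using that l[OF that]
    by (auto simp: lin_space_simps(2-) vs lin_space_simps(1) intro!: extensionalityI[of _ "carrier V"])
  show "f \<oplus>\<^bsub>lin_space V W\<^esub> g = g \<oplus>\<^bsub>lin_space V W\<^esub> f"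
    if "f \<in> carrier (lin_space V W)" "g \<in> carrier (lin_space V W)" for f g
    using that by (auto simp: lin_space_simps(3) l W[THEN vs_add_comm] intro!: restrict_ext)
qed (auto simp: lin_space_simps(2-) V[THEN vs_add] V[THEN vs_smult] W[THEN vs_zero] W[THEN vs_add] W[THEN vs_smult]
    W[THEN vs_add_zero] W[THEN vs_zero_add] W[THEN vs_add_neg] W[THEN vs_one_smult]
    lin_space_lin[THEN lin_closed] W[THEN vs_smult_add] W[THEN vs_smult_smult]
    W[THEN vs_add_smult] W[THEN vs_add_assoc] intro!: restrict_ext)

lemma dual_space_vs: "is_vs V \<Longrightarrow> is_vs (dual_space V)"
  by (simp add: dual_space_eq lin_space_vs ground_space_vs)

lemma dual_space_simps:
  "\<xi> \<in> carrier (dual_space V) \<longleftrightarrow> \<xi> \<in> linear_maps V ground_space \<and> \<xi> \<in> extensional (carrier V)"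
  "\<zero>\<^bsub>dual_space V\<^esub> = (\<lambda>v\<in>carrier V. 0)"
  "\<xi> \<oplus>\<^bsub>dual_space V\<^esub> \<zeta> = (\<lambda>v\<in>carrier V. \<xi> v + \<zeta> v)"
  "c \<odot>\<^bsub>dual_space V\<^esub> \<xi> = (\<lambda>v\<in>carrier V. c * \<xi> v)"
  by (simp_all add: dual_space_def)

lemma dual_lin: "\<xi> \<in> carrier (dual_space V) \<Longrightarrow> \<xi> \<in> linear_maps V ground_space"
  by (simp add: dual_space_simps)

lemma dual_space_eqI:
  "\<xi> \<in> carrier (dual_space V) \<Longrightarrow> \<zeta> \<in> carrier (dual_space V) \<Longrightarrow>
    (\<And>v. v \<in> carrier V \<Longrightarrow> \<xi> v = \<zeta> v) \<Longrightarrow> \<xi> = \<zeta>"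
  by (auto simp: dual_space_simps intro: extensionalityI)

lemma eval_lin: "v \<in> carrier V \<Longrightarrow> (\<lambda>f. f v) \<in> linear_maps (lin_space V W) W"
  by (rule lin_mapI) (simp_all add: lin_space_simps lin_closed[of _ V W])

lemma eval_dual_lin: "v \<in> carrier V \<Longrightarrow> (\<lambda>f. f v) \<in> linear_maps (dual_space V) ground_space"
  by (simp add: dual_space_eq eval_lin)

text \<open>A frame decomposes every vector, but its vectors need not be linearly independent.\<close>

definition frame :: "('k::field, 'v) module \<Rightarrow> ('v \<times> ('v \<Rightarrow> 'k)) list \<Rightarrow> bool" where
  "frame V L \<longleftrightarrow> set L \<subseteq> carrier V \<times> carrier (dual_space V) \<and>
     (\<forall>v\<in>carrier V. vsum V (map (\<lambda>(e, x). x v \<odot>\<^bsub>V\<^esub> e) L) = v)"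

lemma frame_in:
  "frame V L \<Longrightarrow> p \<in> set L \<Longrightarrow> fst p \<in> carrier V \<and> snd p \<in> carrier (dual_space V)"
  by (auto simp: frame_def)

text \<open>Apply \<open>f\<close> to the decomposition of \<open>v\<close>. Most sums over a frame
  that occur later are recognised as values of a linear map in this form.\<close>

lemma frame_expand:
  assumes "is_vs V" "is_vs W" "frame V L" "f \<in> linear_maps V W" "v \<in> carrier V"
  shows "f v = vsum W (map (\<lambda>p. snd p v \<odot>\<^bsub>W\<^esub> f (fst p)) L)"
proof -
  have "f v = f (vsum V (map (\<lambda>p. snd p v \<odot>\<^bsub>V\<^esub> fst p) L))"
    using assms(3,5) by (simp add: frame_def split_def)
  also have "\<dots> = vsum W (map f (map (\<lambda>p. snd p v \<odot>\<^bsub>V\<^esub> fst p) L))"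
    using assms frame_in[OF assms(3)] by (intro lin_vsum) auto
  also have "\<dots> = vsum W (map (\<lambda>p. snd p v \<odot>\<^bsub>W\<^esub> f (fst p)) L)"
    using frame_in[OF assms(3)] by (auto simp: lin_smult[OF assms(4)] intro!: arg_cong[where f = "vsum W"])
  finally show ?thesis .
qed

lemma frame_self:
  "is_vs V \<Longrightarrow> frame V L \<Longrightarrow> v \<in> carrier V \<Longrightarrow> vsum V (map (\<lambda>p. snd p v \<odot>\<^bsub>V\<^esub> fst p) L) = v"
  by (simp add: frame_def split_def)

text \<open>With its components exchanged, a frame of \<open>V\<close> also decomposes functionals:
  evaluation at \<open>v\<close> reduces the claim to the expansion of \<open>\<xi> v\<close> along
  the frame.\<close>

lemma frame_dual:
  assumes V: "is_vs V" and L: "frame V L" and \<xi>: "\<xi> \<in> carrier (dual_space V)"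
  shows "vsum (dual_space V) (map (\<lambda>p. \<xi> (fst p) \<odot>\<^bsub>dual_space V\<^esub> snd p) L) = \<xi>"
proof (rule dual_space_eqI)
  have c: "set (map (\<lambda>p. \<xi> (fst p) \<odot>\<^bsub>dual_space V\<^esub> snd p) L) \<subseteq> carrier (dual_space V)"
    using frame_in[OF L] by (auto intro!: vs_smult[OF dual_space_vs[OF V]])
  then show "vsum (dual_space V) (map (\<lambda>p. \<xi> (fst p) \<odot>\<^bsub>dual_space V\<^esub> snd p) L) \<in> carrier (dual_space V)"
    by (intro vsum_closed dual_space_vs V)
  fix v assume v: "v \<in> carrier V"
  have "vsum (dual_space V) (map (\<lambda>p. \<xi> (fst p) \<odot>\<^bsub>dual_space V\<^esub> snd p) L) v =
    vsum ground_space (map (\<lambda>f. f v) (map (\<lambda>p. \<xi> (fst p) \<odot>\<^bsub>dual_space V\<^esub> snd p) L))"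
    by (rule lin_vsum[OF dual_space_vs[OF V] ground_space_vs eval_dual_lin[OF v] c])
  also have "\<dots> = vsum ground_space (map (\<lambda>p. snd p v \<odot>\<^bsub>ground_space\<^esub> \<xi> (fst p)) L)"
    by (simp add: dual_space_simps v o_def mult.commute)
  also have "\<dots> = \<xi> v"
    by (rule frame_expand[OF V ground_space_vs L dual_lin[OF \<xi>] v, symmetric])
  finally show "vsum (dual_space V) (map (\<lambda>p. \<xi> (fst p) \<odot>\<^bsub>dual_space V\<^esub> snd p) L) v = \<xi> v" .
qed (rule \<xi>)

lemma finsum_vsum:
  assumes V: "is_vs V" and "distinct L" "\<And>i. i \<in> set L \<Longrightarrow> f i \<in> carrier V"
  shows "finsum V f (set L) = vsum V (map f L)"
proof -
  interpret V: vectorspace class_ring V by (rule V)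
  show ?thesis using assms(2,3)
    by (induction L) (auto simp: V.finsum_insert)
qed

text \<open>The frame vectors span \<open>V\<close>, and a finite spanning set is what
  \<open>fin_dim\<close> asks for.\<close>

lemma frame_fd:
  assumes V: "is_vs V" and L: "frame V L"
  shows "fd_space V"
proof -
  interpret V: vectorspace class_ring V by (rule V)
  let ?A = "set (map fst L)"
  have A: "?A \<subseteq> carrier V" using frame_in[OF L] by auto
  have sub: "submodule class_ring (V.span ?A) V" by (rule V.span_is_submodule[OF A])
  have "v \<in> V.span ?A" if v: "v \<in> carrier V" for v
  proof -
    have "vsum V (map (\<lambda>p. snd p v \<odot>\<^bsub>V\<^esub> fst p) M) \<in> V.span ?A" if "set M \<subseteq> set L" for M
      using that
    proof (induction M)
      case Nil then show ?case using sub by (simp add: submodule_def)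
    next
      case (Cons p M)
      have "fst p \<in> V.span ?A" using V.in_own_span[OF A] Cons.prems by auto
      then show ?case using Cons sub by (simp add: submodule_def)
    qed
    from this[of L] show ?thesis using frame_self[OF V L v] by simp
  qed
  then have "V.span ?A = carrier V" using V.span_is_subset2[OF A] by auto
  then show ?thesis using A V unfolding fd_space_def V.fin_dim_def by blast
qed

text \<open>The frame pairs the vectors of a basis with their coordinate functionals. Coefficient
  functions are taken extensional on \<open>B\<close>; being unique, they depend linearly on the
  vector.\<close>

lemma fd_frame:
  fixes V :: "('k::field, 'v) module"
  assumes "fd_space V"
  obtains L where "frame V L"
proof -
  have V: "is_vs V" using assms by (rule fd_vs)
  interpret V: vectorspace class_ring V by (rule V)
  obtain B where B: "finite B" "V.basis B"
    using assms V.finite_basis_exists by (auto simp: fd_space_def)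
  have BV: "B \<subseteq> carrier V" using B(2) by (simp add: V.basis_def)
  have ex1: "\<exists>!a. a \<in> B \<rightarrow>\<^sub>E UNIV \<and> V.lincomb a B = v" if "v \<in> carrier V" for v
    using V.basis_criterion[OF B(1) BV] B(2) that by auto
  define co where "co v = (THE a. a \<in> B \<rightarrow>\<^sub>E UNIV \<and> V.lincomb a B = v)" for v
  have co: "co v \<in> B \<rightarrow>\<^sub>E UNIV" "V.lincomb (co v) B = v" if "v \<in> carrier V" for v
    using theI'[OF ex1[OF that]] by (auto simp: co_def)
  have co_eq: "co v = a" if "v \<in> carrier V" "a \<in> B \<rightarrow>\<^sub>E UNIV" "V.lincomb a B = v" for v a
    using ex1[OF that(1)] co[OF that(1)] that(2,3) by blast
  obtain bs where bs: "set bs = B" "distinct bs" using finite_distinct_list[OF B(1)] by blast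
  have lc: "V.lincomb a B = vsum V (map (\<lambda>b. a b \<odot>\<^bsub>V\<^esub> b) bs)" for a
    unfolding V.lincomb_def using bs BV by (subst bs(1)[symmetric], subst finsum_vsum[OF V]) auto
  have co_add: "co (v \<oplus>\<^bsub>V\<^esub> w) = (\<lambda>b\<in>B. co v b + co w b)" if "v \<in> carrier V" "w \<in> carrier V" for v w
  proof (rule co_eq)
    have "vsum V (map (\<lambda>b. (co v b + co w b) \<odot>\<^bsub>V\<^esub> b) bs) =
      vsum V (map (\<lambda>b. co v b \<odot>\<^bsub>V\<^esub> b \<oplus>\<^bsub>V\<^esub> co w b \<odot>\<^bsub>V\<^esub> b) bs)"
      using bs BV by (intro arg_cong[where f = "vsum V"] map_cong) (auto intro!: vs_add_smult[OF V])
    also have "\<dots> = v \<oplus>\<^bsub>V\<^esub> w"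
      using bs BV co that by (subst vsum_add[OF V]) (auto simp: lc)
    finally show "V.lincomb (\<lambda>b\<in>B. co v b + co w b) B = v \<oplus>\<^bsub>V\<^esub> w"
      unfolding lc using bs by (auto cong: map_cong)
  qed (use that in \<open>auto\<close>)
  have co_smult: "co (c \<odot>\<^bsub>V\<^esub> v) = (\<lambda>b\<in>B. c * co v b)" if "v \<in> carrier V" for c v
  proof (rule co_eq)
    have l: "(\<lambda>v. c \<odot>\<^bsub>V\<^esub> v) \<in> linear_maps V V"
      by (rule lin_mapI) (auto simp: V vs_smult_add[OF V] vs_smult_smult[OF V] mult.commute)
    have "c \<odot>\<^bsub>V\<^esub> v = vsum V (map (\<lambda>v. c \<odot>\<^bsub>V\<^esub> v) (map (\<lambda>b. co v b \<odot>\<^bsub>V\<^esub> b) bs))"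
      using co(2)[OF that] bs BV by (subst lin_vsum[OF V V l, symmetric]) (auto simp: lc)
    also have "\<dots> = vsum V (map (\<lambda>b. (c * co v b) \<odot>\<^bsub>V\<^esub> b) bs)"
      using bs BV by (auto simp: vs_smult_smult[OF V] subset_iff intro!: arg_cong[where f = "vsum V"])
    finally show "V.lincomb (\<lambda>b\<in>B. c * co v b) B = c \<odot>\<^bsub>V\<^esub> v"
      unfolding lc using bs by (auto cong: map_cong)
  qed (use that in auto)
  have "frame V (map (\<lambda>b. (b, \<lambda>v\<in>carrier V. co v b)) bs)"
    unfolding frame_def
  proof (intro conjI ballI)
    show "set (map (\<lambda>b. (b, \<lambda>v\<in>carrier V. co v b)) bs) \<subseteq> carrier V \<times> carrier (dual_space V)"
      using bs BV by (auto intro!: restrict_dual_space[OF V] lin_mapI simp: co_add co_smult)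
    fix v assume v: "v \<in> carrier V"
    show "vsum V (map (\<lambda>(e, x). x v \<odot>\<^bsub>V\<^esub> e) (map (\<lambda>b. (b, \<lambda>v\<in>carrier V. co v b)) bs)) = v"
      using co(2)[OF v] v by (simp add: lc o_def)
  qed
  then show ?thesis by (rule that)
qed

lemma lin_space_fd:
  assumes V: "fd_space V" and W: "fd_space W"
  shows "fd_space (lin_space V W)"
proof -
  have vV: "is_vs V" and vW: "is_vs W" using assms fd_vs by auto
  obtain L where L: "frame V L" using V by (rule fd_frame)
  obtain M where M: "frame W M" using W by (rule fd_frame)
  note vlin = lin_space_vs[OF vV vW]
  \<comment> \<open>Elementary matrices with respect to the two frames: \<open>E p q\<close> has
    rank one, and \<open>X p q\<close> reads off the matrix entry at the same position.\<close>
  define E where "E p q = (\<lambda>v\<in>carrier V. snd p v \<odot>\<^bsub>W\<^esub> fst q)" for p :: "'a \<times> ('a \<Rightarrow> 'b)" and q :: "'c \<times> ('c \<Rightarrow> 'b)"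
  define X where "X p q = (\<lambda>f\<in>carrier (lin_space V W). snd q (f (fst p)))"
    for p :: "'a \<times> ('a \<Rightarrow> 'b)" and q :: "'c \<times> ('c \<Rightarrow> 'b)"
  have E: "E p q \<in> carrier (lin_space V W)" if "p \<in> set L" "q \<in> set M" for p q
    unfolding E_def
  proof (rule restrict_lin_space[OF vV], rule lin_mapI)
    note p = frame_in[OF L that(1)] and q = frame_in[OF M that(2)]
    note lp = dual_lin[of "snd p" V]
    show "snd p v \<odot>\<^bsub>W\<^esub> fst q \<in> carrier W" for v using q by (simp add: vW)
    show "snd p (v \<oplus>\<^bsub>V\<^esub> v') \<odot>\<^bsub>W\<^esub> fst q = snd p v \<odot>\<^bsub>W\<^esub> fst q \<oplus>\<^bsub>W\<^esub> snd p v' \<odot>\<^bsub>W\<^esub> fst q"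
      if "v \<in> carrier V" "v' \<in> carrier V" for v v'
      using p q that by (simp add: lin_add[OF lp] vs_add_smult[OF vW])
    show "snd p (c \<odot>\<^bsub>V\<^esub> v) \<odot>\<^bsub>W\<^esub> fst q = c \<odot>\<^bsub>W\<^esub> (snd p v \<odot>\<^bsub>W\<^esub> fst q)" if "v \<in> carrier V" for c v
      using p q that by (simp add: lin_smult[OF lp] vs_smult_smult[OF vW])
  qed
  have X: "X p q \<in> carrier (dual_space (lin_space V W))" if "p \<in> set L" "q \<in> set M" for p q
    unfolding X_def using frame_in[OF L that(1)] frame_in[OF M that(2)]
    by (intro restrict_dual_space[OF vlin] lin_comp[OF eval_lin dual_lin]) auto
  define F where "F = concat (map (\<lambda>p. map (\<lambda>q. (E p q, X p q)) M) L)"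
  have "frame (lin_space V W) F"
    unfolding frame_def
  proof (intro conjI ballI)
    show "set F \<subseteq> carrier (lin_space V W) \<times> carrier (dual_space (lin_space V W))"
      using E X by (auto simp: F_def)
    fix f assume f: "f \<in> carrier (lin_space V W)"
    let ?S = "map (\<lambda>p. map (\<lambda>q. X p q f \<odot>\<^bsub>lin_space V W\<^esub> E p q) M) L"
    have S: "\<forall>vs\<in>set ?S. set vs \<subseteq> carrier (lin_space V W)"
      using E by (auto intro!: vs_smult[OF vlin])
    have "vsum (lin_space V W) (map (\<lambda>(e, x). x f \<odot>\<^bsub>lin_space V W\<^esub> e) F) = vsum (lin_space V W) (concat ?S)"
      by (simp add: F_def map_concat o_def)
    also have "\<dots> = f"
    proof (rule lin_space_eqI[OF _ f])
      show "vsum (lin_space V W) (concat ?S) \<in> carrier (lin_space V W)"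
        using S by (intro vsum_closed[OF vlin]) auto
      fix v assume v: "v \<in> carrier V"
      have "vsum (lin_space V W) (concat ?S) v = vsum W (map (\<lambda>f. f v) (concat ?S))"
        using S by (intro lin_vsum[OF vlin vW eval_lin[OF v]]) auto
      also have "\<dots> = vsum W (concat (map (map (\<lambda>f. f v)) ?S))" by (simp add: map_concat)
      also have "\<dots> = vsum W (map (vsum W) (map (map (\<lambda>f. f v)) ?S))"
      proof (rule vsum_concat[OF vW])
        show "\<forall>vs\<in>set (map (map (\<lambda>f. f v)) ?S). set vs \<subseteq> carrier W"
          using S lin_closed[OF eval_lin[OF v]] by fastforce
      qed
      also have "map (vsum W) (map (map (\<lambda>f. f v)) ?S) = map (\<lambda>p. snd p v \<odot>\<^bsub>W\<^esub> f (fst p)) L"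
      proof (simp add: o_def, intro ballI)
        fix p assume p: "p \<in> set L"
        note fp = frame_in[OF L p]
        have fc: "f (fst p) \<in> carrier W" using fp lin_closed[OF lin_space_lin[OF f]] by blast
        have l: "(\<lambda>w. snd p v \<odot>\<^bsub>W\<^esub> w) \<in> linear_maps W W"
          by (rule lin_mapI) (auto simp: vW vs_smult_add[OF vW] vs_smult_smult[OF vW] mult.commute)
        have "snd p v \<odot>\<^bsub>W\<^esub> f (fst p) = snd p v \<odot>\<^bsub>W\<^esub> vsum W (map (\<lambda>q. snd q (f (fst p)) \<odot>\<^bsub>W\<^esub> fst q) M)"
          using frame_self[OF vW M fc] by simp
        also have "\<dots> = vsum W (map (\<lambda>w. snd p v \<odot>\<^bsub>W\<^esub> w) (map (\<lambda>q. snd q (f (fst p)) \<odot>\<^bsub>W\<^esub> fst q) M))"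
          using frame_in[OF M] by (intro lin_vsum[OF vW vW l]) (auto simp: vW)
        also have "\<dots> = vsum W (map (\<lambda>q. (X p q f \<odot>\<^bsub>lin_space V W\<^esub> E p q) v) M)"
          using frame_in[OF M] f v
          by (intro arg_cong[where f = "vsum W"])
            (auto simp: lin_space_simps(4) X_def E_def vs_smult_smult[OF vW] mult.commute)
        finally show "vsum W (map (\<lambda>q. (X p q f \<odot>\<^bsub>lin_space V W\<^esub> E p q) v) M) = snd p v \<odot>\<^bsub>W\<^esub> f (fst p)" by simp
      qed
      also have "vsum W (map (\<lambda>p. snd p v \<odot>\<^bsub>W\<^esub> f (fst p)) L) = f v"
        by (rule frame_expand[OF vV vW L lin_space_lin[OF f] v, symmetric])
      finally show "vsum (lin_space V W) (concat ?S) v = f v" .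
    qed
    finally show "vsum (lin_space V W) (map (\<lambda>(e, x). x f \<odot>\<^bsub>lin_space V W\<^esub> e) F) = f" .
  qed
  then show ?thesis by (rule frame_fd[OF vlin])
qed

lemma ground_space_fd: "fd_space (ground_space :: ('k::field, 'k) module)"
proof (rule frame_fd[OF ground_space_vs])
  show "frame (ground_space :: ('k, 'k) module) [(1, \<lambda>x\<in>UNIV. x)]"
    by (auto simp: frame_def intro!: restrict_dual_space[OF ground_space_vs, simplified] lin_mapI)
qed

lemma dual_space_fd: "fd_space V \<Longrightarrow> fd_space (dual_space V)"
  by (simp add: dual_space_eq lin_space_fd ground_space_fd)

text \<open>Gaussian elimination: finitely many functionals that separate points yield a frame.\<close>

lemma separating_fd:
  fixes U :: "('k::field, 'v) module"
  assumes U: "is_vs U" and xs: "set xs \<subseteq> carrier (dual_space U)"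
    and sep: "\<And>u u'. u \<in> carrier U \<Longrightarrow> u' \<in> carrier U \<Longrightarrow> (\<And>x. x \<in> set xs \<Longrightarrow> x u = x u') \<Longrightarrow> u = u'"
  shows "fd_space U"
proof -
  let ?P = "\<lambda>L u. vsum U (map (\<lambda>p. snd p u \<odot>\<^bsub>U\<^esub> fst p) L)"
  \<comment> \<open>The candidate projection \<open>?P L\<close> only has to preserve the
    functionals of \<open>xs\<close>; since these separate points, it is then the identity. The list
    is built up one functional at a time.\<close>
  have "\<exists>L. set L \<subseteq> carrier U \<times> carrier (dual_space U) \<and> (\<forall>u\<in>carrier U. \<forall>x\<in>set xs. x (?P L u) = x u)"
    using xs
  proof (induction xs)
    case Nil show ?case by (rule exI[of _ "[]"]) simp
  next
    case (Cons z xs)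
    then obtain L where L: "set L \<subseteq> carrier U \<times> carrier (dual_space U)"
      and Lx: "\<And>u x. u \<in> carrier U \<Longrightarrow> x \<in> set xs \<Longrightarrow> x (?P L u) = x u" by auto
    have z: "z \<in> carrier (dual_space U)" using Cons.prems by simp
    have Pc: "?P L u \<in> carrier U" if "u \<in> carrier U" for u
      using L by (intro vsum_closed[OF U]) (auto intro!: vs_smult[OF U])
    show ?case
    proof (cases "\<forall>u\<in>carrier U. z (?P L u) = z u")
      case True then show ?thesis using L Lx by (intro exI[of _ L]) auto
    next
      case False
      then obtain w where w: "w \<in> carrier U" "z (?P L w) \<noteq> z w" by blast
      \<comment> \<open>The error \<open>w - ?P L w\<close> is killed by the earlier functionals,
        because \<open>?P L\<close> preserves them, but not by \<open>z\<close>. Dividing by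
        \<open>d\<close> normalises it to \<open>z w' = 1\<close>.\<close>
      define d where "d = z w - z (?P L w)"
      define w' where "w' = inverse d \<odot>\<^bsub>U\<^esub> (w \<oplus>\<^bsub>U\<^esub> (-1) \<odot>\<^bsub>U\<^esub> ?P L w)"
      have w'c: "w' \<in> carrier U" using w(1) Pc by (simp add: w'_def U)
      have aux: "x w' = inverse d * (x w - x (?P L w))" if "x \<in> carrier (dual_space U)" for x
        using Pc[OF w(1)] w(1) dual_lin[OF that]
        by (simp add: w'_def U lin_smult lin_add)
      have zw': "z w' = 1" using aux[OF z] w(2) by (simp add: d_def)
      have xw': "x w' = 0" if "x \<in> set xs" for x
        using aux[of x] Lx[OF w(1) that] Cons.prems that by auto
      have PL: "?P L \<in> linear_maps U U"
      proof (rule lin_mapI)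
        have dl: "p \<in> set L \<Longrightarrow> fst p \<in> carrier U \<and> snd p \<in> linear_maps U ground_space" for p
          using L dual_lin by fastforce
        show "?P L v \<in> carrier U" if "v \<in> carrier U" for v by (rule Pc[OF that])
        show "?P L (v \<oplus>\<^bsub>U\<^esub> v') = ?P L v \<oplus>\<^bsub>U\<^esub> ?P L v'" if v: "v \<in> carrier U" "v' \<in> carrier U" for v v'
          using dl by (subst vsum_add[OF U, symmetric])
            (auto simp: U lin_add[of _ U ground_space] v vs_add_smult[OF U] intro!: arg_cong[where f = "vsum U"])
        show "?P L (c \<odot>\<^bsub>U\<^esub> v) = c \<odot>\<^bsub>U\<^esub> ?P L v" if v: "v \<in> carrier U" for c v
        proof -
          have l: "(\<lambda>v. c \<odot>\<^bsub>U\<^esub> v) \<in> linear_maps U U"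
            by (rule lin_mapI) (auto simp: U vs_smult_add[OF U] vs_smult_smult[OF U] mult.commute)
          show ?thesis using dl by (subst lin_vsum[OF U U l])
             (auto simp: U lin_smult[of _ U ground_space] v vs_smult_smult[OF U] intro!: arg_cong[where f = "vsum U"])
        qed
      qed
      \<comment> \<open>\<open>y\<close> measures by how much \<open>?P L\<close> fails to preserve
        \<open>z\<close>. The new pair \<open>(w', y)\<close> adds exactly this amount to the value
        of \<open>z\<close> and nothing to the values of \<open>xs\<close>.\<close>
      define y where "y = (\<lambda>u\<in>carrier U. z u - z (?P L u))"
      have y: "y \<in> carrier (dual_space U)"
        unfolding y_def
        by (rule restrict_dual_space[OF U], rule lin_mapI)
          (simp_all add: lin_add[OF dual_lin[OF z]] lin_smult[OF dual_lin[OF z]] lin_add[OF PL] lin_smult[OF PL]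
            Pc algebra_simps)
      have "x (?P ((w', y) # L) u) = x u" if u: "u \<in> carrier U" and x: "x \<in> set (z # xs)" for u x
      proof -
        have xd: "x \<in> carrier (dual_space U)" using Cons.prems x by auto
        have "x (?P ((w', y) # L) u) = y u * x w' + x (?P L u)"
          using dual_lin[OF xd] w'c Pc[OF u] by (simp add: lin_add lin_smult U)
        also have "\<dots> = x u"
        proof (cases "x = z")
          case True then show ?thesis by (simp add: zw' y_def u)
        next
          case False then show ?thesis using x xw'[of x] Lx[OF u, of x] by simp
        qed
        finally show ?thesis .
      qed
      then show ?thesis using L w'c y by (intro exI[of _ "(w', y) # L"]) simp
    qed
  qed
  then obtain L where L: "set L \<subseteq> carrier U \<times> carrier (dual_space U)"
    and Lx: "\<And>u x. u \<in> carrier U \<Longrightarrow> x \<in> set xs \<Longrightarrow> x (?P L u) = x u" by auto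
  have "frame U L"
    unfolding frame_def
  proof (intro conjI L ballI)
    fix u assume u: "u \<in> carrier U"
    have "?P L u = u"
      using L u Lx by (intro sep vsum_closed[OF U]) (auto intro!: vs_smult[OF U])
    then show "vsum U (map (\<lambda>(e, x). x u \<odot>\<^bsub>U\<^esub> e) L) = u" by (simp add: split_def)
  qed
  then show ?thesis by (rule frame_fd[OF U])
qed

text \<open>The functionals of a frame of \<open>W\<close>, pulled back along \<open>f\<close>,
  separate the points of \<open>U\<close>. So neither the image of \<open>f\<close> nor a left
  inverse has to be studied.\<close>

lemma inj_fd:
  assumes U: "is_vs U" and W: "fd_space W" and f: "f \<in> linear_maps U W" "inj_on f (carrier U)"
  shows "fd_space U"
proof -
  obtain L where L: "frame W L" using W by (rule fd_frame)
  let ?xs = "map (\<lambda>p. \<lambda>u\<in>carrier U. snd p (f u)) L"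
  show ?thesis
  proof (rule separating_fd[OF U, of ?xs])
    show "set ?xs \<subseteq> carrier (dual_space U)"
    proof clarsimp
      fix e x assume "(e, x) \<in> set L"
      then have "x \<in> linear_maps W ground_space" using frame_in[OF L, of "(e, x)"] dual_lin[of x W] by simp
      then show "(\<lambda>u\<in>carrier U. x (f u)) \<in> carrier (dual_space U)"
        by (rule restrict_dual_space[OF U lin_comp[OF f(1)]])
    qed
    fix u u' assume u: "u \<in> carrier U" "u' \<in> carrier U" and eq': "\<And>x. x \<in> set ?xs \<Longrightarrow> x u = x u'"
    have eq: "snd p (f u) = snd p (f u')" if "p \<in> set L" for p
      using eq'[of "\<lambda>u\<in>carrier U. snd p (f u)"] that u by simp
    note self = frame_self[OF fd_vs[OF W] L lin_closed[OF f(1)]]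
    have "f u = f u'"
      using self[OF u(1)] self[OF u(2)] eq by (metis (mono_tags, lifting) map_eq_conv)
    then show "u = u'" using f(2) u by (auto dest: inj_onD)
  qed
qed


subsection \<open>Tensor products\<close>

lemma lookup_map_mult [simp]:
  fixes p :: "'a \<Rightarrow>\<^sub>0 'k::field"
  shows "Poly_Mapping.lookup (Poly_Mapping.map ((*) c) p) x = c * Poly_Mapping.lookup p x"
  by (simp add: Poly_Mapping.map.rep_eq when_def)

lemma keys_map_mult: "Poly_Mapping.keys (Poly_Mapping.map ((*) c) p) \<subseteq> Poly_Mapping.keys p"
  for p :: "'a \<Rightarrow>\<^sub>0 'k::field"
  by (auto simp: in_keys_iff)

lemma keys_diff_subset: "Poly_Mapping.keys (p - q) \<subseteq> Poly_Mapping.keys p \<union> Poly_Mapping.keys q"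
  for p :: "'a \<Rightarrow>\<^sub>0 'k::field"
  by (auto simp: in_keys_iff lookup_minus)

section \<open>Linear extension from a free vector space\<close>

definition free_ext :: "('k::field, 'u) module \<Rightarrow> ('a \<Rightarrow> 'u) \<Rightarrow> ('a \<Rightarrow>\<^sub>0 'k) \<Rightarrow> 'u" where
  "free_ext U b p = finsum U (\<lambda>x. Poly_Mapping.lookup p x \<odot>\<^bsub>U\<^esub> b x) (Poly_Mapping.keys p)"

context
  fixes U :: "('k::field, 'u) module" and b :: "'a \<Rightarrow> 'u" and S :: "'a set"
  assumes U: "is_vs U" and b: "\<And>x. x \<in> S \<Longrightarrow> b x \<in> carrier U"
begin

interpretation U: vectorspace class_ring U by (rule U)

lemma free_ext_superset:
  assumes "finite T" "Poly_Mapping.keys p \<subseteq> T" "T \<subseteq> S"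
  shows "free_ext U b p = finsum U (\<lambda>x. Poly_Mapping.lookup p x \<odot>\<^bsub>U\<^esub> b x) T"
  unfolding free_ext_def using assms b
  by (intro U.add.finprod_mono_neutral_cong_left) (auto simp: in_keys_iff U)

lemma free_ext_closed: "Poly_Mapping.keys p \<subseteq> S \<Longrightarrow> free_ext U b p \<in> carrier U"
  unfolding free_ext_def using b by (intro U.finsum_closed) (auto simp: U)

lemma free_ext_zero [simp]: "free_ext U b 0 = \<zero>\<^bsub>U\<^esub>"
  by (simp add: free_ext_def)

lemma free_ext_add:
  assumes "Poly_Mapping.keys p \<subseteq> S" "Poly_Mapping.keys q \<subseteq> S"
  shows "free_ext U b (p + q) = free_ext U b p \<oplus>\<^bsub>U\<^esub> free_ext U b q"
proof -
  let ?T = "Poly_Mapping.keys p \<union> Poly_Mapping.keys q"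
  have T: "finite ?T" "?T \<subseteq> S" using assms by auto
  have bT: "b x \<in> carrier U" if "x \<in> ?T" for x using b T(2) that by blast
  have "free_ext U b (p + q) =
    finsum U (\<lambda>x. Poly_Mapping.lookup p x \<odot>\<^bsub>U\<^esub> b x \<oplus>\<^bsub>U\<^esub> Poly_Mapping.lookup q x \<odot>\<^bsub>U\<^esub> b x) ?T"
    unfolding free_ext_superset[OF T(1) Poly_Mapping.keys_add T(2)] lookup_add
    by (rule U.finsum_cong') (use bT in \<open>auto simp: vs_add_smult[OF U] U\<close>)
  also have "\<dots> = free_ext U b p \<oplus>\<^bsub>U\<^esub> free_ext U b q"
    using bT
    by (subst U.finsum_addf)
      (auto simp: U Pi_iff free_ext_superset[OF T(1) _ T(2)])
  finally show ?thesis .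
qed

lemma free_ext_scale:
  assumes "Poly_Mapping.keys p \<subseteq> S"
  shows "free_ext U b (Poly_Mapping.map ((*) c) p) = c \<odot>\<^bsub>U\<^esub> free_ext U b p"
proof -
  have bT: "b x \<in> carrier U" if "x \<in> Poly_Mapping.keys p" for x using b assms that by blast
  have "free_ext U b (Poly_Mapping.map ((*) c) p) =
    finsum U (\<lambda>x. c \<odot>\<^bsub>U\<^esub> (Poly_Mapping.lookup p x \<odot>\<^bsub>U\<^esub> b x)) (Poly_Mapping.keys p)"
    using bT
    by (subst free_ext_superset[OF _ keys_map_mult assms])
      (auto intro!: U.finsum_cong' simp: vs_smult_smult[OF U] U Pi_iff)
  also have "\<dots> = c \<odot>\<^bsub>U\<^esub> free_ext U b p"
    unfolding free_ext_def using bT by (subst U.finsum_smult) (auto simp: U Pi_iff)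
  finally show ?thesis .
qed

lemma free_ext_single: "x \<in> S \<Longrightarrow> free_ext U b (Poly_Mapping.single x c) = c \<odot>\<^bsub>U\<^esub> b x"
  using b[of x]
  by (subst free_ext_superset[of "{x}"]) (auto simp: U)

lemma free_ext_diff:
  assumes "Poly_Mapping.keys p \<subseteq> S" "Poly_Mapping.keys q \<subseteq> S" "free_ext U b (p - q) = \<zero>\<^bsub>U\<^esub>"
  shows "free_ext U b p = free_ext U b q"
proof -
  have "Poly_Mapping.keys (p - q) \<subseteq> S" using keys_diff_subset[of p q] assms(1,2) by blast
  from free_ext_add[OF this assms(2)] assms(3) show ?thesis
    using free_ext_closed[OF assms(2)] U by simp
qed

end

lemma free_space_add: "p \<in> free_space V W \<Longrightarrow> q \<in> free_space V W \<Longrightarrow> p + q \<in> free_space V W"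
  unfolding free_space_def using Poly_Mapping.keys_add[of p q] by blast

lemma free_space_diff: "p \<in> free_space V W \<Longrightarrow> q \<in> free_space V W \<Longrightarrow> p - q \<in> free_space V W"
  unfolding free_space_def using keys_diff_subset[of p q] by blast

lemma free_space_scale: "p \<in> free_space V W \<Longrightarrow> Poly_Mapping.map ((*) c) p \<in> free_space V W"
  unfolding free_space_def using keys_map_mult[of c p] by blast

lemma free_space_zero: "0 \<in> free_space V W"
  by (simp add: free_space_def)

lemma free_space_single: "v \<in> carrier V \<Longrightarrow> w \<in> carrier W \<Longrightarrow> Poly_Mapping.single (v, w) c \<in> free_space V W"
  by (simp add: free_space_def)

section \<open>The tensor product as a quotient of a free vector space\<close>

context
  fixes V :: "('k::field, 'v) module" and W :: "('k, 'w) module"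
  assumes V: "is_vs V" and W: "is_vs W"
begin

lemma tensor_null_free: "p \<in> tensor_null V W \<Longrightarrow> p \<in> free_space V W"
  by (induction rule: tensor_null.induct)
    (simp_all add: free_space_add free_space_scale free_space_zero free_space_single free_space_diff V W)

lemma tensor_null_neg: "p \<in> tensor_null V W \<Longrightarrow> - p \<in> tensor_null V W"
proof -
  assume "p \<in> tensor_null V W"
  then have "Poly_Mapping.map ((*) (-1)) p \<in> tensor_null V W" by (rule tensor_null.scale)
  also have "Poly_Mapping.map ((*) (-1)) p = - p" by (rule poly_mapping_eqI) simp
  finally show ?thesis .
qed

lemma tensor_null_sub_comm: "p - q \<in> tensor_null V W \<Longrightarrow> q - p \<in> tensor_null V W"
  using tensor_null_neg[of "p - q"] by simp

lemma tensor_null_trans: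
  "p - q \<in> tensor_null V W \<Longrightarrow> q - r \<in> tensor_null V W \<Longrightarrow> p - r \<in> tensor_null V W"
  using tensor_null.add[of "p - q" V W "q - r"] by simp

lemma tensor_rel_equiv: "equiv (free_space V W) (tensor_rel V W)"
proof (rule equivI)
  show "refl_on (free_space V W) (tensor_rel V W)"
    by (auto simp: refl_on_def tensor_rel_def tensor_null.zero)
  show "tensor_rel V W \<subseteq> free_space V W \<times> free_space V W"
    by (auto simp: tensor_rel_def)
qed (auto simp: sym_def trans_def tensor_rel_def intro: tensor_null_sub_comm tensor_null_trans)

definition tclass :: "(('v \<times> 'w) \<Rightarrow>\<^sub>0 'k) \<Rightarrow> (('v \<times> 'w) \<Rightarrow>\<^sub>0 'k) set" where
  "tclass p = tensor_rel V W `` {p}"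

lemma tclass_eq_iff:
  "p \<in> free_space V W \<Longrightarrow> q \<in> free_space V W \<Longrightarrow> tclass p = tclass q \<longleftrightarrow> p - q \<in> tensor_null V W"
  unfolding tclass_def using eq_equiv_class_iff[OF tensor_rel_equiv, of p q] by (auto simp: tensor_rel_def)

lemma tensor_carrier: "X \<in> carrier (tensor_space V W) \<longleftrightarrow> (\<exists>p\<in>free_space V W. X = tclass p)"
  unfolding tensor_space_def tclass_def quotient_def by simp

lemma tclass_self: "p \<in> free_space V W \<Longrightarrow> p \<in> tclass p"
  unfolding tclass_def by (rule equiv_class_self[OF tensor_rel_equiv])

lemma tclass_mem: "q \<in> tclass p \<Longrightarrow> q \<in> free_space V W \<and> p \<in> free_space V W \<and> p - q \<in> tensor_null V W"
  by (auto simp: tclass_def tensor_rel_def)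

text \<open>All choices of representatives lead to one and the same class, so the double union in
  the definition of the sum collapses to it.\<close>

lemma tensor_add:
  assumes "p \<in> free_space V W" "q \<in> free_space V W"
  shows "tclass p \<oplus>\<^bsub>tensor_space V W\<^esub> tclass q = tclass (p + q)"
proof -
  have eq: "tclass (p' + q') = tclass (p + q)" if p': "p' \<in> tclass p" and q': "q' \<in> tclass q" for p' q'
  proof -
    have "p' + q' - (p + q) = (p' - p) + (q' - q)" by simp
    also have "\<dots> \<in> tensor_null V W"
      using tclass_mem[OF p'] tclass_mem[OF q'] by (blast intro: tensor_null.add[OF tensor_null_sub_comm tensor_null_sub_comm])
    finally show ?thesis
      using tclass_mem[OF p'] tclass_mem[OF q'] by (subst tclass_eq_iff) (auto intro: free_space_add)
  qed
  have "tclass p \<oplus>\<^bsub>tensor_space V W\<^esub> tclass q = (\<Union>p'\<in>tclass p. \<Union>q'\<in>tclass q. tclass (p' + q'))"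
    by (simp add: tensor_space_def tclass_def)
  also have "\<dots> = tclass (p + q)" using eq tclass_self[OF assms(1)] tclass_self[OF assms(2)] by blast
  finally show ?thesis .
qed

lemma tensor_smult:
  assumes "p \<in> free_space V W"
  shows "c \<odot>\<^bsub>tensor_space V W\<^esub> tclass p = tclass (Poly_Mapping.map ((*) c) p)"
proof -
  have eq: "tclass (Poly_Mapping.map ((*) c) p') = tclass (Poly_Mapping.map ((*) c) p)"
    if p': "p' \<in> tclass p" for p'
  proof -
    have "Poly_Mapping.map ((*) c) p' - Poly_Mapping.map ((*) c) p = Poly_Mapping.map ((*) c) (p' - p)"
      by (rule poly_mapping_eqI) (simp add: lookup_minus right_diff_distrib)
    also have "\<dots> \<in> tensor_null V W"
      using tclass_mem[OF p'] by (blast intro: tensor_null.scale[OF tensor_null_sub_comm])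
    finally show ?thesis
      using tclass_mem[OF p'] by (subst tclass_eq_iff) (auto intro: free_space_scale)
  qed
  have "c \<odot>\<^bsub>tensor_space V W\<^esub> tclass p = (\<Union>p'\<in>tclass p. tclass (Poly_Mapping.map ((*) c) p'))"
    by (simp add: tensor_space_def tclass_def)
  also have "\<dots> = tclass (Poly_Mapping.map ((*) c) p)" using eq tclass_self[OF assms] by blast
  finally show ?thesis .
qed

lemma pure_tclass: "pure_tensor V W v w = tclass (Poly_Mapping.single (v, w) 1)"
  by (simp add: pure_tensor_def tclass_def)

lemma pure_carrier: "v \<in> carrier V \<Longrightarrow> w \<in> carrier W \<Longrightarrow> pure_tensor V W v w \<in> carrier (tensor_space V W)"
  unfolding tensor_carrier pure_tclass by (blast intro: free_space_single)

lemma pure_add_left: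
  assumes "v \<in> carrier V" "v' \<in> carrier V" "w \<in> carrier W"
  shows "pure_tensor V W (v \<oplus>\<^bsub>V\<^esub> v') w = pure_tensor V W v w \<oplus>\<^bsub>tensor_space V W\<^esub> pure_tensor V W v' w"
  using tensor_null.add_left[OF assms] assms
  by (simp add: pure_tclass tensor_add free_space_single V tclass_eq_iff free_space_add diff_diff_add)

lemma map_single_one: "Poly_Mapping.map ((*) c) (Poly_Mapping.single x (1::'k)) = Poly_Mapping.single x c"
  by (rule poly_mapping_eqI) (simp add: lookup_single when_def)

lemma pure_smult_left:
  assumes "v \<in> carrier V" "w \<in> carrier W"
  shows "pure_tensor V W (c \<odot>\<^bsub>V\<^esub> v) w = c \<odot>\<^bsub>tensor_space V W\<^esub> pure_tensor V W v w"
  using tensor_null.scale_left[OF assms] assms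
  by (simp add: pure_tclass tensor_smult free_space_single V tclass_eq_iff map_single_one)

text \<open>The universal property of the tensor product: bilinearity of \<open>b\<close> kills each
  of the four kinds of generating relations, and the closure rules are preserved because the
  extension is linear.\<close>

lemma free_ext_null:
  assumes U: "is_vs U"
    and c: "\<And>v w. v \<in> carrier V \<Longrightarrow> w \<in> carrier W \<Longrightarrow> b (v, w) \<in> carrier U"
    and l: "\<And>w. w \<in> carrier W \<Longrightarrow> (\<lambda>v. b (v, w)) \<in> linear_maps V U"
    and r: "\<And>v. v \<in> carrier V \<Longrightarrow> (\<lambda>w. b (v, w)) \<in> linear_maps W U"
    and p: "p \<in> tensor_null V W"
  shows "free_ext U b p = \<zero>\<^bsub>U\<^esub>"
proof -
  let ?S = "carrier V \<times> carrier W"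
  have b: "b x \<in> carrier U" if "x \<in> ?S" for x using c that by auto
  note keys = tensor_null_free[unfolded free_space_def, simplified]
  note ks = free_space_diff[of _ V W, unfolded free_space_def, simplified]
    free_space_single[of _ V _ W, unfolded free_space_def, simplified]
  note ext = free_ext_add[OF U b] free_ext_scale[OF U b] free_ext_single[OF U b]
  have diff: "free_ext U b (q - r) = free_ext U b q \<oplus>\<^bsub>U\<^esub> (-1) \<odot>\<^bsub>U\<^esub> free_ext U b r"
    if "q \<in> free_space V W" "r \<in> free_space V W" for q r
  proof -
    have eq: "q - r = q + Poly_Mapping.map ((*) (-1)) r"
      by (rule poly_mapping_eqI) (simp add: lookup_minus lookup_add)
    show ?thesis
      unfolding eq using that free_space_scale[OF that(2), of "-1"] by (simp add: ext free_space_def)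
  qed
  have single: "free_ext U b (Poly_Mapping.single (v, w) a) = a \<odot>\<^bsub>U\<^esub> b (v, w)"
    if "v \<in> carrier V" "w \<in> carrier W" for v w a
    using that by (simp add: ext)
  have cancel: "(x \<oplus>\<^bsub>U\<^esub> y) \<oplus>\<^bsub>U\<^esub> (-1) \<odot>\<^bsub>U\<^esub> x \<oplus>\<^bsub>U\<^esub> (-1) \<odot>\<^bsub>U\<^esub> y = \<zero>\<^bsub>U\<^esub>"
    if "x \<in> carrier U" "y \<in> carrier U" for x y
  proof -
    have "(x \<oplus>\<^bsub>U\<^esub> y) \<oplus>\<^bsub>U\<^esub> (-1) \<odot>\<^bsub>U\<^esub> x \<oplus>\<^bsub>U\<^esub> (-1) \<odot>\<^bsub>U\<^esub> y
      = (x \<oplus>\<^bsub>U\<^esub> y) \<oplus>\<^bsub>U\<^esub> ((-1) \<odot>\<^bsub>U\<^esub> (x \<oplus>\<^bsub>U\<^esub> y))"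
      using that U by (simp add: vs_smult_add vs_add_assoc)
    also have "\<dots> = \<zero>\<^bsub>U\<^esub>" using that U by (intro vs_add_neg) auto
    finally show ?thesis .
  qed
  from p show ?thesis
  proof (induction rule: tensor_null.induct)
    case zero show ?case by (simp add: free_ext_zero[OF U b])
  next
    case (add p q)
    then show ?case using keys by (simp add: ext U)
  next
    case (scale p c)
    then show ?case using keys by (simp add: ext U)
  next
    case (add_left v v' w)
    then show ?case
      by (simp add: diff free_space_single free_space_diff V single c U lin_add[OF l] cancel)
  next
    case (add_right v w w')
    then show ?case
      by (simp add: diff free_space_single free_space_diff W single c U lin_add[OF r] cancel)
  next
    case (scale_left v w c)
    then show ?case
      by (simp add: diff free_space_single V single assms(2) U lin_smult[OF l] vs_add_neg)
  next
    case (scale_right v w c)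
    then show ?case
      by (simp add: diff free_space_single W single assms(2) U lin_smult[OF r] vs_add_neg)
  qed
qed

text \<open>On representatives this is \<open>\<xi> \<otimes> id\<close>, a map from
  \<open>V \<otimes> W\<close> to \<open>W\<close>. The contractions with the functionals of a frame
  of \<open>V\<close> serve as coordinates of a tensor with values in \<open>W\<close>.\<close>

definition contract :: "('v \<Rightarrow> 'k) \<Rightarrow> (('v \<times> 'w) \<Rightarrow>\<^sub>0 'k) \<Rightarrow> 'w" where
  "contract \<xi> = free_ext W (\<lambda>(v, w). \<xi> v \<odot>\<^bsub>W\<^esub> w)"

lemma contract_basis: "x \<in> carrier V \<times> carrier W \<Longrightarrow> (\<lambda>(v, w). \<xi> v \<odot>\<^bsub>W\<^esub> w) x \<in> carrier W"
  by (auto simp: W)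

lemma contract_closed: "p \<in> free_space V W \<Longrightarrow> contract \<xi> p \<in> carrier W"
  unfolding contract_def free_space_def by (rule free_ext_closed[OF W contract_basis]) auto

lemma contract_add:
  "p \<in> free_space V W \<Longrightarrow> q \<in> free_space V W \<Longrightarrow> contract \<xi> (p + q) = contract \<xi> p \<oplus>\<^bsub>W\<^esub> contract \<xi> q"
  unfolding contract_def free_space_def by (rule free_ext_add[OF W contract_basis]) auto

lemma contract_single:
  "v \<in> carrier V \<Longrightarrow> w \<in> carrier W \<Longrightarrow> contract \<xi> (Poly_Mapping.single (v, w) c) = (c * \<xi> v) \<odot>\<^bsub>W\<^esub> w"
  unfolding contract_def by (subst free_ext_single[OF W contract_basis]) (auto simp: vs_smult_smult[OF W])

lemma contract_zero: "contract \<xi> 0 = \<zero>\<^bsub>W\<^esub>"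
  unfolding contract_def by (rule free_ext_zero[OF W contract_basis]) auto

text \<open>Since \<open>\<xi> v \<odot> w\<close> is bilinear, the contraction depends on the
  tensor alone and not on its representative.\<close>

lemma contract_cong:
  assumes \<xi>: "\<xi> \<in> linear_maps V ground_space"
    and "p \<in> free_space V W" "q \<in> free_space V W" "p - q \<in> tensor_null V W"
  shows "contract \<xi> p = contract \<xi> q"
proof -
  have "contract \<xi> (p - q) = \<zero>\<^bsub>W\<^esub>"
    unfolding contract_def
  proof (rule free_ext_null[OF W _ _ _ assms(4)])
    show "(\<lambda>v. case (v, w) of (v, w) \<Rightarrow> \<xi> v \<odot>\<^bsub>W\<^esub> w) \<in> linear_maps V W" if "w \<in> carrier W" for w
      using that by (intro lin_mapI) (simp_all add: W lin_add[OF \<xi>] lin_smult[OF \<xi>] vs_add_smult[OF W] vs_smult_smult[OF W])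
    show "(\<lambda>w. case (v, w) of (v, w) \<Rightarrow> \<xi> v \<odot>\<^bsub>W\<^esub> w) \<in> linear_maps W W" if "v \<in> carrier V" for v
      by (intro lin_mapI) (simp_all add: W vs_smult_add[OF W] vs_smult_smult[OF W] mult.commute)
  qed (auto simp: W)
  then show ?thesis
    using assms(2,3) unfolding contract_def free_space_def by (intro free_ext_diff[OF W contract_basis]) auto
qed

definition fsum :: "('v \<times> 'w) list \<Rightarrow> ('v \<times> 'w) \<Rightarrow>\<^sub>0 'k" where
  "fsum xs = sum_list (map (\<lambda>x. Poly_Mapping.single x 1) xs)"

lemma fsum_free: "set xs \<subseteq> carrier V \<times> carrier W \<Longrightarrow> fsum xs \<in> free_space V W"
  by (induction xs) (auto simp: fsum_def free_space_zero intro!: free_space_add free_space_single)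

lemma contract_fsum:
  "set xs \<subseteq> carrier V \<times> carrier W \<Longrightarrow> contract \<xi> (fsum xs) = vsum W (map (\<lambda>(v, w). \<xi> v \<odot>\<^bsub>W\<^esub> w) xs)"
proof (induction xs)
  case Nil show ?case by (simp add: fsum_def contract_zero)
next
  case (Cons x xs)
  obtain v w where x: "x = (v, w)" by (cases x)
  have "contract \<xi> (fsum (x # xs)) = contract \<xi> (Poly_Mapping.single (v, w) 1 + fsum xs)"
    by (simp add: fsum_def x)
  also have "\<dots> = \<xi> v \<odot>\<^bsub>W\<^esub> w \<oplus>\<^bsub>W\<^esub> contract \<xi> (fsum xs)"
    using Cons.prems x fsum_free[of xs] by (subst contract_add) (auto simp: free_space_single contract_single)
  finally show ?case using Cons by (simp add: x)
qed

lemma fsum_pair_add: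
  assumes "\<And>x. x \<in> set L \<Longrightarrow> f x \<in> carrier V \<and> g x \<in> carrier W \<and> h x \<in> carrier W"
  shows "fsum (map (\<lambda>x. (f x, g x \<oplus>\<^bsub>W\<^esub> h x)) L) - (fsum (map (\<lambda>x. (f x, g x)) L) + fsum (map (\<lambda>x. (f x, h x)) L))
    \<in> tensor_null V W"
  using assms
proof (induction L)
  case Nil show ?case by (simp add: fsum_def tensor_null.zero)
next
  case (Cons x L)
  let ?s = "\<lambda>y. Poly_Mapping.single y (1::'k)"
  have "?s (f x, g x \<oplus>\<^bsub>W\<^esub> h x) - ?s (f x, g x) - ?s (f x, h x) \<in> tensor_null V W"
    using Cons.prems by (intro tensor_null.add_right) auto
  from tensor_null.add[OF this Cons.IH] Cons.prems show ?case
    by (simp add: fsum_def algebra_simps)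
qed

lemma fsum_smult_vec:
  assumes "w \<in> carrier W" "\<And>x. x \<in> set L \<Longrightarrow> f x \<in> carrier V"
  shows "fsum (map (\<lambda>x. (f x, a x \<odot>\<^bsub>W\<^esub> w)) L) - Poly_Mapping.single (vsum V (map (\<lambda>x. a x \<odot>\<^bsub>V\<^esub> f x) L), w) 1
    \<in> tensor_null V W"
  using assms(2)
proof (induction L)
  case Nil
  \<comment> \<open>No relation mentions the zero vector of \<open>V\<close> as such, so it is
    written as \<open>0 \<odot> \<zero>\<close> and the scalar is moved out.\<close>
  have "Poly_Mapping.single (0 \<odot>\<^bsub>V\<^esub> \<zero>\<^bsub>V\<^esub>, w) 1 - Poly_Mapping.single (\<zero>\<^bsub>V\<^esub>, w) 0 \<in> tensor_null V W"
    using assms(1) by (intro tensor_null.scale_left) (auto simp: V)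
  from tensor_null_neg[OF this] show ?case by (simp add: fsum_def V)
next
  case (Cons x L)
  let ?s = "\<lambda>y. Poly_Mapping.single y (1::'k)"
  let ?t = "vsum V (map (\<lambda>x. a x \<odot>\<^bsub>V\<^esub> f x) L)"
  have t: "?t \<in> carrier V" using Cons.prems by (intro vsum_closed[OF V]) (auto simp: V)
  have 1: "?s (f x, a x \<odot>\<^bsub>W\<^esub> w) - Poly_Mapping.single (f x, w) (a x) \<in> tensor_null V W"
    using Cons.prems assms(1) by (intro tensor_null.scale_right) auto
  have 2: "?s (a x \<odot>\<^bsub>V\<^esub> f x, w) - Poly_Mapping.single (f x, w) (a x) \<in> tensor_null V W"
    using Cons.prems assms(1) by (intro tensor_null.scale_left) auto
  have 3: "?s (a x \<odot>\<^bsub>V\<^esub> f x \<oplus>\<^bsub>V\<^esub> ?t, w) - ?s (a x \<odot>\<^bsub>V\<^esub> f x, w) - ?s (?t, w) \<in> tensor_null V W"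
    using Cons.prems assms(1) t by (intro tensor_null.add_left) (auto simp: V)
  have 4: "fsum (map (\<lambda>x. (f x, a x \<odot>\<^bsub>W\<^esub> w)) L) - ?s (?t, w) \<in> tensor_null V W"
    using Cons by auto
  have "(?s (f x, a x \<odot>\<^bsub>W\<^esub> w) - Poly_Mapping.single (f x, w) (a x)) +
    ((Poly_Mapping.single (f x, w) (a x) - ?s (a x \<odot>\<^bsub>V\<^esub> f x, w)) +
      (((fsum (map (\<lambda>x. (f x, a x \<odot>\<^bsub>W\<^esub> w)) L) - ?s (?t, w))) +
      - (?s (a x \<odot>\<^bsub>V\<^esub> f x \<oplus>\<^bsub>V\<^esub> ?t, w) - ?s (a x \<odot>\<^bsub>V\<^esub> f x, w) - ?s (?t, w)))) \<in> tensor_null V W"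
    by (intro tensor_null.add 1 4 tensor_null_neg[OF 3] tensor_null_sub_comm[OF 2])
  then show ?case by (simp add: fsum_def algebra_simps)
qed

lemma fsum_zero:
  assumes "\<And>x. x \<in> set L \<Longrightarrow> f x \<in> carrier V"
  shows "fsum (map (\<lambda>x. (f x, \<zero>\<^bsub>W\<^esub>)) L) \<in> tensor_null V W"
  using assms
proof (induction L)
  case (Cons x L)
  have "Poly_Mapping.single (f x, 0 \<odot>\<^bsub>W\<^esub> \<zero>\<^bsub>W\<^esub>) 1 - Poly_Mapping.single (f x, \<zero>\<^bsub>W\<^esub>) 0 \<in> tensor_null V W"
    using Cons.prems by (intro tensor_null.scale_right) (auto simp: W)
  from tensor_null.add[OF this Cons.IH] Cons.prems show ?case by (simp add: fsum_def W)
qed (simp add: fsum_def tensor_null.zero)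

lemma frame_tensor_single:
  assumes L: "frame V L" and vw: "v \<in> carrier V" "w \<in> carrier W"
  shows "Poly_Mapping.single (v, w) c - fsum (map (\<lambda>l. (fst l, contract (snd l) (Poly_Mapping.single (v, w) c))) L)
    \<in> tensor_null V W"
proof -
  let ?s = "\<lambda>y. Poly_Mapping.single y (1::'k)"
  have "fsum (map (\<lambda>l. (fst l, (c * snd l v) \<odot>\<^bsub>W\<^esub> w)) L) -
    ?s (vsum V (map (\<lambda>l. (c * snd l v) \<odot>\<^bsub>V\<^esub> fst l) L), w) \<in> tensor_null V W"
    using frame_in[OF L] by (intro fsum_smult_vec vw) auto
  moreover have "vsum V (map (\<lambda>l. (c * snd l v) \<odot>\<^bsub>V\<^esub> fst l) L) = c \<odot>\<^bsub>V\<^esub> v"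
  proof -
    have l: "(\<lambda>v. c \<odot>\<^bsub>V\<^esub> v) \<in> linear_maps V V"
      by (rule lin_mapI) (auto simp: V vs_smult_add[OF V] vs_smult_smult[OF V] mult.commute)
    have "c \<odot>\<^bsub>V\<^esub> v = vsum V (map (\<lambda>l. snd l v \<odot>\<^bsub>V\<^esub> (c \<odot>\<^bsub>V\<^esub> fst l)) L)"
      by (rule frame_expand[OF V V L l vw(1)])
    also have "\<dots> = vsum V (map (\<lambda>l. (c * snd l v) \<odot>\<^bsub>V\<^esub> fst l) L)"
      using frame_in[OF L] by (auto simp: vs_smult_smult[OF V] mult.commute intro!: arg_cong[where f = "vsum V"])
    finally show ?thesis by simp
  qed
  ultimately have 1: "?s (c \<odot>\<^bsub>V\<^esub> v, w) - fsum (map (\<lambda>l. (fst l, (c * snd l v) \<odot>\<^bsub>W\<^esub> w)) L) \<in> tensor_null V W"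
    using tensor_null_sub_comm by simp
  have 2: "Poly_Mapping.single (v, w) c - ?s (c \<odot>\<^bsub>V\<^esub> v, w) \<in> tensor_null V W"
    using tensor_null.scale_left[OF vw] by (rule tensor_null_sub_comm)
  show ?thesis using tensor_null_trans[OF 2 1] by (simp add: contract_single vw)
qed

text \<open>A tensor equals the sum of the frame vectors tensored with its contractions, by
  induction on the support of a representative. Hence the contractions determine the tensor, which
  replaces the use of a basis of \<open>V \<otimes> W\<close>.\<close>

lemma frame_tensor:
  assumes L: "frame V L"
  shows "p \<in> free_space V W \<Longrightarrow> p - fsum (map (\<lambda>l. (fst l, contract (snd l) p)) L) \<in> tensor_null V W"
proof (induction p rule: update_induct)
  case const
  have "fsum (map (\<lambda>l. (fst l, \<zero>\<^bsub>W\<^esub>)) L) \<in> tensor_null V W"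
    using frame_in[OF L] by (intro fsum_zero) auto
  then show ?case using tensor_null_neg by (simp add: contract_zero)
next
  case (update p x c)
  have eq: "Poly_Mapping.update x c p = p + Poly_Mapping.single x c"
    using update.hyps(1)
    by (intro poly_mapping_eqI) (auto simp: lookup_update lookup_add lookup_single when_def in_keys_iff)
  have "Poly_Mapping.keys (Poly_Mapping.update x c p) = insert x (Poly_Mapping.keys p)"
    using update.hyps by (auto simp: in_keys_iff lookup_update split: if_splits)
  then have "insert x (Poly_Mapping.keys p) \<subseteq> carrier V \<times> carrier W"
    using update.prems by (simp add: free_space_def)
  then obtain v w where x: "x = (v, w)" "v \<in> carrier V" "w \<in> carrier W" and p: "p \<in> free_space V W"
    by (auto simp: free_space_def)
  let ?q = "Poly_Mapping.single (v, w) c"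
  let ?F = "\<lambda>p. fsum (map (\<lambda>l. (fst l, contract (snd l) p)) L)"
  have q: "?q \<in> free_space V W" using x by (simp add: free_space_single)
  have 1: "(p - ?F p) + (?q - ?F ?q) \<in> tensor_null V W"
    by (intro tensor_null.add update.IH p frame_tensor_single[OF L x(2,3)])
  have 2: "?F (p + ?q) - (?F p + ?F ?q) \<in> tensor_null V W"
    unfolding contract_add[OF p q] using frame_in[OF L]
    by (intro fsum_pair_add) (auto intro: contract_closed p q)
  from tensor_null.add[OF 1 tensor_null_neg[OF 2]] show ?case
    by (simp add: eq[unfolded x(1)] x(1) algebra_simps)
qed

lemma tensor_lin_fsum:
  assumes U: "is_vs U" and T: "T \<in> linear_maps (tensor_space V W) U" and xs: "set xs \<subseteq> carrier V \<times> carrier W"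
  shows "T (tclass (fsum xs)) = vsum U (map (\<lambda>(v, w). T (pure_tensor V W v w)) xs)"
  using xs
proof (induction xs)
  case Nil
  \<comment> \<open>\<open>lin_zero\<close> would require the vector space axioms for
    \<open>tensor_space V W\<close>; multiplying the class of 0 by the scalar 0 gives the value at
    zero directly.\<close>
  have z: "tclass 0 \<in> carrier (tensor_space V W)" unfolding tensor_carrier using free_space_zero by blast
  have "Poly_Mapping.map ((*) 0) 0 = (0 :: ('v \<times> 'w) \<Rightarrow>\<^sub>0 'k)" by (rule poly_mapping_eqI) simp
  then have "T (tclass 0) = T (0 \<odot>\<^bsub>tensor_space V W\<^esub> tclass 0)"
    by (simp add: tensor_smult free_space_zero)
  also have "\<dots> = \<zero>\<^bsub>U\<^esub>" using lin_closed[OF T z] U by (simp add: lin_smult[OF T z])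
  finally show ?case by (simp add: fsum_def)
next
  case (Cons x xs)
  obtain v w where x: "x = (v, w)" by (cases x)
  have vw: "v \<in> carrier V" "w \<in> carrier W" using Cons.prems x by auto
  have f: "fsum xs \<in> free_space V W" using Cons.prems by (intro fsum_free) auto
  have "tclass (fsum (x # xs)) = pure_tensor V W v w \<oplus>\<^bsub>tensor_space V W\<^esub> tclass (fsum xs)"
    by (simp add: pure_tclass tensor_add f free_space_single vw) (simp add: fsum_def x)
  moreover have "tclass (fsum xs) \<in> carrier (tensor_space V W)" using f unfolding tensor_carrier by blast
  ultimately show ?case
    using Cons vw by (simp add: x lin_add[OF T] pure_carrier)
qed

lemma frame_tensor_class:
  assumes "frame V L" "p \<in> free_space V W"
  shows "tclass p = tclass (fsum (map (\<lambda>l. (fst l, contract (snd l) p)) L))"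
  using frame_tensor[OF assms] frame_in[OF assms(1)] assms(2)
  by (subst tclass_eq_iff) (auto intro!: fsum_free contract_closed)

end


section \<open>Linear categories\<close>

context category
begin

lemma dom_obj [simp]: "f \<in> Arr C \<Longrightarrow> Dom C f \<in> Obj C"
  and cod_obj [simp]: "f \<in> Arr C \<Longrightarrow> Cod C f \<in> Obj C"
  using dom_cod by auto

lemma hom_dom: "f \<in> Hom C a b \<Longrightarrow> a \<in> Obj C" and hom_cod: "f \<in> Hom C a b \<Longrightarrow> b \<in> Obj C"
  using dom_cod by (auto simp: Hom_def)

lemma id_arr [simp]:
  assumes "a \<in> Obj C"
  shows "Idt C a \<in> Arr C" "Dom C (Idt C a) = a" "Cod C (Idt C a) = a"
  using id_in_hom[OF assms] by (auto simp: Hom_def)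

lemma comp_arr [simp]:
  assumes "f \<in> Arr C" "g \<in> Arr C" "Cod C f = Dom C g"
  shows "g \<cdot> f \<in> Arr C" "Dom C (g \<cdot> f) = Dom C f" "Cod C (g \<cdot> f) = Cod C g"
  using comp_in_hom[of f "Dom C f" "Cod C f" g "Cod C g"] assms by (auto simp: Hom_def)

lemma comp_id [simp]:
  "f \<in> Arr C \<Longrightarrow> Cod C f = a \<Longrightarrow> Idt C a \<cdot> f = f"
  "f \<in> Arr C \<Longrightarrow> Dom C f = a \<Longrightarrow> f \<cdot> Idt C a = f"
  using comp_id_left[of f "Dom C f" "Cod C f"] comp_id_right[of f "Dom C f" "Cod C f"]
  by (auto simp: Hom_def)

lemma comp_ass [simp]:
  "f \<in> Arr C \<Longrightarrow> g \<in> Arr C \<Longrightarrow> h \<in> Arr C \<Longrightarrow> Cod C f = Dom C g \<Longrightarrow> Cod C g = Dom C h \<Longrightarrow>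
    (h \<cdot> g) \<cdot> f = h \<cdot> (g \<cdot> f)"
  using comp_assoc[of f "Dom C f" "Cod C f" g "Cod C g" h "Cod C h"] by (auto simp: Hom_def)

lemma inverse_arrows_iff:
  "f \<in> Hom C a b \<Longrightarrow>
    inverse_arrows C f g \<longleftrightarrow> g \<in> Hom C b a \<and> g \<cdot> f = Idt C a \<and> f \<cdot> g = Idt C b"
  by (auto simp: inverse_arrows_def Hom_def)

lemma iso_arrowI:
  "f \<in> Hom C a b \<Longrightarrow> g \<in> Hom C b a \<Longrightarrow> g \<cdot> f = Idt C a \<Longrightarrow> f \<cdot> g = Idt C b \<Longrightarrow> iso_arrow C f"
  using inverse_arrows_iff by (auto simp: iso_arrow_def)

lemma inverse_unique:
  assumes f: "f \<in> Hom C a b" and g: "g \<in> Hom C b a" "g \<cdot> f = Idt C a"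
    and h: "h \<in> Hom C b a" "f \<cdot> h = Idt C b"
  shows "g = h"
proof -
  have "g = g \<cdot> (f \<cdot> h)" using g h by (simp add: Hom_def)
  also have "\<dots> = (g \<cdot> f) \<cdot> h" using f g(1) h(1) comp_assoc by simp
  also have "\<dots> = h" unfolding g(2) using h(1) by (simp add: Hom_def)
  finally show ?thesis .
qed

lemma inv_arrow_eq:
  assumes "f \<in> Hom C a b" "g \<in> Hom C b a" "g \<cdot> f = Idt C a" "f \<cdot> g = Idt C b"
  shows "inv_arrow C f = g"
  unfolding inv_arrow_def
  by (rule the_equality) (use assms inverse_unique in \<open>auto simp: inverse_arrows_iff[OF assms(1)]\<close>)

lemma inv_arrow:
  assumes "f \<in> Hom C a b" "iso_arrow C f"
  shows "inv_arrow C f \<in> Hom C b a" "inv_arrow C f \<cdot> f = Idt C a" "f \<cdot> inv_arrow C f = Idt C b"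
proof -
  obtain g where "g \<in> Hom C b a" "g \<cdot> f = Idt C a" "f \<cdot> g = Idt C b"
    using assms by (auto simp: iso_arrow_def inverse_arrows_iff)
  with inv_arrow_eq[OF assms(1)]
  show "inv_arrow C f \<in> Hom C b a" "inv_arrow C f \<cdot> f = Idt C a" "f \<cdot> inv_arrow C f = Idt C b"
    by auto
qed

lemma iso_inv_arrow: "f \<in> Hom C a b \<Longrightarrow> iso_arrow C f \<Longrightarrow> iso_arrow C (inv_arrow C f)"
  using inv_arrow[of f a b] by (intro iso_arrowI[of _ b a f]) auto

lemma iso_comp:
  assumes f: "f \<in> Hom C a b" "iso_arrow C f" and g: "g \<in> Hom C b c" "iso_arrow C g"
  shows "iso_arrow C (g \<cdot> f)"
proof -
  note i = inv_arrow[OF f] and k = inv_arrow[OF g]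
  note h = f(1) g(1) i(1) k(1)
  have 1: "(inv_arrow C f \<cdot> inv_arrow C g) \<cdot> (g \<cdot> f) = inv_arrow C f \<cdot> ((inv_arrow C g \<cdot> g) \<cdot> f)"
    using h by (simp add: Hom_def)
  have 2: "(g \<cdot> f) \<cdot> (inv_arrow C f \<cdot> inv_arrow C g) = g \<cdot> ((f \<cdot> inv_arrow C f) \<cdot> inv_arrow C g)"
    using h by (simp add: Hom_def)
  show ?thesis
    by (rule iso_arrowI[of _ a c "inv_arrow C f \<cdot> inv_arrow C g"], use h in \<open>simp add: Hom_def\<close>,
      use h in \<open>simp add: Hom_def\<close>)
      (use 1 2 i k h in \<open>simp_all add: Hom_def\<close>)
qed

lemma iso_id: "a \<in> Obj C \<Longrightarrow> iso_arrow C (Idt C a)"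
  by (rule iso_arrowI[of _ a a "Idt C a"]) (auto simp: Hom_def)

end

lemma functor_arr:
  assumes "is_functor C D F" "f \<in> Hom C a b"
  shows "on_arr F f \<in> Hom D (on_obj F a) (on_obj F b)"
  using is_functor.arr_map[OF assms] .

lemma isomorphic_functors_sym:
  assumes "isomorphic_functors C D F G"
  shows "isomorphic_functors C D G F"
proof -
  obtain \<eta> where \<eta>: "natural_isomorphism C D F G \<eta>" using assms by (auto simp: isomorphic_functors_def)
  then have FG: "is_functor C D F" "is_functor C D G" by (auto simp: natural_isomorphism_def)
  interpret D: category D using FG(1) by (simp add: is_functor_def)
  have e: "\<eta> a \<in> Hom D (on_obj F a) (on_obj G a)" "iso_arrow D (\<eta> a)" if "a \<in> Obj C" for a
    using \<eta> that by (auto simp: natural_isomorphism_def)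
  note i = D.inv_arrow[OF e]
  have "natural_isomorphism C D G F (\<lambda>a. inv_arrow D (\<eta> a))"
    unfolding natural_isomorphism_def
  proof (intro conjI FG ballI)
    fix a b f assume a: "a \<in> Obj C" and b: "b \<in> Obj C" and f: "f \<in> Hom C a b"
    note h = i(1)[OF a a] i(1)[OF b b] e(1)[OF a] e(1)[OF b] functor_arr[OF FG(1) f] functor_arr[OF FG(2) f]
    have n: "\<eta> b \<cdot>\<^bsub>D\<^esub> on_arr F f = on_arr G f \<cdot>\<^bsub>D\<^esub> \<eta> a"
      using \<eta> a b f by (auto simp: natural_isomorphism_def)
    have "inv_arrow D (\<eta> b) \<cdot>\<^bsub>D\<^esub> on_arr G f =
      inv_arrow D (\<eta> b) \<cdot>\<^bsub>D\<^esub> ((on_arr G f \<cdot>\<^bsub>D\<^esub> \<eta> a) \<cdot>\<^bsub>D\<^esub> inv_arrow D (\<eta> a))"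
      using h i(3)[OF a a] by (simp add: Hom_def)
    also have "\<dots> = (inv_arrow D (\<eta> b) \<cdot>\<^bsub>D\<^esub> \<eta> b) \<cdot>\<^bsub>D\<^esub> (on_arr F f \<cdot>\<^bsub>D\<^esub> inv_arrow D (\<eta> a))"
      unfolding n[symmetric] using h by (simp add: Hom_def)
    also have "\<dots> = on_arr F f \<cdot>\<^bsub>D\<^esub> inv_arrow D (\<eta> a)"
      using h i(2)[OF b b] by (simp add: Hom_def)
    finally show "inv_arrow D (\<eta> b) \<cdot>\<^bsub>D\<^esub> on_arr G f = on_arr F f \<cdot>\<^bsub>D\<^esub> inv_arrow D (\<eta> a)" .
  qed (use i e D.iso_inv_arrow in blast)+
  then show ?thesis by (auto simp: isomorphic_functors_def)
qed

lemma isomorphic_functors_trans: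
  assumes "isomorphic_functors C D F G" "isomorphic_functors C D G H"
  shows "isomorphic_functors C D F H"
proof -
  obtain \<eta> \<theta> where \<eta>: "natural_isomorphism C D F G \<eta>" and \<theta>: "natural_isomorphism C D G H \<theta>"
    using assms by (auto simp: isomorphic_functors_def)
  then have FGH: "is_functor C D F" "is_functor C D G" "is_functor C D H"
    by (auto simp: natural_isomorphism_def)
  interpret D: category D using FGH(1) by (simp add: is_functor_def)
  have e: "\<eta> a \<in> Hom D (on_obj F a) (on_obj G a)" "iso_arrow D (\<eta> a)" if "a \<in> Obj C" for a
    using \<eta> that by (auto simp: natural_isomorphism_def)
  have t: "\<theta> a \<in> Hom D (on_obj G a) (on_obj H a)" "iso_arrow D (\<theta> a)" if "a \<in> Obj C" for a
    using \<theta> that by (auto simp: natural_isomorphism_def)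
  have "natural_isomorphism C D F H (\<lambda>a. \<theta> a \<cdot>\<^bsub>D\<^esub> \<eta> a)"
    unfolding natural_isomorphism_def
  proof (intro conjI FGH ballI)
    fix a b f assume a: "a \<in> Obj C" and b: "b \<in> Obj C" and f: "f \<in> Hom C a b"
    note h = t(1)[OF a] t(1)[OF b] e(1)[OF a] e(1)[OF b] FGH[THEN functor_arr, OF f]
    have n: "\<eta> b \<cdot>\<^bsub>D\<^esub> on_arr F f = on_arr G f \<cdot>\<^bsub>D\<^esub> \<eta> a" "\<theta> b \<cdot>\<^bsub>D\<^esub> on_arr G f = on_arr H f \<cdot>\<^bsub>D\<^esub> \<theta> a"
      using \<eta> \<theta> a b f by (auto simp: natural_isomorphism_def)
    have "(\<theta> b \<cdot>\<^bsub>D\<^esub> \<eta> b) \<cdot>\<^bsub>D\<^esub> on_arr F f = \<theta> b \<cdot>\<^bsub>D\<^esub> (\<eta> b \<cdot>\<^bsub>D\<^esub> on_arr F f)"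
      using h by (simp add: Hom_def)
    also have "\<dots> = (\<theta> b \<cdot>\<^bsub>D\<^esub> on_arr G f) \<cdot>\<^bsub>D\<^esub> \<eta> a"
      unfolding n(1) using h by (simp add: Hom_def)
    also have "\<dots> = on_arr H f \<cdot>\<^bsub>D\<^esub> (\<theta> a \<cdot>\<^bsub>D\<^esub> \<eta> a)"
      unfolding n(2) using h by (simp add: Hom_def)
    finally show "(\<theta> b \<cdot>\<^bsub>D\<^esub> \<eta> b) \<cdot>\<^bsub>D\<^esub> on_arr F f = on_arr H f \<cdot>\<^bsub>D\<^esub> (\<theta> a \<cdot>\<^bsub>D\<^esub> \<eta> a)" .
  qed (use e t in \<open>blast intro: D.comp_in_hom D.iso_comp\<close>)+
  then show ?thesis by (auto simp: isomorphic_functors_def)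
qed

lemma functor_cong:
  assumes F: "is_functor C D F"
    and obj: "\<And>a. a \<in> Obj C \<Longrightarrow> on_obj G a = on_obj F a"
    and arr: "\<And>f. f \<in> Arr C \<Longrightarrow> on_arr G f = on_arr F f"
  shows "is_functor C D G"
proof -
  interpret F: is_functor C D F by (rule F)
  show ?thesis
  proof unfold_locales
    show "on_obj G a \<in> Obj D" if "a \<in> Obj C" for a using that F.obj_map obj by simp
    show "on_arr G f \<in> Hom D (on_obj G a) (on_obj G b)" if "f \<in> Hom C a b" for f a b
      using F.arr_map[OF that] that obj[OF F.C.hom_dom[OF that]] obj[OF F.C.hom_cod[OF that]] arr
      by (simp add: Hom_def)
    show "on_arr G (Idt C a) = Idt D (on_obj G a)" if "a \<in> Obj C" for a
      using F.id_map[OF that] that obj arr by simp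
    show "on_arr G (g \<cdot>\<^bsub>C\<^esub> f) = on_arr G g \<cdot>\<^bsub>D\<^esub> on_arr G f"
      if "f \<in> Hom C a b" "g \<in> Hom C b c" for f a b g c
      using F.comp_map[OF that] that arr by (simp add: Hom_def)
  qed
qed

text \<open>Functor records may differ outside the category, so agreement on objects and arrows
  yields an isomorphism, with identities as components, and not an equation of records.\<close>

lemma isomorphic_functors_cong:
  assumes F: "is_functor C D F"
    and obj: "\<And>a. a \<in> Obj C \<Longrightarrow> on_obj G a = on_obj F a"
    and arr: "\<And>f. f \<in> Arr C \<Longrightarrow> on_arr G f = on_arr F f"
  shows "isomorphic_functors C D F G"
proof -
  interpret F: is_functor C D F by (rule F)
  have "natural_isomorphism C D F G (\<lambda>a. Idt D (on_obj F a))"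
    unfolding natural_isomorphism_def
  proof (intro conjI F functor_cong[OF F obj arr] ballI)
    fix a b f assume "a \<in> Obj C" "b \<in> Obj C" "f \<in> Hom C a b"
    then show "Idt D (on_obj F b) \<cdot>\<^bsub>D\<^esub> on_arr F f = on_arr G f \<cdot>\<^bsub>D\<^esub> Idt D (on_obj F a)"
      using F.arr_map arr by (simp add: Hom_def)
  qed (auto simp: obj F.obj_map F.D.id_in_hom F.D.iso_id)
  then show ?thesis by (auto simp: isomorphic_functors_def)
qed

lemma hom_space_simps [simp]:
  "carrier (hom_space C a b) = Hom C a b"
  "\<zero>\<^bsub>hom_space C a b\<^esub> = zero_arr C a b"
  "f \<oplus>\<^bsub>hom_space C a b\<^esub> g = add_arr C f g"
  "c \<odot>\<^bsub>hom_space C a b\<^esub> f = scale_arr C c f"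
  by (simp_all add: hom_space_def)

context linear_category
begin

lemma scale_hom: "f \<in> Hom C a b \<Longrightarrow> scale_arr C k f \<in> Hom C a b"
  using vs_smult[OF hom_vectorspace[OF hom_dom hom_cod], of f a b f a b f k] by simp

lemma comp_scale_right: "f \<in> Hom C a b \<Longrightarrow> g \<in> Hom C b c \<Longrightarrow> g \<cdot> scale_arr C k f = scale_arr C k (g \<cdot> f)"
  using lin_smult[OF comp_linear_right[OF hom_dom], of f a b g b c f k] by simp

lemma comp_scale_left: "f \<in> Hom C a b \<Longrightarrow> g \<in> Hom C b c \<Longrightarrow> scale_arr C k g \<cdot> f = scale_arr C k (g \<cdot> f)"
  using lin_smult[OF comp_linear_left[OF hom_cod], of g b c f a b g k] by simp

lemma vsum_hom:
  "a \<in> Obj C \<Longrightarrow> b \<in> Obj C \<Longrightarrow> set fs \<subseteq> Hom C a b \<Longrightarrow> vsum (hom_space C a b) fs \<in> Hom C a b"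
  using vsum_closed[OF hom_vectorspace, of a b fs] by simp

lemma comp_vsum:
  assumes "a \<in> Obj C" "g \<in> Hom C b c" "set fs \<subseteq> Hom C a b"
  shows "g \<cdot> vsum (hom_space C a b) fs = vsum (hom_space C a c) (map (\<lambda>f. g \<cdot> f) fs)"
  using assms hom_dom[OF assms(2)] hom_cod[OF assms(2)]
  by (intro lin_vsum comp_linear_right hom_vectorspace) auto

lemma vsum_comp:
  assumes "c \<in> Obj C" "f \<in> Hom C a b" "set gs \<subseteq> Hom C b c"
  shows "vsum (hom_space C b c) gs \<cdot> f = vsum (hom_space C a c) (map (\<lambda>g. g \<cdot> f) gs)"
  using assms hom_dom[OF assms(2)] hom_cod[OF assms(2)]
  by (intro lin_vsum[where f = "\<lambda>g. g \<cdot> f"] comp_linear_left hom_vectorspace) auto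

end


subsection \<open>Copowers by finite-dimensional spaces\<close>

text \<open>
  \<open>n\<close> is both the copower of \<open>x\<close> by \<open>V\<close>, with injections \<open>j v\<close>, and its power by the dual
  space, with projections \<open>p \<xi>\<close>.
\<close>

definition copower ::
  "('k::field, 'o, 'm, 'z) lin_cat_scheme \<Rightarrow> ('k, 'v) module \<Rightarrow> 'o \<Rightarrow> 'o \<Rightarrow> ('v \<Rightarrow> 'm) \<Rightarrow>
    (('v \<Rightarrow> 'k) \<Rightarrow> 'm) \<Rightarrow> bool" where
  "copower C V x n j p \<longleftrightarrow> x \<in> Obj C \<and> n \<in> Obj C \<and> is_vs V \<and>
     j \<in> linear_maps V (hom_space C x n) \<and> p \<in> linear_maps (dual_space V) (hom_space C n x) \<and>
     (\<forall>v\<in>carrier V. \<forall>\<xi>\<in>carrier (dual_space V). p \<xi> \<cdot>\<^bsub>C\<^esub> j v = scale_arr C (\<xi> v) (Idt C x)) \<and>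
     (\<exists>L. frame V L \<and> vsum (hom_space C n n) (map (\<lambda>q. j (fst q) \<cdot>\<^bsub>C\<^esub> p (snd q)) L) = Idt C n)"

context linear_category
begin

context
  fixes V :: "('k, 'v) module" and x n j p
  assumes cop: "copower C V x n j p"
begin

lemma copower_obj: "x \<in> Obj C" "n \<in> Obj C" "is_vs V"
  using cop by (auto simp: copower_def)

lemma copower_inj: "v \<in> carrier V \<Longrightarrow> j v \<in> Hom C x n"
  using cop lin_closed[of j V "hom_space C x n"] by (simp add: copower_def)

lemma copower_inj_lin: "j \<in> linear_maps V (hom_space C x n)"
  using cop by (simp add: copower_def)

lemma copower_proj: "\<xi> \<in> carrier (dual_space V) \<Longrightarrow> p \<xi> \<in> Hom C n x"
  using cop lin_closed[of p "dual_space V" "hom_space C n x"] by (simp add: copower_def)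

lemma copower_proj_lin: "p \<in> linear_maps (dual_space V) (hom_space C n x)"
  using cop by (simp add: copower_def)

lemma copower_proj_inj:
  "v \<in> carrier V \<Longrightarrow> \<xi> \<in> carrier (dual_space V) \<Longrightarrow> p \<xi> \<cdot> j v = scale_arr C (\<xi> v) (Idt C x)"
  using cop by (simp add: copower_def)

lemma copower_frame:
  obtains L where "frame V L" "vsum (hom_space C n n) (map (\<lambda>q. j (fst q) \<cdot> p (snd q)) L) = Idt C n"
  using cop by (auto simp: copower_def)

text \<open>The resolution of the identity of \<open>n\<close> by the composites of \<open>j\<close>
  and \<open>p\<close> expresses \<open>t\<close> through the arrows \<open>t \<cdot> j v\<close>
  alone.\<close>

lemma copower_eqI:
  assumes t: "t \<in> Hom C n z" "t' \<in> Hom C n z" and eq: "\<And>v. v \<in> carrier V \<Longrightarrow> t \<cdot> j v = t' \<cdot> j v"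
  shows "t = t'"
proof -
  obtain L where L: "frame V L" and id: "vsum (hom_space C n n) (map (\<lambda>q. j (fst q) \<cdot> p (snd q)) L) = Idt C n"
    by (rule copower_frame)
  note q = frame_in[OF L]
  have S: "set (map (\<lambda>q. j (fst q) \<cdot> p (snd q)) L) \<subseteq> Hom C n n"
    using q copower_inj copower_proj by (auto intro!: comp_in_hom)
  have *: "s = vsum (hom_space C n z) (map (\<lambda>q. (s \<cdot> j (fst q)) \<cdot> p (snd q)) L)" if s: "s \<in> Hom C n z" for s
  proof -
    have "s = s \<cdot> vsum (hom_space C n n) (map (\<lambda>q. j (fst q) \<cdot> p (snd q)) L)"
      unfolding id using s by (simp add: Hom_def)
    also have "\<dots> = vsum (hom_space C n z) (map (\<lambda>q. s \<cdot> (j (fst q) \<cdot> p (snd q))) L)"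
      by (subst comp_vsum[OF copower_obj(2) s S]) (simp add: o_def)
    also have "\<dots> = vsum (hom_space C n z) (map (\<lambda>q. (s \<cdot> j (fst q)) \<cdot> p (snd q)) L)"
      using q comp_assoc[OF copower_proj copower_inj s] by (intro arg_cong[where f = "vsum _"] map_cong) auto
    finally show ?thesis .
  qed
  have m: "map (\<lambda>q. (t \<cdot> j (fst q)) \<cdot> p (snd q)) L = map (\<lambda>q. (t' \<cdot> j (fst q)) \<cdot> p (snd q)) L"
    using q eq by (intro map_cong) auto
  show ?thesis by (rule trans[OF *[OF t(1), unfolded m] *[OF t(2), symmetric]])
qed

text \<open>The witness is the sum of \<open>\<phi> e \<cdot> x'\<close> over the frame, where
  \<open>x'\<close> is the projection attached to the functional paired with \<open>e\<close>.
  Composed with \<open>j v\<close> it becomes the frame expansion of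
  \<open>\<phi> v\<close>.\<close>

lemma copower_ex:
  assumes z: "z \<in> Obj C" and \<phi>: "\<phi> \<in> linear_maps V (hom_space C x z)"
  shows "\<exists>t\<in>Hom C n z. \<forall>v\<in>carrier V. t \<cdot> j v = \<phi> v"
proof -
  obtain L where L: "frame V L" by (rule copower_frame)
  note q = frame_in[OF L]
  have \<phi>h: "v \<in> carrier V \<Longrightarrow> \<phi> v \<in> Hom C x z" for v using lin_closed[OF \<phi>] by simp
  let ?fs = "map (\<lambda>q. \<phi> (fst q) \<cdot> p (snd q)) L"
  have S: "set ?fs \<subseteq> Hom C n z" using q copower_proj \<phi>h by (auto intro!: comp_in_hom)
  have "vsum (hom_space C n z) ?fs \<cdot> j v = \<phi> v" if v: "v \<in> carrier V" for v
  proof -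
    have "vsum (hom_space C n z) ?fs \<cdot> j v = vsum (hom_space C x z) (map (\<lambda>g. g \<cdot> j v) ?fs)"
      by (rule vsum_comp[OF z copower_inj[OF v] S])
    also have "\<dots> = vsum (hom_space C x z) (map (\<lambda>q. snd q v \<odot>\<^bsub>hom_space C x z\<^esub> \<phi> (fst q)) L)"
    proof (simp add: o_def, intro arg_cong[where f = "vsum _"] map_cong refl)
      fix r assume r: "r \<in> set L"
      have a: "\<phi> (fst r) \<in> Hom C x z" "p (snd r) \<in> Hom C n x" "j v \<in> Hom C x n"
        using q[OF r] \<phi>h copower_proj copower_inj v by auto
      have "(\<phi> (fst r) \<cdot> p (snd r)) \<cdot> j v = \<phi> (fst r) \<cdot> (p (snd r) \<cdot> j v)" using a by (simp add: comp_assoc)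
      also have "\<dots> = scale_arr C (snd r v) (\<phi> (fst r))"
        using q[OF r] v a copower_obj comp_scale_right[OF id_in_hom a(1)]
        by (simp add: copower_proj_inj comp_id_right)
      finally show "(\<phi> (fst r) \<cdot> p (snd r)) \<cdot> j v = scale_arr C (snd r v) (\<phi> (fst r))" .
    qed
    also have "\<dots> = \<phi> v"
      by (rule frame_expand[OF copower_obj(3) hom_vectorspace[OF copower_obj(1) z] L \<phi> v, symmetric])
    finally show ?thesis .
  qed
  then show ?thesis using vsum_hom[OF copower_obj(2) z S] by blast
qed

lemma power_eqI:
  assumes s: "s \<in> Hom C d n" "s' \<in> Hom C d n"
    and eq: "\<And>\<xi>. \<xi> \<in> carrier (dual_space V) \<Longrightarrow> p \<xi> \<cdot> s = p \<xi> \<cdot> s'"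
  shows "s = s'"
proof -
  obtain L where L: "frame V L" and id: "vsum (hom_space C n n) (map (\<lambda>q. j (fst q) \<cdot> p (snd q)) L) = Idt C n"
    by (rule copower_frame)
  note q = frame_in[OF L]
  have S: "set (map (\<lambda>q. j (fst q) \<cdot> p (snd q)) L) \<subseteq> Hom C n n"
    using q copower_inj copower_proj by (auto intro!: comp_in_hom)
  have *: "s = vsum (hom_space C d n) (map (\<lambda>q. j (fst q) \<cdot> (p (snd q) \<cdot> s)) L)" if s: "s \<in> Hom C d n" for s
  proof -
    have "s = vsum (hom_space C n n) (map (\<lambda>q. j (fst q) \<cdot> p (snd q)) L) \<cdot> s"
      unfolding id using s by (simp add: Hom_def)
    also have "\<dots> = vsum (hom_space C d n) (map (\<lambda>q. (j (fst q) \<cdot> p (snd q)) \<cdot> s) L)"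
      by (subst vsum_comp[OF copower_obj(2) s S]) (simp add: o_def)
    also have "\<dots> = vsum (hom_space C d n) (map (\<lambda>q. j (fst q) \<cdot> (p (snd q) \<cdot> s)) L)"
      using q comp_assoc[OF s copower_proj copower_inj] by (intro arg_cong[where f = "vsum _"] map_cong) auto
    finally show ?thesis .
  qed
  have m: "map (\<lambda>q. j (fst q) \<cdot> (p (snd q) \<cdot> s)) L = map (\<lambda>q. j (fst q) \<cdot> (p (snd q) \<cdot> s')) L"
    using q eq by (intro map_cong) auto
  show ?thesis by (rule trans[OF *[OF s(1), unfolded m] *[OF s(2), symmetric]])
qed

text \<open>Dual to \<open>copower_ex\<close>: composing the witness with \<open>p \<xi>\<close>
  gives the expansion of \<open>\<xi>\<close> along the frame, now read as a decomposition of
  functionals by \<open>frame_dual\<close>.\<close>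

lemma power_ex:
  assumes d: "d \<in> Obj C" and \<psi>: "\<psi> \<in> linear_maps (dual_space V) (hom_space C d x)"
  shows "\<exists>s\<in>Hom C d n. \<forall>\<xi>\<in>carrier (dual_space V). p \<xi> \<cdot> s = \<psi> \<xi>"
proof -
  obtain L where L: "frame V L" by (rule copower_frame)
  note q = frame_in[OF L]
  note dual = dual_space_vs[OF copower_obj(3)]
  have \<psi>h: "\<xi> \<in> carrier (dual_space V) \<Longrightarrow> \<psi> \<xi> \<in> Hom C d x" for \<xi> using lin_closed[OF \<psi>] by simp
  let ?fs = "map (\<lambda>q. j (fst q) \<cdot> \<psi> (snd q)) L"
  have S: "set ?fs \<subseteq> Hom C d n" using q copower_inj \<psi>h by (auto intro!: comp_in_hom)
  have "p \<xi> \<cdot> vsum (hom_space C d n) ?fs = \<psi> \<xi>" if \<xi>: "\<xi> \<in> carrier (dual_space V)" for \<xi>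
  proof -
    have "p \<xi> \<cdot> vsum (hom_space C d n) ?fs = vsum (hom_space C d x) (map (\<lambda>g. p \<xi> \<cdot> g) ?fs)"
      by (rule comp_vsum[OF d copower_proj[OF \<xi>] S])
    also have "map (\<lambda>g. p \<xi> \<cdot> g) ?fs = map \<psi> (map (\<lambda>q. \<xi> (fst q) \<odot>\<^bsub>dual_space V\<^esub> snd q) L)"
    proof (simp add: o_def, intro ballI)
      fix r assume r: "r \<in> set L"
      have a: "\<psi> (snd r) \<in> Hom C d x" "p \<xi> \<in> Hom C n x" "j (fst r) \<in> Hom C x n"
        using q[OF r] \<psi>h copower_proj copower_inj \<xi> by auto
      have "p \<xi> \<cdot> (j (fst r) \<cdot> \<psi> (snd r)) = (p \<xi> \<cdot> j (fst r)) \<cdot> \<psi> (snd r)" using a by (simp add: comp_assoc)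
      also have "\<dots> = scale_arr C (\<xi> (fst r)) (\<psi> (snd r))"
        using q[OF r] \<xi> a copower_obj comp_scale_left[OF a(1) id_in_hom]
        by (simp add: copower_proj_inj comp_id_left)
      also have "\<dots> = \<psi> (\<xi> (fst r) \<odot>\<^bsub>dual_space V\<^esub> snd r)"
        using lin_smult[OF \<psi>, of "snd r"] q[OF r] by simp
      finally show "p \<xi> \<cdot> (j (fst r) \<cdot> \<psi> (snd r)) = \<psi> (\<xi> (fst r) \<odot>\<^bsub>dual_space V\<^esub> snd r)" .
    qed
    also have "vsum (hom_space C d x) (map \<psi> (map (\<lambda>q. \<xi> (fst q) \<odot>\<^bsub>dual_space V\<^esub> snd q) L)) =
      \<psi> (vsum (dual_space V) (map (\<lambda>q. \<xi> (fst q) \<odot>\<^bsub>dual_space V\<^esub> snd q) L))"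
      using q by (intro lin_vsum[symmetric, OF dual hom_vectorspace[OF d copower_obj(1)] \<psi>])
        (auto intro!: vs_smult[OF dual])
    also have "\<dots> = \<psi> \<xi>" by (simp only: frame_dual[OF copower_obj(3) L \<xi>])
    finally show ?thesis .
  qed
  then show ?thesis using vsum_hom[OF d copower_obj(2) S] by blast
qed

end

end


subsection \<open>Tensorings\<close>

text \<open>The Yoneda element of the tensoring: by naturality it determines \<open>tens_iso\<close>
  on pure tensors at every object, as \<open>tens_iso_pure\<close> states.\<close>

definition tens_inj ::
  "('k::field, 'o, 'm, 'z) lin_cat_scheme \<Rightarrow> ('k, 'v, 'o, 'm) tensoring \<Rightarrow> ('k, 'v) module \<Rightarrow> 'o \<Rightarrow>
    'v \<Rightarrow> 'm" where
  "tens_inj C \<Theta> V x v = tens_iso \<Theta> V x x (pure_tensor V (hom_space C x x) v (Idt C x))"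

text \<open>A tensoring comes with no projections; they are chosen here, and
  \<open>tens_copower_ex\<close> supplies their existence.\<close>

definition tens_proj ::
  "('k::field, 'o, 'm, 'z) lin_cat_scheme \<Rightarrow> ('k, 'v, 'o, 'm) tensoring \<Rightarrow> ('k, 'v) module \<Rightarrow> 'o \<Rightarrow>
    ('v \<Rightarrow> 'k) \<Rightarrow> 'm" where
  "tens_proj C \<Theta> V x = (SOME p. copower C V x (tens_obj \<Theta> V x) (tens_inj C \<Theta> V x) p)"

context linear_category
begin

context
  fixes \<Theta> :: "('k, 'v, 'o, 'm) tensoring"
  assumes \<Theta>: "is_tensoring C \<Theta>"
begin

lemma tens_iso_pure:
  assumes "fd_space V" "x \<in> Obj C" "k \<in> Hom C y x" "v \<in> carrier V"
  shows "tens_iso \<Theta> V x y (pure_tensor V (hom_space C y x) v k) = tens_inj C \<Theta> V x v \<cdot> k"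
proof -
  have nat: "\<forall>y\<in>Obj C. \<forall>y'\<in>Obj C. \<forall>h\<in>Hom C y' y. \<forall>v\<in>carrier V. \<forall>k\<in>Hom C y x.
        tens_iso \<Theta> V x y' (pure_tensor V (hom_space C y' x) v (k \<cdot> h)) =
        tens_iso \<Theta> V x y (pure_tensor V (hom_space C y x) v k) \<cdot> h"
    using \<Theta> assms(1,2) unfolding is_tensoring_def by blast
  have "tens_iso \<Theta> V x y (pure_tensor V (hom_space C y x) v (Idt C x \<cdot> k)) =
    tens_iso \<Theta> V x x (pure_tensor V (hom_space C x x) v (Idt C x)) \<cdot> k"
    using assms hom_dom[OF assms(3)] id_in_hom by (intro nat[rule_format]) auto
  then show ?thesis using comp_id_left[OF assms(3)] by (simp add: tens_inj_def)
qed

text \<open>The identity of the object \<open>?n\<close> that represents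
  \<open>V \<otimes> x\<close> corresponds to a tensor in \<open>V \<otimes> Hom(n, x)\<close>. Its
  contractions with functionals are the projections, and its decomposition along a frame is the
  resolution of the identity.\<close>

lemma tens_copower_ex:
  assumes V: "fd_space V" and x: "x \<in> Obj C"
  shows "\<exists>p. copower C V x (tens_obj \<Theta> V x) (tens_inj C \<Theta> V x) p"
proof -
  let ?n = "tens_obj \<Theta> V x" and ?j = "tens_inj C \<Theta> V x"
  note vV = fd_vs[OF V]
  have n: "?n \<in> Obj C" and
    iso: "\<And>y. y \<in> Obj C \<Longrightarrow> tens_iso \<Theta> V x y \<in> linear_maps (tensor_space V (hom_space C y x)) (hom_space C y ?n)"
    "\<And>y. y \<in> Obj C \<Longrightarrow> bij_betw (tens_iso \<Theta> V x y) (carrier (tensor_space V (hom_space C y x))) (Hom C y ?n)"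
    using \<Theta> V x unfolding is_tensoring_def by blast+
  note hvs = hom_vectorspace[OF _ x]
  have jl: "?j \<in> linear_maps V (hom_space C x ?n)"
    unfolding tens_inj_def
  proof (rule lin_mapI)
    note T = iso(1)[OF x] and H = hvs[OF x] and id = id_in_hom[OF x]
    note pc = pure_carrier[OF vV H]
    show "tens_iso \<Theta> V x x (pure_tensor V (hom_space C x x) v (Idt C x)) \<in> carrier (hom_space C x ?n)"
      if "v \<in> carrier V" for v by (rule lin_closed[OF T pc]) (use that id in auto)
    show "tens_iso \<Theta> V x x (pure_tensor V (hom_space C x x) (v \<oplus>\<^bsub>V\<^esub> v') (Idt C x)) =
      tens_iso \<Theta> V x x (pure_tensor V (hom_space C x x) v (Idt C x)) \<oplus>\<^bsub>hom_space C x ?n\<^esub>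
      tens_iso \<Theta> V x x (pure_tensor V (hom_space C x x) v' (Idt C x))"
      if "v \<in> carrier V" "v' \<in> carrier V" for v v'
      by (subst pure_add_left[OF vV H], use that id in simp_all, subst lin_add[OF T])
        (use that id pc in auto)
    show "tens_iso \<Theta> V x x (pure_tensor V (hom_space C x x) (c \<odot>\<^bsub>V\<^esub> v) (Idt C x)) =
      c \<odot>\<^bsub>hom_space C x ?n\<^esub> tens_iso \<Theta> V x x (pure_tensor V (hom_space C x x) v (Idt C x))"
      if "v \<in> carrier V" for c v
      by (subst pure_smult_left[OF vV H], use that id in simp_all, subst lin_smult[OF T])
        (use that id pc in auto)
  qed
  have jh: "v \<in> carrier V \<Longrightarrow> ?j v \<in> Hom C x ?n" for v using lin_closed[OF jl] by simp
  obtain L where L: "frame V L" using V by (rule fd_frame)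
  note Lin = frame_in[OF L]
  let ?H = "hom_space C ?n x"
  note Hn = hvs[OF n] and Hx = hvs[OF x]
  \<comment> \<open>Surjectivity at \<open>y = ?n\<close> yields the tensor \<open>\<tau>\<close>
    behind the identity. Its frame components \<open>k l\<close> are arrows from \<open>?n\<close>
    to \<open>x\<close>.\<close>
  have "Idt C ?n \<in> tens_iso \<Theta> V x ?n ` carrier (tensor_space V ?H)"
    unfolding bij_betw_imp_surj_on[OF iso(2)[OF n]] by (rule id_in_hom[OF n])
  then obtain \<tau> where \<tau>: "\<tau> \<in> carrier (tensor_space V ?H)" "tens_iso \<Theta> V x ?n \<tau> = Idt C ?n"
    by (elim imageE) simp
  obtain p where p: "p \<in> free_space V ?H" "\<tau> = tclass V ?H p"
    using \<tau>(1) tensor_carrier[OF vV Hn] by blast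
  define k where "k l = contract ?H (snd l) p" for l :: "'v \<times> ('v \<Rightarrow> 'k)"
  have k: "k l \<in> Hom C ?n x" for l
    using contract_closed[OF vV Hn p(1)] by (simp add: k_def)
  have sub: "set (map (\<lambda>l. (fst l, k l)) L) \<subseteq> carrier V \<times> carrier ?H" using Lin k by auto
  have "Idt C ?n = tens_iso \<Theta> V x ?n (tclass V ?H (fsum (map (\<lambda>l. (fst l, k l)) L)))"
    using \<tau>(2) frame_tensor_class[OF vV Hn L p(1)] by (simp add: p(2) k_def)
  also have "\<dots> = vsum (hom_space C ?n ?n)
      (map (\<lambda>(v, w). tens_iso \<Theta> V x ?n (pure_tensor V ?H v w)) (map (\<lambda>l. (fst l, k l)) L))"
    by (rule tensor_lin_fsum[OF vV Hn hom_vectorspace[OF n n] iso(1)[OF n] sub])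
  also have "\<dots> = vsum (hom_space C ?n ?n) (map (\<lambda>l. ?j (fst l) \<cdot> k l) L)"
    using Lin tens_iso_pure[OF V x k] by (auto intro!: arg_cong[where f = "vsum _"])
  finally have id1: "Idt C ?n = vsum (hom_space C ?n ?n) (map (\<lambda>l. ?j (fst l) \<cdot> k l) L)" .
  have jk: "?j (fst l) \<cdot> k l \<in> Hom C ?n ?n" if "l \<in> set L" for l
    using comp_in_hom[OF k jh] Lin[OF that] by blast
  \<comment> \<open>The contraction with \<open>\<xi>\<close> of the tensor that has the
    \<open>k l\<close> as coefficients of the frame vectors; a sum over the frame, so linearity in
    \<open>\<xi>\<close> is visible.\<close>
  define q where "q \<xi> = vsum ?H (map (\<lambda>l. \<xi> (fst l) \<odot>\<^bsub>?H\<^esub> k l) L)" for \<xi>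
  have qh: "q \<xi> \<in> Hom C ?n x" for \<xi>
    unfolding q_def using k by (intro vsum_hom[OF n x]) (auto intro: scale_hom)
  have ql: "q \<in> linear_maps (dual_space V) ?H"
  proof (rule lin_mapI)
    show "q \<xi> \<in> carrier ?H" for \<xi> using qh by simp
    show "q (\<xi> \<oplus>\<^bsub>dual_space V\<^esub> \<zeta>) = q \<xi> \<oplus>\<^bsub>?H\<^esub> q \<zeta>" for \<xi> \<zeta>
      unfolding q_def using k Lin
      by (subst vsum_add[OF Hn, symmetric])
        (auto simp: dual_space_simps(3) vs_add_smult[OF Hn, simplified] scale_hom intro!: arg_cong[where f = "vsum _"])
    have l: "(\<lambda>f. c \<odot>\<^bsub>?H\<^esub> f) \<in> linear_maps ?H ?H" for c
      by (rule lin_mapI) (use Hn in \<open>auto simp: vs_smult_add[OF Hn, simplified] vs_smult_smult[OF Hn, simplified] mult.commute scale_hom\<close>)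
    show "q (c \<odot>\<^bsub>dual_space V\<^esub> \<xi>) = c \<odot>\<^bsub>?H\<^esub> q \<xi>" for c \<xi>
      unfolding q_def using k Lin
      by (subst lin_vsum[OF Hn Hn l])
        (auto simp: dual_space_simps(4) vs_smult_smult[OF Hn, simplified] scale_hom intro!: arg_cong[where f = "vsum _"])
  qed
  \<comment> \<open>The arrow \<open>?j v\<close> is the image of two tensors in
    \<open>V \<otimes> Hom(x, x)\<close>: of \<open>v\<close> tensored with the identity, and of the
    sum of the frame vectors tensored with \<open>k l \<cdot> ?j v\<close>. Injectivity of
    \<open>tens_iso\<close> at \<open>x\<close> identifies the tensors, and contracting both with
    \<open>\<xi>\<close> gives the claim.\<close>
  have qj: "q \<xi> \<cdot> ?j v = scale_arr C (\<xi> v) (Idt C x)"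
    if v: "v \<in> carrier V" and \<xi>: "\<xi> \<in> carrier (dual_space V)" for v \<xi>
  proof -
    let ?K = "hom_space C x x"
    have kj: "k l \<cdot> ?j v \<in> carrier ?K" for l using comp_in_hom[OF jh[OF v] k] by simp
    let ?ys = "map (\<lambda>l. (fst l, k l \<cdot> ?j v)) L"
    have ys: "set ?ys \<subseteq> carrier V \<times> carrier ?K" using Lin kj by auto
    have "?j v = Idt C ?n \<cdot> ?j v" using jh[OF v] by (simp add: comp_id_left)
    also have "\<dots> = vsum (hom_space C x ?n) (map (\<lambda>l. (?j (fst l) \<cdot> k l) \<cdot> ?j v) L)"
      unfolding id1 using jk by (subst vsum_comp[OF n jh[OF v]]) (auto simp: o_def)
    also have "\<dots> = vsum (hom_space C x ?n) (map (\<lambda>(v, w). tens_iso \<Theta> V x x (pure_tensor V ?K v w)) ?ys)"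
      using Lin jh k v kj comp_assoc[OF jh[OF v] k jh]
      by (auto simp: tens_iso_pure[OF V x] intro!: arg_cong[where f = "vsum _"])
    also have "\<dots> = tens_iso \<Theta> V x x (tclass V ?K (fsum ?ys))"
      by (rule tensor_lin_fsum[OF vV Hx hom_vectorspace[OF x n] iso(1)[OF x] ys, symmetric])
    finally have "tens_iso \<Theta> V x x (tclass V ?K (Poly_Mapping.single (v, Idt C x) 1)) =
      tens_iso \<Theta> V x x (tclass V ?K (fsum ?ys))"
      by (simp add: tens_inj_def pure_tclass[OF vV Hx])
    note eq = this
    have f: "Poly_Mapping.single (v, Idt C x) 1 \<in> free_space V ?K" "fsum ?ys \<in> free_space V ?K"
      using v id_in_hom[OF x] fsum_free[OF vV Hx ys] by (auto intro: free_space_single)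
    have tc: "tclass V ?K p' \<in> carrier (tensor_space V ?K)" if "p' \<in> free_space V ?K" for p'
      using that tensor_carrier[OF vV Hx] by blast
    have "tclass V ?K (Poly_Mapping.single (v, Idt C x) 1) = tclass V ?K (fsum ?ys)"
      by (rule inj_onD[OF bij_betw_imp_inj_on[OF iso(2)[OF x]] eq tc[OF f(1)] tc[OF f(2)]])
    then have "contract ?K \<xi> (Poly_Mapping.single (v, Idt C x) 1) = contract ?K \<xi> (fsum ?ys)"
      using f tclass_eq_iff[OF vV Hx f] by (intro contract_cong[OF vV Hx dual_lin[OF \<xi>]]) auto
    then have "scale_arr C (\<xi> v) (Idt C x) = vsum ?K (map (\<lambda>l. scale_arr C (\<xi> (fst l)) (k l \<cdot> ?j v)) L)"
      using v id_in_hom[OF x] contract_fsum[OF vV Hx ys, of \<xi>]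
      by (simp add: contract_single[OF vV Hx] o_def)
    also have "\<dots> = q \<xi> \<cdot> ?j v"
      unfolding q_def using k
      by (subst vsum_comp[OF x jh[OF v]])
        (auto simp: o_def comp_scale_left[OF jh[OF v] k] scale_hom intro!: arg_cong[where f = "vsum _"])
    finally show ?thesis by simp
  qed
  \<comment> \<open>The resolution \<open>id1\<close> uses the arrows \<open>k l\<close>, whereas a
    copower asks for \<open>q (snd l)\<close>. The sum \<open>?s\<close> fixes every
    \<open>?j v\<close>, so composing it with \<open>id1\<close> shows that it is the identity
    too.\<close>
  have id2: "vsum (hom_space C ?n ?n) (map (\<lambda>l. ?j (fst l) \<cdot> q (snd l)) L) = Idt C ?n" (is "?s = _")
  proof -
    have S: "set (map (\<lambda>l. ?j (fst l) \<cdot> q (snd l)) L) \<subseteq> Hom C ?n ?n"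
      using Lin comp_in_hom[OF qh jh] by auto
    have s: "?s \<in> Hom C ?n ?n" by (rule vsum_hom[OF n n S])
    have sj: "?s \<cdot> ?j v = ?j v" if v: "v \<in> carrier V" for v
    proof -
      have "?s \<cdot> ?j v = vsum (hom_space C x ?n) (map (\<lambda>l. (?j (fst l) \<cdot> q (snd l)) \<cdot> ?j v) L)"
        by (subst vsum_comp[OF n jh[OF v] S]) (simp add: o_def)
      also have "\<dots> = vsum (hom_space C x ?n) (map (\<lambda>l. snd l v \<odot>\<^bsub>hom_space C x ?n\<^esub> ?j (fst l)) L)"
      proof (intro arg_cong[where f = "vsum _"] map_cong refl)
        fix l assume l: "l \<in> set L"
        have jl': "?j (fst l) \<in> Hom C x ?n" using Lin[OF l] jh by auto
        have "(?j (fst l) \<cdot> q (snd l)) \<cdot> ?j v = ?j (fst l) \<cdot> (q (snd l) \<cdot> ?j v)"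
          by (rule comp_assoc[OF jh[OF v] qh jl'])
        also have "\<dots> = snd l v \<odot>\<^bsub>hom_space C x ?n\<^esub> ?j (fst l)"
          using qj[OF v] Lin[OF l] comp_scale_right[OF id_in_hom[OF x] jl'] comp_id_right[OF jl'] by simp
        finally show "(?j (fst l) \<cdot> q (snd l)) \<cdot> ?j v = snd l v \<odot>\<^bsub>hom_space C x ?n\<^esub> ?j (fst l)" .
      qed
      also have "\<dots> = ?j v" by (rule frame_expand[OF vV hom_vectorspace[OF x n] L jl v, symmetric])
      finally show ?thesis .
    qed
    have "?s = ?s \<cdot> Idt C ?n" using s by (simp add: comp_id_right)
    also have "\<dots> = vsum (hom_space C ?n ?n) (map (\<lambda>l. ?s \<cdot> (?j (fst l) \<cdot> k l)) L)"
      by (subst id1, subst comp_vsum[OF n s]) (use jk in \<open>auto simp: o_def\<close>)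
    also have "\<dots> = vsum (hom_space C ?n ?n) (map (\<lambda>l. ?j (fst l) \<cdot> k l) L)"
    proof (intro arg_cong[where f = "vsum _"] map_cong refl)
      fix l assume l: "l \<in> set L"
      have "?s \<cdot> (?j (fst l) \<cdot> k l) = (?s \<cdot> ?j (fst l)) \<cdot> k l"
        using comp_assoc[OF k jh s] Lin[OF l] by simp
      then show "?s \<cdot> (?j (fst l) \<cdot> k l) = ?j (fst l) \<cdot> k l" using sj Lin[OF l] by simp
    qed
    also have "\<dots> = Idt C ?n" by (rule id1[symmetric])
    finally show ?thesis .
  qed
  have "copower C V x ?n ?j q"
    unfolding copower_def using x n vV jl ql qj L id2 by blast
  then show ?thesis by blast
qed

lemma tens_copower:
  "fd_space V \<Longrightarrow> x \<in> Obj C \<Longrightarrow>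
    copower C V x (tens_obj \<Theta> V x) (tens_inj C \<Theta> V x) (tens_proj C \<Theta> V x)"
  unfolding tens_proj_def by (rule someI_ex[OF tens_copower_ex])

text \<open>The condition under \<open>THE\<close> ranges over all objects \<open>y\<close>, but by
  naturality it is equivalent to its instance at the identity of \<open>x\<close>, that is, to a
  condition on the injections. There the copower property gives existence and uniqueness.\<close>

lemma tens_arr:
  assumes V: "fd_space V" and W: "fd_space W" and \<phi>: "\<phi> \<in> linear_maps V W" and g: "g \<in> Hom C x x'"
  shows tens_arr_hom: "tens_arr C \<Theta> V W \<phi> g \<in> Hom C (tens_obj \<Theta> V x) (tens_obj \<Theta> W x')"
    and tens_arr_inj: "\<And>v. v \<in> carrier V \<Longrightarrow>
      tens_arr C \<Theta> V W \<phi> g \<cdot> tens_inj C \<Theta> V x v = tens_inj C \<Theta> W x' (\<phi> v) \<cdot> g"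
proof -
  note x = hom_dom[OF g] and x' = hom_cod[OF g]
  note cV = tens_copower[OF V x] and cW = tens_copower[OF W x']
  let ?P = "\<lambda>t. t \<in> Hom C (tens_obj \<Theta> V (Dom C g)) (tens_obj \<Theta> W (Cod C g)) \<and>
     (\<forall>y\<in>Obj C. \<forall>v\<in>carrier V. \<forall>k\<in>Hom C y (Dom C g).
        t \<cdot> tens_iso \<Theta> V (Dom C g) y (pure_tensor V (hom_space C y (Dom C g)) v k) =
        tens_iso \<Theta> W (Cod C g) y (pure_tensor W (hom_space C y (Cod C g)) (\<phi> v) (g \<cdot> k)))"
  let ?Q = "\<lambda>t. t \<in> Hom C (tens_obj \<Theta> V x) (tens_obj \<Theta> W x') \<and>
     (\<forall>v\<in>carrier V. t \<cdot> tens_inj C \<Theta> V x v = tens_inj C \<Theta> W x' (\<phi> v) \<cdot> g)"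
  have dc: "Dom C g = x" "Cod C g = x'" using g by (auto simp: Hom_def)
  have \<phi>c: "v \<in> carrier V \<Longrightarrow> \<phi> v \<in> carrier W" for v by (rule lin_closed[OF \<phi>])
  have PQ: "?P t \<longleftrightarrow> ?Q t" for t
    unfolding dc
  proof (intro conj_cong refl iffI ballI)
    fix v assume t: "t \<in> Hom C (tens_obj \<Theta> V x) (tens_obj \<Theta> W x')" and v: "v \<in> carrier V"
    { assume "\<forall>y\<in>Obj C. \<forall>v\<in>carrier V. \<forall>k\<in>Hom C y x. t \<cdot> tens_iso \<Theta> V x y (pure_tensor V (hom_space C y x) v k) =
        tens_iso \<Theta> W x' y (pure_tensor W (hom_space C y x') (\<phi> v) (g \<cdot> k))"
      then have "t \<cdot> tens_iso \<Theta> V x x (pure_tensor V (hom_space C x x) v (Idt C x)) =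
        tens_iso \<Theta> W x' x (pure_tensor W (hom_space C x x') (\<phi> v) (g \<cdot> Idt C x))"
        using x v id_in_hom by blast
      then show "t \<cdot> tens_inj C \<Theta> V x v = tens_inj C \<Theta> W x' (\<phi> v) \<cdot> g"
        using comp_id_right[OF g] tens_iso_pure[OF W x' g \<phi>c[OF v]] by (simp add: tens_inj_def[of C \<Theta> V]) }
    fix y k assume "\<forall>v\<in>carrier V. t \<cdot> tens_inj C \<Theta> V x v = tens_inj C \<Theta> W x' (\<phi> v) \<cdot> g"
      and k: "k \<in> Hom C y x"
    then have e: "t \<cdot> tens_inj C \<Theta> V x v = tens_inj C \<Theta> W x' (\<phi> v) \<cdot> g" using v by blast
    have "t \<cdot> (tens_inj C \<Theta> V x v \<cdot> k) = (t \<cdot> tens_inj C \<Theta> V x v) \<cdot> k"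
      by (rule comp_assoc[OF k copower_inj[OF cV v] t, symmetric])
    also have "\<dots> = tens_inj C \<Theta> W x' (\<phi> v) \<cdot> (g \<cdot> k)"
      unfolding e by (rule comp_assoc[OF k g copower_inj[OF cW \<phi>c[OF v]]])
    finally show "t \<cdot> tens_iso \<Theta> V x y (pure_tensor V (hom_space C y x) v k) =
        tens_iso \<Theta> W x' y (pure_tensor W (hom_space C y x') (\<phi> v) (g \<cdot> k))"
      using tens_iso_pure[OF V x k v] tens_iso_pure[OF W x' comp_in_hom[OF k g] \<phi>c[OF v]] by simp
  qed
  have "(\<lambda>v. tens_inj C \<Theta> W x' (\<phi> v) \<cdot> g) \<in> linear_maps V (hom_space C x (tens_obj \<Theta> W x'))"
    using lin_comp[OF \<phi> lin_comp[OF copower_inj_lin[OF cW] comp_linear_left[OF copower_obj(2)[OF cW] g]]] .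
  from copower_ex[OF cV copower_obj(2)[OF cW] this]
  obtain t where t: "?Q t" by blast
  have uniq: "t' = t" if "?Q t'" for t'
    by (rule copower_eqI[OF cV]) (use t that in auto)
  have "tens_arr C \<Theta> V W \<phi> g = t"
    unfolding tens_arr_def PQ by (rule the_equality) (use t uniq in blast)+
  then show "tens_arr C \<Theta> V W \<phi> g \<in> Hom C (tens_obj \<Theta> V x) (tens_obj \<Theta> W x')"
    "\<And>v. v \<in> carrier V \<Longrightarrow> tens_arr C \<Theta> V W \<phi> g \<cdot> tens_inj C \<Theta> V x v = tens_inj C \<Theta> W x' (\<phi> v) \<cdot> g"
    using t by auto
qed

end

end


section \<open>Nakayama functors by a universal property\<close>

lemma dual_map_closed:
  assumes "is_vs V" "\<phi> \<in> linear_maps V W" "\<xi> \<in> carrier (dual_space W)"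
  shows "dual_map V \<phi> \<xi> \<in> carrier (dual_space V)"
  unfolding dual_map_def
  by (rule restrict_dual_space[OF assms(1) lin_comp[OF assms(2) dual_lin[OF assms(3)]]])

lemma dual_map_lin:
  assumes "is_vs V" "\<phi> \<in> linear_maps V W"
  shows "dual_map V \<phi> \<in> linear_maps (dual_space W) (dual_space V)"
proof (rule lin_mapI)
  show "dual_map V \<phi> \<xi> \<in> carrier (dual_space V)" if "\<xi> \<in> carrier (dual_space W)" for \<xi>
    by (rule dual_map_closed[OF assms that])
qed (auto simp: dual_map_def dual_space_simps(3,4) lin_closed[OF assms(2)] intro!: restrict_ext)

lemma dual_map_apply: "v \<in> carrier V \<Longrightarrow> dual_map V \<phi> \<xi> v = \<xi> (\<phi> v)"
  by (simp add: dual_map_def)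

lemma dual_map_id:
  assumes "is_vs V" "\<xi> \<in> carrier (dual_space V)" "\<And>v. v \<in> carrier V \<Longrightarrow> \<phi> v = v"
  shows "dual_map V \<phi> \<xi> = \<xi>"
  using assms(2,3) by (auto simp: dual_map_def dual_space_simps(1) intro!: extensionalityI[of _ "carrier V"])

lemma dual_map_comp:
  assumes "\<And>v. v \<in> carrier U \<Longrightarrow> \<phi> v \<in> carrier V" "\<And>v. v \<in> carrier U \<Longrightarrow> \<chi> v = \<psi> (\<phi> v)"
  shows "dual_map U \<phi> (dual_map V \<psi> \<xi>) = dual_map U \<chi> \<xi>"
  using assms by (auto simp: dual_map_def intro!: restrict_ext)

text \<open>Here \<open>\<sigma> a \<xi>\<close> stands for the component at \<open>a\<close>
  composed with the injection of \<open>\<xi>\<close>. Both \<open>Hom(c, a)\<close> dualised and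
  \<open>Hom(a, d)\<close> are contravariant in \<open>a\<close>, hence the composition with
  \<open>h\<close> on the right.\<close>

definition nak_family ::
  "('k::field, 'o, 'm, 'z) lin_cat_scheme \<Rightarrow> 'o \<Rightarrow> 'o \<Rightarrow> ('o \<Rightarrow> ('m \<Rightarrow> 'k) \<Rightarrow> 'm) \<Rightarrow> bool" where
  "nak_family C c d \<sigma> \<longleftrightarrow> d \<in> Obj C \<and>
     (\<forall>a\<in>Obj C. \<sigma> a \<in> linear_maps (dual_space (hom_space C c a)) (hom_space C a d)) \<and>
     (\<forall>a\<in>Obj C. \<forall>b\<in>Obj C. \<forall>h\<in>Hom C a b. \<forall>\<xi>\<in>carrier (dual_space (hom_space C c b)).
        \<sigma> a (dual_map (hom_space C c a) (\<lambda>k. h \<cdot>\<^bsub>C\<^esub> k) \<xi>) = \<sigma> b \<xi> \<cdot>\<^bsub>C\<^esub> h)"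

definition nak_univ ::
  "('k::field, 'o, 'm, 'z) lin_cat_scheme \<Rightarrow> 'o \<Rightarrow> 'o \<Rightarrow> ('o \<Rightarrow> ('m \<Rightarrow> 'k) \<Rightarrow> 'm) \<Rightarrow> bool" where
  "nak_univ C c n \<iota> \<longleftrightarrow> nak_family C c n \<iota> \<and>
     (\<forall>d \<sigma>. nak_family C c d \<sigma> \<longrightarrow>
        (\<exists>!t. t \<in> Hom C n d \<and>
          (\<forall>a\<in>Obj C. \<forall>\<xi>\<in>carrier (dual_space (hom_space C c a)). t \<cdot>\<^bsub>C\<^esub> \<iota> a \<xi> = \<sigma> a \<xi>)))"

text \<open>
  The functor \<open>N\<close> represents, in \<open>d\<close>, the natural transformations from \<open>Hom(c, -)*\<close> to
  \<open>Hom(-, d)\<close>. This describes the right Nakayama functor without copowers, and the left one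
  when read in the opposite category.
\<close>

definition nakayama ::
  "('k::field, 'o, 'm, 'z) lin_cat_scheme \<Rightarrow> ('o, 'm, 'o, 'm) fun_data \<Rightarrow> bool" where
  "nakayama C N \<longleftrightarrow> is_functor C C N \<and> (\<exists>\<iota>.
     (\<forall>c\<in>Obj C. nak_univ C c (on_obj N c) (\<iota> c)) \<and>
     (\<forall>c\<in>Obj C. \<forall>c'\<in>Obj C. \<forall>f\<in>Hom C c c'. \<forall>a\<in>Obj C. \<forall>\<xi>\<in>carrier (dual_space (hom_space C c a)).
        on_arr N f \<cdot>\<^bsub>C\<^esub> \<iota> c a \<xi> = \<iota> c' a (dual_map (hom_space C c' a) (\<lambda>k. k \<cdot>\<^bsub>C\<^esub> f) \<xi>)))"

text \<open>A tensoring is specified at finite-dimensional spaces only, so Hom-spaces and their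
  duals have to be finite-dimensional before it can be applied to them.\<close>

locale fd_category = linear_category C
  for C :: "('k::field, 'o, 'm, 'z) lin_cat_scheme" (structure) +
  assumes hom_fd: "a \<in> Obj C \<Longrightarrow> b \<in> Obj C \<Longrightarrow> fd_space (hom_space C a b)"
begin

lemma pre_lin:
  "f \<in> Hom C a b \<Longrightarrow> c \<in> Obj C \<Longrightarrow> (\<lambda>k. k \<cdot> f) \<in> linear_maps (hom_space C b c) (hom_space C a c)"
  by (rule comp_linear_left)

lemma post_lin:
  "g \<in> Hom C b c \<Longrightarrow> a \<in> Obj C \<Longrightarrow> (\<lambda>k. g \<cdot> k) \<in> linear_maps (hom_space C a b) (hom_space C a c)"
  by (rule comp_linear_right)

text \<open>Covers both Nakayama bifunctors: \<open>V\<close> with \<open>\<phi>\<close> is a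
  contravariant functor into finite-dimensional spaces, namely \<open>Hom(-, c)\<close> or the dual
  of \<open>Hom(c, -)\<close>. The functor laws are checked on injections.\<close>

lemma tens_bifunctor:
  fixes \<Theta> :: "('k, 'v, 'o, 'm) tensoring" and V :: "'o \<Rightarrow> ('k, 'v) module" and \<phi> :: "'m \<Rightarrow> 'v \<Rightarrow> 'v"
  assumes \<Theta>: "is_tensoring C \<Theta>"
    and V: "\<And>a. a \<in> Obj C \<Longrightarrow> fd_space (V a)"
    and \<phi>: "\<And>a b f. f \<in> Hom C a b \<Longrightarrow> \<phi> f \<in> linear_maps (V b) (V a)"
    and \<phi>_id: "\<And>a v. a \<in> Obj C \<Longrightarrow> v \<in> carrier (V a) \<Longrightarrow> \<phi> (Idt C a) v = v"
    and \<phi>_comp: "\<And>a b c f g v. f \<in> Hom C a b \<Longrightarrow> g \<in> Hom C b c \<Longrightarrow> v \<in> carrier (V c) \<Longrightarrow>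
      \<phi> (g \<cdot> f) v = \<phi> f (\<phi> g v)"
    and F: "on_obj F = (\<lambda>(a, b). tens_obj \<Theta> (V a) b)"
      "on_arr F = (\<lambda>(f, g). tens_arr C \<Theta> (V (Cod C f)) (V (Dom C f)) (\<phi> f) g)"
  shows "is_functor (prod_cat (op_cat C) C) C F"
proof -
  note cop = tens_copower[OF \<Theta> V]
  have arr: "tens_arr C \<Theta> (V b) (V a) (\<phi> f) g \<in> Hom C (tens_obj \<Theta> (V b) x) (tens_obj \<Theta> (V a) x')"
    if "f \<in> Hom C a b" "g \<in> Hom C x x'" for f a b g x x'
    by (rule tens_arr_hom[OF \<Theta> V V \<phi>[OF that(1)] that(2)]) (use hom_dom hom_cod that in auto)
  have inj: "tens_arr C \<Theta> (V b) (V a) (\<phi> f) g \<cdot> tens_inj C \<Theta> (V b) x v = tens_inj C \<Theta> (V a) x' (\<phi> f v) \<cdot> g"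
    if "f \<in> Hom C a b" "g \<in> Hom C x x'" "v \<in> carrier (V b)" for f a b g x x' v
    by (rule tens_arr_inj[OF \<Theta> V V \<phi>[OF that(1)] that(2,3)]) (use hom_dom hom_cod that in auto)
  have id: "tens_arr C \<Theta> (V a) (V a) (\<phi> (Idt C a)) (Idt C x) = Idt C (tens_obj \<Theta> (V a) x)"
    if a: "a \<in> Obj C" and x: "x \<in> Obj C" for a x
  proof (rule copower_eqI[OF cop[OF a x] arr[OF id_in_hom[OF a] id_in_hom[OF x]]])
    show "Idt C (tens_obj \<Theta> (V a) x) \<in> Hom C (tens_obj \<Theta> (V a) x) (tens_obj \<Theta> (V a) x)"
      by (rule id_in_hom[OF copower_obj(2)[OF cop[OF a x]]])
    fix v assume v: "v \<in> carrier (V a)"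
    show "tens_arr C \<Theta> (V a) (V a) (\<phi> (Idt C a)) (Idt C x) \<cdot> tens_inj C \<Theta> (V a) x v =
      Idt C (tens_obj \<Theta> (V a) x) \<cdot> tens_inj C \<Theta> (V a) x v"
      using inj[OF id_in_hom[OF a] id_in_hom[OF x] v] \<phi>_id[OF a v] copower_inj[OF cop[OF a x] v]
      by (simp add: comp_id_left comp_id_right)
  qed
  have comp: "tens_arr C \<Theta> (V c) (V a) (\<phi> (f' \<cdot> f)) (g' \<cdot> g) =
      tens_arr C \<Theta> (V b) (V a) (\<phi> f) g' \<cdot> tens_arr C \<Theta> (V c) (V b) (\<phi> f') g"
    if f: "f \<in> Hom C a b" "f' \<in> Hom C b c" and g: "g \<in> Hom C x y" "g' \<in> Hom C y z" for a b c f f' x y z g g'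
  proof -
    note o = hom_cod[OF f(2)] hom_dom[OF g(1)] hom_cod[OF f(1)] hom_cod[OF g(1)] hom_dom[OF f(1)] hom_cod[OF g(2)]
    note ar = arr[OF comp_in_hom[OF f] comp_in_hom[OF g]] arr[OF f(2) g(1)] arr[OF f(1) g(2)]
    show ?thesis
    proof (rule copower_eqI[OF cop[OF o(1,2)] ar(1) comp_in_hom[OF ar(2,3)]])
      fix v assume v: "v \<in> carrier (V c)"
      have v': "\<phi> f' v \<in> carrier (V b)" "\<phi> f (\<phi> f' v) \<in> carrier (V a)"
        using lin_closed[OF \<phi>[OF f(2)] v] lin_closed[OF \<phi>[OF f(1)]] by auto
      note i = copower_inj[OF cop[OF o(1,2)] v] copower_inj[OF cop[OF o(3,4)] v'(1)]
        copower_inj[OF cop[OF o(5,6)] v'(2)]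
      have "(tens_arr C \<Theta> (V b) (V a) (\<phi> f) g' \<cdot> tens_arr C \<Theta> (V c) (V b) (\<phi> f') g) \<cdot> tens_inj C \<Theta> (V c) x v =
        tens_arr C \<Theta> (V b) (V a) (\<phi> f) g' \<cdot> (tens_inj C \<Theta> (V b) y (\<phi> f' v) \<cdot> g)"
        using ar i by (simp add: comp_assoc inj[OF f(2) g(1) v])
      also have "\<dots> = (tens_inj C \<Theta> (V a) z (\<phi> f (\<phi> f' v)) \<cdot> g') \<cdot> g"
        by (subst comp_assoc[OF g(1) i(2) ar(3), symmetric]) (simp only: inj[OF f(1) g(2) v'(1)])
      also have "\<dots> = tens_arr C \<Theta> (V c) (V a) (\<phi> (f' \<cdot> f)) (g' \<cdot> g) \<cdot> tens_inj C \<Theta> (V c) x v"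
        using inj[OF comp_in_hom[OF f] comp_in_hom[OF g] v] comp_assoc[OF g i(3)] \<phi>_comp[OF f v] by simp
      finally show "tens_arr C \<Theta> (V c) (V a) (\<phi> (f' \<cdot> f)) (g' \<cdot> g) \<cdot> tens_inj C \<Theta> (V c) x v =
        (tens_arr C \<Theta> (V b) (V a) (\<phi> f) g' \<cdot> tens_arr C \<Theta> (V c) (V b) (\<phi> f') g) \<cdot> tens_inj C \<Theta> (V c) x v"
        by simp
    qed
  qed
  \<comment> \<open>The first six goals are the category axioms of the product with the opposite
    category; the functor laws are the last four.\<close>
  show ?thesis
  proof (unfold_locales, goal_cases)
    case (1 f) then show ?case by (auto simp: prod_cat_def op_cat_def)
  next
    case (2 a) then show ?case by (auto simp: prod_cat_def op_cat_def Hom_def)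
  next
    case (3 f a b g c) then show ?case by (auto simp: prod_cat_def op_cat_def Hom_def)
  next
    case (4 f a b) then show ?case by (auto simp: prod_cat_def op_cat_def Hom_def)
  next
    case (5 f a b) then show ?case by (auto simp: prod_cat_def op_cat_def Hom_def)
  next
    case (6 f a b g c h d) then show ?case by (auto simp: prod_cat_def op_cat_def Hom_def)
  next
    case (7 a) then show ?case using copower_obj(2)[OF cop] by (auto simp: prod_cat_def op_cat_def F)
  next
    case (8 f a b) then show ?case
      using arr by (auto simp: prod_cat_def op_cat_def Hom_def F)
  next
    case (9 a) then show ?case using id by (auto simp: prod_cat_def op_cat_def F)
  next
    case (10 f a b g c)
    obtain f1 f2 g1 g2 where fg: "f = (f1, f2)" "g = (g1, g2)" by (cases f, cases g) auto
    have h: "g1 \<in> Hom C (Dom C g1) (Cod C g1)" "f1 \<in> Hom C (Cod C g1) (Cod C f1)"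
      "f2 \<in> Hom C (Dom C f2) (Cod C f2)" "g2 \<in> Hom C (Cod C f2) (Cod C g2)"
      using 10 by (auto simp: prod_cat_def op_cat_def Hom_def fg)
    have e: "Dom C f1 = Cod C g1" using h by (simp add: Hom_def)
    show ?case
      using comp[OF h] h by (simp add: prod_cat_def op_cat_def F fg e Hom_def)
  qed
qed

lemma right_nak_functor:
  assumes "is_tensoring C \<Theta>" "c \<in> Obj C"
  shows "is_functor (prod_cat (op_cat C) C) C (right_nakayama_bifunctor C \<Theta> c)"
proof (rule tens_bifunctor[OF assms(1), where V = "\<lambda>a. dual_space (hom_space C c a)"
      and \<phi> = "\<lambda>f. dual_map (hom_space C c (Dom C f)) (\<lambda>h. f \<cdot> h)"])
  note h = hom_vectorspace[OF assms(2)]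
  show "fd_space (dual_space (hom_space C c a))" if "a \<in> Obj C" for a
    by (rule dual_space_fd[OF hom_fd[OF assms(2) that]])
  show "dual_map (hom_space C c (Dom C f)) ((\<cdot>) f)
    \<in> linear_maps (dual_space (hom_space C c b)) (dual_space (hom_space C c a))" if "f \<in> Hom C a b" for f a b
    using dual_map_lin[OF h[OF hom_dom[OF that]] post_lin[OF that assms(2)]] that by (simp add: Hom_def)
  show "dual_map (hom_space C c (Dom C (Idt C a))) ((\<cdot>) (Idt C a)) v = v"
    if "a \<in> Obj C" "v \<in> carrier (dual_space (hom_space C c a))" for a v
    using dual_map_id[OF h[OF that(1)] that(2), of "(\<cdot>) (Idt C a)"] that(1) by (simp add: Hom_def)
  show "dual_map (hom_space C c (Dom C (g \<cdot> f))) ((\<cdot>) (g \<cdot> f)) v =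
    dual_map (hom_space C c (Dom C f)) ((\<cdot>) f) (dual_map (hom_space C c (Dom C g)) ((\<cdot>) g) v)"
    if "f \<in> Hom C a b" "g \<in> Hom C b d" for a b d f g v
    by (rule dual_map_comp[symmetric, THEN trans]) (use that in \<open>auto simp: Hom_def\<close>)
qed (auto simp: right_nakayama_bifunctor_def)

lemma left_nak_functor:
  assumes "is_tensoring C \<Theta>" "c \<in> Obj C"
  shows "is_functor (prod_cat (op_cat C) C) C (left_nakayama_bifunctor C \<Theta> c)"
proof (rule tens_bifunctor[OF assms(1), where V = "\<lambda>a. hom_space C a c" and \<phi> = "\<lambda>f h. h \<cdot> f"])
  show "fd_space (hom_space C a c)" if "a \<in> Obj C" for a
    by (rule hom_fd[OF that assms(2)])
  show "(\<lambda>h. h \<cdot> f) \<in> linear_maps (hom_space C b c) (hom_space C a c)" if "f \<in> Hom C a b" for f a b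
    by (rule pre_lin[OF that assms(2)])
qed (auto simp: left_nakayama_bifunctor_def comp_assoc comp_id_right)

end


text \<open>Unlike \<open>op_cat\<close>, this keeps the linear structure and the record type, and
  its Hom-spaces are literally those of \<open>C\<close> with the arguments exchanged.\<close>

definition op_lin :: "('k, 'o, 'm, 'z) lin_cat_scheme \<Rightarrow> ('k, 'o, 'm, 'z) lin_cat_scheme" where
  "op_lin C = C\<lparr>Dom := Cod C, Cod := Dom C, Comp := (\<lambda>g f. f \<cdot>\<^bsub>C\<^esub> g), zero_arr := (\<lambda>a b. zero_arr C b a)\<rparr>"

lemma op_lin_simps [simp]:
  "Obj (op_lin C) = Obj C" "Arr (op_lin C) = Arr C" "Dom (op_lin C) = Cod C" "Cod (op_lin C) = Dom C"
  "Idt (op_lin C) = Idt C" "Comp (op_lin C) = (\<lambda>g f. f \<cdot>\<^bsub>C\<^esub> g)"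
  by (simp_all add: op_lin_def)

lemma Hom_op_lin [simp]: "Hom (op_lin C) a b = Hom C b a"
  by (auto simp: Hom_def)

lemma hom_space_op_lin [simp]: "hom_space (op_lin C) a b = hom_space C b a"
  by (simp add: hom_space_def Hom_op_lin) (simp add: op_lin_def)

lemma op_lin_functor:
  fixes D :: "('k, 'o, 'm, 'y) lin_cat_scheme"
  assumes "is_functor D D N"
  shows "is_functor (op_lin D) (op_lin D) N"
proof -
  interpret N: is_functor D D N by (rule assms)
  show ?thesis
    by (unfold_locales)
      (auto simp: N.obj_map N.arr_map N.id_map N.comp_map N.C.dom_cod N.C.id_in_hom N.C.comp_in_hom
        N.C.comp_id_left N.C.comp_id_right N.C.comp_assoc intro: N.comp_map N.arr_map N.C.comp_in_hom)
qed

context fd_category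
begin

text \<open>The counterpart of \<open>tens_arr_inj\<close> for projections, as required by ends. On
  the injection of \<open>v\<close> both sides equal the multiple of \<open>g\<close> by
  \<open>\<xi> (\<phi> v)\<close>.\<close>

lemma tens_proj_arr:
  assumes \<Theta>: "is_tensoring C \<Theta>" and V: "fd_space V" and W: "fd_space W" and \<phi>: "\<phi> \<in> linear_maps V W"
    and g: "g \<in> Hom C x x'" and \<xi>: "\<xi> \<in> carrier (dual_space W)"
  shows "tens_proj C \<Theta> W x' \<xi> \<cdot> tens_arr C \<Theta> V W \<phi> g = g \<cdot> tens_proj C \<Theta> V x (dual_map V \<phi> \<xi>)"
proof -
  note x = hom_dom[OF g] and x' = hom_cod[OF g]
  note cV = tens_copower[OF \<Theta> V x] and cW = tens_copower[OF \<Theta> W x']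
  have d: "dual_map V \<phi> \<xi> \<in> carrier (dual_space V)" by (rule dual_map_closed[OF fd_vs[OF V] \<phi> \<xi>])
  note p = copower_proj[OF cW \<xi>] copower_proj[OF cV d] and t = tens_arr_hom[OF \<Theta> V W \<phi> g]
  show ?thesis
  proof (rule copower_eqI[OF cV comp_in_hom[OF t p(1)] comp_in_hom[OF p(2) g]])
    fix v assume v: "v \<in> carrier V"
    have \<phi>v: "\<phi> v \<in> carrier W" by (rule lin_closed[OF \<phi> v])
    note j = copower_inj[OF cV v] copower_inj[OF cW \<phi>v]
    have "(tens_proj C \<Theta> W x' \<xi> \<cdot> tens_arr C \<Theta> V W \<phi> g) \<cdot> tens_inj C \<Theta> V x v =
      tens_proj C \<Theta> W x' \<xi> \<cdot> (tens_inj C \<Theta> W x' (\<phi> v) \<cdot> g)"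
      using comp_assoc[OF j(1) t p(1)] tens_arr_inj[OF \<Theta> V W \<phi> g v] by simp
    also have "\<dots> = (tens_proj C \<Theta> W x' \<xi> \<cdot> tens_inj C \<Theta> W x' (\<phi> v)) \<cdot> g"
      using comp_assoc[OF g j(2) p(1)] by simp
    also have "\<dots> = scale_arr C (\<xi> (\<phi> v)) g"
      using copower_proj_inj[OF cW \<phi>v \<xi>] comp_scale_left[OF g id_in_hom[OF x']] comp_id_left[OF g] by simp
    also have "\<dots> = g \<cdot> (tens_proj C \<Theta> V x (dual_map V \<phi> \<xi>) \<cdot> tens_inj C \<Theta> V x v)"
      using copower_proj_inj[OF cV v d] comp_scale_right[OF id_in_hom[OF x] g] comp_id_right[OF g]
      by (simp add: dual_map_apply v)
    also have "\<dots> = (g \<cdot> tens_proj C \<Theta> V x (dual_map V \<phi> \<xi>)) \<cdot> tens_inj C \<Theta> V x v"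
      using comp_assoc[OF j(1) p(2) g] by simp
    finally show "(tens_proj C \<Theta> W x' \<xi> \<cdot> tens_arr C \<Theta> V W \<phi> g) \<cdot> tens_inj C \<Theta> V x v =
      (g \<cdot> tens_proj C \<Theta> V x (dual_map V \<phi> \<xi>)) \<cdot> tens_inj C \<Theta> V x v" .
  qed
qed


subsection \<open>The right Nakayama functor\<close>

context
  fixes \<Theta> :: "('k, 'm \<Rightarrow> 'k, 'o, 'm) tensoring"
  assumes \<Theta>: "is_tensoring C \<Theta>"
begin

abbreviation (input) "rsp c a \<equiv> dual_space (hom_space C c a)"
abbreviation (input) "rten c a b \<equiv> tens_obj \<Theta> (rsp c a) b"
abbreviation (input) "rinj c a b \<equiv> tens_inj C \<Theta> (rsp c a) b"

lemma rsp_fd: "c \<in> Obj C \<Longrightarrow> a \<in> Obj C \<Longrightarrow> fd_space (rsp c a)"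
  by (intro dual_space_fd hom_fd)

lemmas rcop = tens_copower[OF \<Theta> rsp_fd]

text \<open>Arrows out of a copower are tested on its injections. The dinaturality square at
  \<open>f\<close> from \<open>a\<close> to \<open>b\<close> starts at \<open>rten c b a\<close>,
  and on the injection of \<open>\<xi>\<close> its two sides become the two sides of naturality of
  \<open>\<sigma>\<close> at \<open>f\<close>.\<close>

lemma right_dinat_iff:
  assumes c: "c \<in> Obj C" and d: "d \<in> Obj C" and s: "\<And>a. a \<in> Obj C \<Longrightarrow> s a \<in> Hom C (rten c a a) d"
    and \<sigma>: "\<And>a \<xi>. a \<in> Obj C \<Longrightarrow> \<xi> \<in> carrier (rsp c a) \<Longrightarrow> \<sigma> a \<xi> = s a \<cdot> rinj c a a \<xi>"
  shows "dinatural_from C C (right_nakayama_bifunctor C \<Theta> c) d s \<longleftrightarrow> nak_family C c d \<sigma>"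
proof -
  have lin: "\<sigma> a \<in> linear_maps (rsp c a) (hom_space C a d)" if a: "a \<in> Obj C" for a
    using lin_comp[OF copower_inj_lin[OF rcop[OF c a a]] post_lin[OF s[OF a] a]]
    by (rule lin_cong) (auto simp: \<sigma>[OF a] intro: dual_space_vs hom_vectorspace c a)
  have key: "s a \<cdot> on_arr (right_nakayama_bifunctor C \<Theta> c) (f, Idt C a) =
      s b \<cdot> on_arr (right_nakayama_bifunctor C \<Theta> c) (Idt C b, f) \<longleftrightarrow>
      (\<forall>\<xi>\<in>carrier (rsp c b). \<sigma> a (dual_map (hom_space C c a) (\<lambda>k. f \<cdot> k) \<xi>) = \<sigma> b \<xi> \<cdot> f)"
    if f: "f \<in> Hom C a b" for a b f
  proof -
    note a = hom_dom[OF f] and b = hom_cod[OF f]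
    note ida = id_in_hom[OF a] and idb = id_in_hom[OF b]
    let ?\<phi> = "dual_map (hom_space C c a) (\<lambda>k. f \<cdot> k)" and ?\<psi> = "dual_map (hom_space C c b) (\<lambda>k. Idt C b \<cdot> k)"
    let ?T = "tens_arr C \<Theta> (rsp c b) (rsp c a) ?\<phi> (Idt C a)" and ?S = "tens_arr C \<Theta> (rsp c b) (rsp c b) ?\<psi> f"
    have e: "on_arr (right_nakayama_bifunctor C \<Theta> c) (f, Idt C a) = ?T"
      "on_arr (right_nakayama_bifunctor C \<Theta> c) (Idt C b, f) = ?S"
      using f a b by (auto simp: right_nakayama_bifunctor_def Hom_def)
    have \<phi>: "?\<phi> \<in> linear_maps (rsp c b) (rsp c a)" "?\<psi> \<in> linear_maps (rsp c b) (rsp c b)"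
      using dual_map_lin[OF hom_vectorspace[OF c a] post_lin[OF f c]]
        dual_map_lin[OF hom_vectorspace[OF c b] post_lin[OF idb c]] by auto
    note T = tens_arr_hom[OF \<Theta> rsp_fd[OF c b] rsp_fd[OF c a] \<phi>(1) ida]
      and S = tens_arr_hom[OF \<Theta> rsp_fd[OF c b] rsp_fd[OF c b] \<phi>(2) f]
    note cop = rcop[OF c b a]
    have l: "(s a \<cdot> ?T) \<cdot> rinj c b a \<xi> = \<sigma> a (?\<phi> \<xi>)" if \<xi>: "\<xi> \<in> carrier (rsp c b)" for \<xi>
    proof -
      have p: "?\<phi> \<xi> \<in> carrier (rsp c a)" by (rule lin_closed[OF \<phi>(1) \<xi>])
      show ?thesis
        using comp_assoc[OF copower_inj[OF cop \<xi>] T s[OF a]] comp_id_right[OF copower_inj[OF rcop[OF c a a] p]]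
          tens_arr_inj[OF \<Theta> rsp_fd[OF c b] rsp_fd[OF c a] \<phi>(1) ida \<xi>] \<sigma>[OF a p] by simp
    qed
    have r: "(s b \<cdot> ?S) \<cdot> rinj c b a \<xi> = \<sigma> b \<xi> \<cdot> f" if \<xi>: "\<xi> \<in> carrier (rsp c b)" for \<xi>
    proof -
      have p: "?\<psi> \<xi> = \<xi>" by (rule dual_map_id[OF hom_vectorspace[OF c b] \<xi>]) (simp add: comp_id_left)
      show ?thesis
        using comp_assoc[OF copower_inj[OF cop \<xi>] S s[OF b]] comp_assoc[OF f copower_inj[OF rcop[OF c b b] \<xi>] s[OF b]]
          tens_arr_inj[OF \<Theta> rsp_fd[OF c b] rsp_fd[OF c b] \<phi>(2) f \<xi>] \<sigma>[OF b \<xi>] p by simp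
    qed
    have "s a \<cdot> ?T = s b \<cdot> ?S \<longleftrightarrow>
      (\<forall>\<xi>\<in>carrier (rsp c b). (s a \<cdot> ?T) \<cdot> rinj c b a \<xi> = (s b \<cdot> ?S) \<cdot> rinj c b a \<xi>)"
      using copower_eqI[OF cop comp_in_hom[OF T s[OF a]] comp_in_hom[OF S s[OF b]]] by metis
    then show ?thesis unfolding e using l r by simp
  qed
  have o: "on_obj (right_nakayama_bifunctor C \<Theta> c) (a, a) = rten c a a" for a
    by (simp add: right_nakayama_bifunctor_def)
  show ?thesis
    unfolding dinatural_from_def nak_family_def o using d s lin key by auto
qed

text \<open>By \<open>copower_ex\<close> each natural family comes from arrows \<open>r a\<close>
  out of the copowers, and \<open>fac\<close> shows that an arrow \<open>t\<close> factors the one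
  exactly when it factors the other. So the two universal properties have the same
  solutions.\<close>

lemma right_coend_iff:
  assumes c: "c \<in> Obj C" and n: "n \<in> Obj C" and s: "\<And>a. a \<in> Obj C \<Longrightarrow> s a \<in> Hom C (rten c a a) n"
    and \<kappa>: "\<And>a \<xi>. a \<in> Obj C \<Longrightarrow> \<xi> \<in> carrier (rsp c a) \<Longrightarrow> \<kappa> a \<xi> = s a \<cdot> rinj c a a \<xi>"
  shows "is_coend C C (right_nakayama_bifunctor C \<Theta> c) n s \<longleftrightarrow> nak_univ C c n \<kappa>"
proof -
  let ?F = "right_nakayama_bifunctor C \<Theta> c"
  have fac: "(\<forall>a\<in>Obj C. t \<cdot> s a = r a) \<longleftrightarrow> (\<forall>a\<in>Obj C. \<forall>\<xi>\<in>carrier (rsp c a). t \<cdot> \<kappa> a \<xi> = \<sigma> a \<xi>)"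
    if t: "t \<in> Hom C n d" and r: "\<And>a. a \<in> Obj C \<Longrightarrow> r a \<in> Hom C (rten c a a) d"
      and \<sigma>: "\<And>a \<xi>. a \<in> Obj C \<Longrightarrow> \<xi> \<in> carrier (rsp c a) \<Longrightarrow> \<sigma> a \<xi> = r a \<cdot> rinj c a a \<xi>" for t d r \<sigma>
  proof (intro ball_cong refl)
    fix a assume a: "a \<in> Obj C"
    have "t \<cdot> \<kappa> a \<xi> = (t \<cdot> s a) \<cdot> rinj c a a \<xi>" if "\<xi> \<in> carrier (rsp c a)" for \<xi>
      using comp_assoc[OF copower_inj[OF rcop[OF c a a] that] s[OF a] t] \<kappa>[OF a that] by simp
    then show "t \<cdot> s a = r a \<longleftrightarrow> (\<forall>\<xi>\<in>carrier (rsp c a). t \<cdot> \<kappa> a \<xi> = \<sigma> a \<xi>)"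
      using copower_eqI[OF rcop[OF c a a] comp_in_hom[OF s[OF a] t] r[OF a]] \<sigma>[OF a] by metis
  qed
  show ?thesis
  proof
    assume L: "is_coend C C ?F n s"
    show "nak_univ C c n \<kappa>"
      unfolding nak_univ_def
    proof (intro conjI allI impI)
      show "nak_family C c n \<kappa>" using L right_dinat_iff[OF c n s \<kappa>] by (simp add: is_coend_def)
      fix d \<sigma> assume fam: "nak_family C c d \<sigma>"
      have d: "d \<in> Obj C" using fam by (simp add: nak_family_def)
      have "\<exists>r\<in>Hom C (rten c a a) d. \<forall>\<xi>\<in>carrier (rsp c a). r \<cdot> rinj c a a \<xi> = \<sigma> a \<xi>" if a: "a \<in> Obj C" for a
        using fam a by (intro copower_ex[OF rcop[OF c a a] d]) (simp add: nak_family_def)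
      then obtain r where r: "\<And>a. a \<in> Obj C \<Longrightarrow> r a \<in> Hom C (rten c a a) d"
        and r\<sigma>: "\<And>a \<xi>. a \<in> Obj C \<Longrightarrow> \<xi> \<in> carrier (rsp c a) \<Longrightarrow> \<sigma> a \<xi> = r a \<cdot> rinj c a a \<xi>"
        by metis
      have "dinatural_from C C ?F d r" using right_dinat_iff[OF c d r r\<sigma>] fam by simp
      then have "\<exists>!t. t \<in> Hom C n d \<and> (\<forall>a\<in>Obj C. t \<cdot> s a = r a)" using L by (simp add: is_coend_def)
      then show "\<exists>!t. t \<in> Hom C n d \<and> (\<forall>a\<in>Obj C. \<forall>\<xi>\<in>carrier (rsp c a). t \<cdot> \<kappa> a \<xi> = \<sigma> a \<xi>)"
        using fac[OF _ r r\<sigma>] by (metis (no_types, lifting))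
    qed
  next
    assume R: "nak_univ C c n \<kappa>"
    show "is_coend C C ?F n s"
      unfolding is_coend_def
    proof (intro conjI allI impI)
      show "is_functor (prod_cat (op_cat C) C) C ?F" by (rule right_nak_functor[OF \<Theta> c])
      show "dinatural_from C C ?F n s" using R right_dinat_iff[OF c n s \<kappa>] by (simp add: nak_univ_def)
      fix d r assume D: "dinatural_from C C ?F d r"
      have d: "d \<in> Obj C" and r: "\<And>a. a \<in> Obj C \<Longrightarrow> r a \<in> Hom C (rten c a a) d"
        using D by (auto simp: dinatural_from_def right_nakayama_bifunctor_def)
      let ?\<sigma> = "\<lambda>a \<xi>. r a \<cdot> rinj c a a \<xi>"
      have "nak_family C c d ?\<sigma>" using right_dinat_iff[OF c d r refl] D by simp
      then have "\<exists>!t. t \<in> Hom C n d \<and> (\<forall>a\<in>Obj C. \<forall>\<xi>\<in>carrier (rsp c a). t \<cdot> \<kappa> a \<xi> = ?\<sigma> a \<xi>)"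
        using R by (simp add: nak_univ_def)
      then show "\<exists>!t. t \<in> Hom C n d \<and> (\<forall>a\<in>Obj C. t \<cdot> s a = r a)"
        using fac[OF _ r refl] by (metis (no_types, lifting))
    qed
  qed
qed

lemma right_compat_iff:
  assumes f: "f \<in> Hom C c c'" and a: "a \<in> Obj C"
    and s: "s \<in> Hom C (rten c a a) n" and s': "s' \<in> Hom C (rten c' a a) n'" and t: "t \<in> Hom C n n'"
    and \<kappa>: "\<And>\<xi>. \<xi> \<in> carrier (rsp c a) \<Longrightarrow> \<kappa> \<xi> = s \<cdot> rinj c a a \<xi>"
    and \<kappa>': "\<And>\<xi>. \<xi> \<in> carrier (rsp c' a) \<Longrightarrow> \<kappa>' \<xi> = s' \<cdot> rinj c' a a \<xi>"
  shows "t \<cdot> s = s' \<cdot> tens_arr C \<Theta> (rsp c a) (rsp c' a) (dual_map (hom_space C c' a) (\<lambda>h. h \<cdot> f)) (Idt C a) \<longleftrightarrow>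
    (\<forall>\<xi>\<in>carrier (rsp c a). t \<cdot> \<kappa> \<xi> = \<kappa>' (dual_map (hom_space C c' a) (\<lambda>h. h \<cdot> f) \<xi>))"
proof -
  note c = hom_dom[OF f] and c' = hom_cod[OF f] and ida = id_in_hom[OF a]
  let ?\<phi> = "dual_map (hom_space C c' a) (\<lambda>h. h \<cdot> f)"
  let ?T = "tens_arr C \<Theta> (rsp c a) (rsp c' a) ?\<phi> (Idt C a)"
  have \<phi>: "?\<phi> \<in> linear_maps (rsp c a) (rsp c' a)"
    by (rule dual_map_lin[OF hom_vectorspace[OF c' a] pre_lin[OF f a]])
  note T = tens_arr_hom[OF \<Theta> rsp_fd[OF c a] rsp_fd[OF c' a] \<phi> ida] and cop = rcop[OF c a a]
  have l: "(t \<cdot> s) \<cdot> rinj c a a \<xi> = t \<cdot> \<kappa> \<xi>" if \<xi>: "\<xi> \<in> carrier (rsp c a)" for \<xi>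
    using comp_assoc[OF copower_inj[OF cop \<xi>] s t] \<kappa>[OF \<xi>] by simp
  have r: "(s' \<cdot> ?T) \<cdot> rinj c a a \<xi> = \<kappa>' (?\<phi> \<xi>)" if \<xi>: "\<xi> \<in> carrier (rsp c a)" for \<xi>
  proof -
    have p: "?\<phi> \<xi> \<in> carrier (rsp c' a)" by (rule lin_closed[OF \<phi> \<xi>])
    show ?thesis
      using comp_assoc[OF copower_inj[OF cop \<xi>] T s'] comp_id_right[OF copower_inj[OF rcop[OF c' a a] p]]
        tens_arr_inj[OF \<Theta> rsp_fd[OF c a] rsp_fd[OF c' a] \<phi> ida \<xi>] \<kappa>'[OF p] by simp
  qed
  have "t \<cdot> s = s' \<cdot> ?T \<longleftrightarrow>
    (\<forall>\<xi>\<in>carrier (rsp c a). (t \<cdot> s) \<cdot> rinj c a a \<xi> = (s' \<cdot> ?T) \<cdot> rinj c a a \<xi>)"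
    using copower_eqI[OF cop comp_in_hom[OF s t] comp_in_hom[OF T s']] by metis
  then show ?thesis using l r by simp
qed

text \<open>The tensoring is arbitrary here, so the existence of a right Nakayama functor splits
  into the existence of some tensoring and that of universal families.\<close>

lemma nakayama_imp_right:
  assumes N: "nakayama C N"
  shows "right_nakayama C N"
proof -
  have F: "is_functor C C N" using N by (simp add: nakayama_def)
  interpret N: is_functor C C N by (rule F)
  obtain \<kappa> where \<kappa>: "\<And>c. c \<in> Obj C \<Longrightarrow> nak_univ C c (on_obj N c) (\<kappa> c)"
    and \<kappa>N: "\<And>c c' f a \<xi>. f \<in> Hom C c c' \<Longrightarrow> a \<in> Obj C \<Longrightarrow> \<xi> \<in> carrier (rsp c a) \<Longrightarrow>
        on_arr N f \<cdot> \<kappa> c a \<xi> = \<kappa> c' a (dual_map (hom_space C c' a) (\<lambda>k. k \<cdot> f) \<xi>)"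
    using N hom_dom hom_cod unfolding nakayama_def by metis
  have "\<exists>s\<in>Hom C (rten c a a) (on_obj N c). \<forall>\<xi>\<in>carrier (rsp c a). s \<cdot> rinj c a a \<xi> = \<kappa> c a \<xi>"
    if c: "c \<in> Obj C" and a: "a \<in> Obj C" for c a
    using \<kappa>[OF c] a by (intro copower_ex[OF rcop[OF c a a] N.obj_map[OF c]]) (simp add: nak_univ_def nak_family_def)
  then obtain s where s: "\<And>c a. c \<in> Obj C \<Longrightarrow> a \<in> Obj C \<Longrightarrow> s c a \<in> Hom C (rten c a a) (on_obj N c)"
    and s\<kappa>: "\<And>c a \<xi>. c \<in> Obj C \<Longrightarrow> a \<in> Obj C \<Longrightarrow> \<xi> \<in> carrier (rsp c a) \<Longrightarrow> \<kappa> c a \<xi> = s c a \<cdot> rinj c a a \<xi>"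
    by metis
  have "is_coend C C (right_nakayama_bifunctor C \<Theta> c) (on_obj N c) (s c)" if c: "c \<in> Obj C" for c
    using right_coend_iff[OF c N.obj_map[OF c] s[OF c] s\<kappa>[OF c]] \<kappa>[OF c] by simp
  moreover have "on_arr N f \<cdot> s c a =
      s c' a \<cdot> tens_arr C \<Theta> (rsp c a) (rsp c' a) (dual_map (hom_space C c' a) (\<lambda>h. h \<cdot> f)) (Idt C a)"
    if f: "f \<in> Hom C c c'" and a: "a \<in> Obj C" for c c' f a
    using right_compat_iff[OF f a s[OF hom_dom[OF f] a] s[OF hom_cod[OF f] a] N.arr_map[OF f]
        s\<kappa>[OF hom_dom[OF f] a] s\<kappa>[OF hom_cod[OF f] a]] \<kappa>N[OF f a] by blast
  ultimately show ?thesis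
    unfolding right_nakayama_def using F \<Theta> by blast
qed

end

lemma right_imp_nakayama:
  assumes N: "right_nakayama C N"
  shows "nakayama C N"
proof -
  have F: "is_functor C C N" using N by (simp add: right_nakayama_def)
  interpret N: is_functor C C N by (rule F)
  obtain \<Theta> :: "('k, 'm \<Rightarrow> 'k, 'o, 'm) tensoring" and s where \<Theta>: "is_tensoring C \<Theta>"
    and co: "\<And>c. c \<in> Obj C \<Longrightarrow> is_coend C C (right_nakayama_bifunctor C \<Theta> c) (on_obj N c) (s c)"
    and co': "\<And>c c' f a. f \<in> Hom C c c' \<Longrightarrow> a \<in> Obj C \<Longrightarrow> on_arr N f \<cdot> s c a = s c' a \<cdot> tens_arr C \<Theta>
          (dual_space (hom_space C c a)) (dual_space (hom_space C c' a))
          (dual_map (hom_space C c' a) (\<lambda>h. h \<cdot> f)) (Idt C a)"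
    using N hom_dom hom_cod unfolding right_nakayama_def by metis
  have s: "s c a \<in> Hom C (tens_obj \<Theta> (dual_space (hom_space C c a)) a) (on_obj N c)"
    if "c \<in> Obj C" "a \<in> Obj C" for c a
    using co[OF that(1)] that(2) by (auto simp: is_coend_def dinatural_from_def right_nakayama_bifunctor_def)
  let ?\<kappa> = "\<lambda>c a \<xi>. s c a \<cdot> tens_inj C \<Theta> (dual_space (hom_space C c a)) a \<xi>"
  have "nak_univ C c (on_obj N c) (?\<kappa> c)" if c: "c \<in> Obj C" for c
    using right_coend_iff[OF \<Theta> c N.obj_map[OF c] s[OF c] refl] co[OF c] by simp
  moreover have "on_arr N f \<cdot> ?\<kappa> c a \<xi> = ?\<kappa> c' a (dual_map (hom_space C c' a) (\<lambda>k. k \<cdot> f) \<xi>)"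
    if f: "f \<in> Hom C c c'" and a: "a \<in> Obj C" and \<xi>: "\<xi> \<in> carrier (dual_space (hom_space C c a))" for c c' f a \<xi>
    using right_compat_iff[OF \<Theta> f a s[OF hom_dom[OF f] a] s[OF hom_cod[OF f] a] N.arr_map[OF f] refl refl]
      co'[OF f a] \<xi> by blast
  ultimately show ?thesis
    unfolding nakayama_def using F by (intro conjI exI[of _ ?\<kappa>]) auto
qed


subsection \<open>The left Nakayama functor\<close>

context
  fixes \<Theta> :: "('k, 'm, 'o, 'm) tensoring"
  assumes \<Theta>: "is_tensoring C \<Theta>"
begin

abbreviation (input) "lten c a b \<equiv> tens_obj \<Theta> (hom_space C a c) b"
abbreviation (input) "lproj c a b \<equiv> tens_proj C \<Theta> (hom_space C a c) b"
abbreviation (input) "lsp c a \<equiv> dual_space (hom_space C a c)"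

lemmas lcop = tens_copower[OF \<Theta> hom_fd]

text \<open>The power structure takes over from the copower structure: arrows into
  \<open>lten c a a\<close> are tested on the projections, which are indexed by functionals on
  \<open>Hom(a, c)\<close>. In the opposite category that Hom-space runs from \<open>c\<close> to
  \<open>a\<close>, so \<open>nak_family\<close> has the right shape.\<close>

lemma left_dinat_iff:
  assumes c: "c \<in> Obj C" and d: "d \<in> Obj C" and s: "\<And>a. a \<in> Obj C \<Longrightarrow> s a \<in> Hom C d (lten c a a)"
    and \<sigma>: "\<And>a \<xi>. a \<in> Obj C \<Longrightarrow> \<xi> \<in> carrier (lsp c a) \<Longrightarrow> \<sigma> a \<xi> = lproj c a a \<xi> \<cdot> s a"
  shows "dinatural_to C C (left_nakayama_bifunctor C \<Theta> c) d s \<longleftrightarrow> nak_family (op_lin C) c d \<sigma>"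
proof -
  have lin: "\<sigma> a \<in> linear_maps (lsp c a) (hom_space C d a)" if a: "a \<in> Obj C" for a
    using lin_comp[OF copower_proj_lin[OF lcop[OF a c a]] pre_lin[OF s[OF a] a]]
    by (rule lin_cong) (auto simp: \<sigma>[OF a] intro: dual_space_vs hom_vectorspace c a)
  have key: "on_arr (left_nakayama_bifunctor C \<Theta> c) (Idt C a, f) \<cdot> s a =
      on_arr (left_nakayama_bifunctor C \<Theta> c) (f, Idt C b) \<cdot> s b \<longleftrightarrow>
      (\<forall>\<xi>\<in>carrier (lsp c a). f \<cdot> \<sigma> a \<xi> = \<sigma> b (dual_map (hom_space C b c) (\<lambda>k. k \<cdot> f) \<xi>))"
    if f: "f \<in> Hom C a b" for a b f
  proof -
    note a = hom_dom[OF f] and b = hom_cod[OF f]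
    note ida = id_in_hom[OF a] and idb = id_in_hom[OF b]
    note fda = hom_fd[OF a c] and fdb = hom_fd[OF b c]
    let ?T = "tens_arr C \<Theta> (hom_space C a c) (hom_space C a c) (\<lambda>h. h \<cdot> Idt C a) f"
      and ?S = "tens_arr C \<Theta> (hom_space C b c) (hom_space C a c) (\<lambda>h. h \<cdot> f) (Idt C b)"
    have e: "on_arr (left_nakayama_bifunctor C \<Theta> c) (Idt C a, f) = ?T"
      "on_arr (left_nakayama_bifunctor C \<Theta> c) (f, Idt C b) = ?S"
      using f a b by (auto simp: left_nakayama_bifunctor_def Hom_def)
    note \<phi> = pre_lin[OF ida c] pre_lin[OF f c]
    note T = tens_arr_hom[OF \<Theta> fda fda \<phi>(1) f] and S = tens_arr_hom[OF \<Theta> fdb fda \<phi>(2) idb]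
    note cop = lcop[OF a c b]
    have l: "lproj c a b \<xi> \<cdot> (?T \<cdot> s a) = f \<cdot> \<sigma> a \<xi>" if \<xi>: "\<xi> \<in> carrier (lsp c a)" for \<xi>
    proof -
      have p: "dual_map (hom_space C a c) (\<lambda>h. h \<cdot> Idt C a) \<xi> = \<xi>"
        by (rule dual_map_id[OF hom_vectorspace[OF a c] \<xi>]) (simp add: comp_id_right)
      show ?thesis
        using comp_assoc[OF s[OF a] T copower_proj[OF cop \<xi>]] comp_assoc[OF s[OF a] copower_proj[OF lcop[OF a c a] \<xi>] f]
          tens_proj_arr[OF \<Theta> fda fda \<phi>(1) f \<xi>] \<sigma>[OF a \<xi>] p by simp
    qed
    have r: "lproj c a b \<xi> \<cdot> (?S \<cdot> s b) = \<sigma> b (dual_map (hom_space C b c) (\<lambda>k. k \<cdot> f) \<xi>)"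
      if \<xi>: "\<xi> \<in> carrier (lsp c a)" for \<xi>
    proof -
      have p: "dual_map (hom_space C b c) (\<lambda>k. k \<cdot> f) \<xi> \<in> carrier (lsp c b)"
        by (rule dual_map_closed[OF hom_vectorspace[OF b c] \<phi>(2) \<xi>])
      show ?thesis
        using comp_assoc[OF s[OF b] S copower_proj[OF cop \<xi>]] comp_id_left[OF copower_proj[OF lcop[OF b c b] p]]
          tens_proj_arr[OF \<Theta> fdb fda \<phi>(2) idb \<xi>] \<sigma>[OF b p] by simp
    qed
    have "?T \<cdot> s a = ?S \<cdot> s b \<longleftrightarrow>
      (\<forall>\<xi>\<in>carrier (lsp c a). lproj c a b \<xi> \<cdot> (?T \<cdot> s a) = lproj c a b \<xi> \<cdot> (?S \<cdot> s b))"
      using power_eqI[OF cop comp_in_hom[OF s[OF a] T] comp_in_hom[OF s[OF b] S]] by metis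
    then show ?thesis unfolding e using l r by simp
  qed
  have o: "on_obj (left_nakayama_bifunctor C \<Theta> c) (a, a) = lten c a a" for a
    by (simp add: left_nakayama_bifunctor_def)
  show ?thesis
    unfolding dinatural_to_def nak_family_def o using d s lin key by auto
qed

lemma left_end_iff:
  assumes c: "c \<in> Obj C" and n: "n \<in> Obj C" and s: "\<And>a. a \<in> Obj C \<Longrightarrow> s a \<in> Hom C n (lten c a a)"
    and \<kappa>: "\<And>a \<xi>. a \<in> Obj C \<Longrightarrow> \<xi> \<in> carrier (lsp c a) \<Longrightarrow> \<kappa> a \<xi> = lproj c a a \<xi> \<cdot> s a"
  shows "is_end C C (left_nakayama_bifunctor C \<Theta> c) n s \<longleftrightarrow> nak_univ (op_lin C) c n \<kappa>"
proof -
  let ?F = "left_nakayama_bifunctor C \<Theta> c"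
  have fac: "(\<forall>a\<in>Obj C. s a \<cdot> t = r a) \<longleftrightarrow> (\<forall>a\<in>Obj C. \<forall>\<xi>\<in>carrier (lsp c a). \<kappa> a \<xi> \<cdot> t = \<sigma> a \<xi>)"
    if t: "t \<in> Hom C d n" and r: "\<And>a. a \<in> Obj C \<Longrightarrow> r a \<in> Hom C d (lten c a a)"
      and \<sigma>: "\<And>a \<xi>. a \<in> Obj C \<Longrightarrow> \<xi> \<in> carrier (lsp c a) \<Longrightarrow> \<sigma> a \<xi> = lproj c a a \<xi> \<cdot> r a" for t d r \<sigma>
  proof (intro ball_cong refl)
    fix a assume a: "a \<in> Obj C"
    have "\<kappa> a \<xi> \<cdot> t = lproj c a a \<xi> \<cdot> (s a \<cdot> t)" if "\<xi> \<in> carrier (lsp c a)" for \<xi>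
      using comp_assoc[OF t s[OF a] copower_proj[OF lcop[OF a c a] that]] \<kappa>[OF a that] by simp
    then show "s a \<cdot> t = r a \<longleftrightarrow> (\<forall>\<xi>\<in>carrier (lsp c a). \<kappa> a \<xi> \<cdot> t = \<sigma> a \<xi>)"
      using power_eqI[OF lcop[OF a c a] comp_in_hom[OF t s[OF a]] r[OF a]] \<sigma>[OF a] by metis
  qed
  show ?thesis
  proof
    assume L: "is_end C C ?F n s"
    show "nak_univ (op_lin C) c n \<kappa>"
      unfolding nak_univ_def op_lin_simps Hom_op_lin hom_space_op_lin
    proof (intro conjI allI impI)
      show "nak_family (op_lin C) c n \<kappa>" using L left_dinat_iff[OF c n s \<kappa>] by (simp add: is_end_def)
      fix d \<sigma> assume fam: "nak_family (op_lin C) c d \<sigma>"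
      have d: "d \<in> Obj C" using fam by (simp add: nak_family_def)
      have "\<exists>r\<in>Hom C d (lten c a a). \<forall>\<xi>\<in>carrier (lsp c a). lproj c a a \<xi> \<cdot> r = \<sigma> a \<xi>" if a: "a \<in> Obj C" for a
        using fam a by (intro power_ex[OF lcop[OF a c a] d]) (simp add: nak_family_def)
      then obtain r where r: "\<And>a. a \<in> Obj C \<Longrightarrow> r a \<in> Hom C d (lten c a a)"
        and r\<sigma>: "\<And>a \<xi>. a \<in> Obj C \<Longrightarrow> \<xi> \<in> carrier (lsp c a) \<Longrightarrow> \<sigma> a \<xi> = lproj c a a \<xi> \<cdot> r a"
        by metis
      have "dinatural_to C C ?F d r" using left_dinat_iff[OF c d r r\<sigma>] fam by simp
      then have "\<exists>!t. t \<in> Hom C d n \<and> (\<forall>a\<in>Obj C. s a \<cdot> t = r a)" using L by (simp add: is_end_def)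
      then show "\<exists>!t. t \<in> Hom C d n \<and> (\<forall>a\<in>Obj C. \<forall>\<xi>\<in>carrier (lsp c a). \<kappa> a \<xi> \<cdot> t = \<sigma> a \<xi>)"
        using fac[OF _ r r\<sigma>] by (metis (no_types, lifting))
    qed
  next
    assume R: "nak_univ (op_lin C) c n \<kappa>"
    show "is_end C C ?F n s"
      unfolding is_end_def
    proof (intro conjI allI impI)
      show "is_functor (prod_cat (op_cat C) C) C ?F" by (rule left_nak_functor[OF \<Theta> c])
      show "dinatural_to C C ?F n s" using R left_dinat_iff[OF c n s \<kappa>] by (simp add: nak_univ_def)
      fix d r assume D: "dinatural_to C C ?F d r"
      have d: "d \<in> Obj C" and r: "\<And>a. a \<in> Obj C \<Longrightarrow> r a \<in> Hom C d (lten c a a)"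
        using D by (auto simp: dinatural_to_def left_nakayama_bifunctor_def)
      let ?\<sigma> = "\<lambda>a \<xi>. lproj c a a \<xi> \<cdot> r a"
      have "nak_family (op_lin C) c d ?\<sigma>" using left_dinat_iff[OF c d r refl] D by simp
      then have "\<exists>!t. t \<in> Hom C d n \<and> (\<forall>a\<in>Obj C. \<forall>\<xi>\<in>carrier (lsp c a). \<kappa> a \<xi> \<cdot> t = ?\<sigma> a \<xi>)"
        using R by (simp add: nak_univ_def)
      then show "\<exists>!t. t \<in> Hom C d n \<and> (\<forall>a\<in>Obj C. s a \<cdot> t = r a)"
        using fac[OF _ r refl] by (metis (no_types, lifting))
    qed
  qed
qed

lemma left_compat_iff:
  assumes f: "f \<in> Hom C c c'" and a: "a \<in> Obj C"
    and s: "s \<in> Hom C n (lten c a a)" and s': "s' \<in> Hom C n' (lten c' a a)" and t: "t \<in> Hom C n n'"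
    and \<kappa>: "\<And>\<xi>. \<xi> \<in> carrier (lsp c a) \<Longrightarrow> \<kappa> \<xi> = lproj c a a \<xi> \<cdot> s"
    and \<kappa>': "\<And>\<xi>. \<xi> \<in> carrier (lsp c' a) \<Longrightarrow> \<kappa>' \<xi> = lproj c' a a \<xi> \<cdot> s'"
  shows "s' \<cdot> t = tens_arr C \<Theta> (hom_space C a c) (hom_space C a c') (\<lambda>h. f \<cdot> h) (Idt C a) \<cdot> s \<longleftrightarrow>
    (\<forall>\<xi>\<in>carrier (lsp c' a). \<kappa>' \<xi> \<cdot> t = \<kappa> (dual_map (hom_space C a c) (\<lambda>h. f \<cdot> h) \<xi>))"
proof -
  note c = hom_dom[OF f] and c' = hom_cod[OF f] and ida = id_in_hom[OF a]
  let ?T = "tens_arr C \<Theta> (hom_space C a c) (hom_space C a c') (\<lambda>h. f \<cdot> h) (Idt C a)"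
  note \<phi> = post_lin[OF f a]
  note T = tens_arr_hom[OF \<Theta> hom_fd[OF a c] hom_fd[OF a c'] \<phi> ida] and cop = lcop[OF a c' a]
  have l: "lproj c' a a \<xi> \<cdot> (s' \<cdot> t) = \<kappa>' \<xi> \<cdot> t" if \<xi>: "\<xi> \<in> carrier (lsp c' a)" for \<xi>
    using comp_assoc[OF t s' copower_proj[OF cop \<xi>]] \<kappa>'[OF \<xi>] by simp
  have r: "lproj c' a a \<xi> \<cdot> (?T \<cdot> s) = \<kappa> (dual_map (hom_space C a c) (\<lambda>h. f \<cdot> h) \<xi>)"
    if \<xi>: "\<xi> \<in> carrier (lsp c' a)" for \<xi>
  proof -
    have p: "dual_map (hom_space C a c) (\<lambda>h. f \<cdot> h) \<xi> \<in> carrier (lsp c a)"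
      by (rule dual_map_closed[OF hom_vectorspace[OF a c] \<phi> \<xi>])
    show ?thesis
      using comp_assoc[OF s T copower_proj[OF cop \<xi>]] comp_id_left[OF copower_proj[OF lcop[OF a c a] p]]
        tens_proj_arr[OF \<Theta> hom_fd[OF a c] hom_fd[OF a c'] \<phi> ida \<xi>] \<kappa>[OF p] by simp
  qed
  have "s' \<cdot> t = ?T \<cdot> s \<longleftrightarrow>
    (\<forall>\<xi>\<in>carrier (lsp c' a). lproj c' a a \<xi> \<cdot> (s' \<cdot> t) = lproj c' a a \<xi> \<cdot> (?T \<cdot> s))"
    using power_eqI[OF cop comp_in_hom[OF t s'] comp_in_hom[OF s T]] by metis
  then show ?thesis using l r by simp
qed

lemma nakayama_op_imp_left:
  assumes N: "nakayama (op_lin C) N" and F: "is_functor C C N"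
  shows "left_nakayama C N"
proof -
  interpret N: is_functor C C N by (rule F)
  obtain \<kappa> where \<kappa>: "\<And>c. c \<in> Obj C \<Longrightarrow> nak_univ (op_lin C) c (on_obj N c) (\<kappa> c)"
    and \<kappa>N: "\<And>c c' f a \<xi>. f \<in> Hom C c c' \<Longrightarrow> a \<in> Obj C \<Longrightarrow> \<xi> \<in> carrier (lsp c' a) \<Longrightarrow>
        \<kappa> c' a \<xi> \<cdot> on_arr N f = \<kappa> c a (dual_map (hom_space C a c) (\<lambda>k. f \<cdot> k) \<xi>)"
    using N hom_dom hom_cod unfolding nakayama_def op_lin_simps Hom_op_lin hom_space_op_lin by metis
  have "\<exists>s\<in>Hom C (on_obj N c) (lten c a a). \<forall>\<xi>\<in>carrier (lsp c a). lproj c a a \<xi> \<cdot> s = \<kappa> c a \<xi>"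
    if c: "c \<in> Obj C" and a: "a \<in> Obj C" for c a
    using \<kappa>[OF c] a by (intro power_ex[OF lcop[OF a c a] N.obj_map[OF c]]) (simp add: nak_univ_def nak_family_def)
  then obtain s where s: "\<And>c a. c \<in> Obj C \<Longrightarrow> a \<in> Obj C \<Longrightarrow> s c a \<in> Hom C (on_obj N c) (lten c a a)"
    and s\<kappa>: "\<And>c a \<xi>. c \<in> Obj C \<Longrightarrow> a \<in> Obj C \<Longrightarrow> \<xi> \<in> carrier (lsp c a) \<Longrightarrow> \<kappa> c a \<xi> = lproj c a a \<xi> \<cdot> s c a"
    by metis
  have "is_end C C (left_nakayama_bifunctor C \<Theta> c) (on_obj N c) (s c)" if c: "c \<in> Obj C" for c
    using left_end_iff[OF c N.obj_map[OF c] s[OF c] s\<kappa>[OF c]] \<kappa>[OF c] by simp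
  moreover have "s c' a \<cdot> on_arr N f =
      tens_arr C \<Theta> (hom_space C a c) (hom_space C a c') (\<lambda>h. f \<cdot> h) (Idt C a) \<cdot> s c a"
    if f: "f \<in> Hom C c c'" and a: "a \<in> Obj C" for c c' f a
    using left_compat_iff[OF f a s[OF hom_dom[OF f] a] s[OF hom_cod[OF f] a] N.arr_map[OF f]
        s\<kappa>[OF hom_dom[OF f] a] s\<kappa>[OF hom_cod[OF f] a]] \<kappa>N[OF f a] by blast
  ultimately show ?thesis
    unfolding left_nakayama_def using F \<Theta> by blast
qed

end

lemma left_imp_nakayama_op:
  assumes N: "left_nakayama C N"
  shows "nakayama (op_lin C) N"
proof -
  have F: "is_functor C C N" using N by (simp add: left_nakayama_def)
  interpret N: is_functor C C N by (rule F)
  obtain \<Theta> :: "('k, 'm, 'o, 'm) tensoring" and s where \<Theta>: "is_tensoring C \<Theta>"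
    and en: "\<And>c. c \<in> Obj C \<Longrightarrow> is_end C C (left_nakayama_bifunctor C \<Theta> c) (on_obj N c) (s c)"
    and en': "\<And>c c' f a. f \<in> Hom C c c' \<Longrightarrow> a \<in> Obj C \<Longrightarrow> s c' a \<cdot> on_arr N f =
        tens_arr C \<Theta> (hom_space C a c) (hom_space C a c') (\<lambda>h. f \<cdot> h) (Idt C a) \<cdot> s c a"
    using N hom_dom hom_cod unfolding left_nakayama_def by metis
  have s: "s c a \<in> Hom C (on_obj N c) (tens_obj \<Theta> (hom_space C a c) a)"
    if "c \<in> Obj C" "a \<in> Obj C" for c a
    using en[OF that(1)] that(2) by (auto simp: is_end_def dinatural_to_def left_nakayama_bifunctor_def)
  let ?\<kappa> = "\<lambda>c a \<xi>. tens_proj C \<Theta> (hom_space C a c) a \<xi> \<cdot> s c a"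
  have "nak_univ (op_lin C) c (on_obj N c) (?\<kappa> c)" if c: "c \<in> Obj C" for c
    using left_end_iff[OF \<Theta> c N.obj_map[OF c] s[OF c] refl] en[OF c] by simp
  moreover have "?\<kappa> c' a \<xi> \<cdot> on_arr N f = ?\<kappa> c a (dual_map (hom_space C a c) (\<lambda>k. f \<cdot> k) \<xi>)"
    if f: "f \<in> Hom C c c'" and a: "a \<in> Obj C" and \<xi>: "\<xi> \<in> carrier (dual_space (hom_space C a c'))" for c c' f a \<xi>
    using left_compat_iff[OF \<Theta> f a s[OF hom_dom[OF f] a] s[OF hom_cod[OF f] a] N.arr_map[OF f] refl refl]
      en'[OF f a] \<xi> by blast
  ultimately show ?thesis
    unfolding nakayama_def using op_lin_functor[OF F] by (intro conjI exI[of _ ?\<kappa>]) auto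
qed

end


section \<open>Monoidal categories and duals\<close>

text \<open>Simplification normalises composites to the right; this lemma applies an equation
  between arrows at the head of such a chain.\<close>

lemma (in category) comp_reassoc:
  assumes "g \<cdot> f = h" "f \<in> Arr C" "g \<in> Arr C" "Cod C f = Dom C g" "k \<in> Arr C" "Cod C k = Dom C f"
  shows "g \<cdot> (f \<cdot> k) = h \<cdot> k"
  using comp_ass[of k f g] assms by simp

text \<open>\<open>ldual_arr\<close> and \<open>rdual_arr\<close> are defined as sixfold composites
  nested to the left; this renests them in one step.\<close>

lemma (in category) comp_ass6:
  "g1 \<in> Arr C \<Longrightarrow> g2 \<in> Arr C \<Longrightarrow> g3 \<in> Arr C \<Longrightarrow> g4 \<in> Arr C \<Longrightarrow> g5 \<in> Arr C \<Longrightarrow> g6 \<in> Arr C \<Longrightarrow>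
    Cod C g1 = Dom C g2 \<Longrightarrow> Cod C g2 = Dom C g3 \<Longrightarrow> Cod C g3 = Dom C g4 \<Longrightarrow> Cod C g4 = Dom C g5 \<Longrightarrow>
    Cod C g5 = Dom C g6 \<Longrightarrow>
    ((((g6 \<cdot> g5) \<cdot> g4) \<cdot> g3) \<cdot> g2) \<cdot> g1 = g6 \<cdot> (g5 \<cdot> (g4 \<cdot> (g3 \<cdot> (g2 \<cdot> g1))))"
  by simp

lemma (in category) inv_simps:
  assumes "iso_arrow C u" "u \<in> Arr C"
  shows "inv_arrow C u \<in> Arr C" "Dom C (inv_arrow C u) = Cod C u" "Cod C (inv_arrow C u) = Dom C u"
    "inv_arrow C u \<cdot> u = Idt C (Dom C u)" "u \<cdot> inv_arrow C u = Idt C (Cod C u)"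
    "f \<in> Arr C \<Longrightarrow> Cod C f = Dom C u \<Longrightarrow> inv_arrow C u \<cdot> (u \<cdot> f) = f"
    "g \<in> Arr C \<Longrightarrow> Cod C g = Cod C u \<Longrightarrow> u \<cdot> (inv_arrow C u \<cdot> g) = g"
proof -
  have u: "u \<in> Hom C (Dom C u) (Cod C u)" using assms by (simp add: Hom_def)
  note i = inv_arrow[OF u assms(1)]
  show 1: "inv_arrow C u \<in> Arr C" "Dom C (inv_arrow C u) = Cod C u" "Cod C (inv_arrow C u) = Dom C u"
    using i(1) by (auto simp: Hom_def)
  show 2: "inv_arrow C u \<cdot> u = Idt C (Dom C u)" "u \<cdot> inv_arrow C u = Idt C (Cod C u)" using i by auto
  show "inv_arrow C u \<cdot> (u \<cdot> f) = f" if "f \<in> Arr C" "Cod C f = Dom C u"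
    using that 1 assms by (subst comp_reassoc[OF 2(1)]) auto
  show "u \<cdot> (inv_arrow C u \<cdot> g) = g" if "g \<in> Arr C" "Cod C g = Cod C u"
    using that 1 assms by (subst comp_reassoc[OF 2(2)]) auto
qed

lemma (in category) iso_cancel_right:
  assumes "iso_arrow C u" "u \<in> Arr C" "f \<in> Arr C" "g \<in> Arr C" "Dom C f = Cod C u" "Dom C g = Cod C u"
    "f \<cdot> u = g \<cdot> u"
  shows "f = g"
proof -
  note i = inv_simps[OF assms(1,2)]
  have "f = (f \<cdot> u) \<cdot> inv_arrow C u" using assms(2-6) i(1-5) by simp
  also have "\<dots> = g" unfolding assms(7) using assms(2-6) i(1-5) by simp
  finally show ?thesis .
qed

lemma (in category) iso_cancel_left:
  assumes "iso_arrow C u" "u \<in> Arr C" "f \<in> Arr C" "g \<in> Arr C" "Cod C f = Dom C u" "Cod C g = Dom C u"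
    "u \<cdot> f = u \<cdot> g"
  shows "f = g"
proof -
  note i = inv_simps[OF assms(1,2)]
  have "f = inv_arrow C u \<cdot> (u \<cdot> f)" using assms(3,5) i(6) by simp
  also have "\<dots> = g" unfolding assms(7) using assms(4,6) i(6) by simp
  finally show ?thesis .
qed

context linear_monoidal_category
begin

abbreviation "\<alpha> \<equiv> assoc A"
abbreviation "\<alpha>i a b c \<equiv> inv_arrow A (assoc A a b c)"
abbreviation "lu \<equiv> lunit A"
abbreviation "lui a \<equiv> inv_arrow A (lunit A a)"
abbreviation "ru \<equiv> runit A"
abbreviation "rui a \<equiv> inv_arrow A (runit A a)"
abbreviation "idt \<equiv> Idt A"

lemma unit_obj' [simp]: "\<I> \<in> Obj A" by (rule unit_obj)

lemma tensor_obj_closed [simp]: "a \<in> Obj A \<Longrightarrow> b \<in> Obj A \<Longrightarrow> a \<otimes>\<^sub>o b \<in> Obj A"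
  using is_functor.obj_map[OF tensor_functor, of "(a, b)"] by (simp add: prod_cat_def)

lemma tensor_arr_arr [simp]:
  assumes "f \<in> Arr A" "g \<in> Arr A"
  shows "f \<otimes>\<^sub>a g \<in> Arr A" "Dom A (f \<otimes>\<^sub>a g) = Dom A f \<otimes>\<^sub>o Dom A g" "Cod A (f \<otimes>\<^sub>a g) = Cod A f \<otimes>\<^sub>o Cod A g"
  using is_functor.arr_map[OF tensor_functor, of "(f, g)" "(Dom A f, Dom A g)" "(Cod A f, Cod A g)"] assms
  by (auto simp: prod_cat_def Hom_def)

lemma tensor_id [simp]: "a \<in> Obj A \<Longrightarrow> b \<in> Obj A \<Longrightarrow> idt a \<otimes>\<^sub>a idt b = idt (a \<otimes>\<^sub>o b)"
  using is_functor.id_map[OF tensor_functor, of "(a, b)"] by (simp add: prod_cat_def)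

lemma interchange:
  assumes "f \<in> Arr A" "g \<in> Arr A" "f' \<in> Arr A" "g' \<in> Arr A" "Cod A f = Dom A g" "Cod A f' = Dom A g'"
  shows "(g \<otimes>\<^sub>a g') \<cdot> (f \<otimes>\<^sub>a f') = (g \<cdot> f) \<otimes>\<^sub>a (g' \<cdot> f')"
  using is_functor.comp_map[OF tensor_functor, of "(f, f')" "(Dom A f, Dom A f')" "(Cod A f, Cod A f')"
      "(g, g')" "(Cod A g, Cod A g')"] assms
  by (auto simp: prod_cat_def Hom_def)

lemma interchange_left:
  assumes "f \<in> Arr A" "g \<in> Arr A" "f' \<in> Arr A" "g' \<in> Arr A" "Cod A f = Dom A g" "Cod A f' = Dom A g'"
    "k \<in> Arr A" "Cod A k = Dom A f \<otimes>\<^sub>o Dom A f'"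
  shows "(g \<otimes>\<^sub>a g') \<cdot> ((f \<otimes>\<^sub>a f') \<cdot> k) = ((g \<cdot> f) \<otimes>\<^sub>a (g' \<cdot> f')) \<cdot> k"
  by (rule comp_reassoc[OF interchange]) (use assms in auto)

lemma assoc_simps [simp]:
  assumes "a \<in> Obj A" "b \<in> Obj A" "c \<in> Obj A"
  shows "\<alpha> a b c \<in> Arr A" "Dom A (\<alpha> a b c) = (a \<otimes>\<^sub>o b) \<otimes>\<^sub>o c" "Cod A (\<alpha> a b c) = a \<otimes>\<^sub>o (b \<otimes>\<^sub>o c)"
    "iso_arrow A (\<alpha> a b c)"
  using assoc_iso[OF assms] by (auto simp: Hom_def)

lemma lunit_simps [simp]:
  assumes "a \<in> Obj A"
  shows "lu a \<in> Arr A" "Dom A (lu a) = \<I> \<otimes>\<^sub>o a" "Cod A (lu a) = a" "iso_arrow A (lu a)"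
  using lunit_iso[OF assms] by (auto simp: Hom_def)

lemma runit_simps [simp]:
  assumes "a \<in> Obj A"
  shows "ru a \<in> Arr A" "Dom A (ru a) = a \<otimes>\<^sub>o \<I>" "Cod A (ru a) = a" "iso_arrow A (ru a)"
  using runit_iso[OF assms] by (auto simp: Hom_def)

declare inv_simps [simp]

lemma assoc_nat:
  assumes "f \<in> Arr A" "g \<in> Arr A" "h \<in> Arr A"
  shows "\<alpha> (Cod A f) (Cod A g) (Cod A h) \<cdot> ((f \<otimes>\<^sub>a g) \<otimes>\<^sub>a h) =
    (f \<otimes>\<^sub>a (g \<otimes>\<^sub>a h)) \<cdot> \<alpha> (Dom A f) (Dom A g) (Dom A h)"
  by (rule assoc_natural) (use assms in \<open>auto simp: Hom_def\<close>)

lemma associ_nat: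
  assumes "f \<in> Arr A" "g \<in> Arr A" "h \<in> Arr A"
  shows "\<alpha>i (Cod A f) (Cod A g) (Cod A h) \<cdot> (f \<otimes>\<^sub>a (g \<otimes>\<^sub>a h)) =
    ((f \<otimes>\<^sub>a g) \<otimes>\<^sub>a h) \<cdot> \<alpha>i (Dom A f) (Dom A g) (Dom A h)"
proof (rule iso_cancel_left[of "\<alpha> (Cod A f) (Cod A g) (Cod A h)"])
  show "\<alpha> (Cod A f) (Cod A g) (Cod A h) \<cdot> (\<alpha>i (Cod A f) (Cod A g) (Cod A h) \<cdot> (f \<otimes>\<^sub>a (g \<otimes>\<^sub>a h))) =
    \<alpha> (Cod A f) (Cod A g) (Cod A h) \<cdot> (((f \<otimes>\<^sub>a g) \<otimes>\<^sub>a h) \<cdot> \<alpha>i (Dom A f) (Dom A g) (Dom A h))"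
    using assms by (subst comp_reassoc[OF assoc_nat]) auto
qed (use assms in auto)

lemma lunit_nat: "f \<in> Arr A \<Longrightarrow> lu (Cod A f) \<cdot> (idt \<I> \<otimes>\<^sub>a f) = f \<cdot> lu (Dom A f)"
  by (rule lunit_natural) (simp add: Hom_def)

lemma runit_nat: "f \<in> Arr A \<Longrightarrow> ru (Cod A f) \<cdot> (f \<otimes>\<^sub>a idt \<I>) = f \<cdot> ru (Dom A f)"
  by (rule runit_natural) (simp add: Hom_def)

lemma luniti_nat: "f \<in> Arr A \<Longrightarrow> lui (Cod A f) \<cdot> f = (idt \<I> \<otimes>\<^sub>a f) \<cdot> lui (Dom A f)"
proof (rule iso_cancel_left[of "lu (Cod A f)"])
  assume f: "f \<in> Arr A"
  show "lu (Cod A f) \<cdot> (lui (Cod A f) \<cdot> f) = lu (Cod A f) \<cdot> ((idt \<I> \<otimes>\<^sub>a f) \<cdot> lui (Dom A f))"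
    using f by (subst comp_reassoc[OF lunit_nat]) auto
qed auto

lemma runiti_nat: "f \<in> Arr A \<Longrightarrow> rui (Cod A f) \<cdot> f = (f \<otimes>\<^sub>a idt \<I>) \<cdot> rui (Dom A f)"
proof (rule iso_cancel_left[of "ru (Cod A f)"])
  assume f: "f \<in> Arr A"
  show "ru (Cod A f) \<cdot> (rui (Cod A f) \<cdot> f) = ru (Cod A f) \<cdot> ((f \<otimes>\<^sub>a idt \<I>) \<cdot> rui (Dom A f))"
    using f by (subst comp_reassoc[OF runit_nat]) auto
qed auto

lemma tensor_inv:
  assumes u: "u \<in> Arr A" "iso_arrow A u" and v: "v \<in> Arr A" "iso_arrow A v"
  shows "iso_arrow A (u \<otimes>\<^sub>a v)" "inv_arrow A (u \<otimes>\<^sub>a v) = inv_arrow A u \<otimes>\<^sub>a inv_arrow A v"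
proof -
  have h: "u \<otimes>\<^sub>a v \<in> Hom A (Dom A u \<otimes>\<^sub>o Dom A v) (Cod A u \<otimes>\<^sub>o Cod A v)"
    "inv_arrow A u \<otimes>\<^sub>a inv_arrow A v \<in> Hom A (Cod A u \<otimes>\<^sub>o Cod A v) (Dom A u \<otimes>\<^sub>o Dom A v)"
    using assms by (auto simp: Hom_def)
  have e: "(inv_arrow A u \<otimes>\<^sub>a inv_arrow A v) \<cdot> (u \<otimes>\<^sub>a v) = idt (Dom A u \<otimes>\<^sub>o Dom A v)"
    "(u \<otimes>\<^sub>a v) \<cdot> (inv_arrow A u \<otimes>\<^sub>a inv_arrow A v) = idt (Cod A u \<otimes>\<^sub>o Cod A v)"
    using assms by (simp_all add: interchange)
  show "iso_arrow A (u \<otimes>\<^sub>a v)" by (rule iso_arrowI[OF h e])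
  show "inv_arrow A (u \<otimes>\<^sub>a v) = inv_arrow A u \<otimes>\<^sub>a inv_arrow A v" by (rule inv_arrow_eq[OF h e])
qed

lemma iso_idt [simp]: "a \<in> Obj A \<Longrightarrow> iso_arrow A (idt a)" by (rule iso_id)

text \<open>Naturality of the left unitor makes \<open>f\<close> a conjugate of
  \<open>idt \<I> \<otimes>\<^sub>a f\<close>.\<close>

lemma unit_tensor_faithful:
  assumes "f \<in> Arr A" "g \<in> Arr A" "Dom A f = Dom A g" "Cod A f = Cod A g" "idt \<I> \<otimes>\<^sub>a f = idt \<I> \<otimes>\<^sub>a g"
  shows "f = g"
proof (rule iso_cancel_right[of "lu (Dom A f)"])
  show "f \<cdot> lu (Dom A f) = g \<cdot> lu (Dom A f)"
    using lunit_nat[OF assms(1)] lunit_nat[OF assms(2)] assms(3-) by simp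
qed (use assms in auto)

lemma tensor_unit_faithful:
  assumes "f \<in> Arr A" "g \<in> Arr A" "Dom A f = Dom A g" "Cod A f = Cod A g" "f \<otimes>\<^sub>a idt \<I> = g \<otimes>\<^sub>a idt \<I>"
  shows "f = g"
proof (rule iso_cancel_right[of "ru (Dom A f)"])
  show "f \<cdot> ru (Dom A f) = g \<cdot> ru (Dom A f)"
    using runit_nat[OF assms(1)] runit_nat[OF assms(2)] assms(3-) by simp
qed (use assms in auto)

lemma pentagon':
  assumes "a \<in> Obj A" "b \<in> Obj A" "c \<in> Obj A" "d \<in> Obj A"
  shows "(idt a \<otimes>\<^sub>a \<alpha> b c d) \<cdot> (\<alpha> a (b \<otimes>\<^sub>o c) d \<cdot> (\<alpha> a b c \<otimes>\<^sub>a idt d)) = \<alpha> a b (c \<otimes>\<^sub>o d) \<cdot> \<alpha> (a \<otimes>\<^sub>o b) c d"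
  using pentagon[OF assms] assms by simp

text \<open>Kelly's derivation of this coherence law: it suffices to prove the equation tensored
  with \<open>\<I>\<close> and precomposed with the isomorphism \<open>?u\<close>, one side of the
  pentagon at \<open>\<I>\<close>, \<open>\<I>\<close>, \<open>a\<close>, \<open>b\<close>. There
  pentagon, triangle and naturality of the associator apply.\<close>

lemma lunit_tensor:
  assumes a: "a \<in> Obj A" and b: "b \<in> Obj A"
  shows "lu (a \<otimes>\<^sub>o b) \<cdot> \<alpha> \<I> a b = lu a \<otimes>\<^sub>a idt b"
proof (rule unit_tensor_faithful)
  let ?u = "\<alpha> \<I> (\<I> \<otimes>\<^sub>o a) b \<cdot> (\<alpha> \<I> \<I> a \<otimes>\<^sub>a idt b)"
  have u: "?u \<in> Arr A" "Dom A ?u = ((\<I> \<otimes>\<^sub>o \<I>) \<otimes>\<^sub>o a) \<otimes>\<^sub>o b" "Cod A ?u = \<I> \<otimes>\<^sub>o ((\<I> \<otimes>\<^sub>o a) \<otimes>\<^sub>o b)"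
    using a b by simp_all
  have iu: "iso_arrow A ?u"
    by (rule iso_comp[of _ "((\<I> \<otimes>\<^sub>o \<I>) \<otimes>\<^sub>o a) \<otimes>\<^sub>o b" "(\<I> \<otimes>\<^sub>o (\<I> \<otimes>\<^sub>o a)) \<otimes>\<^sub>o b" _ "\<I> \<otimes>\<^sub>o ((\<I> \<otimes>\<^sub>o a) \<otimes>\<^sub>o b)"])
      (use a b in \<open>auto simp: Hom_def tensor_inv\<close>)
  show "idt \<I> \<otimes>\<^sub>a (lu (a \<otimes>\<^sub>o b) \<cdot> \<alpha> \<I> a b) = idt \<I> \<otimes>\<^sub>a (lu a \<otimes>\<^sub>a idt b)"
  proof (rule iso_cancel_right[OF iu u(1)])
    have "(idt \<I> \<otimes>\<^sub>a (lu (a \<otimes>\<^sub>o b) \<cdot> \<alpha> \<I> a b)) \<cdot> ?u =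
      (idt \<I> \<otimes>\<^sub>a lu (a \<otimes>\<^sub>o b)) \<cdot> ((idt \<I> \<otimes>\<^sub>a \<alpha> \<I> a b) \<cdot> ?u)"
      using a b u by (simp add: interchange_left)
    also have "\<dots> = (idt \<I> \<otimes>\<^sub>a lu (a \<otimes>\<^sub>o b)) \<cdot> (\<alpha> \<I> \<I> (a \<otimes>\<^sub>o b) \<cdot> \<alpha> (\<I> \<otimes>\<^sub>o \<I>) a b)"
      using a b by (subst pentagon') auto
    also have "\<dots> = (ru \<I> \<otimes>\<^sub>a idt (a \<otimes>\<^sub>o b)) \<cdot> \<alpha> (\<I> \<otimes>\<^sub>o \<I>) a b"
      using a b by (intro comp_reassoc triangle) auto
    also have "\<dots> = \<alpha> \<I> a b \<cdot> ((ru \<I> \<otimes>\<^sub>a idt a) \<otimes>\<^sub>a idt b)"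
      using a b assoc_nat[of "ru \<I>" "idt a" "idt b"] by simp
    also have "\<dots> = \<alpha> \<I> a b \<cdot> (((idt \<I> \<otimes>\<^sub>a lu a) \<otimes>\<^sub>a idt b) \<cdot> (\<alpha> \<I> \<I> a \<otimes>\<^sub>a idt b))"
      using a b by (simp add: interchange triangle)
    also have "\<dots> = ((idt \<I> \<otimes>\<^sub>a (lu a \<otimes>\<^sub>a idt b)) \<cdot> \<alpha> \<I> (\<I> \<otimes>\<^sub>o a) b) \<cdot> (\<alpha> \<I> \<I> a \<otimes>\<^sub>a idt b)"
      using a b assoc_nat[of "idt \<I>" "lu a" "idt b"] by (intro comp_reassoc) auto
    also have "\<dots> = (idt \<I> \<otimes>\<^sub>a (lu a \<otimes>\<^sub>a idt b)) \<cdot> ?u"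
      using a b by simp
    finally show "(idt \<I> \<otimes>\<^sub>a (lu (a \<otimes>\<^sub>o b) \<cdot> \<alpha> \<I> a b)) \<cdot> ?u = (idt \<I> \<otimes>\<^sub>a (lu a \<otimes>\<^sub>a idt b)) \<cdot> ?u" .
  qed (use a b u in auto)
qed (use a b in auto)

lemma lunit_unit_tensor: "a \<in> Obj A \<Longrightarrow> lu (\<I> \<otimes>\<^sub>o a) = idt \<I> \<otimes>\<^sub>a lu a"
  by (rule iso_cancel_left[of "lu a"]) (use lunit_nat[of "lu a"] in auto)

text \<open>Tensored with \<open>idt \<I>\<close>, both arrows become the composite of
  \<open>idt \<I> \<otimes>\<^sub>a lu \<I>\<close> with the associator, the left one by
  \<open>lunit_tensor\<close> and the right one by the triangle.\<close>

lemma lunit_eq_runit: "lu \<I> = ru \<I>"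
proof (rule tensor_unit_faithful)
  show "lu \<I> \<otimes>\<^sub>a idt \<I> = ru \<I> \<otimes>\<^sub>a idt \<I>"
    using lunit_tensor[of \<I> \<I>] triangle[of \<I> \<I>] by (simp add: lunit_unit_tensor)
qed auto

end


subsection \<open>The reversed category\<close>

text \<open>Reversing the tensor product exchanges the unitors, inverts the associator and turns
  left duals into right duals. Facts proved for left duals thereby become facts about right
  duals.\<close>

definition rev_mon :: "('k::field, 'o, 'm, 'z) rigid_cat_scheme \<Rightarrow> ('k, 'o, 'm, 'z) rigid_cat_scheme" where
  "rev_mon A = A\<lparr>tensor_obj := (\<lambda>a b. b \<otimes>\<^sub>o\<^bsub>A\<^esub> a), tensor_arr := (\<lambda>f g. g \<otimes>\<^sub>a\<^bsub>A\<^esub> f),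
     assoc := (\<lambda>a b c. inv_arrow A (assoc A c b a)), lunit := runit A, runit := lunit A,
     rdual := ldual A, rev_arr := lev_arr A, rcoev_arr := lcoev_arr A,
     ldual := rdual A, lev_arr := rev_arr A, lcoev_arr := rcoev_arr A\<rparr>"

lemma rev_mon_simps [simp]:
  "Obj (rev_mon A) = Obj A" "Arr (rev_mon A) = Arr A" "Dom (rev_mon A) = Dom A" "Cod (rev_mon A) = Cod A"
  "Idt (rev_mon A) = Idt A" "Comp (rev_mon A) = Comp A" "add_arr (rev_mon A) = add_arr A"
  "zero_arr (rev_mon A) = zero_arr A" "scale_arr (rev_mon A) = scale_arr A"
  "unit_obj (rev_mon A) = unit_obj A" "tensor_obj (rev_mon A) = (\<lambda>a b. b \<otimes>\<^sub>o\<^bsub>A\<^esub> a)"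
  "tensor_arr (rev_mon A) = (\<lambda>f g. g \<otimes>\<^sub>a\<^bsub>A\<^esub> f)"
  "assoc (rev_mon A) = (\<lambda>a b c. inv_arrow A (assoc A c b a))"
  "lunit (rev_mon A) = runit A" "runit (rev_mon A) = lunit A"
  "rdual (rev_mon A) = ldual A" "rev_arr (rev_mon A) = lev_arr A" "rcoev_arr (rev_mon A) = lcoev_arr A"
  "ldual (rev_mon A) = rdual A" "lev_arr (rev_mon A) = rev_arr A" "lcoev_arr (rev_mon A) = rcoev_arr A"
  by (simp_all add: rev_mon_def)

lemma rev_mon_cat [simp]:
  "Hom (rev_mon A) = Hom A" "inverse_arrows (rev_mon A) = inverse_arrows A" "iso_arrow (rev_mon A) = iso_arrow A"
  "inv_arrow (rev_mon A) = inv_arrow A" "hom_space (rev_mon A) = hom_space A"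
  by (auto simp: Hom_def inverse_arrows_def iso_arrow_def inv_arrow_def hom_space_def fun_eq_iff)

lemma category_rev_mon [simp]: "category (rev_mon A) \<longleftrightarrow> category A"
  by (simp add: category_def)

lemma is_functor_rev_mon [simp]: "is_functor (rev_mon A) (rev_mon A) N \<longleftrightarrow> is_functor A A N"
  by (simp add: is_functor_def is_functor_axioms_def)

context linear_monoidal_category
begin

lemma rev_mon_monoidal: "linear_monoidal_category (rev_mon A)"
proof -
  have cat: "category A" by unfold_locales
  have lin: "linear_category (rev_mon A)"
    using linear_category_axioms by (simp add: linear_category_def linear_category_axioms_def)
  show ?thesis
  proof (rule linear_monoidal_category.intro[OF lin], rule linear_monoidal_category_axioms.intro, goal_cases)
    case 1 show ?case by simp
  next
    case 2
    have "is_functor (prod_cat A A) A \<lparr>on_obj = \<lambda>(a, b). b \<otimes>\<^sub>o a, on_arr = \<lambda>(f, g). g \<otimes>\<^sub>a f\<rparr>"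
    proof -
      interpret T: is_functor "prod_cat A A" A "\<lparr>on_obj = (\<lambda>(a, b). a \<otimes>\<^sub>o b), on_arr = (\<lambda>(f, g). f \<otimes>\<^sub>a g)\<rparr>"
        by (rule tensor_functor)
      show ?thesis
        by unfold_locales (auto simp: prod_cat_def Hom_def interchange)
    qed
    moreover have "prod_cat (rev_mon A) (rev_mon A) = prod_cat A A" by (simp add: prod_cat_def)
    ultimately show ?case by (simp add: is_functor_def is_functor_axioms_def)
  next
    case (3 c d f a b) then show ?case by (simp add: tensor_linear_left)
  next
    case (4 a b g c d) then show ?case by (simp add: tensor_linear_right)
  next
    case (5 a b c) then show ?case
      using iso_inv_arrow[of "\<alpha> c b a"] by (auto simp: Hom_def)
  next
    case (6 f a a' g b b' h c c') then show ?case
      using associ_nat[of h g f] by (auto simp: Hom_def)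
  next
    case (7 a) then show ?case by (simp add: Hom_def)
  next
    case (8 f a b) then show ?case using runit_nat[of f] by (simp add: Hom_def)
  next
    case (9 a) then show ?case by (simp add: Hom_def)
  next
    case (10 f a b) then show ?case using lunit_nat[of f] by (simp add: Hom_def)
  next
    case (11 a b c d)
    then have o: "d \<in> Obj A" "c \<in> Obj A" "b \<in> Obj A" "a \<in> Obj A" by simp_all
    \<comment> \<open>For the inverted pentagon, \<open>?q\<close> is a left inverse and
      \<open>?r\<close> a right inverse of the same arrow \<open>?p\<close>, so they
      coincide.\<close>
    let ?p = "(idt d \<otimes>\<^sub>a \<alpha> c b a) \<cdot> (\<alpha> d (c \<otimes>\<^sub>o b) a \<cdot> (\<alpha> d c b \<otimes>\<^sub>a idt a))"
    let ?q = "\<alpha>i (d \<otimes>\<^sub>o c) b a \<cdot> \<alpha>i d c (b \<otimes>\<^sub>o a)"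
    let ?r = "(\<alpha>i d c b \<otimes>\<^sub>a idt a) \<cdot> (\<alpha>i d (c \<otimes>\<^sub>o b) a \<cdot> (idt d \<otimes>\<^sub>a \<alpha>i c b a))"
    have t: "?p \<in> Hom A (((d \<otimes>\<^sub>o c) \<otimes>\<^sub>o b) \<otimes>\<^sub>o a) (d \<otimes>\<^sub>o (c \<otimes>\<^sub>o (b \<otimes>\<^sub>o a)))"
      "?q \<in> Hom A (d \<otimes>\<^sub>o (c \<otimes>\<^sub>o (b \<otimes>\<^sub>o a))) (((d \<otimes>\<^sub>o c) \<otimes>\<^sub>o b) \<otimes>\<^sub>o a)"
      "?r \<in> Hom A (d \<otimes>\<^sub>o (c \<otimes>\<^sub>o (b \<otimes>\<^sub>o a))) (((d \<otimes>\<^sub>o c) \<otimes>\<^sub>o b) \<otimes>\<^sub>o a)"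
      using o by (simp_all add: Hom_def)
    have "?q \<cdot> ?p = idt (((d \<otimes>\<^sub>o c) \<otimes>\<^sub>o b) \<otimes>\<^sub>o a)"
      using o by (subst pentagon') simp_all
    moreover have "?p \<cdot> ?r = idt (d \<otimes>\<^sub>o (c \<otimes>\<^sub>o (b \<otimes>\<^sub>o a)))"
      using o by (simp add: interchange interchange_left)
    ultimately have "?q = ?r" by (rule inverse_unique[OF t(1,2) _ t(3)])
    then show ?case using o by simp
  next
    case (12 a b)
    then have o: "a \<in> Obj A" "b \<in> Obj A" by simp_all
    have "(ru b \<otimes>\<^sub>a idt a) \<cdot> \<alpha>i b \<I> a = ((idt b \<otimes>\<^sub>a lu a) \<cdot> \<alpha> b \<I> a) \<cdot> \<alpha>i b \<I> a"
      using o by (simp only: triangle)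
    then show ?case using o by simp
  qed
qed

lemma runit_tensor:
  assumes a: "a \<in> Obj A" and b: "b \<in> Obj A"
  shows "ru (a \<otimes>\<^sub>o b) \<cdot> \<alpha>i a b \<I> = idt a \<otimes>\<^sub>a ru b"
  using linear_monoidal_category.lunit_tensor[OF rev_mon_monoidal, of b a] assms by simp

lemma duality_rev: "duality (rev_mon A) c d ev coev \<longleftrightarrow> duality A d c ev coev"
proof -
  have "inv_arrow A (\<alpha>i d c d) = \<alpha> d c d" if "c \<in> Obj A" "d \<in> Obj A"
    by (rule inv_arrow_eq[of _ "d \<otimes>\<^sub>o (c \<otimes>\<^sub>o d)" "(d \<otimes>\<^sub>o c) \<otimes>\<^sub>o d"]) (use that in \<open>auto simp: Hom_def\<close>)
  then show ?thesis unfolding duality_def rev_mon_simps rev_mon_cat by auto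
qed

end

lemma (in rigid_linear_monoidal_category) rev_mon_rigid: "rigid_linear_monoidal_category (rev_mon A)"
  unfolding rigid_linear_monoidal_category_def rigid_linear_monoidal_category_axioms_def
  using rev_mon_monoidal right_dual left_dual by (simp add: duality_rev)


subsection \<open>The opposite category\<close>

text \<open>The arrows turn around while the tensor product keeps its order, so evaluations and
  coevaluations trade places and with them left and right duals. Structure isomorphisms are inverted
  to keep their prescribed direction.\<close>

definition op_mon :: "('k::field, 'o, 'm, 'z) rigid_cat_scheme \<Rightarrow> ('k, 'o, 'm, 'z) rigid_cat_scheme" where
  "op_mon A = A\<lparr>Dom := Cod A, Cod := Dom A, Comp := (\<lambda>g f. f \<cdot>\<^bsub>A\<^esub> g), zero_arr := (\<lambda>a b. zero_arr A b a),
     assoc := (\<lambda>a b c. inv_arrow A (assoc A a b c)), lunit := (\<lambda>a. inv_arrow A (lunit A a)),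
     runit := (\<lambda>a. inv_arrow A (runit A a)),
     rdual := ldual A, rev_arr := lcoev_arr A, rcoev_arr := lev_arr A,
     ldual := rdual A, lev_arr := rcoev_arr A, lcoev_arr := rev_arr A\<rparr>"

lemma op_mon_simps [simp]:
  "Obj (op_mon A) = Obj A" "Arr (op_mon A) = Arr A" "Dom (op_mon A) = Cod A" "Cod (op_mon A) = Dom A"
  "Idt (op_mon A) = Idt A" "Comp (op_mon A) = (\<lambda>g f. f \<cdot>\<^bsub>A\<^esub> g)" "add_arr (op_mon A) = add_arr A"
  "zero_arr (op_mon A) = (\<lambda>a b. zero_arr A b a)" "scale_arr (op_mon A) = scale_arr A"
  "unit_obj (op_mon A) = unit_obj A" "tensor_obj (op_mon A) = tensor_obj A"
  "tensor_arr (op_mon A) = tensor_arr A"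
  "assoc (op_mon A) = (\<lambda>a b c. inv_arrow A (assoc A a b c))"
  "lunit (op_mon A) = (\<lambda>a. inv_arrow A (lunit A a))" "runit (op_mon A) = (\<lambda>a. inv_arrow A (runit A a))"
  "rdual (op_mon A) = ldual A" "rev_arr (op_mon A) = lcoev_arr A" "rcoev_arr (op_mon A) = lev_arr A"
  "ldual (op_mon A) = rdual A" "lev_arr (op_mon A) = rcoev_arr A" "lcoev_arr (op_mon A) = rev_arr A"
  by (simp_all add: op_mon_def)

lemma Hom_op_mon [simp]: "Hom (op_mon A) a b = Hom A b a"
  by (auto simp: Hom_def)

lemma inverse_arrows_op_mon [simp]: "inverse_arrows (op_mon A) = inverse_arrows A"
  by (auto simp: inverse_arrows_def fun_eq_iff)

lemma op_mon_cat [simp]: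
  "iso_arrow (op_mon A) = iso_arrow A" "inv_arrow (op_mon A) = inv_arrow A"
  "hom_space (op_mon A) a b = hom_space A b a"
  by (auto simp: iso_arrow_def inv_arrow_def hom_space_def fun_eq_iff)

lemma category_op_mon:
  assumes "category A"
  shows "category (op_mon A)"
proof -
  interpret category A by (rule assms)
  show ?thesis
    by unfold_locales
      (auto simp: dom_cod id_in_hom comp_in_hom comp_id_left comp_id_right comp_assoc intro: comp_in_hom)
qed

lemma op_mon_linear: "linear_category A \<Longrightarrow> linear_category (op_mon A)"
  by (auto simp: linear_category_def linear_category_axioms_def category_op_mon)

lemma nakayama_op_mon: "nakayama (op_mon A) N \<longleftrightarrow> is_functor (op_mon A) (op_mon A) N \<and> (\<exists>\<iota>.
     (\<forall>c\<in>Obj A. nak_univ (op_lin A) c (on_obj N c) (\<iota> c)) \<and>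
     (\<forall>c\<in>Obj A. \<forall>c'\<in>Obj A. \<forall>f\<in>Hom A c' c. \<forall>a\<in>Obj A. \<forall>\<xi>\<in>carrier (dual_space (hom_space A a c)).
        \<iota> c a \<xi> \<cdot>\<^bsub>A\<^esub> on_arr N f = \<iota> c' a (dual_map (hom_space A a c') (\<lambda>k. f \<cdot>\<^bsub>A\<^esub> k) \<xi>)))"
  by (simp add: nakayama_def nak_univ_def nak_family_def)

context linear_monoidal_category
begin

lemma pentagon_inv:
  assumes "a \<in> Obj A" "b \<in> Obj A" "c \<in> Obj A" "d \<in> Obj A"
  shows "(\<alpha>i a b c \<otimes>\<^sub>a idt d) \<cdot> (\<alpha>i a (b \<otimes>\<^sub>o c) d \<cdot> (idt a \<otimes>\<^sub>a \<alpha>i b c d)) =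
    \<alpha>i (a \<otimes>\<^sub>o b) c d \<cdot> \<alpha>i a b (c \<otimes>\<^sub>o d)"
  using linear_monoidal_category.pentagon[OF rev_mon_monoidal, of d c b a] assms by simp

lemma triangle_inv:
  assumes "a \<in> Obj A" "b \<in> Obj A"
  shows "\<alpha>i a \<I> b \<cdot> (idt a \<otimes>\<^sub>a lui b) = rui a \<otimes>\<^sub>a idt b"
proof (rule inverse_unique[of "(idt a \<otimes>\<^sub>a lu b) \<cdot> \<alpha> a \<I> b" "(a \<otimes>\<^sub>o \<I>) \<otimes>\<^sub>o b" "a \<otimes>\<^sub>o b"])
  show "(\<alpha>i a \<I> b \<cdot> (idt a \<otimes>\<^sub>a lui b)) \<cdot> ((idt a \<otimes>\<^sub>a lu b) \<cdot> \<alpha> a \<I> b) = idt ((a \<otimes>\<^sub>o \<I>) \<otimes>\<^sub>o b)"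
    using assms by (simp add: interchange interchange_left)
  show "((idt a \<otimes>\<^sub>a lu b) \<cdot> \<alpha> a \<I> b) \<cdot> (rui a \<otimes>\<^sub>a idt b) = idt (a \<otimes>\<^sub>o b)"
    unfolding triangle[OF assms] using assms by (simp add: interchange)
qed (use assms in \<open>auto simp: Hom_def\<close>)

lemma op_mon_monoidal: "linear_monoidal_category (op_mon A)"
proof (rule linear_monoidal_category.intro, goal_cases)
  case 1 show ?case by (rule op_mon_linear) unfold_locales
next
  case 2 show ?case
  proof (rule linear_monoidal_category_axioms.intro, goal_cases)
    case 1 show ?case by simp
  next
    case 2
    have "category (prod_cat A A)" using tensor_functor by (simp add: is_functor_def)
    then have "category (prod_cat (op_mon A) (op_mon A))"
      by (auto simp: category_def prod_cat_def Hom_def)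
    moreover have "category (op_mon A)" by (rule category_op_mon) unfold_locales
    ultimately show ?case
      by (auto simp: is_functor_def is_functor_axioms_def prod_cat_def Hom_def interchange)
  next
    case (3 c d f a b) then show ?case by (simp add: tensor_linear_right)
  next
    case (4 a b g c d) then show ?case by (simp add: tensor_linear_left)
  next
    case (5 a b c) then show ?case
      using iso_inv_arrow[of "\<alpha> a b c"] by (auto simp: Hom_def)
  next
    case (6 f a a' g b b' h c c') then show ?case
      using associ_nat[of f g h] by (auto simp: Hom_def)
  next
    case (7 a) then show ?case using iso_inv_arrow[of "lu a"] by (auto simp: Hom_def)
  next
    case (8 f a b) then show ?case using luniti_nat[of f] by (simp add: Hom_def)
  next
    case (9 a) then show ?case using iso_inv_arrow[of "ru a"] by (auto simp: Hom_def)
  next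
    case (10 f a b) then show ?case using runiti_nat[of f] by (simp add: Hom_def)
  next
    case (11 a b c d)
    then show ?case using pentagon_inv[of a b c d] by simp
  next
    case (12 a b)
    then show ?case using triangle_inv[of a b] by simp
  qed
qed

lemma inv_inv:
  "u \<in> Arr A \<Longrightarrow> iso_arrow A u \<Longrightarrow> inv_arrow A (inv_arrow A u) = u"
  by (rule inv_arrow_eq[of _ "Cod A u" "Dom A u"]) (auto simp: Hom_def)

text \<open>The zigzag equations of the opposite category contain inverted unitors; composing with
  the unitors (\<open>swap\<close>, \<open>swap'\<close>) brings them to their form in
  \<open>A\<close>. If the four typing conditions fail, both sides are false.\<close>

lemma duality_op: "duality (op_mon A) c d ev coev \<longleftrightarrow> duality A d c coev ev"
proof (cases "c \<in> Obj A \<and> d \<in> Obj A \<and> ev \<in> Hom A \<I> (d \<otimes>\<^sub>o c) \<and> coev \<in> Hom A (c \<otimes>\<^sub>o d) \<I>")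
  case True
  then have o [simp]: "c \<in> Obj A" "d \<in> Obj A"
    and e [simp]: "ev \<in> Arr A" "Dom A ev = \<I>" "Cod A ev = d \<otimes>\<^sub>o c"
    "coev \<in> Arr A" "Dom A coev = c \<otimes>\<^sub>o d" "Cod A coev = \<I>"
    by (auto simp: Hom_def)
  have swap: "p \<cdot> rui x = lui y \<longleftrightarrow> lu y \<cdot> p = ru x" if "p \<in> Hom A (x \<otimes>\<^sub>o \<I>) (\<I> \<otimes>\<^sub>o y)" "x \<in> Obj A" "y = x" for p x y
  proof
    assume "p \<cdot> rui x = lui y"
    then have "lu y \<cdot> ((p \<cdot> rui x) \<cdot> ru x) = lu y \<cdot> (lui y \<cdot> ru x)" by simp
    then show "lu y \<cdot> p = ru x" using that by (simp add: Hom_def)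
  next
    assume "lu y \<cdot> p = ru x"
    then have "lui y \<cdot> ((lu y \<cdot> p) \<cdot> rui x) = lui y \<cdot> (ru x \<cdot> rui x)" by simp
    then show "p \<cdot> rui x = lui y" using that by (simp add: Hom_def)
  qed
  have swap': "p \<cdot> lui x = rui y \<longleftrightarrow> ru y \<cdot> p = lu x" if "p \<in> Hom A (\<I> \<otimes>\<^sub>o x) (y \<otimes>\<^sub>o \<I>)" "x \<in> Obj A" "y = x" for p x y
  proof
    assume "p \<cdot> lui x = rui y"
    then have "ru y \<cdot> ((p \<cdot> lui x) \<cdot> lu x) = ru y \<cdot> (rui y \<cdot> lu x)" by simp
    then show "ru y \<cdot> p = lu x" using that by (simp add: Hom_def)
  next
    assume "ru y \<cdot> p = lu x"
    then have "rui y \<cdot> ((ru y \<cdot> p) \<cdot> lui x) = rui y \<cdot> (lu x \<cdot> lui x)" by simp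
    then show "p \<cdot> lui x = rui y" using that by (simp add: Hom_def)
  qed
  note s = swap[of "(coev \<otimes>\<^sub>a idt c) \<cdot> (\<alpha>i c d c \<cdot> (idt c \<otimes>\<^sub>a ev))" c c]
  note s' = swap'[of "(idt d \<otimes>\<^sub>a coev) \<cdot> (\<alpha> d c d \<cdot> (ev \<otimes>\<^sub>a idt d))" d d]
  show ?thesis
    unfolding duality_def using s s' True by (auto simp: inv_inv Hom_def)
qed (auto simp: duality_def)

end

lemma (in rigid_linear_monoidal_category) op_mon_rigid: "rigid_linear_monoidal_category (op_mon A)"
  unfolding rigid_linear_monoidal_category_def rigid_linear_monoidal_category_axioms_def
  using op_mon_monoidal right_dual left_dual by (simp add: duality_op)


subsection \<open>The adjunction of a dual pair\<close>

context linear_monoidal_category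
begin

context
  fixes c d ev coev
  assumes dual: "duality A c d ev coev"
begin

lemma dual_obj [simp]: "c \<in> Obj A" "d \<in> Obj A"
  and dual_ev [simp]: "ev \<in> Arr A" "Dom A ev = d \<otimes>\<^sub>o c" "Cod A ev = \<I>"
  and dual_coev [simp]: "coev \<in> Arr A" "Dom A coev = \<I>" "Cod A coev = c \<otimes>\<^sub>o d"
  using dual by (auto simp: duality_def Hom_def)

lemma zigzag1: "ru c \<cdot> ((idt c \<otimes>\<^sub>a ev) \<cdot> (\<alpha> c d c \<cdot> (coev \<otimes>\<^sub>a idt c))) = lu c"
  using dual by (auto simp: duality_def)

lemma zigzag2: "lu d \<cdot> ((ev \<otimes>\<^sub>a idt d) \<cdot> (\<alpha>i d c d \<cdot> (idt d \<otimes>\<^sub>a coev))) = ru d"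
  using dual by (auto simp: duality_def)

text \<open>Together with \<open>unit\<close> these belong to the adjunction in which
  \<open>d \<otimes> -\<close> is left adjoint to \<open>c \<otimes> -\<close>.\<close>

definition "counit y = lu y \<cdot> ((ev \<otimes>\<^sub>a idt y) \<cdot> \<alpha>i d c y)"
definition "unit x = \<alpha> c d x \<cdot> ((coev \<otimes>\<^sub>a idt x) \<cdot> lui x)"

lemma counit_simps [simp]:
  "y \<in> Obj A \<Longrightarrow> counit y \<in> Arr A" "y \<in> Obj A \<Longrightarrow> Dom A (counit y) = d \<otimes>\<^sub>o (c \<otimes>\<^sub>o y)"
  "y \<in> Obj A \<Longrightarrow> Cod A (counit y) = y"
  by (simp_all add: counit_def)

lemma unit_simps [simp]:
  "x \<in> Obj A \<Longrightarrow> unit x \<in> Arr A" "x \<in> Obj A \<Longrightarrow> Dom A (unit x) = x"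
  "x \<in> Obj A \<Longrightarrow> Cod A (unit x) = c \<otimes>\<^sub>o (d \<otimes>\<^sub>o x)"
  by (simp_all add: unit_def)

lemma counit_nat:
  assumes "f \<in> Arr A"
  shows "counit (Cod A f) \<cdot> (idt d \<otimes>\<^sub>a (idt c \<otimes>\<^sub>a f)) = f \<cdot> counit (Dom A f)"
proof -
  have "counit (Cod A f) \<cdot> (idt d \<otimes>\<^sub>a (idt c \<otimes>\<^sub>a f)) =
    lu (Cod A f) \<cdot> ((ev \<otimes>\<^sub>a idt (Cod A f)) \<cdot> (\<alpha>i d c (Cod A f) \<cdot> (idt d \<otimes>\<^sub>a (idt c \<otimes>\<^sub>a f))))"
    using assms by (simp add: counit_def)
  also have "\<dots> = lu (Cod A f) \<cdot> ((idt \<I> \<otimes>\<^sub>a f) \<cdot> ((ev \<otimes>\<^sub>a idt (Dom A f)) \<cdot> \<alpha>i d c (Dom A f)))"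
    using assms associ_nat[of "idt d" "idt c" f] by (simp add: interchange_left)
  also have "\<dots> = f \<cdot> counit (Dom A f)"
    using assms by (subst comp_reassoc[OF lunit_nat]) (simp_all add: counit_def)
  finally show ?thesis .
qed

lemma unit_nat:
  assumes "f \<in> Arr A"
  shows "unit (Cod A f) \<cdot> f = (idt c \<otimes>\<^sub>a (idt d \<otimes>\<^sub>a f)) \<cdot> unit (Dom A f)"
proof -
  have "unit (Cod A f) \<cdot> f = \<alpha> c d (Cod A f) \<cdot> ((coev \<otimes>\<^sub>a idt (Cod A f)) \<cdot> (lui (Cod A f) \<cdot> f))"
    using assms by (simp add: unit_def)
  also have "\<dots> = \<alpha> c d (Cod A f) \<cdot> (((idt c \<otimes>\<^sub>a idt d) \<otimes>\<^sub>a f) \<cdot> ((coev \<otimes>\<^sub>a idt (Dom A f)) \<cdot> lui (Dom A f)))"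
    using assms by (simp add: luniti_nat interchange_left)
  also have "\<dots> = (idt c \<otimes>\<^sub>a (idt d \<otimes>\<^sub>a f)) \<cdot> unit (Dom A f)"
    using assms assoc_nat[of "idt c" "idt d" f] comp_reassoc[OF assoc_nat[of "idt c" "idt d" f]]
    by (simp add: unit_def)
  finally show ?thesis .
qed

text \<open>Once the coherence isomorphisms have been moved out of the way by \<open>s1\<close> to
  \<open>s6\<close>, what remains is the zigzag equation of \<open>d\<close> tensored with
  \<open>idt x\<close>.\<close>

lemma triangle_left:
  assumes x [simp]: "x \<in> Obj A"
  shows "counit (d \<otimes>\<^sub>o x) \<cdot> (idt d \<otimes>\<^sub>a unit x) = idt (d \<otimes>\<^sub>o x)"
proof -
  have s1: "idt d \<otimes>\<^sub>a unit x = (idt d \<otimes>\<^sub>a \<alpha> c d x) \<cdot> ((idt d \<otimes>\<^sub>a (coev \<otimes>\<^sub>a idt x)) \<cdot> (idt d \<otimes>\<^sub>a lui x))"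
    by (simp add: unit_def interchange)
  have s2: "\<alpha>i d c (d \<otimes>\<^sub>o x) \<cdot> (idt d \<otimes>\<^sub>a \<alpha> c d x) =
    \<alpha> (d \<otimes>\<^sub>o c) d x \<cdot> ((\<alpha>i d c d \<otimes>\<^sub>a idt x) \<cdot> \<alpha>i d (c \<otimes>\<^sub>o d) x)"
  proof -
    have "\<alpha>i d c (d \<otimes>\<^sub>o x) = \<alpha> (d \<otimes>\<^sub>o c) d x \<cdot> (\<alpha>i (d \<otimes>\<^sub>o c) d x \<cdot> \<alpha>i d c (d \<otimes>\<^sub>o x))" by simp
    also have "\<dots> = \<alpha> (d \<otimes>\<^sub>o c) d x \<cdot> ((\<alpha>i d c d \<otimes>\<^sub>a idt x) \<cdot> (\<alpha>i d (c \<otimes>\<^sub>o d) x \<cdot> (idt d \<otimes>\<^sub>a \<alpha>i c d x)))"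
      by (simp only: pentagon_inv dual_obj x)
    finally show ?thesis by (simp add: interchange)
  qed
  have s3: "\<alpha>i d (c \<otimes>\<^sub>o d) x \<cdot> (idt d \<otimes>\<^sub>a (coev \<otimes>\<^sub>a idt x)) = ((idt d \<otimes>\<^sub>a coev) \<otimes>\<^sub>a idt x) \<cdot> \<alpha>i d \<I> x"
    using associ_nat[of "idt d" coev "idt x"] by simp
  have s4: "\<alpha>i d \<I> x \<cdot> (idt d \<otimes>\<^sub>a lui x) = rui d \<otimes>\<^sub>a idt x" by (simp add: triangle_inv)
  have s5: "(ev \<otimes>\<^sub>a idt (d \<otimes>\<^sub>o x)) \<cdot> \<alpha> (d \<otimes>\<^sub>o c) d x = \<alpha> \<I> d x \<cdot> ((ev \<otimes>\<^sub>a idt d) \<otimes>\<^sub>a idt x)"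
    using assoc_nat[of ev "idt d" "idt x"] by simp
  have s6: "lu (d \<otimes>\<^sub>o x) \<cdot> \<alpha> \<I> d x = lu d \<otimes>\<^sub>a idt x" by (simp add: lunit_tensor)
  have "counit (d \<otimes>\<^sub>o x) \<cdot> (idt d \<otimes>\<^sub>a unit x) = lu (d \<otimes>\<^sub>o x) \<cdot> ((ev \<otimes>\<^sub>a idt (d \<otimes>\<^sub>o x)) \<cdot>
    (\<alpha>i d c (d \<otimes>\<^sub>o x) \<cdot> ((idt d \<otimes>\<^sub>a \<alpha> c d x) \<cdot> ((idt d \<otimes>\<^sub>a (coev \<otimes>\<^sub>a idt x)) \<cdot> (idt d \<otimes>\<^sub>a lui x)))))"
    by (simp add: counit_def s1)
  also have "\<dots> = (lu d \<otimes>\<^sub>a idt x) \<cdot> (((ev \<otimes>\<^sub>a idt d) \<otimes>\<^sub>a idt x) \<cdot>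
    ((\<alpha>i d c d \<otimes>\<^sub>a idt x) \<cdot> (((idt d \<otimes>\<^sub>a coev) \<otimes>\<^sub>a idt x) \<cdot> (rui d \<otimes>\<^sub>a idt x))))"
    by (simp add: comp_reassoc[OF s2] comp_reassoc[OF s3] s4 comp_reassoc[OF s5] comp_reassoc[OF s6])
  also have "\<dots> = ((lu d \<cdot> ((ev \<otimes>\<^sub>a idt d) \<cdot> (\<alpha>i d c d \<cdot> (idt d \<otimes>\<^sub>a coev)))) \<cdot> rui d) \<otimes>\<^sub>a idt x"
    by (simp add: interchange)
  also have "\<dots> = idt (d \<otimes>\<^sub>o x)" unfolding zigzag2 by simp
  finally show ?thesis .
qed

text \<open>Reduces in the same manner to the other zigzag equation, that of \<open>c\<close>,
  tensored with \<open>idt y\<close>.\<close>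

lemma triangle_right:
  assumes y [simp]: "y \<in> Obj A"
  shows "(idt c \<otimes>\<^sub>a counit y) \<cdot> unit (c \<otimes>\<^sub>o y) = idt (c \<otimes>\<^sub>o y)"
proof -
  have s1: "idt c \<otimes>\<^sub>a counit y = (idt c \<otimes>\<^sub>a lu y) \<cdot> ((idt c \<otimes>\<^sub>a (ev \<otimes>\<^sub>a idt y)) \<cdot> (idt c \<otimes>\<^sub>a \<alpha>i d c y))"
    by (simp add: counit_def interchange)
  have s2: "(idt c \<otimes>\<^sub>a \<alpha>i d c y) \<cdot> \<alpha> c d (c \<otimes>\<^sub>o y) =
    \<alpha> c (d \<otimes>\<^sub>o c) y \<cdot> ((\<alpha> c d c \<otimes>\<^sub>a idt y) \<cdot> \<alpha>i (c \<otimes>\<^sub>o d) c y)"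
  proof -
    have "\<alpha> c d (c \<otimes>\<^sub>o y) = (\<alpha> c d (c \<otimes>\<^sub>o y) \<cdot> \<alpha> (c \<otimes>\<^sub>o d) c y) \<cdot> \<alpha>i (c \<otimes>\<^sub>o d) c y" by simp
    also have "\<dots> = ((idt c \<otimes>\<^sub>a \<alpha> d c y) \<cdot> (\<alpha> c (d \<otimes>\<^sub>o c) y \<cdot> (\<alpha> c d c \<otimes>\<^sub>a idt y))) \<cdot> \<alpha>i (c \<otimes>\<^sub>o d) c y"
      by (simp only: pentagon' dual_obj y)
    finally show ?thesis by (simp add: interchange_left)
  qed
  have s3: "\<alpha>i (c \<otimes>\<^sub>o d) c y \<cdot> (coev \<otimes>\<^sub>a idt (c \<otimes>\<^sub>o y)) = ((coev \<otimes>\<^sub>a idt c) \<otimes>\<^sub>a idt y) \<cdot> \<alpha>i \<I> c y"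
    using associ_nat[of coev "idt c" "idt y"] by simp
  have s4: "\<alpha>i \<I> c y \<cdot> lui (c \<otimes>\<^sub>o y) = lui c \<otimes>\<^sub>a idt y"
  proof (rule inverse_unique[of "lu (c \<otimes>\<^sub>o y) \<cdot> \<alpha> \<I> c y" "(\<I> \<otimes>\<^sub>o c) \<otimes>\<^sub>o y" "c \<otimes>\<^sub>o y"])
    show "(lu (c \<otimes>\<^sub>o y) \<cdot> \<alpha> \<I> c y) \<cdot> (lui c \<otimes>\<^sub>a idt y) = idt (c \<otimes>\<^sub>o y)"
      by (simp only: lunit_tensor dual_obj y) (simp add: interchange)
  qed (auto simp: Hom_def)
  have s5: "(idt c \<otimes>\<^sub>a (ev \<otimes>\<^sub>a idt y)) \<cdot> \<alpha> c (d \<otimes>\<^sub>o c) y = \<alpha> c \<I> y \<cdot> ((idt c \<otimes>\<^sub>a ev) \<otimes>\<^sub>a idt y)"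
    using assoc_nat[of "idt c" ev "idt y"] by simp
  have s6: "(idt c \<otimes>\<^sub>a lu y) \<cdot> \<alpha> c \<I> y = ru c \<otimes>\<^sub>a idt y" by (simp add: triangle)
  have "(idt c \<otimes>\<^sub>a counit y) \<cdot> unit (c \<otimes>\<^sub>o y) = (idt c \<otimes>\<^sub>a lu y) \<cdot> ((idt c \<otimes>\<^sub>a (ev \<otimes>\<^sub>a idt y)) \<cdot>
    ((idt c \<otimes>\<^sub>a \<alpha>i d c y) \<cdot> (\<alpha> c d (c \<otimes>\<^sub>o y) \<cdot> ((coev \<otimes>\<^sub>a idt (c \<otimes>\<^sub>o y)) \<cdot> lui (c \<otimes>\<^sub>o y)))))"
    by (simp add: unit_def s1)
  also have "\<dots> = (ru c \<otimes>\<^sub>a idt y) \<cdot> (((idt c \<otimes>\<^sub>a ev) \<otimes>\<^sub>a idt y) \<cdot>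
    ((\<alpha> c d c \<otimes>\<^sub>a idt y) \<cdot> (((coev \<otimes>\<^sub>a idt c) \<otimes>\<^sub>a idt y) \<cdot> (lui c \<otimes>\<^sub>a idt y))))"
    by (simp add: comp_reassoc[OF s2] comp_reassoc[OF s3] s4 comp_reassoc[OF s5] comp_reassoc[OF s6])
  also have "\<dots> = ((ru c \<cdot> ((idt c \<otimes>\<^sub>a ev) \<cdot> (\<alpha> c d c \<cdot> (coev \<otimes>\<^sub>a idt c)))) \<cdot> lui c) \<otimes>\<^sub>a idt y"
    by (simp add: interchange)
  also have "\<dots> = idt (c \<otimes>\<^sub>o y)" unfolding zigzag1 by simp
  finally show ?thesis .
qed

end

end


context linear_monoidal_category
begin

context
  fixes c d ev coev
  assumes dual: "duality A c d ev coev"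
begin

lemmas ds = dual_obj[OF dual] dual_ev[OF dual] dual_coev[OF dual] counit_simps[OF dual] unit_simps[OF dual]

text \<open>Adjoint transposition between \<open>Hom(d \<otimes> x, y)\<close> and
  \<open>Hom(x, c \<otimes> y)\<close>. The object \<open>x\<close>, and \<open>y\<close> in
  \<open>luntrans\<close>, is an argument because it cannot be recovered from the tensor product at
  which the arrow starts or ends.\<close>

definition "ltrans x f = (idt c \<otimes>\<^sub>a f) \<cdot> unit c d coev x"
definition "luntrans y g = counit c d ev y \<cdot> (idt d \<otimes>\<^sub>a g)"

lemma ltrans_simps:
  assumes "x \<in> Obj A" "f \<in> Arr A" "Dom A f = d \<otimes>\<^sub>o x"
  shows "ltrans x f \<in> Arr A" "Dom A (ltrans x f) = x" "Cod A (ltrans x f) = c \<otimes>\<^sub>o Cod A f"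
  using assms by (simp_all add: ltrans_def ds)

lemma luntrans_simps:
  assumes "y \<in> Obj A" "g \<in> Arr A" "Cod A g = c \<otimes>\<^sub>o y"
  shows "luntrans y g \<in> Arr A" "Dom A (luntrans y g) = d \<otimes>\<^sub>o Dom A g" "Cod A (luntrans y g) = y"
  using assms by (simp_all add: luntrans_def ds)

lemma luntrans_ltrans:
  assumes "x \<in> Obj A" "f \<in> Arr A" "Dom A f = d \<otimes>\<^sub>o x" "y = Cod A f"
  shows "luntrans y (ltrans x f) = f"
proof -
  have "luntrans y (ltrans x f) = counit c d ev (Cod A f) \<cdot> ((idt d \<otimes>\<^sub>a (idt c \<otimes>\<^sub>a f)) \<cdot> (idt d \<otimes>\<^sub>a unit c d coev x))"
    using assms by (simp add: luntrans_def ltrans_def ds interchange)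
  also have "\<dots> = (f \<cdot> counit c d ev (d \<otimes>\<^sub>o x)) \<cdot> (idt d \<otimes>\<^sub>a unit c d coev x)"
    using assms counit_nat[OF dual assms(2)] by (intro comp_reassoc) (simp_all add: ds)
  also have "\<dots> = f" using assms by (simp add: ds triangle_left[OF dual])
  finally show ?thesis .
qed

lemma ltrans_luntrans:
  assumes "y \<in> Obj A" "g \<in> Arr A" "Cod A g = c \<otimes>\<^sub>o y" "x = Dom A g"
  shows "ltrans x (luntrans y g) = g"
proof -
  have "ltrans x (luntrans y g) = (idt c \<otimes>\<^sub>a counit c d ev y) \<cdot> ((idt c \<otimes>\<^sub>a (idt d \<otimes>\<^sub>a g)) \<cdot> unit c d coev (Dom A g))"
    using assms by (simp add: luntrans_def ltrans_def ds interchange_left)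
  also have "\<dots> = (idt c \<otimes>\<^sub>a counit c d ev y) \<cdot> (unit c d coev (c \<otimes>\<^sub>o y) \<cdot> g)"
    using unit_nat[OF dual assms(2)] assms by simp
  also have "\<dots> = idt (c \<otimes>\<^sub>o y) \<cdot> g"
    using assms by (intro comp_reassoc triangle_right[OF dual]) (simp_all add: ds)
  also have "\<dots> = g" using assms by simp
  finally show ?thesis .
qed

lemma ltrans_post:
  assumes "x \<in> Obj A" "f \<in> Arr A" "Dom A f = d \<otimes>\<^sub>o x" "g \<in> Arr A" "Dom A g = Cod A f"
  shows "ltrans x (g \<cdot> f) = (idt c \<otimes>\<^sub>a g) \<cdot> ltrans x f"
  using assms by (simp add: ltrans_def ds interchange_left)

lemma ltrans_pre:
  assumes "x \<in> Obj A" "f \<in> Arr A" "Dom A f = d \<otimes>\<^sub>o x" "h \<in> Arr A" "Cod A h = x" "x' = Dom A h"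
  shows "ltrans x' (f \<cdot> (idt d \<otimes>\<^sub>a h)) = ltrans x f \<cdot> h"
proof -
  have "ltrans x f \<cdot> h = (idt c \<otimes>\<^sub>a f) \<cdot> (unit c d coev (Cod A h) \<cdot> h)"
    using assms by (simp add: ltrans_def ds)
  also have "\<dots> = ltrans x' (f \<cdot> (idt d \<otimes>\<^sub>a h))"
    unfolding unit_nat[OF dual assms(4)] using assms by (simp add: ltrans_def ds interchange_left)
  finally show ?thesis by simp
qed

lemma luntrans_post:
  assumes "y \<in> Obj A" "g \<in> Arr A" "Cod A g = c \<otimes>\<^sub>o y" "k \<in> Arr A" "Dom A k = y" "y' = Cod A k"
  shows "luntrans y' ((idt c \<otimes>\<^sub>a k) \<cdot> g) = k \<cdot> luntrans y g"
proof -
  have "luntrans y' ((idt c \<otimes>\<^sub>a k) \<cdot> g) = counit c d ev (Cod A k) \<cdot> ((idt d \<otimes>\<^sub>a (idt c \<otimes>\<^sub>a k)) \<cdot> (idt d \<otimes>\<^sub>a g))"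
    using assms by (simp add: luntrans_def ds interchange)
  also have "\<dots> = (k \<cdot> counit c d ev (Dom A k)) \<cdot> (idt d \<otimes>\<^sub>a g)"
    using assms counit_nat[OF dual assms(4)] by (intro comp_reassoc) (simp_all add: ds)
  also have "\<dots> = k \<cdot> luntrans y g" using assms by (simp add: luntrans_def ds)
  finally show ?thesis .
qed

lemma luntrans_pre:
  assumes "y \<in> Obj A" "g \<in> Arr A" "Cod A g = c \<otimes>\<^sub>o y" "h \<in> Arr A" "Cod A h = Dom A g"
  shows "luntrans y (g \<cdot> h) = luntrans y g \<cdot> (idt d \<otimes>\<^sub>a h)"
  using assms by (simp add: luntrans_def ds interchange)

lemma counit_unit_obj: "counit c d ev \<I> = ev \<cdot> (idt d \<otimes>\<^sub>a ru c)"
proof -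
  have "counit c d ev \<I> = ru \<I> \<cdot> ((ev \<otimes>\<^sub>a idt \<I>) \<cdot> \<alpha>i d c \<I>)"
    by (simp add: counit_def[OF dual] lunit_eq_runit)
  also have "\<dots> = (ev \<cdot> ru (d \<otimes>\<^sub>o c)) \<cdot> \<alpha>i d c \<I>"
    using runit_nat[of ev] by (intro comp_reassoc) (simp_all add: ds)
  also have "\<dots> = ev \<cdot> (idt d \<otimes>\<^sub>a ru c)" by (simp add: ds runit_tensor)
  finally show ?thesis .
qed

text \<open>Transposition with \<open>y = \<I>\<close>: every pairing of \<open>d\<close> with an
  object \<open>x\<close> factors through \<open>ev\<close>. With
  \<open>dual_transpose_unique\<close> this says that \<open>ev\<close> is the universal pairing
  with \<open>d\<close> on the left.\<close>

lemma dual_transpose: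
  assumes "x \<in> Obj A" "e \<in> Hom A (d \<otimes>\<^sub>o x) \<I>"
  shows "ev \<cdot> (idt d \<otimes>\<^sub>a (ru c \<cdot> ltrans x e)) = e"
proof -
  have e: "e \<in> Arr A" "Dom A e = d \<otimes>\<^sub>o x" "Cod A e = \<I>" using assms(2) by (auto simp: Hom_def)
  note t = ltrans_simps[OF assms(1) e(1,2)]
  have "ev \<cdot> (idt d \<otimes>\<^sub>a (ru c \<cdot> ltrans x e)) = ev \<cdot> ((idt d \<otimes>\<^sub>a ru c) \<cdot> (idt d \<otimes>\<^sub>a ltrans x e))"
    using t e by (simp add: ds interchange)
  also have "\<dots> = counit c d ev \<I> \<cdot> (idt d \<otimes>\<^sub>a ltrans x e)"
    using t e by (intro comp_reassoc) (simp_all add: ds counit_unit_obj)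
  also have "\<dots> = e" using luntrans_ltrans[OF assms(1) e(1,2) refl] e by (simp add: luntrans_def)
  finally show ?thesis .
qed

lemma dual_transpose_unique:
  assumes "k \<in> Hom A x c"
  shows "ru c \<cdot> ltrans x (ev \<cdot> (idt d \<otimes>\<^sub>a k)) = k"
proof -
  have k: "k \<in> Arr A" "Dom A k = x" "Cod A k = c" "x \<in> Obj A" using assms by (auto simp: Hom_def)
  have "ru c \<cdot> ltrans c ev = (ru c \<cdot> ((idt c \<otimes>\<^sub>a ev) \<cdot> (\<alpha> c d c \<cdot> (coev \<otimes>\<^sub>a idt c)))) \<cdot> lui c"
    by (simp add: ltrans_def unit_def[OF dual] ds)
  also have "\<dots> = idt c" unfolding zigzag1[OF dual] by (simp add: ds)
  finally have z: "ru c \<cdot> ltrans c ev = idt c" .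
  have "ltrans x (ev \<cdot> (idt d \<otimes>\<^sub>a k)) = ltrans c ev \<cdot> k"
    using k by (intro ltrans_pre) (simp_all add: ds)
  then show ?thesis using comp_reassoc[OF z, of k] k ltrans_simps[of c ev] by (simp add: ds)
qed

end

end

section \<open>Left duals of arrows and dinaturality of evaluation and coevaluation\<close>

context rigid_linear_monoidal_category
begin

abbreviation "ld \<equiv> ldual A"
abbreviation "lev \<equiv> lev_arr A"
abbreviation "lcoev \<equiv> lcoev_arr A"
abbreviation "tr c \<equiv> ltrans (ld c) c (lcoev c)"
abbreviation "un c \<equiv> luntrans (ld c) c (lev c)"
abbreviation "cu c \<equiv> counit (ld c) c (lev c)"
abbreviation "uu c \<equiv> unit (ld c) c (lcoev c)"

lemma ldual_simps [simp]:
  assumes "c \<in> Obj A"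
  shows "ld c \<in> Obj A" "lev c \<in> Arr A" "Dom A (lev c) = c \<otimes>\<^sub>o ld c" "Cod A (lev c) = \<I>"
    "lcoev c \<in> Arr A" "Dom A (lcoev c) = \<I>" "Cod A (lcoev c) = ld c \<otimes>\<^sub>o c"
    "y \<in> Obj A \<Longrightarrow> cu c y \<in> Arr A" "y \<in> Obj A \<Longrightarrow> Dom A (cu c y) = c \<otimes>\<^sub>o (ld c \<otimes>\<^sub>o y)"
    "y \<in> Obj A \<Longrightarrow> Cod A (cu c y) = y"
    "x \<in> Obj A \<Longrightarrow> uu c x \<in> Arr A" "x \<in> Obj A \<Longrightarrow> Dom A (uu c x) = x"
    "x \<in> Obj A \<Longrightarrow> Cod A (uu c x) = ld c \<otimes>\<^sub>o (c \<otimes>\<^sub>o x)"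
  using ds[OF left_dual[OF assms]] by auto

lemmas tr_simps [simp] = ltrans_simps[OF left_dual]
lemmas un_simps [simp] = luntrans_simps[OF left_dual]

lemma tr_def: "c \<in> Obj A \<Longrightarrow> tr c x f = (idt (ld c) \<otimes>\<^sub>a f) \<cdot> uu c x"
  by (rule ltrans_def[OF left_dual])

lemma un_def: "c \<in> Obj A \<Longrightarrow> un c y g = cu c y \<cdot> (idt c \<otimes>\<^sub>a g)"
  by (rule luntrans_def[OF left_dual])

text \<open>Naturality of the associator exhibits the dual arrow as the transpose of a pairing. From
  then on it is handled through \<open>ldual_mate\<close>, which characterises it by
  \<open>ldual_eqI\<close>.\<close>

lemma ldual_arr_eq:
  assumes f: "f \<in> Arr A"
  shows "ldual_arr A f = ru (ld (Dom A f)) \<cdot> tr (Dom A f) (ld (Cod A f)) (lev (Cod A f) \<cdot> (f \<otimes>\<^sub>a idt (ld (Cod A f))))"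
proof -
  let ?c = "Dom A f" and ?d = "Cod A f"
  have o: "?c \<in> Obj A" "?d \<in> Obj A" using f by auto
  have "ldual_arr A f = ru (ld ?c) \<cdot> ((idt (ld ?c) \<otimes>\<^sub>a lev ?d) \<cdot> (\<alpha> (ld ?c) ?d (ld ?d) \<cdot>
     (((idt (ld ?c) \<otimes>\<^sub>a f) \<otimes>\<^sub>a idt (ld ?d)) \<cdot> ((lcoev ?c \<otimes>\<^sub>a idt (ld ?d)) \<cdot> lui (ld ?d)))))"
    unfolding ldual_arr_def Let_def by (subst comp_ass6) (use f o in simp_all)
  also have "\<dots> = ru (ld ?c) \<cdot> ((idt (ld ?c) \<otimes>\<^sub>a lev ?d) \<cdot> (((idt (ld ?c) \<otimes>\<^sub>a (f \<otimes>\<^sub>a idt (ld ?d))) \<cdot> \<alpha> (ld ?c) ?c (ld ?d)) \<cdot>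
     ((lcoev ?c \<otimes>\<^sub>a idt (ld ?d)) \<cdot> lui (ld ?d))))"
    using comp_reassoc[OF assoc_nat[of "idt (ld ?c)" f "idt (ld ?d)"]] f o by simp
  also have "\<dots> = ru (ld ?c) \<cdot> tr ?c (ld ?d) (lev ?d \<cdot> (f \<otimes>\<^sub>a idt (ld ?d)))"
    using f o by (simp add: tr_def unit_def[OF left_dual] interchange_left)
  finally show ?thesis .
qed

lemma ldual_arr_simps [simp]:
  assumes "f \<in> Arr A"
  shows "ldual_arr A f \<in> Arr A" "Dom A (ldual_arr A f) = ld (Cod A f)" "Cod A (ldual_arr A f) = ld (Dom A f)"
  using assms by (simp_all add: ldual_arr_eq)

lemma ldual_mate:
  assumes f: "f \<in> Arr A"
  shows "lev (Dom A f) \<cdot> (idt (Dom A f) \<otimes>\<^sub>a ldual_arr A f) = lev (Cod A f) \<cdot> (f \<otimes>\<^sub>a idt (ld (Cod A f)))"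
  unfolding ldual_arr_eq[OF f] using f by (intro dual_transpose[OF left_dual]) (auto simp: Hom_def)

lemma ldual_eqI:
  assumes "c \<in> Obj A" "k \<in> Hom A x (ld c)" "k' \<in> Hom A x (ld c)"
    "lev c \<cdot> (idt c \<otimes>\<^sub>a k) = lev c \<cdot> (idt c \<otimes>\<^sub>a k')"
  shows "k = k'"
  by (rule trans[OF dual_transpose_unique[OF left_dual[OF assms(1)] assms(2), unfolded assms(4), symmetric]
        dual_transpose_unique[OF left_dual[OF assms(1)] assms(3)]])

lemma ldual_id: "c \<in> Obj A \<Longrightarrow> ldual_arr A (idt c) = idt (ld c)"
  by (rule ldual_eqI[of c _ "ld c"]) (use ldual_mate[of "idt c"] in \<open>auto simp: Hom_def\<close>)

lemma ldual_comp:
  assumes "f \<in> Arr A" "g \<in> Arr A" "Cod A f = Dom A g"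
  shows "ldual_arr A (g \<cdot> f) = ldual_arr A f \<cdot> ldual_arr A g"
proof (rule ldual_eqI[of "Dom A f" _ "ld (Cod A g)"])
  let ?b = "Dom A f" and ?c = "Cod A f" and ?d = "Cod A g"
  have "lev ?b \<cdot> (idt ?b \<otimes>\<^sub>a (ldual_arr A f \<cdot> ldual_arr A g)) =
    lev ?b \<cdot> ((idt ?b \<otimes>\<^sub>a ldual_arr A f) \<cdot> (idt ?b \<otimes>\<^sub>a ldual_arr A g))"
    using assms by (simp add: interchange)
  also have "\<dots> = (lev ?c \<cdot> (f \<otimes>\<^sub>a idt (ld ?c))) \<cdot> (idt ?b \<otimes>\<^sub>a ldual_arr A g)"
    using assms by (intro comp_reassoc ldual_mate) auto
  also have "\<dots> = lev ?c \<cdot> ((idt ?c \<otimes>\<^sub>a ldual_arr A g) \<cdot> (f \<otimes>\<^sub>a idt (ld ?d)))"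
    using assms by (simp add: interchange)
  also have "\<dots> = (lev ?d \<cdot> (g \<otimes>\<^sub>a idt (ld ?d))) \<cdot> (f \<otimes>\<^sub>a idt (ld ?d))"
    using assms ldual_mate[of g] by (intro comp_reassoc) auto
  also have "\<dots> = lev ?b \<cdot> (idt ?b \<otimes>\<^sub>a ldual_arr A (g \<cdot> f))"
    using assms ldual_mate[of "g \<cdot> f"] by (simp add: interchange)
  finally show "lev ?b \<cdot> (idt ?b \<otimes>\<^sub>a ldual_arr A (g \<cdot> f)) = lev ?b \<cdot> (idt ?b \<otimes>\<^sub>a (ldual_arr A f \<cdot> ldual_arr A g))"
    by simp
qed (use assms in \<open>auto simp: Hom_def\<close>)

text \<open>This is \<open>ldual_mate\<close> tensored with \<open>a\<close> and conjugated by the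
  associator; it lets \<open>f\<close> pass from the object \<open>Dom A f\<close> to its
  dual.\<close>

lemma counit_dinat:
  assumes f: "f \<in> Arr A" and a: "a \<in> Obj A"
  shows "cu (Dom A f) a \<cdot> (idt (Dom A f) \<otimes>\<^sub>a (ldual_arr A f \<otimes>\<^sub>a idt a)) =
    cu (Cod A f) a \<cdot> (f \<otimes>\<^sub>a idt (ld (Cod A f) \<otimes>\<^sub>o a))"
proof -
  let ?c = "Dom A f" and ?d = "Cod A f"
  have "cu ?c a \<cdot> (idt ?c \<otimes>\<^sub>a (ldual_arr A f \<otimes>\<^sub>a idt a)) =
    lu a \<cdot> ((lev ?c \<otimes>\<^sub>a idt a) \<cdot> (\<alpha>i ?c (ld ?c) a \<cdot> (idt ?c \<otimes>\<^sub>a (ldual_arr A f \<otimes>\<^sub>a idt a))))"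
    using assms by (simp add: counit_def[OF left_dual])
  also have "\<dots> = lu a \<cdot> (((lev ?c \<cdot> (idt ?c \<otimes>\<^sub>a ldual_arr A f)) \<otimes>\<^sub>a idt a) \<cdot> \<alpha>i ?c (ld ?d) a)"
    using assms associ_nat[of "idt ?c" "ldual_arr A f" "idt a"] by (simp add: interchange_left)
  also have "\<dots> = lu a \<cdot> ((lev ?d \<otimes>\<^sub>a idt a) \<cdot> (((f \<otimes>\<^sub>a idt (ld ?d)) \<otimes>\<^sub>a idt a) \<cdot> \<alpha>i ?c (ld ?d) a))"
    unfolding ldual_mate[OF f] using assms by (simp add: interchange_left)
  also have "\<dots> = lu a \<cdot> ((lev ?d \<otimes>\<^sub>a idt a) \<cdot> (\<alpha>i ?d (ld ?d) a \<cdot> (f \<otimes>\<^sub>a (idt (ld ?d) \<otimes>\<^sub>a idt a))))"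
    using assms associ_nat[of f "idt (ld ?d)" "idt a"] by (simp del: tensor_id)
  also have "\<dots> = cu ?d a \<cdot> (f \<otimes>\<^sub>a idt (ld ?d \<otimes>\<^sub>o a))"
    using assms by (simp add: counit_def[OF left_dual])
  finally show ?thesis .
qed

text \<open>Transposition is injective, so both sides are compared after applying \<open>un\<close>.
  By \<open>counit_dinat\<close> on the left and naturality on the right, each becomes
  \<open>h\<close> composed with the right unitor.\<close>

lemma lcoev_dinat:
  assumes h: "h \<in> Arr A"
  shows "(ldual_arr A h \<otimes>\<^sub>a idt (Cod A h)) \<cdot> lcoev (Cod A h) = (idt (ld (Dom A h)) \<otimes>\<^sub>a h) \<cdot> lcoev (Dom A h)"
    (is "?l = ?r")
proof -
  let ?x = "Dom A h" and ?y = "Cod A h"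
  \<comment> \<open>The second zigzag equation, read as a statement about the transpose of the
    coevaluation.\<close>
  have z: "un c c (lcoev c) = ru c" if "c \<in> Obj A" for c
    using zigzag2[OF left_dual[OF that]] that by (simp add: un_def counit_def[OF left_dual])
  have t: "?l \<in> Arr A" "Dom A ?l = \<I>" "Cod A ?l = ld ?x \<otimes>\<^sub>o ?y" "?r \<in> Arr A" "Dom A ?r = \<I>" "Cod A ?r = ld ?x \<otimes>\<^sub>o ?y"
    using h by auto
  have "un ?x ?y ?l = cu ?x ?y \<cdot> ((idt ?x \<otimes>\<^sub>a (ldual_arr A h \<otimes>\<^sub>a idt ?y)) \<cdot> (idt ?x \<otimes>\<^sub>a lcoev ?y))"
    using h by (simp add: un_def interchange)
  also have "\<dots> = (cu ?y ?y \<cdot> (h \<otimes>\<^sub>a idt (ld ?y \<otimes>\<^sub>o ?y))) \<cdot> (idt ?x \<otimes>\<^sub>a lcoev ?y)"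
    using h by (intro comp_reassoc counit_dinat) auto
  also have "\<dots> = cu ?y ?y \<cdot> ((idt ?y \<otimes>\<^sub>a lcoev ?y) \<cdot> (h \<otimes>\<^sub>a idt \<I>))"
    using h by (simp add: interchange)
  also have "\<dots> = un ?y ?y (lcoev ?y) \<cdot> (h \<otimes>\<^sub>a idt \<I>)"
    using h by (simp add: un_def)
  also have "\<dots> = h \<cdot> ru ?x" using h by (simp add: z runit_nat)
  also have "\<dots> = h \<cdot> un ?x ?x (lcoev ?x)" using h by (simp add: z)
  also have "\<dots> = un ?x ?y ?r" using h by (intro luntrans_post[OF left_dual, symmetric]) auto
  finally have "tr ?x \<I> (un ?x ?y ?l) = tr ?x \<I> (un ?x ?y ?r)" by simp
  then show ?thesis
    using ltrans_luntrans[OF left_dual, of ?x ?y ?l \<I>] ltrans_luntrans[OF left_dual, of ?x ?y ?r \<I>] h t by simp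
qed

lemma unit_dinat:
  assumes h: "h \<in> Arr A" and a: "a \<in> Obj A"
  shows "(ldual_arr A h \<otimes>\<^sub>a idt (Cod A h \<otimes>\<^sub>o a)) \<cdot> uu (Cod A h) a =
    (idt (ld (Dom A h)) \<otimes>\<^sub>a (h \<otimes>\<^sub>a idt a)) \<cdot> uu (Dom A h) a"
proof -
  let ?x = "Dom A h" and ?y = "Cod A h"
  have "(ldual_arr A h \<otimes>\<^sub>a idt (?y \<otimes>\<^sub>o a)) \<cdot> uu ?y a =
    (ldual_arr A h \<otimes>\<^sub>a (idt ?y \<otimes>\<^sub>a idt a)) \<cdot> (\<alpha> (ld ?y) ?y a \<cdot> ((lcoev ?y \<otimes>\<^sub>a idt a) \<cdot> lui a))"
    using assms by (simp add: unit_def[OF left_dual])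
  also have "\<dots> = (\<alpha> (ld ?x) ?y a \<cdot> ((ldual_arr A h \<otimes>\<^sub>a idt ?y) \<otimes>\<^sub>a idt a)) \<cdot> ((lcoev ?y \<otimes>\<^sub>a idt a) \<cdot> lui a)"
    using assms assoc_nat[of "ldual_arr A h" "idt ?y" "idt a"] by (intro comp_reassoc) auto
  also have "\<dots> = \<alpha> (ld ?x) ?y a \<cdot> (((idt (ld ?x) \<otimes>\<^sub>a h) \<otimes>\<^sub>a idt a) \<cdot> ((lcoev ?x \<otimes>\<^sub>a idt a) \<cdot> lui a))"
    using assms by (simp add: interchange_left lcoev_dinat)
  also have "\<dots> = ((idt (ld ?x) \<otimes>\<^sub>a (h \<otimes>\<^sub>a idt a)) \<cdot> \<alpha> (ld ?x) ?x a) \<cdot> ((lcoev ?x \<otimes>\<^sub>a idt a) \<cdot> lui a)"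
    using assms assoc_nat[of "idt (ld ?x)" h "idt a"] by (intro comp_reassoc) auto
  also have "\<dots> = (idt (ld ?x) \<otimes>\<^sub>a (h \<otimes>\<^sub>a idt a)) \<cdot> uu ?x a"
    using assms by (simp add: unit_def[OF left_dual])
  finally show ?thesis .
qed

lemma left_double_dual_functor: "is_functor A A (left_double_dual A)"
proof (rule is_functor.intro)
  show "is_functor_axioms A A (left_double_dual A)"
    by unfold_locales (auto simp: left_double_dual_def Hom_def ldual_id ldual_comp)
qed unfold_locales

lemma tensor_on_right_functor:
  assumes F: "is_functor A A F" and D: "D \<in> Obj A"
  shows "is_functor A A (tensor_on_right A F D)"
proof -
  interpret F: is_functor A A F by (rule F)
  have h: "on_arr F f \<in> Arr A" "Dom A (on_arr F f) = on_obj F (Dom A f)" "Cod A (on_arr F f) = on_obj F (Cod A f)"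
    if "f \<in> Arr A" for f
    using F.arr_map[of f "Dom A f" "Cod A f"] that by (auto simp: Hom_def)
  show ?thesis
  proof (rule is_functor.intro)
    show "is_functor_axioms A A (tensor_on_right A F D)"
    proof (unfold_locales, goal_cases)
      case (4 f a b g c)
      then show ?case using h D F.comp_map[OF 4] by (simp add: tensor_on_right_def interchange Hom_def)
    qed (use D in \<open>auto simp: tensor_on_right_def Hom_def h F.obj_map F.id_map\<close>)
  qed unfold_locales
qed

end


section \<open>The Nakayama functor of a rigid category\<close>

context linear_category
begin

lemma nak_family_lin:
  "nak_family C c d \<sigma> \<Longrightarrow> a \<in> Obj C \<Longrightarrow> \<sigma> a \<in> linear_maps (dual_space (hom_space C c a)) (hom_space C a d)"
  by (simp add: nak_family_def)

lemma nak_family_hom: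
  "nak_family C c d \<sigma> \<Longrightarrow> a \<in> Obj C \<Longrightarrow> \<xi> \<in> carrier (dual_space (hom_space C c a)) \<Longrightarrow> \<sigma> a \<xi> \<in> Hom C a d"
  using lin_closed[OF nak_family_lin] by simp

lemma nak_family_nat:
  assumes "nak_family C c d \<sigma>" "h \<in> Hom C a b" "\<xi> \<in> carrier (dual_space (hom_space C c b))"
  shows "\<sigma> a (dual_map (hom_space C c a) (\<lambda>k. h \<cdot> k) \<xi>) = \<sigma> b \<xi> \<cdot> h"
  using assms hom_dom[OF assms(2)] hom_cod[OF assms(2)] by (simp add: nak_family_def)

lemma nak_univ_family: "nak_univ C c n \<iota> \<Longrightarrow> nak_family C c n \<iota>"
  by (simp add: nak_univ_def)

lemma nak_family_post:
  assumes \<iota>: "nak_family C c n \<iota>" and s: "s \<in> Hom C n d"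
  shows "nak_family C c d (\<lambda>a \<xi>. s \<cdot> \<iota> a \<xi>)"
  unfolding nak_family_def
proof (intro conjI ballI)
  show "d \<in> Obj C" by (rule hom_cod[OF s])
  show "(\<lambda>\<xi>. s \<cdot> \<iota> a \<xi>) \<in> linear_maps (dual_space (hom_space C c a)) (hom_space C a d)" if a: "a \<in> Obj C" for a
    by (rule lin_comp[OF nak_family_lin[OF \<iota> a] comp_linear_right[OF a s]])
  fix a b h \<xi> assume a: "a \<in> Obj C" "b \<in> Obj C" and h: "h \<in> Hom C a b"
    and \<xi>: "\<xi> \<in> carrier (dual_space (hom_space C c b))"
  show "s \<cdot> \<iota> a (dual_map (hom_space C c a) (\<lambda>k. h \<cdot> k) \<xi>) = (s \<cdot> \<iota> b \<xi>) \<cdot> h"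
    using nak_family_nat[OF \<iota> h \<xi>] comp_assoc[OF h nak_family_hom[OF \<iota> a(2) \<xi>] s] by simp
qed

lemma nak_univ_ex:
  assumes "nak_univ C c n \<iota>" "nak_family C c d \<sigma>"
  obtains t where "t \<in> Hom C n d"
    "\<And>a \<xi>. a \<in> Obj C \<Longrightarrow> \<xi> \<in> carrier (dual_space (hom_space C c a)) \<Longrightarrow> t \<cdot> \<iota> a \<xi> = \<sigma> a \<xi>"
  using assms unfolding nak_univ_def by metis

lemma nak_univ_eqI:
  assumes \<iota>: "nak_univ C c n \<iota>" and s: "s \<in> Hom C n d" "s' \<in> Hom C n d"
    and eq: "\<And>a \<xi>. a \<in> Obj C \<Longrightarrow> \<xi> \<in> carrier (dual_space (hom_space C c a)) \<Longrightarrow> s \<cdot> \<iota> a \<xi> = s' \<cdot> \<iota> a \<xi>"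
  shows "s = s'"
proof -
  have "\<exists>!t. t \<in> Hom C n d \<and> (\<forall>a\<in>Obj C. \<forall>\<xi>\<in>carrier (dual_space (hom_space C c a)). t \<cdot> \<iota> a \<xi> = s \<cdot> \<iota> a \<xi>)"
    using \<iota> nak_family_post[OF nak_univ_family[OF \<iota>] s(1)] unfolding nak_univ_def by blast
  then show ?thesis using s eq by (elim ex1E) (metis (no_types, lifting))
qed

lemma nak_univ_iso:
  assumes \<iota>: "nak_univ C c n \<iota>" and \<kappa>: "nak_univ C c n' \<kappa>"
  obtains t where "t \<in> Hom C n n'" "iso_arrow C t"
    "\<And>a \<xi>. a \<in> Obj C \<Longrightarrow> \<xi> \<in> carrier (dual_space (hom_space C c a)) \<Longrightarrow> t \<cdot> \<iota> a \<xi> = \<kappa> a \<xi>"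
proof -
  obtain t where t: "t \<in> Hom C n n'"
    "\<And>a \<xi>. a \<in> Obj C \<Longrightarrow> \<xi> \<in> carrier (dual_space (hom_space C c a)) \<Longrightarrow> t \<cdot> \<iota> a \<xi> = \<kappa> a \<xi>"
    using nak_univ_ex[OF \<iota> nak_univ_family[OF \<kappa>]] by blast
  obtain s where s: "s \<in> Hom C n' n"
    "\<And>a \<xi>. a \<in> Obj C \<Longrightarrow> \<xi> \<in> carrier (dual_space (hom_space C c a)) \<Longrightarrow> s \<cdot> \<kappa> a \<xi> = \<iota> a \<xi>"
    using nak_univ_ex[OF \<kappa> nak_univ_family[OF \<iota>]] by blast
  note h = nak_family_hom[OF nak_univ_family[OF \<iota>]] nak_family_hom[OF nak_univ_family[OF \<kappa>]]
  have 1: "s \<cdot> t = Idt C n"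
    by (rule nak_univ_eqI[OF \<iota> comp_in_hom[OF t(1) s(1)] id_in_hom[OF hom_dom[OF t(1)]]])
      (simp add: comp_assoc[OF h(1) t(1) s(1)] t(2) s(2) comp_id_left[OF h(1)])
  have 2: "t \<cdot> s = Idt C n'"
    by (rule nak_univ_eqI[OF \<kappa> comp_in_hom[OF s(1) t(1)] id_in_hom[OF hom_dom[OF s(1)]]])
      (simp add: comp_assoc[OF h(2) s(1) t(1)] t(2) s(2) comp_id_left[OF h(2)])
  show ?thesis by (rule that[OF t(1) iso_arrowI[OF t(1) s(1) 1 2] t(2)])
qed

end

context rigid_linear_monoidal_category
begin

abbreviation "dsp c a \<equiv> dual_space (hom_space A c a)"

text \<open>
  Since \<open>c \<otimes> -\<close> is left adjoint to \<open>ld c \<otimes> -\<close>, which is left adjoint to \<open>ld (ld c) \<otimes> -\<close>, a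
  universal family \<open>\<iota>\<close> at the unit induces one at \<open>c \<cong> c \<otimes> \<I>\<close> by
  \<open>Hom(c, a)* \<cong> Hom(\<I>, ld c \<otimes> a)* \<rightarrow> Hom(ld c \<otimes> a, D) \<cong> Hom(a, ld (ld c) \<otimes> D)\<close>.
\<close>

definition "from_unit c a g = un c a g \<cdot> rui c"
text \<open>This leads from \<open>c\<close> back to the unit, but it is not an inverse of
  \<open>from_unit\<close>: the composites involve the counit (\<open>to_from_unit\<close>) or the
  unit (\<open>from_to_unit\<close>) of the adjunction between \<open>ld c \<otimes> -\<close> and
  \<open>ld (ld c) \<otimes> -\<close>.\<close>

definition "to_unit c b k = cu (ld c) b \<cdot> tr c \<I> (k \<cdot> ru c)"
definition "shift_family c \<iota> a \<xi> =
  tr (ld c) a (\<iota> (ld c \<otimes>\<^sub>o a) (dual_map (hom_space A \<I> (ld c \<otimes>\<^sub>o a)) (from_unit c a) \<xi>))"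

lemma from_unit_simps:
  assumes "c \<in> Obj A" "a \<in> Obj A" "g \<in> Hom A \<I> (ld c \<otimes>\<^sub>o a)"
  shows "from_unit c a g \<in> Hom A c a"
  using assms by (auto simp: from_unit_def Hom_def)

lemma to_unit_simps:
  assumes "c \<in> Obj A" "b \<in> Obj A" "k \<in> Hom A c (ld (ld c) \<otimes>\<^sub>o b)"
  shows "to_unit c b k \<in> Hom A \<I> b"
  using assms by (auto simp: to_unit_def Hom_def)

lemma tensor_left_lin:
  "x \<in> Obj A \<Longrightarrow> a \<in> Obj A \<Longrightarrow> b \<in> Obj A \<Longrightarrow>
    (\<lambda>g. idt x \<otimes>\<^sub>a g) \<in> linear_maps (hom_space A a b) (hom_space A (x \<otimes>\<^sub>o a) (x \<otimes>\<^sub>o b))"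
  by (rule tensor_linear_right) (auto simp: Hom_def)

lemma tr_lin:
  assumes [simp]: "c \<in> Obj A" "x \<in> Obj A" "y \<in> Obj A"
  shows "tr c x \<in> linear_maps (hom_space A (c \<otimes>\<^sub>o x) y) (hom_space A x (ld c \<otimes>\<^sub>o y))"
proof -
  have u: "uu c x \<in> Hom A x (ld c \<otimes>\<^sub>o (c \<otimes>\<^sub>o x))" by (simp add: Hom_def)
  have "(\<lambda>f. (idt (ld c) \<otimes>\<^sub>a f) \<cdot> uu c x) \<in> linear_maps (hom_space A (c \<otimes>\<^sub>o x) y) (hom_space A x (ld c \<otimes>\<^sub>o y))"
    by (rule lin_comp[OF tensor_left_lin comp_linear_left[OF _ u]]) auto
  moreover have "tr c x = (\<lambda>f. (idt (ld c) \<otimes>\<^sub>a f) \<cdot> uu c x)" by (rule ext) (simp add: tr_def)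
  ultimately show ?thesis by simp
qed

lemma un_lin:
  assumes [simp]: "c \<in> Obj A" "x \<in> Obj A" "y \<in> Obj A"
  shows "un c y \<in> linear_maps (hom_space A x (ld c \<otimes>\<^sub>o y)) (hom_space A (c \<otimes>\<^sub>o x) y)"
proof -
  have u: "cu c y \<in> Hom A (c \<otimes>\<^sub>o (ld c \<otimes>\<^sub>o y)) y" by (simp add: Hom_def)
  have "(\<lambda>f. cu c y \<cdot> (idt c \<otimes>\<^sub>a f)) \<in> linear_maps (hom_space A x (ld c \<otimes>\<^sub>o y)) (hom_space A (c \<otimes>\<^sub>o x) y)"
    by (rule lin_comp[OF tensor_left_lin comp_linear_right[OF _ u]]) auto
  moreover have "un c y = (\<lambda>f. cu c y \<cdot> (idt c \<otimes>\<^sub>a f))" by (rule ext) (simp add: un_def)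
  ultimately show ?thesis by simp
qed

lemma from_unit_lin:
  assumes [simp]: "c \<in> Obj A" "a \<in> Obj A"
  shows "from_unit c a \<in> linear_maps (hom_space A \<I> (ld c \<otimes>\<^sub>o a)) (hom_space A c a)"
proof -
  have u: "rui c \<in> Hom A c (c \<otimes>\<^sub>o \<I>)" by (simp add: Hom_def)
  have "(\<lambda>g. un c a g \<cdot> rui c) \<in> linear_maps (hom_space A \<I> (ld c \<otimes>\<^sub>o a)) (hom_space A c a)"
    by (rule lin_comp[OF un_lin comp_linear_left[OF _ u]]) auto
  then show ?thesis by (simp add: from_unit_def[abs_def])
qed

lemma to_unit_lin:
  assumes [simp]: "c \<in> Obj A" "b \<in> Obj A"
  shows "to_unit c b \<in> linear_maps (hom_space A c (ld (ld c) \<otimes>\<^sub>o b)) (hom_space A \<I> b)"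
proof -
  have u: "ru c \<in> Hom A (c \<otimes>\<^sub>o \<I>) c" "cu (ld c) b \<in> Hom A (ld c \<otimes>\<^sub>o (ld (ld c) \<otimes>\<^sub>o b)) b" by (simp_all add: Hom_def)
  have "(\<lambda>k. cu (ld c) b \<cdot> tr c \<I> (k \<cdot> ru c)) \<in> linear_maps (hom_space A c (ld (ld c) \<otimes>\<^sub>o b)) (hom_space A \<I> b)"
    by (rule lin_comp[OF comp_linear_left[OF _ u(1)] lin_comp[OF tr_lin comp_linear_right[OF _ u(2)]]]) auto
  then show ?thesis by (simp add: to_unit_def[abs_def])
qed

lemma from_unit_post:
  assumes "c \<in> Obj A" "h \<in> Hom A a b" "g \<in> Hom A \<I> (ld c \<otimes>\<^sub>o a)"
  shows "from_unit c b ((idt (ld c) \<otimes>\<^sub>a h) \<cdot> g) = h \<cdot> from_unit c a g"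
proof -
  have h: "h \<in> Arr A" "Dom A h = a" "Cod A h = b" "a \<in> Obj A" "g \<in> Arr A" "Dom A g = \<I>" "Cod A g = ld c \<otimes>\<^sub>o a"
    using assms by (auto simp: Hom_def)
  have "un c b ((idt (ld c) \<otimes>\<^sub>a h) \<cdot> g) = h \<cdot> un c a g"
    using h assms(1) by (intro luntrans_post[OF left_dual]) auto
  then show ?thesis using h assms(1) by (simp add: from_unit_def)
qed

lemma to_unit_post:
  assumes "c \<in> Obj A" "h \<in> Hom A a b" "k \<in> Hom A c (ld (ld c) \<otimes>\<^sub>o a)"
  shows "to_unit c b ((idt (ld (ld c)) \<otimes>\<^sub>a h) \<cdot> k) = h \<cdot> to_unit c a k"
proof -
  have h: "h \<in> Arr A" "Dom A h = a" "Cod A h = b" "a \<in> Obj A" "b \<in> Obj A"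
    "k \<in> Arr A" "Dom A k = c" "Cod A k = ld (ld c) \<otimes>\<^sub>o a"
    using assms by (auto simp: Hom_def)
  have "tr c \<I> (((idt (ld (ld c)) \<otimes>\<^sub>a h) \<cdot> k) \<cdot> ru c) = (idt (ld c) \<otimes>\<^sub>a (idt (ld (ld c)) \<otimes>\<^sub>a h)) \<cdot> tr c \<I> (k \<cdot> ru c)"
    using h assms(1) ltrans_post[OF left_dual, of c \<I> "k \<cdot> ru c" "idt (ld (ld c)) \<otimes>\<^sub>a h"] by simp
  then have "to_unit c b ((idt (ld (ld c)) \<otimes>\<^sub>a h) \<cdot> k) =
    cu (ld c) b \<cdot> ((idt (ld c) \<otimes>\<^sub>a (idt (ld (ld c)) \<otimes>\<^sub>a h)) \<cdot> tr c \<I> (k \<cdot> ru c))"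
    by (simp add: to_unit_def)
  also have "\<dots> = (h \<cdot> cu (ld c) a) \<cdot> tr c \<I> (k \<cdot> ru c)"
    using h assms(1) counit_nat[OF left_dual, of "ld c" h] by (intro comp_reassoc) auto
  also have "\<dots> = h \<cdot> to_unit c a k" using h assms(1) by (simp add: to_unit_def)
  finally show ?thesis .
qed

text \<open>The two transpositions along the adjunction of \<open>c \<otimes> -\<close> cancel, and
  only the counit in the definition of \<open>to_unit\<close> survives.\<close>

lemma to_from_unit:
  assumes c: "c \<in> Obj A" and b: "b \<in> Obj A" and g: "g \<in> Hom A \<I> (ld c \<otimes>\<^sub>o (ld (ld c) \<otimes>\<^sub>o b))"
  shows "to_unit c b (from_unit c (ld (ld c) \<otimes>\<^sub>o b) g) = cu (ld c) b \<cdot> g"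
proof -
  have h: "g \<in> Arr A" "Dom A g = \<I>" "Cod A g = ld c \<otimes>\<^sub>o (ld (ld c) \<otimes>\<^sub>o b)" using g by (auto simp: Hom_def)
  show ?thesis
    using ltrans_luntrans[OF left_dual[OF c], of "ld (ld c) \<otimes>\<^sub>o b" g \<I>] c b h
    by (simp add: to_unit_def from_unit_def)
qed

text \<open>The unit \<open>uu (ld c) a\<close> meets the counit inside \<open>to_unit\<close> and
  disappears by a triangle identity; the remaining transpositions are inverse to each other.\<close>

lemma from_to_unit:
  assumes c: "c \<in> Obj A" and a: "a \<in> Obj A" and k: "k \<in> Hom A c a"
  shows "from_unit c a (to_unit c (ld c \<otimes>\<^sub>o a) (uu (ld c) a \<cdot> k)) = k"
proof -
  have h: "k \<in> Arr A" "Dom A k = c" "Cod A k = a" using k by (auto simp: Hom_def)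
  have "tr c \<I> ((uu (ld c) a \<cdot> k) \<cdot> ru c) = (idt (ld c) \<otimes>\<^sub>a uu (ld c) a) \<cdot> tr c \<I> (k \<cdot> ru c)"
    using ltrans_post[OF left_dual[OF c], of \<I> "k \<cdot> ru c" "uu (ld c) a"] c a h by simp
  then have "to_unit c (ld c \<otimes>\<^sub>o a) (uu (ld c) a \<cdot> k) =
    cu (ld c) (ld c \<otimes>\<^sub>o a) \<cdot> ((idt (ld c) \<otimes>\<^sub>a uu (ld c) a) \<cdot> tr c \<I> (k \<cdot> ru c))"
    by (simp add: to_unit_def)
  also have "\<dots> = idt (ld c \<otimes>\<^sub>o a) \<cdot> tr c \<I> (k \<cdot> ru c)"
    using c a h by (intro comp_reassoc triangle_left[OF left_dual]) auto
  also have "\<dots> = tr c \<I> (k \<cdot> ru c)" using c a h by simp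
  finally show ?thesis
    using luntrans_ltrans[OF left_dual[OF c], of \<I> "k \<cdot> ru c" a] c a h by (simp add: from_unit_def)
qed

context
  fixes D \<iota> c
  assumes \<iota>: "nak_univ A \<I> D \<iota>" and c [simp]: "c \<in> Obj A"
begin

abbreviation (input) "l \<equiv> ld c"
abbreviation (input) "m \<equiv> ld (ld c)"
abbreviation (input) "shift a \<equiv> dual_map (hom_space A \<I> (l \<otimes>\<^sub>o a)) (from_unit c a)"
abbreviation (input) "unshift b \<equiv> dual_map (hom_space A c (m \<otimes>\<^sub>o b)) (to_unit c b)"

lemma fam: "nak_family A \<I> D \<iota>" by (rule nak_univ_family[OF \<iota>])

lemma D [simp]: "D \<in> Obj A" using fam by (simp add: nak_family_def)

lemma shift_closed: "a \<in> Obj A \<Longrightarrow> \<xi> \<in> carrier (dsp c a) \<Longrightarrow> shift a \<xi> \<in> carrier (dsp \<I> (l \<otimes>\<^sub>o a))"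
  by (rule dual_map_closed[OF hom_vectorspace from_unit_lin]) auto

lemma unshift_closed: "b \<in> Obj A \<Longrightarrow> \<zeta> \<in> carrier (dsp \<I> b) \<Longrightarrow> unshift b \<zeta> \<in> carrier (dsp c (m \<otimes>\<^sub>o b))"
  by (rule dual_map_closed[OF hom_vectorspace to_unit_lin]) auto

lemma shift_iota:
  assumes "a \<in> Obj A" "\<xi> \<in> carrier (dsp c a)"
  shows "\<iota> (l \<otimes>\<^sub>o a) (shift a \<xi>) \<in> Arr A" "Dom A (\<iota> (l \<otimes>\<^sub>o a) (shift a \<xi>)) = l \<otimes>\<^sub>o a"
    "Cod A (\<iota> (l \<otimes>\<^sub>o a) (shift a \<xi>)) = D"
  using nak_family_hom[OF fam _ shift_closed[OF assms]] assms by (auto simp: Hom_def)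

text \<open>Naturality in \<open>a\<close> is put together from that of \<open>from_unit\<close>, of
  \<open>\<iota>\<close> at \<open>l \<otimes>\<^sub>o a\<close>, and of transposition along the
  adjunction of \<open>l \<otimes> -\<close>.\<close>

lemma shift_family: "nak_family A c (m \<otimes>\<^sub>o D) (shift_family c \<iota>)"
  unfolding nak_family_def
proof (intro conjI ballI)
  show "m \<otimes>\<^sub>o D \<in> Obj A" by simp
  show "shift_family c \<iota> a \<in> linear_maps (dsp c a) (hom_space A a (m \<otimes>\<^sub>o D))" if a: "a \<in> Obj A" for a
  proof -
    have "(\<lambda>\<xi>. tr l a (\<iota> (l \<otimes>\<^sub>o a) (shift a \<xi>))) \<in> linear_maps (dsp c a) (hom_space A a (m \<otimes>\<^sub>o D))"
      using a by (intro lin_comp[OF dual_map_lin lin_comp[OF nak_family_lin[OF fam] tr_lin]] hom_vectorspace from_unit_lin)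
         auto
    then show ?thesis by (simp add: shift_family_def[abs_def])
  qed
  fix a b h \<xi> assume a: "a \<in> Obj A" and b: "b \<in> Obj A" and h: "h \<in> Hom A a b" and \<xi>: "\<xi> \<in> carrier (dsp c b)"
  have lh: "idt l \<otimes>\<^sub>a h \<in> Hom A (l \<otimes>\<^sub>o a) (l \<otimes>\<^sub>o b)" and h': "h \<in> Arr A" "Dom A h = a" "Cod A h = b"
    using h by (auto simp: Hom_def)
  have s: "shift a (dual_map (hom_space A c a) (\<lambda>k. h \<cdot> k) \<xi>) =
    dual_map (hom_space A \<I> (l \<otimes>\<^sub>o a)) (\<lambda>g. (idt l \<otimes>\<^sub>a h) \<cdot> g) (shift b \<xi>)"
    by (rule trans[OF dual_map_comp[where \<chi> = "\<lambda>g. h \<cdot> from_unit c a g"] dual_map_comp[symmetric]])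
      (use from_unit_simps[of c a] from_unit_post[OF c h] comp_in_hom[OF _ lh] a in \<open>auto\<close>)
  have "shift_family c \<iota> a (dual_map (hom_space A c a) (\<lambda>k. h \<cdot> k) \<xi>) = tr l a (\<iota> (l \<otimes>\<^sub>o b) (shift b \<xi>) \<cdot> (idt l \<otimes>\<^sub>a h))"
    unfolding shift_family_def s nak_family_nat[OF fam lh shift_closed[OF b \<xi>]] ..
  also have "\<dots> = shift_family c \<iota> b \<xi> \<cdot> h"
    unfolding shift_family_def using shift_iota[OF b \<xi>] h' a b by (intro ltrans_pre[OF left_dual]) auto
  finally show "shift_family c \<iota> a (dual_map (hom_space A c a) (\<lambda>k. h \<cdot> k) \<xi>) = shift_family c \<iota> b \<xi> \<cdot> h" .
qed

text \<open>The way back: a family at \<open>c\<close> is evaluated at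
  \<open>m \<otimes>\<^sub>o b\<close> and transposed along the adjunction of
  \<open>m \<otimes> -\<close> with \<open>ld m \<otimes> -\<close>, which brings in a third dual.
  The universal property at the unit can then be applied to it.\<close>

lemma unshift_family:
  assumes \<sigma>: "nak_family A c d \<sigma>"
  shows "nak_family A \<I> (ld m \<otimes>\<^sub>o d) (\<lambda>b \<zeta>. tr m b (\<sigma> (m \<otimes>\<^sub>o b) (unshift b \<zeta>)))"
  unfolding nak_family_def
proof (intro conjI ballI)
  have d [simp]: "d \<in> Obj A" using \<sigma> by (simp add: nak_family_def)
  show "ld m \<otimes>\<^sub>o d \<in> Obj A" by simp
  show "(\<lambda>\<zeta>. tr m b (\<sigma> (m \<otimes>\<^sub>o b) (unshift b \<zeta>))) \<in> linear_maps (dsp \<I> b) (hom_space A b (ld m \<otimes>\<^sub>o d))"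
    if b: "b \<in> Obj A" for b
    using b by (intro lin_comp[OF dual_map_lin lin_comp[OF nak_family_lin[OF \<sigma>] tr_lin]] hom_vectorspace to_unit_lin)
       auto
  fix a b h \<zeta> assume a: "a \<in> Obj A" and b: "b \<in> Obj A" and h: "h \<in> Hom A a b" and \<zeta>: "\<zeta> \<in> carrier (dsp \<I> b)"
  have mh: "idt m \<otimes>\<^sub>a h \<in> Hom A (m \<otimes>\<^sub>o a) (m \<otimes>\<^sub>o b)" and h': "h \<in> Arr A" "Dom A h = a" "Cod A h = b"
    using h by (auto simp: Hom_def)
  have s: "unshift a (dual_map (hom_space A \<I> a) (\<lambda>k. h \<cdot> k) \<zeta>) =
    dual_map (hom_space A c (m \<otimes>\<^sub>o a)) (\<lambda>g. (idt m \<otimes>\<^sub>a h) \<cdot> g) (unshift b \<zeta>)"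
    by (rule trans[OF dual_map_comp[where \<chi> = "\<lambda>g. h \<cdot> to_unit c a g"] dual_map_comp[symmetric]])
      (use to_unit_simps[of c a] to_unit_post[OF c h] comp_in_hom[OF _ mh] a in \<open>auto\<close>)
  have g: "\<sigma> (m \<otimes>\<^sub>o b) (unshift b \<zeta>) \<in> Hom A (m \<otimes>\<^sub>o b) d"
    using b by (intro nak_family_hom[OF \<sigma>] unshift_closed \<zeta>) auto
  have "tr m a (\<sigma> (m \<otimes>\<^sub>o a) (unshift a (dual_map (hom_space A \<I> a) (\<lambda>k. h \<cdot> k) \<zeta>))) =
    tr m a (\<sigma> (m \<otimes>\<^sub>o b) (unshift b \<zeta>) \<cdot> (idt m \<otimes>\<^sub>a h))"
    unfolding s nak_family_nat[OF \<sigma> mh unshift_closed[OF b \<zeta>]] ..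
  also have "\<dots> = tr m b (\<sigma> (m \<otimes>\<^sub>o b) (unshift b \<zeta>)) \<cdot> h"
    using g h' a b by (intro ltrans_pre[OF left_dual]) (auto simp: Hom_def)
  finally show "tr m a (\<sigma> (m \<otimes>\<^sub>o a) (unshift a (dual_map (hom_space A \<I> a) (\<lambda>k. h \<cdot> k) \<zeta>))) =
    tr m b (\<sigma> (m \<otimes>\<^sub>o b) (unshift b \<zeta>)) \<cdot> h" .
qed

text \<open>An arrow from \<open>m \<otimes>\<^sub>o D\<close> to \<open>d\<close> is the transpose
  of one from \<open>D\<close> to \<open>ld m \<otimes>\<^sub>o d\<close>. Existence transposes the
  factorisation of the unshifted family; for uniqueness, \<open>key\<close> recovers the arrows
  \<open>idt m \<otimes>\<^sub>a \<iota> b \<zeta>\<close> from the shifted family, so transposes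
  are determined by the universal property at the unit.\<close>

lemma shift_univ: "nak_univ A c (m \<otimes>\<^sub>o D) (shift_family c \<iota>)"
  unfolding nak_univ_def
proof (intro conjI allI impI shift_family)
  fix d \<sigma> assume \<sigma>: "nak_family A c d \<sigma>"
  have d [simp]: "d \<in> Obj A" using \<sigma> by (simp add: nak_family_def)
  let ?\<kappa> = "shift_family c \<iota>"
  obtain s where s: "s \<in> Hom A D (ld m \<otimes>\<^sub>o d)"
    and s\<iota>: "\<And>b \<zeta>. b \<in> Obj A \<Longrightarrow> \<zeta> \<in> carrier (dsp \<I> b) \<Longrightarrow> s \<cdot> \<iota> b \<zeta> = tr m b (\<sigma> (m \<otimes>\<^sub>o b) (unshift b \<zeta>))"
    using nak_univ_ex[OF \<iota> unshift_family[OF \<sigma>]] by blast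
  have s': "s \<in> Arr A" "Dom A s = D" "Cod A s = ld m \<otimes>\<^sub>o d" using s by (auto simp: Hom_def)
  have t: "un m d s \<in> Hom A (m \<otimes>\<^sub>o D) d" using s' by (auto simp: Hom_def)
  have t\<kappa>: "un m d s \<cdot> ?\<kappa> a \<xi> = \<sigma> a \<xi>" if a: "a \<in> Obj A" and \<xi>: "\<xi> \<in> carrier (dsp c a)" for a \<xi>
  proof -
    let ?b = "l \<otimes>\<^sub>o a" and ?u = "uu l a"
    have u: "?u \<in> Hom A a (m \<otimes>\<^sub>o ?b)" using a by (simp add: Hom_def)
    note i = shift_iota[OF a \<xi>] and \<zeta> = shift_closed[OF a \<xi>]
    have g: "\<sigma> (m \<otimes>\<^sub>o ?b) (unshift ?b (shift a \<xi>)) \<in> Hom A (m \<otimes>\<^sub>o ?b) d"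
      using a by (intro nak_family_hom[OF \<sigma>] unshift_closed \<zeta>) auto
    then have g': "\<sigma> (m \<otimes>\<^sub>o ?b) (unshift ?b (shift a \<xi>)) \<in> Arr A"
      "Dom A (\<sigma> (m \<otimes>\<^sub>o ?b) (unshift ?b (shift a \<xi>))) = m \<otimes>\<^sub>o ?b"
      "Cod A (\<sigma> (m \<otimes>\<^sub>o ?b) (unshift ?b (shift a \<xi>))) = d" by (auto simp: Hom_def)
    have "un m d s \<cdot> ?\<kappa> a \<xi> = (un m d s \<cdot> (idt m \<otimes>\<^sub>a \<iota> ?b (shift a \<xi>))) \<cdot> ?u"
      using i s' a by (simp add: shift_family_def tr_def)
    also have "un m d s \<cdot> (idt m \<otimes>\<^sub>a \<iota> ?b (shift a \<xi>)) = un m d (s \<cdot> \<iota> ?b (shift a \<xi>))"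
      using i s' a by (intro luntrans_pre[OF left_dual, symmetric]) auto
    also have "s \<cdot> \<iota> ?b (shift a \<xi>) = tr m ?b (\<sigma> (m \<otimes>\<^sub>o ?b) (unshift ?b (shift a \<xi>)))"
      using a \<zeta> by (intro s\<iota>) auto
    also have "un m d \<dots> = \<sigma> (m \<otimes>\<^sub>o ?b) (unshift ?b (shift a \<xi>))"
      using g' a by (intro luntrans_ltrans[OF left_dual]) auto
    also have "\<dots> \<cdot> ?u = \<sigma> a (dual_map (hom_space A c a) (\<lambda>k. ?u \<cdot> k) (unshift ?b (shift a \<xi>)))"
      using a by (intro nak_family_nat[OF \<sigma> u, symmetric] unshift_closed \<zeta>) auto
    \<comment> \<open>Evaluated at \<open>k\<close>, the three dual maps apply \<open>\<xi>\<close>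
      to the arrow that \<open>from_to_unit\<close> simplifies to \<open>k\<close>.\<close>
    also have "dual_map (hom_space A c a) (\<lambda>k. ?u \<cdot> k) (unshift ?b (shift a \<xi>)) = \<xi>"
    proof (rule dual_space_eqI)
      show "dual_map (hom_space A c a) (\<lambda>k. ?u \<cdot> k) (unshift ?b (shift a \<xi>)) \<in> carrier (dsp c a)"
        using a by (intro dual_map_closed[OF hom_vectorspace comp_linear_right[OF _ u]] unshift_closed \<zeta>) auto
      fix k assume "k \<in> carrier (hom_space A c a)"
      then have k: "k \<in> Hom A c a" by simp
      have uk: "?u \<cdot> k \<in> Hom A c (m \<otimes>\<^sub>o ?b)" by (rule comp_in_hom[OF k u])
      have tk: "to_unit c ?b (?u \<cdot> k) \<in> Hom A \<I> ?b" using uk a by (intro to_unit_simps) auto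
      show "dual_map (hom_space A c a) (\<lambda>k. ?u \<cdot> k) (unshift ?b (shift a \<xi>)) k = \<xi> k"
        using k uk tk from_to_unit[OF c a k] by (simp add: dual_map_apply)
    qed (rule \<xi>)
    finally show ?thesis .
  qed
  have uniq: "t = t'" if t: "t \<in> Hom A (m \<otimes>\<^sub>o D) d" "t' \<in> Hom A (m \<otimes>\<^sub>o D) d"
    and eq: "\<And>a \<xi>. a \<in> Obj A \<Longrightarrow> \<xi> \<in> carrier (dsp c a) \<Longrightarrow> t \<cdot> ?\<kappa> a \<xi> = t' \<cdot> ?\<kappa> a \<xi>" for t t'
  proof -
    have t': "t \<in> Arr A" "Dom A t = m \<otimes>\<^sub>o D" "Cod A t = d" "t' \<in> Arr A" "Dom A t' = m \<otimes>\<^sub>o D" "Cod A t' = d"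
      using t by (auto simp: Hom_def)
    \<comment> \<open>Shifting an unshifted functional amounts to composing with the counit
      \<open>cu l b\<close>; transposition then produces a triangle identity that removes
      it.\<close>
    have key: "idt m \<otimes>\<^sub>a \<iota> b \<zeta> = ?\<kappa> (m \<otimes>\<^sub>o b) (unshift b \<zeta>)"
      if b: "b \<in> Obj A" and \<zeta>: "\<zeta> \<in> carrier (dsp \<I> b)" for b \<zeta>
    proof -
      let ?a = "m \<otimes>\<^sub>o b"
      have a: "?a \<in> Obj A" using b by simp
      have e: "cu l b \<in> Hom A (l \<otimes>\<^sub>o ?a) b" using b by (simp add: Hom_def)
      have i: "\<iota> b \<zeta> \<in> Arr A" "Dom A (\<iota> b \<zeta>) = b" "Cod A (\<iota> b \<zeta>) = D"
        using nak_family_hom[OF fam b \<zeta>] by (auto simp: Hom_def)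
      have "shift ?a (unshift b \<zeta>) = dual_map (hom_space A \<I> (l \<otimes>\<^sub>o ?a)) (\<lambda>g. cu l b \<cdot> g) \<zeta>"
        by (rule dual_map_comp) (use to_from_unit[OF c b] from_unit_simps[OF c a] in auto)
      then have "?\<kappa> ?a (unshift b \<zeta>) = tr l ?a (\<iota> b \<zeta> \<cdot> cu l b)"
        by (simp add: shift_family_def nak_family_nat[OF fam e \<zeta>])
      also have "\<dots> = (idt m \<otimes>\<^sub>a \<iota> b \<zeta>) \<cdot> ((idt m \<otimes>\<^sub>a cu l b) \<cdot> uu l ?a)"
        using i b by (simp add: tr_def interchange_left)
      also have "\<dots> = idt m \<otimes>\<^sub>a \<iota> b \<zeta>"
        using i b triangle_right[OF left_dual, of l b] by simp
      finally show ?thesis by simp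
    qed
    have "tr m D t = tr m D t'"
    proof (rule nak_univ_eqI[OF \<iota>, of _ "ld m \<otimes>\<^sub>o d"])
      show "tr m D t \<in> Hom A D (ld m \<otimes>\<^sub>o d)" "tr m D t' \<in> Hom A D (ld m \<otimes>\<^sub>o d)"
        using t' by (auto simp: Hom_def)
      fix b \<zeta> assume b: "b \<in> Obj A" and \<zeta>: "\<zeta> \<in> carrier (dsp \<I> b)"
      have i: "\<iota> b \<zeta> \<in> Arr A" "Dom A (\<iota> b \<zeta>) = b" "Cod A (\<iota> b \<zeta>) = D"
        using nak_family_hom[OF fam b \<zeta>] by (auto simp: Hom_def)
      have "tr m D t \<cdot> \<iota> b \<zeta> = tr m b (t \<cdot> (idt m \<otimes>\<^sub>a \<iota> b \<zeta>))"
        using i t' b by (intro ltrans_pre[OF left_dual, symmetric]) auto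
      also have "\<dots> = tr m b (t' \<cdot> (idt m \<otimes>\<^sub>a \<iota> b \<zeta>))"
        unfolding key[OF b \<zeta>] using eq[OF _ unshift_closed[OF b \<zeta>]] b by simp
      also have "\<dots> = tr m D t' \<cdot> \<iota> b \<zeta>"
        using i t' b by (intro ltrans_pre[OF left_dual]) auto
      finally show "tr m D t \<cdot> \<iota> b \<zeta> = tr m D t' \<cdot> \<iota> b \<zeta>" .
    qed
    then have "un m d (tr m D t) = un m d (tr m D t')" by simp
    then show ?thesis
      using luntrans_ltrans[OF left_dual, of m D t d] luntrans_ltrans[OF left_dual, of m D t' d] t' by simp
  qed
  show "\<exists>!t. t \<in> Hom A (m \<otimes>\<^sub>o D) d \<and> (\<forall>a\<in>Obj A. \<forall>\<xi>\<in>carrier (dsp c a). t \<cdot> ?\<kappa> a \<xi> = \<sigma> a \<xi>)"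
  proof (rule ex1I[of _ "un m d s"])
    fix t' assume t': "t' \<in> Hom A (m \<otimes>\<^sub>o D) d \<and> (\<forall>a\<in>Obj A. \<forall>\<xi>\<in>carrier (dsp c a). t' \<cdot> ?\<kappa> a \<xi> = \<sigma> a \<xi>)"
    show "t' = un m d s" by (rule uniq) (use t t' t\<kappa> in simp_all)
  qed (use t t\<kappa> in simp)
qed

end

text \<open>This is where the double dual of an arrow arises. \<open>counit_dinat\<close> replaces
  precomposition with \<open>f\<close> by its dual acting on
  \<open>ld c' \<otimes>\<^sub>o a\<close>, and \<open>unit_dinat\<close>, applied to that dual
  arrow, moves it across the second adjunction as the double dual.\<close>

lemma shift_family_nat:
  assumes \<iota>: "nak_univ A \<I> D \<iota>" and f: "f \<in> Hom A c c'" and a: "a \<in> Obj A" and \<xi>: "\<xi> \<in> carrier (dsp c a)"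
  shows "shift_family c' \<iota> a (dual_map (hom_space A c' a) (\<lambda>k. k \<cdot> f) \<xi>) =
    (ldual_arr A (ldual_arr A f) \<otimes>\<^sub>a idt D) \<cdot> shift_family c \<iota> a \<xi>"
proof -
  have c [simp]: "c \<in> Obj A" and c' [simp]: "c' \<in> Obj A" using hom_dom[OF f] hom_cod[OF f] by auto
  have f' [simp]: "f \<in> Arr A" "Dom A f = c" "Cod A f = c'" using f by (auto simp: Hom_def)
  note a' [simp] = a
  note D [simp] = D[OF \<iota> c] and fam = fam[OF \<iota> c]
  let ?lf = "ldual_arr A f" and ?l = "ld c" and ?l' = "ld c'"
  let ?shift = "\<lambda>c. dual_map (hom_space A \<I> (ld c \<otimes>\<^sub>o a)) (from_unit c a)"
  have lf: "?lf \<otimes>\<^sub>a idt a \<in> Hom A (?l' \<otimes>\<^sub>o a) (?l \<otimes>\<^sub>o a)" by (simp add: Hom_def)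
  have fu: "from_unit c a ((?lf \<otimes>\<^sub>a idt a) \<cdot> g) = from_unit c' a g \<cdot> f" if g: "g \<in> Hom A \<I> (?l' \<otimes>\<^sub>o a)" for g
  proof -
    have g' [simp]: "g \<in> Arr A" "Dom A g = \<I>" "Cod A g = ?l' \<otimes>\<^sub>o a" using g by (auto simp: Hom_def)
    have "un c a ((?lf \<otimes>\<^sub>a idt a) \<cdot> g) = cu c a \<cdot> ((idt c \<otimes>\<^sub>a (?lf \<otimes>\<^sub>a idt a)) \<cdot> (idt c \<otimes>\<^sub>a g))"
      by (simp add: un_def interchange)
    also have "\<dots> = (cu c' a \<cdot> (f \<otimes>\<^sub>a idt (?l' \<otimes>\<^sub>o a))) \<cdot> (idt c \<otimes>\<^sub>a g)"
      using counit_dinat[of f a] by (intro comp_reassoc) auto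
    also have "\<dots> = un c' a g \<cdot> (f \<otimes>\<^sub>a idt \<I>)" by (simp add: un_def interchange)
    finally show ?thesis using runiti_nat[of f] by (simp add: from_unit_def)
  qed
  have s: "?shift c' (dual_map (hom_space A c' a) (\<lambda>k. k \<cdot> f) \<xi>) =
    dual_map (hom_space A \<I> (?l' \<otimes>\<^sub>o a)) (\<lambda>g. (?lf \<otimes>\<^sub>a idt a) \<cdot> g) (?shift c \<xi>)"
    by (rule trans[OF dual_map_comp[where \<chi> = "\<lambda>g. from_unit c' a g \<cdot> f"] dual_map_comp[symmetric]])
      (use from_unit_simps[of c' a] fu comp_in_hom[OF _ lf] in auto)
  note i [simp] = shift_iota[OF \<iota> c a \<xi>]
  let ?i = "\<iota> (?l \<otimes>\<^sub>o a) (?shift c \<xi>)"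
  have "shift_family c' \<iota> a (dual_map (hom_space A c' a) (\<lambda>k. k \<cdot> f) \<xi>) = tr ?l' a (?i \<cdot> (?lf \<otimes>\<^sub>a idt a))"
    unfolding shift_family_def s nak_family_nat[OF fam lf shift_closed[OF \<iota> c a \<xi>]] ..
  also have "\<dots> = (idt (ld ?l') \<otimes>\<^sub>a ?i) \<cdot> ((idt (ld ?l') \<otimes>\<^sub>a (?lf \<otimes>\<^sub>a idt a)) \<cdot> uu ?l' a)"
    by (simp add: tr_def interchange_left)
  also have "\<dots> = (idt (ld ?l') \<otimes>\<^sub>a ?i) \<cdot> ((ldual_arr A ?lf \<otimes>\<^sub>a idt (?l \<otimes>\<^sub>o a)) \<cdot> uu ?l a)"
    using unit_dinat[of ?lf a] by simp
  also have "\<dots> = (ldual_arr A ?lf \<otimes>\<^sub>a idt D) \<cdot> shift_family c \<iota> a \<xi>"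
    by (simp add: shift_family_def tr_def interchange_left)
  finally show ?thesis .
qed

text \<open>The value of \<open>N\<close> at \<open>c\<close> and the shifted object carry universal
  families for the same \<open>c\<close>, so a unique compatible isomorphism compares them.
  Naturality is tested on the family \<open>\<iota> c\<close>, where it becomes
  \<open>shift_family_nat\<close>.\<close>

theorem nakayama_iso:
  assumes N: "nakayama A N"
  shows "isomorphic_functors A A N (tensor_on_right A (left_double_dual A) (on_obj N \<I>))"
proof -
  let ?D = "on_obj N \<I>" and ?G = "tensor_on_right A (left_double_dual A) (on_obj N \<I>)"
  have F: "is_functor A A N" using N by (simp add: nakayama_def)
  interpret N: is_functor A A N by (rule F)
  obtain \<iota> where \<iota>: "\<And>c. c \<in> Obj A \<Longrightarrow> nak_univ A c (on_obj N c) (\<iota> c)"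
    and \<iota>N: "\<And>c c' f a \<xi>. f \<in> Hom A c c' \<Longrightarrow> a \<in> Obj A \<Longrightarrow> \<xi> \<in> carrier (dsp c a) \<Longrightarrow>
        on_arr N f \<cdot> \<iota> c a \<xi> = \<iota> c' a (dual_map (hom_space A c' a) (\<lambda>k. k \<cdot> f) \<xi>)"
    using N hom_dom hom_cod unfolding nakayama_def by metis
  note \<iota>1 = \<iota>[OF unit_obj]
  have D: "?D \<in> Obj A" by (rule N.obj_map[OF unit_obj])
  have G: "is_functor A A ?G" by (rule tensor_on_right_functor[OF left_double_dual_functor D])
  have "\<exists>t. t \<in> Hom A (on_obj N c) (on_obj ?G c) \<and> iso_arrow A t \<and>
    (\<forall>a\<in>Obj A. \<forall>\<xi>\<in>carrier (dsp c a). t \<cdot> \<iota> c a \<xi> = shift_family c (\<iota> \<I>) a \<xi>)" if c: "c \<in> Obj A" for c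
    by (rule nak_univ_iso[OF \<iota>[OF c] shift_univ[OF \<iota>1 c]])
      (auto simp: tensor_on_right_def left_double_dual_def)
  then obtain \<theta> where \<theta>: "\<And>c. c \<in> Obj A \<Longrightarrow> \<theta> c \<in> Hom A (on_obj N c) (on_obj ?G c)"
    "\<And>c. c \<in> Obj A \<Longrightarrow> iso_arrow A (\<theta> c)"
    and \<theta>\<iota>: "\<And>c a \<xi>. c \<in> Obj A \<Longrightarrow> a \<in> Obj A \<Longrightarrow> \<xi> \<in> carrier (dsp c a) \<Longrightarrow>
      \<theta> c \<cdot> \<iota> c a \<xi> = shift_family c (\<iota> \<I>) a \<xi>"
    by metis
  have "natural_isomorphism A A N ?G \<theta>"
    unfolding natural_isomorphism_def
  proof (intro conjI F G ballI \<theta>)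
    fix c c' f assume c: "c \<in> Obj A" and c': "c' \<in> Obj A" and f: "f \<in> Hom A c c'"
    note Nf = N.arr_map[OF f] and Gf = functor_arr[OF G f]
    show "\<theta> c' \<cdot> on_arr N f = on_arr ?G f \<cdot> \<theta> c"
    proof (rule nak_univ_eqI[OF \<iota>[OF c] comp_in_hom[OF Nf \<theta>(1)[OF c']] comp_in_hom[OF \<theta>(1)[OF c] Gf]])
      fix a \<xi> assume a: "a \<in> Obj A" and \<xi>: "\<xi> \<in> carrier (dsp c a)"
      note i = nak_family_hom[OF nak_univ_family[OF \<iota>[OF c]] a \<xi>]
      have d: "dual_map (hom_space A c' a) (\<lambda>k. k \<cdot> f) \<xi> \<in> carrier (dsp c' a)"
        by (rule dual_map_closed[OF hom_vectorspace[OF c' a] comp_linear_left[OF a f] \<xi>])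
      have "(\<theta> c' \<cdot> on_arr N f) \<cdot> \<iota> c a \<xi> = shift_family c' (\<iota> \<I>) a (dual_map (hom_space A c' a) (\<lambda>k. k \<cdot> f) \<xi>)"
        by (simp add: comp_assoc[OF i Nf \<theta>(1)[OF c']] \<iota>N[OF f a \<xi>] \<theta>\<iota>[OF c' a d])
      also have "\<dots> = on_arr ?G f \<cdot> shift_family c (\<iota> \<I>) a \<xi>"
        unfolding shift_family_nat[OF \<iota>1 f a \<xi>] by (simp add: tensor_on_right_def left_double_dual_def)
      also have "\<dots> = (on_arr ?G f \<cdot> \<theta> c) \<cdot> \<iota> c a \<xi>"
        by (simp add: comp_assoc[OF i \<theta>(1)[OF c] Gf] \<theta>\<iota>[OF c a \<xi>])
      finally show "(\<theta> c' \<cdot> on_arr N f) \<cdot> \<iota> c a \<xi> = (on_arr ?G f \<cdot> \<theta> c) \<cdot> \<iota> c a \<xi>" .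
    qed
  qed
  then show ?thesis by (auto simp: isomorphic_functors_def)
qed

end


section \<open>Existence\<close>

subsection \<open>Modules over an algebra\<close>

text \<open>The objects of the module category have carriers inside \<open>'k vec\<close>; modules
  built from dual spaces or linear maps are moved there along an injection.\<close>

definition transport :: "('v \<Rightarrow> 'w) \<Rightarrow> ('k::field, 'v) module \<Rightarrow> ('k, 'w) module" where
  "transport \<phi> M = \<lparr>carrier = \<phi> ` carrier M, mult = undefined, one = undefined,
     zero = \<phi> \<zero>\<^bsub>M\<^esub>,
     add = (\<lambda>v w. \<phi> (inv_into (carrier M) \<phi> v \<oplus>\<^bsub>M\<^esub> inv_into (carrier M) \<phi> w)),
     smult = (\<lambda>c v. \<phi> (c \<odot>\<^bsub>M\<^esub> inv_into (carrier M) \<phi> v))\<rparr>"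

context
  fixes \<phi> :: "'v \<Rightarrow> 'w" and M :: "('k::field, 'v) module"
  assumes inj: "inj_on \<phi> (carrier M)" and M: "is_vs M"
begin

lemma transport_simps:
  "carrier (transport \<phi> M) = \<phi> ` carrier M"
  "\<zero>\<^bsub>transport \<phi> M\<^esub> = \<phi> \<zero>\<^bsub>M\<^esub>"
  "v \<in> carrier M \<Longrightarrow> v' \<in> carrier M \<Longrightarrow> \<phi> v \<oplus>\<^bsub>transport \<phi> M\<^esub> \<phi> v' = \<phi> (v \<oplus>\<^bsub>M\<^esub> v')"
  "v \<in> carrier M \<Longrightarrow> c \<odot>\<^bsub>transport \<phi> M\<^esub> \<phi> v = \<phi> (c \<odot>\<^bsub>M\<^esub> v)"
  by (simp_all add: transport_def inj)

lemma transport_vs: "is_vs (transport \<phi> M)"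
  by (rule is_vsI)
    (auto simp: transport_simps M vs_add_comm[OF M] vs_smult_smult[OF M] vs_add_smult[OF M] vs_smult_add[OF M]
      vs_add_neg[OF M] vs_add_assoc[OF M] vs_add_left_comm[OF M])

lemma transport_lin: "\<phi> \<in> linear_maps M (transport \<phi> M)"
  by (rule lin_mapI) (auto simp: transport_simps)

lemma transport_bij: "bij_betw \<phi> (carrier M) (carrier (transport \<phi> M))"
  by (simp add: transport_simps bij_betw_def inj)

lemma transport_fd: "fd_space M \<Longrightarrow> fd_space (transport \<phi> M)"
  by (rule inj_fd[OF transport_vs _ lin_inv[OF M transport_lin transport_bij]])
    (auto simp: transport_simps intro: inj_on_inv_into)

end

text \<open>The coordinates along a frame determine a vector, and \<open>'k vec\<close> contains
  tuples of every length.\<close>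

lemma fd_inj_vec:
  fixes M :: "('k::field, 'v) module"
  assumes "fd_space M"
  obtains \<phi> :: "'v \<Rightarrow> 'k vec" where "inj_on \<phi> (carrier M)"
proof -
  obtain L where L: "frame M L" using assms by (rule fd_frame)
  have "inj_on (\<lambda>v. vec_of_list (map (\<lambda>p. snd p v) L)) (carrier M)"
  proof (rule inj_onI)
    fix v w assume v: "v \<in> carrier M" and w: "w \<in> carrier M"
      and "vec_of_list (map (\<lambda>p. snd p v) L) = vec_of_list (map (\<lambda>p. snd p w) L)"
    then have "map (\<lambda>p. snd p v) L = map (\<lambda>p. snd p w) L" by (metis list_vec)
    then have e: "map (\<lambda>p. snd p v \<odot>\<^bsub>M\<^esub> fst p) L = map (\<lambda>p. snd p w \<odot>\<^bsub>M\<^esub> fst p) L" by simp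
    note self = frame_self[OF fd_vs[OF assms] L]
    show "v = w" by (rule trans[OF self[OF v, symmetric, unfolded e] self[OF w]])
  qed
  then show ?thesis by (rule that)
qed

type_synonym ('k, 'v) amod = "('k, 'v) module \<times> ('v \<Rightarrow> 'v \<Rightarrow> 'v)"

context fd_algebra
begin

definition reg :: "('k, 'a) amod" where "reg = (A, mult A)"

text \<open>The homomorphism out of the regular module that takes the value \<open>m\<close> at the
  unit. These are all homomorphisms from \<open>reg\<close>, which identifies
  \<open>Hom(reg, X)\<close> with \<open>X\<close>.\<close>

definition orbit :: "('k, 'a) module \<times> ('a \<Rightarrow> 'a \<Rightarrow> 'a) \<Rightarrow> 'a \<Rightarrow>
    ('k, 'a) amod \<times> ('a \<Rightarrow> 'a) \<times> ('k, 'a) amod" where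
  "orbit X m = (reg, \<lambda>x\<in>carrier A. snd X x m, X)"

lemma algebra_vs: "is_vs A" using fd by (rule fd_vs)

lemma reg_module: "reg \<in> Obj (module_cat A)"
proof -
  have "fd_module A reg"
    unfolding fd_module_def reg_def
    by (auto simp: fd smult_mult_left smult_mult_right m_assoc l_distr r_distr intro!: lin_mapI)
  then show ?thesis by (simp add: module_cat_def)
qed

lemma orbit_hom:
  assumes X: "X \<in> Obj (module_cat A)" and m: "m \<in> carrier (fst X)"
  shows "orbit X m \<in> Hom (module_cat A) reg X"
proof -
  have fdm: "fd_module A X" "fd_module A reg" using X reg_module by (auto simp: module_cat_def)
  have "(\<lambda>x\<in>carrier A. snd X x m) \<in> linear_maps A (fst X)"
  proof (rule lin_cong[OF _ algebra_vs])
    show "(\<lambda>x. snd X x m) \<in> linear_maps A (fst X)" using fdm(1) m by (auto simp: fd_module_def)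
  qed simp
  then show ?thesis
    using fdm m by (auto simp: orbit_def Hom_def module_cat_def reg_def fd_module_def split_def)
qed

lemma hom_orbit:
  assumes X: "X \<in> Obj (module_cat A)" and f: "f \<in> Hom (module_cat A) reg X"
  shows "\<exists>m\<in>carrier (fst X). f = orbit X m"
proof -
  obtain g where g: "f = (reg, g, X)" "g \<in> linear_maps A (fst X)" "g \<in> extensional (carrier A)"
    "\<And>x m. x \<in> carrier A \<Longrightarrow> m \<in> carrier A \<Longrightarrow> g (x \<otimes> m) = snd X x (g m)"
    using f by (cases f) (auto simp: Hom_def module_cat_def reg_def)
  have gx: "g x = snd X x (g \<one>)" if "x \<in> carrier A" for x using g(4)[OF that one_closed] that by simp
  have "g = (\<lambda>x\<in>carrier A. snd X x (g \<one>))"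
  proof (rule extensionalityI[OF g(3) restrict_extensional])
    show "g x = (\<lambda>x\<in>carrier A. snd X x (g \<one>)) x" if "x \<in> carrier A" for x
      unfolding restrict_apply'[OF that] by (rule gx[OF that])
  qed
  then have "f = orbit X (g \<one>)" using g(1) by (simp add: orbit_def)
  then show ?thesis using lin_closed[OF g(2) one_closed] by blast
qed

lemma orbit_inj:
  assumes "X \<in> Obj (module_cat A)" "m \<in> carrier (fst X)" "m' \<in> carrier (fst X)" "orbit X m = orbit X m'"
  shows "m = m'"
proof -
  have "snd X \<one> m = snd X \<one> m'"
    using assms(4) by (auto simp: orbit_def dest: fun_cong[of _ _ \<one>])
  then show ?thesis using assms(1-3) by (auto simp: module_cat_def fd_module_def)
qed

lemma orbit_lin:
  assumes X: "X \<in> Obj (module_cat A)"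
  shows "orbit X \<in> linear_maps (fst X) (hom_space (module_cat A) reg X)"
proof (rule lin_mapI)
  have fdm: "fd_module A X" using X by (auto simp: module_cat_def)
  then have l: "x \<in> carrier A \<Longrightarrow> snd X x \<in> linear_maps (fst X) (fst X)" for x
    by (auto simp: fd_module_def split_def)
  show "orbit X m \<in> carrier (hom_space (module_cat A) reg X)" if "m \<in> carrier (fst X)" for m
    using orbit_hom[OF X that] by simp
  show "orbit X (m \<oplus>\<^bsub>fst X\<^esub> m') = orbit X m \<oplus>\<^bsub>hom_space (module_cat A) reg X\<^esub> orbit X m'"
    if "m \<in> carrier (fst X)" "m' \<in> carrier (fst X)" for m m'
    using that by (auto simp: orbit_def module_cat_def reg_def lin_add[OF l] intro!: restrict_ext)
  show "orbit X (c \<odot>\<^bsub>fst X\<^esub> m) = c \<odot>\<^bsub>hom_space (module_cat A) reg X\<^esub> orbit X m"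
    if "m \<in> carrier (fst X)" for c m
    using that by (auto simp: orbit_def module_cat_def reg_def lin_smult[OF l] intro!: restrict_ext)
qed

text \<open>Precomposition with right multiplication by \<open>b\<close> is the action of
  \<open>b\<close>. For this reason a left module over the algebra becomes a right module over the
  endomorphisms of \<open>reg\<close>.\<close>

lemma orbit_comp:
  assumes X: "X \<in> Obj (module_cat A)" and m: "m \<in> carrier (fst X)" and b: "b \<in> carrier A"
  shows "orbit X m \<cdot>\<^bsub>module_cat A\<^esub> orbit reg b = orbit X (snd X b m)"
  using assms by (auto simp: orbit_def module_cat_def reg_def fd_module_def split_def intro!: restrict_ext)

lemma orbit_post:
  assumes X: "X \<in> Obj (module_cat A)" and m: "m \<in> carrier (fst X)" and f: "(X, e, Y) \<in> Hom (module_cat A) X Y"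
  shows "(X, e, Y) \<cdot>\<^bsub>module_cat A\<^esub> orbit X m = orbit Y (e m)"
  using f m by (auto simp: orbit_def module_cat_def reg_def Hom_def intro!: restrict_ext)

lemma orbit_one: "orbit reg \<one> = Idt (module_cat A) reg"
  by (auto simp: orbit_def module_cat_def reg_def intro!: restrict_ext)

end


subsection \<open>Categories equivalent to a module category\<close>

text \<open>Of an equivalence only the functor out of the module category is kept, as fully faithful
  and essentially surjective. In this form it can be composed with duality to reach the opposite
  category.\<close>

locale module_equivalence = linear_category C
  for C :: "('k::field, 'o, 'm, 'z) lin_cat_scheme" (structure) +
  fixes B :: "('k, 'k vec) module"
    and G :: "(('k, 'k vec) amod, ('k, 'k vec) amod \<times> ('k vec \<Rightarrow> 'k vec) \<times> ('k, 'k vec) amod, 'o, 'm) fun_data"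
  assumes algebra: "fd_algebra B"
    and G: "linear_functor (module_cat B) C G"
    and G_full: "X \<in> Obj (module_cat B) \<Longrightarrow> Y \<in> Obj (module_cat B) \<Longrightarrow> g \<in> Hom C (on_obj G X) (on_obj G Y) \<Longrightarrow>
      \<exists>f\<in>Hom (module_cat B) X Y. on_arr G f = g"
    and G_faithful: "f \<in> Hom (module_cat B) X Y \<Longrightarrow> f' \<in> Hom (module_cat B) X Y \<Longrightarrow> on_arr G f = on_arr G f' \<Longrightarrow> f = f'"
    and G_ess: "c \<in> Obj C \<Longrightarrow> \<exists>X\<in>Obj (module_cat B). \<exists>s\<in>Hom C (on_obj G X) c. iso_arrow C s"
begin

interpretation B: fd_algebra B by (rule algebra)

abbreviation "MB \<equiv> module_cat B :: ('k, ('k, 'k vec) amod, ('k, 'k vec) amod \<times> ('k vec \<Rightarrow> 'k vec) \<times> ('k, 'k vec) amod) lin_cat"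

interpretation G: is_functor MB C G using G by (simp add: linear_functor_def)

lemma G_lin:
  "X \<in> Obj MB \<Longrightarrow> Y \<in> Obj MB \<Longrightarrow> on_arr G \<in> linear_maps (hom_space MB X Y) (hom_space C (on_obj G X) (on_obj G Y))"
  using G by (simp add: linear_functor_def)

definition P :: 'o where "P = on_obj G B.reg"
text \<open>The image of right multiplication by \<open>b\<close>. It reverses products
  (\<open>R_mult\<close>) and reaches every endomorphism of \<open>P\<close>
  (\<open>R_surj\<close>), so actions of \<open>B\<close> on the left are actions of
  \<open>End(P)\<close> on the right.\<close>

definition R :: "'k vec \<Rightarrow> 'm" where "R b = on_arr G (B.orbit B.reg b)"

lemma P_obj [simp]: "P \<in> Obj C"
  unfolding P_def by (rule G.obj_map[OF B.reg_module])

lemma fst_reg [simp]: "fst B.reg = B" by (simp add: B.reg_def)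

lemma R_hom: "b \<in> carrier B \<Longrightarrow> R b \<in> Hom C P P"
  unfolding R_def P_def using B.orbit_hom[OF B.reg_module] by (intro G.arr_map) simp

lemma R_surj: "h \<in> Hom C P P \<Longrightarrow> \<exists>b\<in>carrier B. h = R b"
  unfolding R_def P_def using G_full[OF B.reg_module B.reg_module] B.hom_orbit[OF B.reg_module] by fastforce

lemma R_lin: "R \<in> linear_maps B (hom_space C P P)"
  using lin_comp[OF B.orbit_lin[OF B.reg_module] G_lin[OF B.reg_module B.reg_module]]
  by (simp add: R_def[abs_def] P_def)

lemma R_mult:
  assumes "x \<in> carrier B" "y \<in> carrier B"
  shows "R (x \<otimes>\<^bsub>B\<^esub> y) = R y \<cdot> R x"
proof -
  have "B.orbit B.reg (x \<otimes>\<^bsub>B\<^esub> y) = B.orbit B.reg y \<cdot>\<^bsub>MB\<^esub> B.orbit B.reg x"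
    using B.orbit_comp[OF B.reg_module, of y x] assms by (simp add: B.reg_def)
  then show ?thesis
    using G.comp_map[OF B.orbit_hom[OF B.reg_module] B.orbit_hom[OF B.reg_module]] assms by (simp add: R_def)
qed

lemma R_one: "R \<one>\<^bsub>B\<^esub> = Idt C P"
  by (simp add: R_def P_def B.orbit_one G.id_map[OF B.reg_module])

text \<open>\<open>Hom(P, x)\<close> is the module corresponding to \<open>x\<close>.\<close>

lemma hom_P_module:
  assumes x: "x \<in> Obj C"
  obtains X s q where "X \<in> Obj MB" "s \<in> Hom C (on_obj G X) x" "iso_arrow C s"
    "\<And>m. m \<in> carrier (fst X) \<Longrightarrow> q m = s \<cdot> on_arr G (B.orbit X m)"
    "q \<in> linear_maps (fst X) (hom_space C P x)" "bij_betw q (carrier (fst X)) (Hom C P x)"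
    "\<And>m b. m \<in> carrier (fst X) \<Longrightarrow> b \<in> carrier B \<Longrightarrow> q (snd X b m) = q m \<cdot> R b"
proof -
  obtain X s where X: "X \<in> Obj MB" and s: "s \<in> Hom C (on_obj G X) x" "iso_arrow C s" using G_ess[OF x] by blast
  let ?q = "\<lambda>m. s \<cdot> on_arr G (B.orbit X m)"
  have h: "on_arr G (B.orbit X m) \<in> Hom C P (on_obj G X)" if "m \<in> carrier (fst X)" for m
    unfolding P_def by (rule G.arr_map[OF B.orbit_hom[OF X that]])
  have lin: "?q \<in> linear_maps (fst X) (hom_space C P x)"
    using lin_comp[OF B.orbit_lin[OF X] lin_comp[OF G_lin[OF B.reg_module X] comp_linear_right[OF G.obj_map[OF B.reg_module] s(1)]]]
    by (simp add: P_def)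
  have "bij_betw ?q (carrier (fst X)) (Hom C P x)"
    unfolding bij_betw_def
  proof
    show "inj_on ?q (carrier (fst X))"
    proof (rule inj_onI)
      fix m m' assume m: "m \<in> carrier (fst X)" "m' \<in> carrier (fst X)" and eq: "?q m = ?q m'"
      have "on_arr G (B.orbit X m) = on_arr G (B.orbit X m')"
        by (rule iso_cancel_left[OF s(2) _ _ _ _ _ eq]) (use s h[OF m(1)] h[OF m(2)] in \<open>auto simp: Hom_def\<close>)
      then have "B.orbit X m = B.orbit X m'" by (rule G_faithful[OF B.orbit_hom[OF X m(1)] B.orbit_hom[OF X m(2)]])
      then show "m = m'" by (rule B.orbit_inj[OF X m])
    qed
    have "r \<in> ?q ` carrier (fst X)" if r: "r \<in> Hom C P x" for r
    proof -
      note i = inv_arrow[OF s]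
      have "inv_arrow C s \<cdot> r \<in> Hom C P (on_obj G X)" by (rule comp_in_hom[OF r i(1)])
      then obtain f where f: "f \<in> Hom MB B.reg X" "on_arr G f = inv_arrow C s \<cdot> r"
        using G_full[OF B.reg_module X] unfolding P_def by blast
      obtain m where m: "m \<in> carrier (fst X)" "f = B.orbit X m" using B.hom_orbit[OF X f(1)] by blast
      have "?q m = (s \<cdot> inv_arrow C s) \<cdot> r" using f(2) m(2) comp_assoc[OF r i(1) s(1)] by simp
      also have "\<dots> = r" using i(3) comp_id_left[OF r] by simp
      finally show ?thesis using m(1) by force
    qed
    then show "?q ` carrier (fst X) = Hom C P x" using lin_closed[OF lin] by auto
  qed
  moreover have "?q (snd X b m) = ?q m \<cdot> R b" if m: "m \<in> carrier (fst X)" and b: "b \<in> carrier B" for m b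
  proof -
    have "on_arr G (B.orbit X (snd X b m)) = on_arr G (B.orbit X m) \<cdot> R b"
      unfolding R_def B.orbit_comp[OF X m b, symmetric]
      by (rule G.comp_map[OF B.orbit_hom[OF B.reg_module] B.orbit_hom[OF X m]]) (simp add: b)
    then show ?thesis using comp_assoc[OF R_hom[OF b] h[OF m] s(1)] by simp
  qed
  ultimately show ?thesis using that[OF X s refl lin] by blast
qed

lemma hom_P_fd: "x \<in> Obj C \<Longrightarrow> fd_space (hom_space C P x)"
proof -
  assume x: "x \<in> Obj C"
  obtain X s q where X: "X \<in> Obj MB" and q: "q \<in> linear_maps (fst X) (hom_space C P x)" "bij_betw q (carrier (fst X)) (Hom C P x)"
    by (rule hom_P_module[OF x]) blast
  have fdX: "fd_space (fst X)" using X by (auto simp: module_cat_def fd_module_def)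
  have b: "bij_betw q (carrier (fst X)) (carrier (hom_space C P x))" using q(2) by simp
  show ?thesis
    by (rule inj_fd[OF hom_vectorspace[OF P_obj x] fdX lin_inv[OF fd_vs[OF fdX] q(1) b]])
      (use bij_betw_inv_into[OF b] in \<open>simp add: bij_betw_def\<close>)
qed

text \<open>\<open>P\<close> is a generator: up to isomorphism the two arrows come from module
  homomorphisms, and composing with arrows out of \<open>P\<close> evaluates these at single
  vectors.\<close>

lemma hom_P_faithful:
  assumes f: "f \<in> Hom C x y" "f' \<in> Hom C x y" and eq: "\<And>r. r \<in> Hom C P x \<Longrightarrow> f \<cdot> r = f' \<cdot> r"
  shows "f = f'"
proof -
  note x = hom_dom[OF f(1)] and y = hom_cod[OF f(1)]
  obtain X s q where X: "X \<in> Obj MB" and s: "s \<in> Hom C (on_obj G X) x" "iso_arrow C s"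
    and q: "\<And>m. m \<in> carrier (fst X) \<Longrightarrow> q m = s \<cdot> on_arr G (B.orbit X m)"
      "bij_betw q (carrier (fst X)) (Hom C P x)"
    by (rule hom_P_module[OF x]) blast
  obtain Y t where Y: "Y \<in> Obj MB" and t: "t \<in> Hom C (on_obj G Y) y" "iso_arrow C t" using G_ess[OF y] by blast
  note i = inv_arrow[OF t]
  have "\<exists>g\<in>Hom MB X Y. t \<cdot> on_arr G g = f \<cdot> s" if f: "f \<in> Hom C x y" for f
  proof -
    have "inv_arrow C t \<cdot> (f \<cdot> s) \<in> Hom C (on_obj G X) (on_obj G Y)"
      by (rule comp_in_hom[OF comp_in_hom[OF s(1) f] i(1)])
    then obtain g where g: "g \<in> Hom MB X Y" "on_arr G g = inv_arrow C t \<cdot> (f \<cdot> s)" using G_full[OF X Y] by blast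
    have "t \<cdot> on_arr G g = (t \<cdot> inv_arrow C t) \<cdot> (f \<cdot> s)"
      using g(2) comp_assoc[OF comp_in_hom[OF s(1) f] i(1) t(1)] by simp
    also have "\<dots> = f \<cdot> s" using i(3) comp_id_left[OF comp_in_hom[OF s(1) f]] by simp
    finally show ?thesis using g(1) by blast
  qed
  then obtain g g' where g: "g \<in> Hom MB X Y" "t \<cdot> on_arr G g = f \<cdot> s" "g' \<in> Hom MB X Y" "t \<cdot> on_arr G g' = f' \<cdot> s"
    using f by metis
  obtain e e' where e: "g = (X, e, Y)" "e \<in> extensional (carrier (fst X))"
      "\<And>m. m \<in> carrier (fst X) \<Longrightarrow> e m \<in> carrier (fst Y)"
    and e': "g' = (X, e', Y)" "e' \<in> extensional (carrier (fst X))"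
      "\<And>m. m \<in> carrier (fst X) \<Longrightarrow> e' m \<in> carrier (fst Y)"
    using g(1,3) by (cases g, cases g') (auto simp: Hom_def module_cat_def intro: lin_closed)
  have "e m = e' m" if m: "m \<in> carrier (fst X)" for m
  proof -
    note o = B.orbit_hom[OF X m]
    have Go: "on_arr G (B.orbit X m) \<in> Hom C P (on_obj G X)" unfolding P_def by (rule G.arr_map[OF o])
    note Gg = G.arr_map[OF g(1)] G.arr_map[OF g(3)]
    have qm: "q m \<in> Hom C P x" using bij_betwE[OF q(2)] m by blast
    have *: "t \<cdot> on_arr G (B.orbit Y (d m)) = h \<cdot> q m"
      if d: "(X, d, Y) \<in> Hom MB X Y" "t \<cdot> on_arr G (X, d, Y) = h \<cdot> s" and h: "h \<in> Hom C x y" for d h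
    proof -
      have "t \<cdot> on_arr G (B.orbit Y (d m)) = t \<cdot> (on_arr G (X, d, Y) \<cdot> on_arr G (B.orbit X m))"
        using G.comp_map[OF o d(1)] B.orbit_post[OF X m d(1)] by simp
      also have "\<dots> = (h \<cdot> s) \<cdot> on_arr G (B.orbit X m)"
        unfolding d(2)[symmetric] by (rule comp_assoc[OF Go G.arr_map[OF d(1)] t(1), symmetric])
      also have "\<dots> = h \<cdot> q m" unfolding q(1)[OF m] by (rule comp_assoc[OF Go s(1) h])
      finally show ?thesis .
    qed
    have te: "t \<cdot> on_arr G (B.orbit Y (e m)) = t \<cdot> on_arr G (B.orbit Y (e' m))"
      using *[OF _ _ f(1), of e] *[OF _ _ f(2), of e'] g eq[OF qm] by (simp add: e(1) e'(1))
    have oY: "B.orbit Y (e m) \<in> Hom MB B.reg Y" "B.orbit Y (e' m) \<in> Hom MB B.reg Y"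
      by (intro B.orbit_hom[OF Y] e(3) e'(3) m)+
    have "on_arr G (B.orbit Y (e m)) = on_arr G (B.orbit Y (e' m))"
      by (rule iso_cancel_left[OF t(2) _ _ _ _ _ te])
        (use t G.arr_map[OF oY(1)] G.arr_map[OF oY(2)] in \<open>auto simp: Hom_def\<close>)
    then have "B.orbit Y (e m) = B.orbit Y (e' m)" by (rule G_faithful[OF oY])
    then show ?thesis by (intro B.orbit_inj[OF Y]) (auto intro: e(3) e'(3) m)
  qed
  then have "g = g'" using e(1,2) e'(1,2) by (auto intro: extensionalityI)
  then have fs: "f \<cdot> s = f' \<cdot> s" using g by simp
  show ?thesis by (rule iso_cancel_right[OF s(2) _ _ _ _ _ fs]) (use s f in \<open>auto simp: Hom_def\<close>)
qed

text \<open>Compatibility with endomorphisms of \<open>P\<close> includes compatibility with every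
  \<open>R b\<close>, that is, linearity over \<open>B\<close>. So \<open>\<tau>\<close> is a module
  homomorphism, and \<open>G\<close> carries it to an arrow.\<close>

lemma hom_P_full:
  assumes x: "x \<in> Obj C" and y: "y \<in> Obj C"
    and \<tau>: "\<tau> \<in> linear_maps (hom_space C P x) (hom_space C P y)"
    and eqv: "\<And>r h. r \<in> Hom C P x \<Longrightarrow> h \<in> Hom C P P \<Longrightarrow> \<tau> (r \<cdot> h) = \<tau> r \<cdot> h"
  shows "\<exists>f\<in>Hom C x y. \<forall>r\<in>Hom C P x. f \<cdot> r = \<tau> r"
proof -
  obtain X s q where X: "X \<in> Obj MB" and s: "s \<in> Hom C (on_obj G X) x" "iso_arrow C s"
    and q: "\<And>m. m \<in> carrier (fst X) \<Longrightarrow> q m = s \<cdot> on_arr G (B.orbit X m)"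
      "q \<in> linear_maps (fst X) (hom_space C P x)" "bij_betw q (carrier (fst X)) (Hom C P x)"
      "\<And>m b. m \<in> carrier (fst X) \<Longrightarrow> b \<in> carrier B \<Longrightarrow> q (snd X b m) = q m \<cdot> R b"
    by (rule hom_P_module[OF x]) blast
  obtain Y t q' where Y: "Y \<in> Obj MB" and t: "t \<in> Hom C (on_obj G Y) y" "iso_arrow C t"
    and q': "\<And>m. m \<in> carrier (fst Y) \<Longrightarrow> q' m = t \<cdot> on_arr G (B.orbit Y m)"
      "q' \<in> linear_maps (fst Y) (hom_space C P y)" "bij_betw q' (carrier (fst Y)) (Hom C P y)"
      "\<And>m b. m \<in> carrier (fst Y) \<Longrightarrow> b \<in> carrier B \<Longrightarrow> q' (snd Y b m) = q' m \<cdot> R b"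
    by (rule hom_P_module[OF y]) blast
  have fdm: "fd_module B X" "fd_module B Y" using X Y by (auto simp: module_cat_def)
  then have vs: "is_vs (fst X)" "is_vs (fst Y)" by (auto simp: fd_module_def intro: fd_vs)
  have act: "snd X b m \<in> carrier (fst X)" if "b \<in> carrier B" "m \<in> carrier (fst X)" for b m
    using fdm(1) that by (auto simp: fd_module_def split_def intro: lin_closed)
  have act': "snd Y b m \<in> carrier (fst Y)" if "b \<in> carrier B" "m \<in> carrier (fst Y)" for b m
    using fdm(2) that by (auto simp: fd_module_def split_def intro: lin_closed)
  \<comment> \<open>The map \<open>\<tau>\<close> transported to the modules that represent
    \<open>x\<close> and \<open>y\<close>.\<close>
  define e where "e m = inv_into (carrier (fst Y)) q' (\<tau> (q m))" for m
  have el: "e \<in> linear_maps (fst X) (fst Y)"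
    unfolding e_def[abs_def] using q'(3) by (intro lin_comp[OF lin_comp[OF q(2) \<tau>] lin_inv[OF vs(2) q'(2)]]) simp
  have qc: "q m \<in> Hom C P x" if "m \<in> carrier (fst X)" for m using lin_closed[OF q(2) that] by simp
  have qe: "q' (e m) = \<tau> (q m)" if "m \<in> carrier (fst X)" for m
    unfolding e_def using q'(3) lin_closed[OF \<tau>] qc[OF that]
    by (intro f_inv_into_f) (auto simp: bij_betw_def)
  have eq: "e (snd X b m) = snd Y b (e m)" if b: "b \<in> carrier B" and m: "m \<in> carrier (fst X)" for b m
  proof (rule inj_onD[OF bij_betw_imp_inj_on[OF q'(3)]])
    have em: "e m \<in> carrier (fst Y)" by (rule lin_closed[OF el m])
    show "q' (e (snd X b m)) = q' (snd Y b (e m))"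
      using qe[OF act[OF b m]] q(4)[OF m b] q'(4)[OF em b] eqv[OF qc[OF m] R_hom[OF b]] qe[OF m] by simp
    show "e (snd X b m) \<in> carrier (fst Y)" by (rule lin_closed[OF el act[OF b m]])
    show "snd Y b (e m) \<in> carrier (fst Y)" by (rule act'[OF b em])
  qed
  let ?e = "\<lambda>m\<in>carrier (fst X). e m"
  have arr: "(X, ?e, Y) \<in> Hom MB X Y"
    using fdm eq act lin_cong[OF el vs(1), of ?e] by (simp add: Hom_def module_cat_def)
  note i = inv_arrow[OF s] and Ge = G.arr_map[OF arr]
  let ?f = "t \<cdot> (on_arr G (X, ?e, Y) \<cdot> inv_arrow C s)"
  have f: "?f \<in> Hom C x y" by (rule comp_in_hom[OF comp_in_hom[OF i(1) Ge] t(1)])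
  have "?f \<cdot> r = \<tau> r" if r: "r \<in> Hom C P x" for r
  proof -
    obtain m where m: "m \<in> carrier (fst X)" "r = q m" using q(3) r by (auto simp: bij_betw_def)
    note o = B.orbit_hom[OF X m(1)]
    have Go: "on_arr G (B.orbit X m) \<in> Hom C P (on_obj G X)" unfolding P_def by (rule G.arr_map[OF o])
    have "?f \<cdot> r = t \<cdot> (on_arr G (X, ?e, Y) \<cdot> ((inv_arrow C s \<cdot> s) \<cdot> on_arr G (B.orbit X m)))"
      using t(1) Ge i(1) s(1) Go by (simp add: m(2) q(1)[OF m(1)] Hom_def)
    also have "\<dots> = t \<cdot> (on_arr G (X, ?e, Y) \<cdot> on_arr G (B.orbit X m))"
      using i(2) comp_id_left[OF Go] by simp
    also have "\<dots> = q' (e m)"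
      using G.comp_map[OF o arr] B.orbit_post[OF X m(1) arr] m(1) q'(1)[OF lin_closed[OF el m(1)]] by simp
    finally show ?thesis using qe[OF m(1)] m(2) by simp
  qed
  then show ?thesis using f by blast
qed

text \<open>The source of all objects constructed below. The type of vectors of \<open>M\<close> is
  arbitrary, because the lemma is applied to a space of linear maps in the construction of copowers
  and to a dual space in that of Nakayama functors.\<close>

lemma hom_P_ess:
  fixes M :: "('k, 'w) module"
  assumes M: "fd_space M"
    and act_l: "\<And>h. h \<in> Hom C P P \<Longrightarrow> (\<lambda>m. act m h) \<in> linear_maps M M"
    and act_r: "\<And>m. m \<in> carrier M \<Longrightarrow> act m \<in> linear_maps (hom_space C P P) M"
    and act_comp: "\<And>m h h'. m \<in> carrier M \<Longrightarrow> h \<in> Hom C P P \<Longrightarrow> h' \<in> Hom C P P \<Longrightarrow> act m (h \<cdot> h') = act (act m h) h'"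
    and act_id: "\<And>m. m \<in> carrier M \<Longrightarrow> act m (Idt C P) = m"
  obtains n u where "n \<in> Obj C" "u \<in> linear_maps M (hom_space C P n)" "bij_betw u (carrier M) (Hom C P n)"
    "\<And>m h. m \<in> carrier M \<Longrightarrow> h \<in> Hom C P P \<Longrightarrow> u (act m h) = u m \<cdot> h"
proof -
  note vM = fd_vs[OF M]
  obtain \<phi> :: "'w \<Rightarrow> 'k vec" where inj: "inj_on \<phi> (carrier M)" using fd_inj_vec[OF M] .
  let ?\<psi> = "inv_into (carrier M) \<phi>"
  let ?T = "transport \<phi> M"
  note Tl = transport_lin[OF inj vM] and Tb = transport_bij[OF inj vM] and Ts = transport_simps[OF inj vM]
  have \<psi>l: "?\<psi> \<in> linear_maps ?T M" by (rule lin_inv[OF vM Tl Tb])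
  have \<psi>\<phi> [simp]: "?\<psi> (\<phi> m) = m" if "m \<in> carrier M" for m using inj that by simp
  have am: "act m h \<in> carrier M" if "m \<in> carrier M" "h \<in> Hom C P P" for m h
    by (rule lin_closed[OF act_l[OF that(2)] that(1)])
  \<comment> \<open>\<open>R\<close> turns the right action of \<open>End(P)\<close> into a left
    action of \<open>B\<close>, and \<open>\<phi>\<close> moves the carrier into
    \<open>'k vec\<close>.\<close>
  define X where "X = (?T, \<lambda>b v. \<phi> (act (?\<psi> v) (R b)))"
  have "fd_module B X"
    unfolding fd_module_def X_def split
  proof (intro conjI ballI)
    show "fd_space ?T" by (rule transport_fd[OF inj vM M])
    show "(\<lambda>v. \<phi> (act (?\<psi> v) (R x))) \<in> linear_maps ?T ?T" if "x \<in> carrier B" for x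
      by (rule lin_comp[OF \<psi>l lin_comp[OF act_l[OF R_hom[OF that]] Tl]])
    show "(\<lambda>x. \<phi> (act (?\<psi> v) (R x))) \<in> linear_maps B ?T" if "v \<in> carrier ?T" for v
      by (rule lin_comp[OF R_lin lin_comp[OF act_r[OF lin_closed[OF \<psi>l that]] Tl]])
    show "\<phi> (act (?\<psi> v) (R (x \<otimes>\<^bsub>B\<^esub> y))) = \<phi> (act (?\<psi> (\<phi> (act (?\<psi> v) (R y)))) (R x))"
      if "x \<in> carrier B" "y \<in> carrier B" "v \<in> carrier ?T" for x y v
      using that lin_closed[OF \<psi>l] by (simp add: R_mult act_comp R_hom am)
    show "\<phi> (act (?\<psi> v) (R \<one>\<^bsub>B\<^esub>)) = v" if "v \<in> carrier ?T" for v
      using that by (auto simp: R_one Ts act_id)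
  qed
  then have X: "X \<in> Obj MB" by (simp add: module_cat_def)
  let ?u = "\<lambda>m. on_arr G (B.orbit X (\<phi> m))"
  have fX: "fst X = ?T" by (simp add: X_def)
  have \<phi>X: "\<phi> m \<in> carrier (fst X)" if "m \<in> carrier M" for m using that by (simp add: fX Ts)
  have ul: "?u \<in> linear_maps M (hom_space C P (on_obj G X))"
    using lin_comp[OF Tl lin_comp[OF B.orbit_lin[OF X, unfolded fX] G_lin[OF B.reg_module X]]] by (simp add: P_def)
  have ub: "bij_betw ?u (carrier M) (Hom C P (on_obj G X))"
    unfolding bij_betw_def
  proof
    show "inj_on ?u (carrier M)"
    proof (rule inj_onI)
      fix m m' assume m: "m \<in> carrier M" "m' \<in> carrier M" and eq: "?u m = ?u m'"
      have "B.orbit X (\<phi> m) = B.orbit X (\<phi> m')"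
        by (rule G_faithful[OF B.orbit_hom[OF X \<phi>X[OF m(1)]] B.orbit_hom[OF X \<phi>X[OF m(2)]] eq])
      then have "\<phi> m = \<phi> m'" by (rule B.orbit_inj[OF X \<phi>X[OF m(1)] \<phi>X[OF m(2)]])
      then show "m = m'" using inj m by (auto dest: inj_onD)
    qed
    have "r \<in> ?u ` carrier M" if r: "r \<in> Hom C P (on_obj G X)" for r
    proof -
      obtain f where f: "f \<in> Hom MB B.reg X" "on_arr G f = r" using G_full[OF B.reg_module X] r unfolding P_def by blast
      obtain v where v: "v \<in> carrier (fst X)" "f = B.orbit X v" using B.hom_orbit[OF X f(1)] by blast
      then obtain m where "m \<in> carrier M" "v = \<phi> m" by (auto simp: fX Ts)
      then show ?thesis using f(2) v(2) by blast
    qed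
    then show "?u ` carrier M = Hom C P (on_obj G X)" using lin_closed[OF ul] by auto
  qed
  have "?u (act m h) = ?u m \<cdot> h" if m: "m \<in> carrier M" and h: "h \<in> Hom C P P" for m h
  proof -
    obtain b where b: "b \<in> carrier B" "h = R b" using R_surj[OF h] by blast
    have "?u m \<cdot> h = on_arr G (B.orbit X (\<phi> m) \<cdot>\<^bsub>MB\<^esub> B.orbit B.reg b)"
      unfolding b(2) R_def
      by (rule G.comp_map[OF B.orbit_hom[OF B.reg_module] B.orbit_hom[OF X \<phi>X[OF m]], symmetric]) (simp add: b)
    also have "\<dots> = on_arr G (B.orbit X (snd X b (\<phi> m)))" by (simp only: B.orbit_comp[OF X \<phi>X[OF m] b(1)])
    also have "snd X b (\<phi> m) = \<phi> (act m h)" using m by (simp add: X_def b(2))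
    finally show ?thesis by simp
  qed
  then show ?thesis using that[OF G.obj_map[OF X] ul ub] by blast
qed

text \<open>As \<open>P\<close> is a generator, sending \<open>f\<close> to composition with
  \<open>f\<close> embeds \<open>Hom(x, y)\<close> into the linear maps between the
  finite-dimensional spaces \<open>Hom(P, x)\<close> and \<open>Hom(P, y)\<close>.\<close>

sublocale fd_category C
proof
  fix x y assume x: "x \<in> Obj C" and y: "y \<in> Obj C"
  let ?f = "\<lambda>f. \<lambda>r\<in>Hom C P x. f \<cdot> r"
  note Hx = hom_vectorspace[OF P_obj x] and Hy = hom_vectorspace[OF P_obj y]
  show "fd_space (hom_space C x y)"
  proof (rule inj_fd[OF hom_vectorspace[OF x y] lin_space_fd[OF hom_P_fd[OF x] hom_P_fd[OF y]]])
    show "?f \<in> linear_maps (hom_space C x y) (lin_space (hom_space C P x) (hom_space C P y))"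
    proof (rule lin_mapI)
      show "?f f \<in> carrier (lin_space (hom_space C P x) (hom_space C P y))" if "f \<in> carrier (hom_space C x y)" for f
        using restrict_lin_space[OF Hx comp_linear_right[OF P_obj, of f x y]] that by simp
      show "?f (f \<oplus>\<^bsub>hom_space C x y\<^esub> f') = ?f f \<oplus>\<^bsub>lin_space (hom_space C P x) (hom_space C P y)\<^esub> ?f f'"
        if "f \<in> carrier (hom_space C x y)" "f' \<in> carrier (hom_space C x y)" for f f'
        using that lin_add[OF comp_linear_left[OF y]]
        by (auto simp: lin_space_simps(3) intro!: restrict_ext)
      show "?f (c \<odot>\<^bsub>hom_space C x y\<^esub> f) = c \<odot>\<^bsub>lin_space (hom_space C P x) (hom_space C P y)\<^esub> ?f f"
        if "f \<in> carrier (hom_space C x y)" for c f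
        using that by (auto simp: lin_space_simps(4) comp_scale_left intro!: restrict_ext)
    qed
    show "inj_on ?f (carrier (hom_space C x y))"
    proof (rule inj_onI)
      fix f f' assume f: "f \<in> carrier (hom_space C x y)" "f' \<in> carrier (hom_space C x y)" and eq: "?f f = ?f f'"
      show "f = f'"
      proof (rule hom_P_faithful)
        show "f \<cdot> r = f' \<cdot> r" if "r \<in> Hom C P x" for r using fun_cong[OF eq, of r] that by simp
      qed (use f in auto)
    qed
  qed
qed

end


subsection \<open>Tensorings from copowers\<close>

lemma lin_free_ext:
  assumes U: "is_vs U" and W: "is_vs W" and f: "f \<in> linear_maps U W" and b: "\<And>x. x \<in> S \<Longrightarrow> b x \<in> carrier U"
  shows "Poly_Mapping.keys p \<subseteq> S \<Longrightarrow> f (free_ext U b p) = free_ext W (\<lambda>x. f (b x)) p"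
proof (induction p rule: update_induct)
  case const
  have "f (b x) \<in> carrier W" if "x \<in> S" for x using lin_closed[OF f b[OF that]] .
  then have "free_ext W (\<lambda>x. f (b x)) 0 = \<zero>\<^bsub>W\<^esub>" by (rule free_ext_zero[OF W, of S "\<lambda>x. f (b x)"])
  moreover have "free_ext U b 0 = \<zero>\<^bsub>U\<^esub>" by (rule free_ext_zero[OF U, of S b]) (rule b)
  ultimately show ?case using lin_zero[OF U W f] by simp
next
  case (update p x c)
  have eq: "Poly_Mapping.update x c p = p + Poly_Mapping.single x c"
    using update.hyps(1)
    by (intro poly_mapping_eqI) (auto simp: lookup_update lookup_add lookup_single when_def in_keys_iff)
  have "Poly_Mapping.keys (Poly_Mapping.update x c p) = insert x (Poly_Mapping.keys p)"
    using update.hyps by (auto simp: in_keys_iff lookup_update split: if_splits)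
  then have x: "x \<in> S" and p: "Poly_Mapping.keys p \<subseteq> S" using update.prems by auto
  have s: "Poly_Mapping.keys (Poly_Mapping.single x c) \<subseteq> S" using x by auto
  have fb: "f (b x) \<in> carrier W" if "x \<in> S" for x using lin_closed[OF f b[OF that]] .
  have "free_ext U b (p + Poly_Mapping.single x c) = free_ext U b p \<oplus>\<^bsub>U\<^esub> free_ext U b (Poly_Mapping.single x c)"
    by (rule free_ext_add[OF U, of S b]) (use b p s in auto)
  moreover have "free_ext U b (Poly_Mapping.single x c) = c \<odot>\<^bsub>U\<^esub> b x"
    by (rule free_ext_single[OF U, of S b]) (use b x in auto)
  moreover have "free_ext W (\<lambda>x. f (b x)) (p + Poly_Mapping.single x c) =
      free_ext W (\<lambda>x. f (b x)) p \<oplus>\<^bsub>W\<^esub> free_ext W (\<lambda>x. f (b x)) (Poly_Mapping.single x c)"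
    by (rule free_ext_add[OF W, of S "\<lambda>x. f (b x)"]) (use fb p s in auto)
  moreover have "free_ext W (\<lambda>x. f (b x)) (Poly_Mapping.single x c) = c \<odot>\<^bsub>W\<^esub> f (b x)"
    by (rule free_ext_single[OF W, of S "\<lambda>x. f (b x)"]) (use fb x in auto)
  moreover have "free_ext U b p \<in> carrier U"
    by (rule free_ext_closed[OF U, of S b]) (use b p in auto)
  ultimately show ?case
    unfolding eq using update.IH[OF p] b[OF x] by (simp add: lin_add[OF f] lin_smult[OF f] U)
qed

context linear_category
begin

text \<open>The converse of \<open>tens_copower_ex\<close>. Injectivity holds because composition
  with the projections recovers the contractions, which determine a tensor along a frame;
  surjectivity is the resolution of the identity of \<open>n\<close>.\<close>

lemma copower_tensor_iso:
  fixes V :: "('k, 'v) module"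
  assumes cop: "copower C V x n j p" and y: "y \<in> Obj C"
  defines "T \<equiv> \<lambda>X. free_ext (hom_space C y n) (\<lambda>(v, k). j v \<cdot> k) (SOME q. q \<in> X)"
  shows "T \<in> linear_maps (tensor_space V (hom_space C y x)) (hom_space C y n)" (is ?lin)
    and "bij_betw T (carrier (tensor_space V (hom_space C y x))) (Hom C y n)" (is ?bij)
    and "\<And>v k. v \<in> carrier V \<Longrightarrow> k \<in> Hom C y x \<Longrightarrow> T (pure_tensor V (hom_space C y x) v k) = j v \<cdot> k"
proof -
  note o = copower_obj[OF cop]
  let ?H = "hom_space C y x" and ?U = "hom_space C y n" and ?b = "\<lambda>(v, k). j v \<cdot> k"
  note V = o(3) and H = hom_vectorspace[OF y o(1)] and U = hom_vectorspace[OF y o(2)]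
  let ?t = "tclass V ?H" and ?F = "free_space V ?H" and ?S = "carrier V \<times> carrier ?H"
  have b: "?b z \<in> carrier ?U" if "z \<in> ?S" for z
    using that comp_in_hom copower_inj[OF cop] by auto
  have keys: "q \<in> ?F \<Longrightarrow> Poly_Mapping.keys q \<subseteq> ?S" for q by (simp add: free_space_def)
  \<comment> \<open>The value does not depend on the representative that \<open>SOME\<close> picks
    in the definition of \<open>T\<close>.\<close>
  have ext: "free_ext ?U ?b q = free_ext ?U ?b q'" if q: "q \<in> ?F" "q' \<in> ?F" "q - q' \<in> tensor_null V ?H" for q q'
  proof (rule free_ext_diff[OF U b keys[OF q(1)] keys[OF q(2)]])
    show "free_ext ?U ?b (q - q') = \<zero>\<^bsub>?U\<^esub>"
    proof (rule free_ext_null[OF V H U _ _ _ q(3)])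
      show "?b (v, w) \<in> carrier ?U" if "v \<in> carrier V" "w \<in> carrier ?H" for v w using b that by auto
      show "(\<lambda>v. ?b (v, w)) \<in> linear_maps V ?U" if "w \<in> carrier ?H" for w
        using lin_comp[OF copower_inj_lin[OF cop] comp_linear_left[OF o(2)], of w y] that by simp
      show "(\<lambda>w. ?b (v, w)) \<in> linear_maps ?H ?U" if "v \<in> carrier V" for v
        using comp_linear_right[OF y copower_inj[OF cop that]] by simp
    qed
  qed
  have T: "T (?t q) = free_ext ?U ?b q" if q: "q \<in> ?F" for q
  proof -
    have "(SOME q'. q' \<in> ?t q) \<in> ?t q" by (rule someI[of _ q]) (rule tclass_self[OF V H q])
    then show ?thesis unfolding T_def using tclass_mem[OF V H] ext tensor_null_sub_comm[OF V H] by blast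
  qed
  have tc: "X \<in> carrier (tensor_space V ?H) \<Longrightarrow> \<exists>q\<in>?F. X = ?t q" for X
    using tensor_carrier[OF V H] by blast
  show lin: ?lin
  proof (rule lin_mapI)
    show "T X \<in> carrier ?U" if X: "X \<in> carrier (tensor_space V ?H)" for X
      using tc[OF X] T free_ext_closed[OF U b keys] by auto
    show "T (X \<oplus>\<^bsub>tensor_space V ?H\<^esub> Y) = T X \<oplus>\<^bsub>?U\<^esub> T Y"
      if XY: "X \<in> carrier (tensor_space V ?H)" "Y \<in> carrier (tensor_space V ?H)" for X Y
    proof -
      obtain q q' where q: "q \<in> ?F" "X = ?t q" "q' \<in> ?F" "Y = ?t q'" using tc XY by metis
      show ?thesis
        unfolding q(2,4) tensor_add[OF V H q(1,3)] T[OF q(1)] T[OF q(3)] T[OF free_space_add[OF q(1,3)]]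
        by (rule free_ext_add[OF U b keys[OF q(1)] keys[OF q(3)]])
    qed
    show "T (c \<odot>\<^bsub>tensor_space V ?H\<^esub> X) = c \<odot>\<^bsub>?U\<^esub> T X" if X: "X \<in> carrier (tensor_space V ?H)" for c X
    proof -
      obtain q where q: "q \<in> ?F" "X = ?t q" using tc X by metis
      show ?thesis
        unfolding q(2) tensor_smult[OF V H q(1)] T[OF q(1)] T[OF free_space_scale[OF q(1)]]
        by (rule free_ext_scale[OF U b keys[OF q(1)]])
    qed
  qed
  show pure: "T (pure_tensor V ?H v k) = j v \<cdot> k" if "v \<in> carrier V" "k \<in> Hom C y x" for v k
  proof -
    have "T (pure_tensor V ?H v k) = free_ext ?U ?b (Poly_Mapping.single (v, k) 1)"
      unfolding pure_tclass[OF V H] using that by (intro T free_space_single) auto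
    also have "\<dots> = j v \<cdot> k"
      using that b[of "(v, k)"] free_ext_single[OF U b, where x = "(v, k)" and c = 1] vs_one_smult[OF U, of "j v \<cdot> k"] by simp
    finally show ?thesis .
  qed
  obtain L where L: "frame V L" and id: "vsum (hom_space C n n) (map (\<lambda>q. j (fst q) \<cdot> p (snd q)) L) = Idt C n"
    by (rule copower_frame[OF cop])
  note Lin = frame_in[OF L]
  \<comment> \<open>Composing with \<open>p \<xi>\<close> sends the arrow of a pure tensor
    \<open>v \<otimes> k\<close> to the multiple of \<open>k\<close> by \<open>\<xi> v\<close>,
    which is what contraction does.\<close>
  have ctr: "p \<xi> \<cdot> T (?t q) = contract ?H \<xi> q" if \<xi>: "\<xi> \<in> carrier (dual_space V)" and q: "q \<in> ?F" for \<xi> q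
  proof -
    have "p \<xi> \<cdot> free_ext ?U ?b q = free_ext ?H (\<lambda>z. p \<xi> \<cdot> ?b z) q"
      by (rule lin_free_ext[OF U H comp_linear_right[OF y copower_proj[OF cop \<xi>]] b keys[OF q]])
    also have "\<dots> = contract ?H \<xi> q"
      unfolding contract_def[OF V H] free_ext_def
    proof (rule abelian_monoid.finsum_cong')
      show "abelian_monoid ?H"
      proof -
        interpret H: vectorspace class_ring ?H by (rule H)
        show ?thesis by (rule H.abelian_monoid_axioms)
      qed
      show "(\<lambda>z. poly_mapping.lookup q z \<odot>\<^bsub>?H\<^esub> (case z of (v, w) \<Rightarrow> \<xi> v \<odot>\<^bsub>?H\<^esub> w)) \<in> Poly_Mapping.keys q \<rightarrow> carrier ?H"
        using keys[OF q] by (auto intro!: scale_hom)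
      fix z assume "z \<in> Poly_Mapping.keys q"
      then obtain v k where z: "z = (v, k)" "v \<in> carrier V" "k \<in> Hom C y x" using keys[OF q] by auto
      have "p \<xi> \<cdot> (j v \<cdot> k) = (p \<xi> \<cdot> j v) \<cdot> k"
        by (rule comp_assoc[OF z(3) copower_inj[OF cop z(2)] copower_proj[OF cop \<xi>], symmetric])
      also have "\<dots> = scale_arr C (\<xi> v) k"
        using copower_proj_inj[OF cop z(2) \<xi>] comp_scale_left[OF z(3) id_in_hom[OF o(1)]] comp_id_left[OF z(3)] by simp
      finally show "poly_mapping.lookup q z \<odot>\<^bsub>?H\<^esub> (p \<xi> \<cdot> ?b z) =
        poly_mapping.lookup q z \<odot>\<^bsub>?H\<^esub> (case z of (v, w) \<Rightarrow> \<xi> v \<odot>\<^bsub>?H\<^esub> w)" by (simp add: z(1))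
    qed simp
    finally show ?thesis by (simp add: T[OF q])
  qed
  show ?bij
    unfolding bij_betw_def
  proof
    show "inj_on T (carrier (tensor_space V ?H))"
    proof (rule inj_onI)
      fix X Y assume XY: "X \<in> carrier (tensor_space V ?H)" "Y \<in> carrier (tensor_space V ?H)" and eq: "T X = T Y"
      obtain q q' where q: "q \<in> ?F" "X = ?t q" "q' \<in> ?F" "Y = ?t q'" using tc XY by metis
      have "map (\<lambda>l. (fst l, contract ?H (snd l) q)) L = map (\<lambda>l. (fst l, contract ?H (snd l) q')) L"
        using ctr[OF _ q(1)] ctr[OF _ q(3)] Lin eq by (auto simp: q(2,4))
      then show "X = Y"
        unfolding q(2,4) by (subst (1 2) frame_tensor_class[OF V H L]) (simp_all only: q)
    qed
    have "s \<in> T ` carrier (tensor_space V ?H)" if s: "s \<in> Hom C y n" for s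
    proof -
      have k: "p (snd l) \<cdot> s \<in> Hom C y x" if "l \<in> set L" for l
        using comp_in_hom[OF s copower_proj[OF cop]] Lin[OF that] by blast
      let ?xs = "map (\<lambda>l. (fst l, p (snd l) \<cdot> s)) L"
      have xs: "set ?xs \<subseteq> ?S" using Lin k by auto
      have jp: "set (map (\<lambda>l. j (fst l) \<cdot> p (snd l)) L) \<subseteq> Hom C n n"
        using comp_in_hom[OF copower_proj[OF cop] copower_inj[OF cop]] Lin by auto
      have "T (?t (fsum ?xs)) = vsum ?U (map (\<lambda>(v, w). T (pure_tensor V ?H v w)) ?xs)"
        by (rule tensor_lin_fsum[OF V H U lin xs])
      also have "\<dots> = vsum ?U (map (\<lambda>l. (j (fst l) \<cdot> p (snd l)) \<cdot> s) L)"
      proof -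
        have "T (pure_tensor V ?H (fst l) (p (snd l) \<cdot> s)) = (j (fst l) \<cdot> p (snd l)) \<cdot> s" if "l \<in> set L" for l
          using Lin[OF that] pure[OF _ k[OF that], of "fst l"] comp_assoc[OF s copower_proj[OF cop] copower_inj[OF cop], of "snd l" "fst l"] by metis
        then show ?thesis by (intro arg_cong[where f = "vsum ?U"]) simp
      qed
      also have "\<dots> = Idt C n \<cdot> s"
        unfolding id[symmetric] by (subst vsum_comp[OF o(2) s jp]) (simp add: o_def)
      also have "\<dots> = s" by (rule comp_id_left[OF s])
      finally have "s = T (?t (fsum ?xs))" by (rule sym)
      moreover have "?t (fsum ?xs) \<in> carrier (tensor_space V ?H)"
        unfolding tensor_carrier[OF V H] by (rule bexI[OF refl fsum_free[OF V H xs]])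
      ultimately show ?thesis by (rule image_eqI)
    qed
    then show "T ` carrier (tensor_space V ?H) = Hom C y n" using lin_closed[OF lin] by auto
  qed
qed

lemma tensoring_if_copowers:
  assumes cop: "\<And>(V :: ('k, 'v) module) x. fd_space V \<Longrightarrow> x \<in> Obj C \<Longrightarrow> \<exists>n j p. copower C V x n j p"
  shows "\<exists>\<Theta> :: ('k, 'v, 'o, 'm) tensoring. is_tensoring C \<Theta>"
proof -
  obtain n j p where c: "\<And>(V :: ('k, 'v) module) x. fd_space V \<Longrightarrow> x \<in> Obj C \<Longrightarrow> copower C V x (n V x) (j V x) (p V x)"
    using cop by metis
  let ?\<Theta> = "\<lparr>tens_obj = n, tens_iso = (\<lambda>V x y X. free_ext (hom_space C y (n V x)) (\<lambda>(v, k). j V x v \<cdot> k) (SOME q. q \<in> X))\<rparr>"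
  have "is_tensoring C ?\<Theta>"
    unfolding is_tensoring_def
  proof (intro allI impI conjI ballI; elim conjE)
    fix V :: "('k, 'v) module" and x assume V: "fd_space V" and x: "x \<in> Obj C"
    note cp = c[OF V x]
    show "tens_obj ?\<Theta> V x \<in> Obj C" using copower_obj(2)[OF cp] by simp
    fix y assume y: "y \<in> Obj C"
    show "tens_iso ?\<Theta> V x y \<in> linear_maps (tensor_space V (hom_space C y x)) (hom_space C y (tens_obj ?\<Theta> V x))"
      using copower_tensor_iso(1)[OF cp y] by simp
    show "bij_betw (tens_iso ?\<Theta> V x y) (carrier (tensor_space V (hom_space C y x))) (Hom C y (tens_obj ?\<Theta> V x))"
      using copower_tensor_iso(2)[OF cp y] by simp
    fix y' h v k assume y': "y' \<in> Obj C" and h: "h \<in> Hom C y' y" and v: "v \<in> carrier V" and k: "k \<in> Hom C y x"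
    show "tens_iso ?\<Theta> V x y' (pure_tensor V (hom_space C y' x) v (k \<cdot> h)) =
      tens_iso ?\<Theta> V x y (pure_tensor V (hom_space C y x) v k) \<cdot> h"
      using copower_tensor_iso(3)[OF cp y v k] copower_tensor_iso(3)[OF cp y' v comp_in_hom[OF h k]]
        comp_assoc[OF h k copower_inj[OF cp v]] by simp
  qed
  then show ?thesis by blast
qed

end


subsection \<open>Copowers and Nakayama functors in module categories\<close>

context module_equivalence
begin

text \<open>The copower is the object \<open>n\<close> for which \<open>Hom(P, n)\<close> is the
  space of linear maps from the dual of \<open>V\<close> to \<open>Hom(P, x)\<close>, a model of
  \<open>V \<otimes> Hom(P, x)\<close> that avoids the quotient. Projections are evaluations at
  functionals, and injections are the rank one maps \<open>E v\<close>.\<close>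

lemma copower_exists:
  fixes V :: "('k, 'v) module"
  assumes V: "fd_space V" and x: "x \<in> Obj C"
  shows "\<exists>n j p. copower C V x n j p"
proof -
  note vV = fd_vs[OF V]
  let ?W = "dual_space V" and ?H = "hom_space C P x"
  note vW = dual_space_vs[OF vV] and vH = hom_vectorspace[OF P_obj x]
  let ?M = "lin_space ?W ?H"
  have fM: "fd_space ?M" by (rule lin_space_fd[OF dual_space_fd[OF V] hom_P_fd[OF x]])
  note vM = fd_vs[OF fM]
  define act where "act \<phi> h = (\<lambda>\<xi>\<in>carrier ?W. \<phi> \<xi> \<cdot> h)" for \<phi> :: "('v \<Rightarrow> 'k) \<Rightarrow> 'm" and h
  have Mh: "\<phi> \<xi> \<in> Hom C P x" if "\<phi> \<in> carrier ?M" "\<xi> \<in> carrier ?W" for \<phi> \<xi>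
    using lin_closed[OF lin_space_lin[OF that(1)] that(2)] by simp
  have actM: "act \<phi> h \<in> carrier ?M" if "\<phi> \<in> carrier ?M" "h \<in> Hom C P P" for \<phi> h
    unfolding act_def by (rule restrict_lin_space[OF vW lin_comp[OF lin_space_lin[OF that(1)] comp_linear_left[OF x that(2)]]])
  obtain n u where n: "n \<in> Obj C" and u: "u \<in> linear_maps ?M (hom_space C P n)" "bij_betw u (carrier ?M) (Hom C P n)"
    "\<And>m h. m \<in> carrier ?M \<Longrightarrow> h \<in> Hom C P P \<Longrightarrow> u (act m h) = u m \<cdot> h"
  proof (rule hom_P_ess[OF fM, of act])
    show "(\<lambda>m. act m h) \<in> linear_maps ?M ?M" if h: "h \<in> Hom C P P" for h
    proof (rule lin_mapI)
      note l = comp_linear_left[OF x h]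
      show "act m h \<in> carrier ?M" if "m \<in> carrier ?M" for m by (rule actM[OF that h])
      show "act (m \<oplus>\<^bsub>?M\<^esub> m') h = act m h \<oplus>\<^bsub>?M\<^esub> act m' h" if "m \<in> carrier ?M" "m' \<in> carrier ?M" for m m'
        unfolding act_def lin_space_simps(3) using lin_add[OF l] Mh that by (auto intro!: restrict_ext)
      show "act (c \<odot>\<^bsub>?M\<^esub> m) h = c \<odot>\<^bsub>?M\<^esub> act m h" if "m \<in> carrier ?M" for m c
        unfolding act_def lin_space_simps(4) using lin_smult[OF l] Mh that by (auto intro!: restrict_ext)
    qed
    show "act m \<in> linear_maps (hom_space C P P) ?M" if m: "m \<in> carrier ?M" for m
    proof (rule lin_mapI)
      note l = comp_linear_right[OF P_obj Mh[OF m]]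
      show "act m h \<in> carrier ?M" if "h \<in> carrier (hom_space C P P)" for h using actM[OF m] that by simp
      show "act m (h \<oplus>\<^bsub>hom_space C P P\<^esub> h') = act m h \<oplus>\<^bsub>?M\<^esub> act m h'"
        if "h \<in> carrier (hom_space C P P)" "h' \<in> carrier (hom_space C P P)" for h h'
        unfolding act_def lin_space_simps(3) using lin_add[OF l] that by (auto intro!: restrict_ext)
      show "act m (c \<odot>\<^bsub>hom_space C P P\<^esub> h) = c \<odot>\<^bsub>?M\<^esub> act m h" if "h \<in> carrier (hom_space C P P)" for h c
        unfolding act_def lin_space_simps(4) using lin_smult[OF l] that by (auto intro!: restrict_ext)
    qed
    show "act m (h \<cdot> h') = act (act m h) h'" if "m \<in> carrier ?M" "h \<in> Hom C P P" "h' \<in> Hom C P P" for m h h'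
      unfolding act_def using comp_assoc[OF that(3,2) Mh[OF that(1)]] by (auto intro!: restrict_ext)
    show "act m (Idt C P) = m" if m: "m \<in> carrier ?M" for m
      using m comp_id_right[OF Mh[OF m]]
      by (auto simp: act_def lin_space_simps(1) intro!: extensionalityI[of _ "carrier ?W"])
  qed blast
  have ub: "bij_betw u (carrier ?M) (carrier (hom_space C P n))" using u(2) by simp
  define w where "w = inv_into (carrier ?M) u"
  have wl: "w \<in> linear_maps (hom_space C P n) ?M" unfolding w_def by (rule lin_inv[OF vM u(1) ub])
  have uw: "u (w r) = r" if "r \<in> Hom C P n" for r
    unfolding w_def by (rule f_inv_into_f[where f = u]) (use u(2) that in \<open>simp add: bij_betw_def\<close>)
  have wu: "w (u m) = m" if "m \<in> carrier ?M" for m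
    unfolding w_def using u(2) that by (intro inv_into_f_f) (simp_all add: bij_betw_def)
  have wc: "w r \<in> carrier ?M" if "r \<in> Hom C P n" for r using lin_closed[OF wl] that by simp
  have uc: "u m \<in> Hom C P n" if "m \<in> carrier ?M" for m using lin_closed[OF u(1) that] by simp
  \<comment> \<open>The linear map that corresponds to the pure tensor of \<open>v\<close> and
    \<open>r\<close> in this model.\<close>
  define E where "E v r = (\<lambda>\<xi>\<in>carrier ?W. \<xi> v \<odot>\<^bsub>?H\<^esub> r)" for v r
  have E: "E v r \<in> carrier ?M" if "v \<in> carrier V" "r \<in> Hom C P x" for v r
    unfolding E_def
  proof (rule restrict_lin_space[OF vW], rule lin_mapI)
    show "\<xi> v \<odot>\<^bsub>?H\<^esub> r \<in> carrier ?H" for \<xi> using that by (simp add: scale_hom)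
  qed (use that vs_add_smult[OF vH, of r] vs_smult_smult[OF vH, of r] in \<open>auto simp: dual_space_simps(3,4)\<close>)
  have E_r: "E v \<in> linear_maps ?H ?M" if v: "v \<in> carrier V" for v
  proof (rule lin_mapI)
    show "E v r \<in> carrier ?M" if "r \<in> carrier ?H" for r using E[OF v] that by simp
  qed (use vs_smult_add[OF vH] vs_smult_smult[OF vH] in
      \<open>auto simp: E_def lin_space_simps(3,4) mult.commute scale_hom intro!: restrict_ext\<close>)
  have E_v: "(\<lambda>v. E v r) \<in> linear_maps V ?M" if r: "r \<in> Hom C P x" for r
  proof (rule lin_mapI)
    show "E v r \<in> carrier ?M" if "v \<in> carrier V" for v by (rule E[OF that r])
    show "E (v \<oplus>\<^bsub>V\<^esub> v') r = E v r \<oplus>\<^bsub>?M\<^esub> E v' r" if "v \<in> carrier V" "v' \<in> carrier V" for v v'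
      unfolding E_def lin_space_simps(3) using that r
      by (auto simp: lin_add[OF dual_lin] vs_add_smult[OF vH, of r, simplified] intro!: restrict_ext)
    show "E (c \<odot>\<^bsub>V\<^esub> v) r = c \<odot>\<^bsub>?M\<^esub> E v r" if "v \<in> carrier V" for c v
      unfolding E_def lin_space_simps(4) using that r
      by (auto simp: lin_smult[OF dual_lin] vs_smult_smult[OF vH, of r, simplified] intro!: restrict_ext)
  qed
  have E_act: "E v (r \<cdot> h) = act (E v r) h" if "r \<in> Hom C P x" "h \<in> Hom C P P" for v r h
    using that comp_scale_left[OF that(2,1)] by (auto simp: E_def act_def intro!: restrict_ext)
  have "\<exists>f\<in>Hom C x n. \<forall>r\<in>Hom C P x. f \<cdot> r = u (E v r)" if v: "v \<in> carrier V" for v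
    by (rule hom_P_full[OF x n lin_comp[OF E_r[OF v] u(1)]]) (simp add: E_act u(3) E[OF v])
  then obtain j where j: "\<And>v. v \<in> carrier V \<Longrightarrow> j v \<in> Hom C x n"
    and jr: "\<And>v r. v \<in> carrier V \<Longrightarrow> r \<in> Hom C P x \<Longrightarrow> j v \<cdot> r = u (E v r)" by metis
  have w_act: "w (r \<cdot> h) = act (w r) h" if "r \<in> Hom C P n" "h \<in> Hom C P P" for r h
    using wu[OF actM[OF wc[OF that(1)] that(2)]] u(3)[OF wc[OF that(1)] that(2)] uw[OF that(1)] by simp
  have "\<exists>f\<in>Hom C n x. \<forall>r\<in>Hom C P n. f \<cdot> r = w r \<xi>" if \<xi>: "\<xi> \<in> carrier ?W" for \<xi>
    by (rule hom_P_full[OF n x lin_comp[OF wl eval_lin[OF \<xi>]]]) (simp add: w_act act_def \<xi>)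
  then obtain p where p: "\<And>\<xi>. \<xi> \<in> carrier ?W \<Longrightarrow> p \<xi> \<in> Hom C n x"
    and pr: "\<And>\<xi> r. \<xi> \<in> carrier ?W \<Longrightarrow> r \<in> Hom C P n \<Longrightarrow> p \<xi> \<cdot> r = w r \<xi>" by metis
  have jl: "j \<in> linear_maps V (hom_space C x n)"
  proof (rule lin_mapI)
    note vn = hom_vectorspace[OF x n]
    show "j v \<in> carrier (hom_space C x n)" if "v \<in> carrier V" for v using j[OF that] by simp
    show "j (v \<oplus>\<^bsub>V\<^esub> v') = j v \<oplus>\<^bsub>hom_space C x n\<^esub> j v'" if v: "v \<in> carrier V" "v' \<in> carrier V" for v v'
    proof (rule hom_P_faithful[OF j])
      show "j v \<oplus>\<^bsub>hom_space C x n\<^esub> j v' \<in> Hom C x n" using vs_add[OF vn] j v by simp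
      fix r assume r: "r \<in> Hom C P x"
      show "j (v \<oplus>\<^bsub>V\<^esub> v') \<cdot> r = (j v \<oplus>\<^bsub>hom_space C x n\<^esub> j v') \<cdot> r"
        using lin_add[OF comp_linear_left[OF n r], of "j v" "j v'"] j v jr[OF _ r] lin_add[OF E_v[OF r] v]
          lin_add[OF u(1) E[OF v(1) r] E[OF v(2) r]] by (simp add: vV)
    qed (simp add: v vV)
    show "j (c \<odot>\<^bsub>V\<^esub> v) = c \<odot>\<^bsub>hom_space C x n\<^esub> j v" if v: "v \<in> carrier V" for c v
    proof (rule hom_P_faithful[OF j])
      show "c \<odot>\<^bsub>hom_space C x n\<^esub> j v \<in> Hom C x n" using scale_hom j v by simp
      fix r assume r: "r \<in> Hom C P x"
      show "j (c \<odot>\<^bsub>V\<^esub> v) \<cdot> r = (c \<odot>\<^bsub>hom_space C x n\<^esub> j v) \<cdot> r"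
        using comp_scale_left[OF r j[OF v]] jr[OF _ r] lin_smult[OF E_v[OF r] v]
          lin_smult[OF u(1) E[OF v r]] v by (simp add: vV)
    qed (simp add: v vV)
  qed
  have pl: "p \<in> linear_maps ?W (hom_space C n x)"
  proof (rule lin_mapI)
    note vn = hom_vectorspace[OF n x]
    show "p \<xi> \<in> carrier (hom_space C n x)" if "\<xi> \<in> carrier ?W" for \<xi> using p[OF that] by simp
    show "p (\<xi> \<oplus>\<^bsub>?W\<^esub> \<zeta>) = p \<xi> \<oplus>\<^bsub>hom_space C n x\<^esub> p \<zeta>" if v: "\<xi> \<in> carrier ?W" "\<zeta> \<in> carrier ?W" for \<xi> \<zeta>
    proof (rule hom_P_faithful[OF p])
      show "p \<xi> \<oplus>\<^bsub>hom_space C n x\<^esub> p \<zeta> \<in> Hom C n x" using vs_add[OF vn] p v by simp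
      fix r assume r: "r \<in> Hom C P n"
      show "p (\<xi> \<oplus>\<^bsub>?W\<^esub> \<zeta>) \<cdot> r = (p \<xi> \<oplus>\<^bsub>hom_space C n x\<^esub> p \<zeta>) \<cdot> r"
        using lin_add[OF comp_linear_left[OF x r], of "p \<xi>" "p \<zeta>"] p v pr[OF _ r] vs_add[OF vW v]
          lin_add[OF lin_space_lin[OF wc[OF r]] v] by simp
    qed (rule vs_add[OF vW v])
    show "p (c \<odot>\<^bsub>?W\<^esub> \<xi>) = c \<odot>\<^bsub>hom_space C n x\<^esub> p \<xi>" if v: "\<xi> \<in> carrier ?W" for c \<xi>
    proof (rule hom_P_faithful[OF p])
      show "c \<odot>\<^bsub>hom_space C n x\<^esub> p \<xi> \<in> Hom C n x" using scale_hom p v by simp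
      fix r assume r: "r \<in> Hom C P n"
      show "p (c \<odot>\<^bsub>?W\<^esub> \<xi>) \<cdot> r = (c \<odot>\<^bsub>hom_space C n x\<^esub> p \<xi>) \<cdot> r"
        using comp_scale_left[OF r p[OF v]] pr[OF _ r] lin_smult[OF lin_space_lin[OF wc[OF r]] v] v
          vs_smult[OF vW v] by simp
    qed (rule vs_smult[OF vW v])
  qed
  have pj: "p \<xi> \<cdot> j v = scale_arr C (\<xi> v) (Idt C x)" if v: "v \<in> carrier V" and \<xi>: "\<xi> \<in> carrier ?W" for v \<xi>
  proof (rule hom_P_faithful[OF comp_in_hom[OF j[OF v] p[OF \<xi>]] scale_hom[OF id_in_hom[OF x]]])
    fix r assume r: "r \<in> Hom C P x"
    have "(p \<xi> \<cdot> j v) \<cdot> r = p \<xi> \<cdot> u (E v r)" using comp_assoc[OF r j[OF v] p[OF \<xi>]] jr[OF v r] by simp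
    also have "\<dots> = scale_arr C (\<xi> v) r" using pr[OF \<xi> uc[OF E[OF v r]]] wu[OF E[OF v r]] \<xi> by (simp add: E_def)
    also have "\<dots> = scale_arr C (\<xi> v) (Idt C x) \<cdot> r"
      using comp_scale_left[OF r id_in_hom[OF x]] comp_id_left[OF r] by simp
    finally show "(p \<xi> \<cdot> j v) \<cdot> r = scale_arr C (\<xi> v) (Idt C x) \<cdot> r" .
  qed
  obtain L where L: "frame V L" using V by (rule fd_frame)
  note Lin = frame_in[OF L]
  have S: "set (map (\<lambda>q. j (fst q) \<cdot> p (snd q)) L) \<subseteq> Hom C n n"
    using comp_in_hom[OF p j] Lin by auto
  \<comment> \<open>Tested on an arrow \<open>r\<close> from \<open>P\<close>, the claim says that
    the linear map \<open>w r\<close> is the sum of its rank one parts; at a functional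
    \<open>\<xi>\<close> this is \<open>frame_dual\<close> followed by linearity of
    \<open>w r\<close>.\<close>
  have id: "vsum (hom_space C n n) (map (\<lambda>q. j (fst q) \<cdot> p (snd q)) L) = Idt C n" (is "?s = _")
  proof (rule hom_P_faithful[OF vsum_hom[OF n n S] id_in_hom[OF n]])
    fix r assume r: "r \<in> Hom C P n"
    note m = wc[OF r]
    have Ec: "E (fst q) (w r (snd q)) \<in> carrier ?M" if "q \<in> set L" for q
      using E[OF _ Mh[OF m]] Lin[OF that] by blast
    let ?Es = "map (\<lambda>q. E (fst q) (w r (snd q))) L"
    have sE: "set ?Es \<subseteq> carrier ?M" using Ec by auto
    have "?s \<cdot> r = vsum (hom_space C P n) (map (\<lambda>q. (j (fst q) \<cdot> p (snd q)) \<cdot> r) L)"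
      by (subst vsum_comp[OF n r S]) (simp add: o_def)
    also have "\<dots> = vsum (hom_space C P n) (map u ?Es)"
    proof (simp add: o_def, intro arg_cong[where f = "vsum _"] map_cong refl)
      fix q assume "q \<in> set L"
      then have q: "fst q \<in> carrier V" "snd q \<in> carrier ?W" using Lin by auto
      show "(j (fst q) \<cdot> p (snd q)) \<cdot> r = u (E (fst q) (w r (snd q)))"
        using comp_assoc[OF r p[OF q(2)] j[OF q(1)]] pr[OF q(2) r] jr[OF q(1) Mh[OF m q(2)]] by simp
    qed
    also have "\<dots> = u (vsum ?M ?Es)"
      by (rule lin_vsum[OF vM hom_vectorspace[OF P_obj n] u(1) sE, symmetric])
    also have "vsum ?M ?Es = w r"
    proof (rule lin_space_eqI[OF vsum_closed[OF vM sE] m])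
      fix \<xi> assume \<xi>: "\<xi> \<in> carrier ?W"
      let ?xs = "map (\<lambda>q. \<xi> (fst q) \<odot>\<^bsub>?W\<^esub> snd q) L"
      have xs: "set ?xs \<subseteq> carrier ?W" using Lin by (auto intro!: vs_smult[OF vW])
      have "vsum ?M ?Es \<xi> = vsum ?H (map (\<lambda>f. f \<xi>) ?Es)"
        by (rule lin_vsum[OF vM vH eval_lin[OF \<xi>] sE])
      also have "map (\<lambda>f. f \<xi>) ?Es = map (w r) ?xs"
        using Lin \<xi> by (auto simp: E_def lin_smult[OF lin_space_lin[OF m]])
      also have "vsum ?H (map (w r) ?xs) = w r (vsum ?W ?xs)"
        by (rule lin_vsum[OF vW vH lin_space_lin[OF m] xs, symmetric])
      also have "vsum ?W ?xs = \<xi>" by (rule frame_dual[OF vV L \<xi>])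
      finally show "vsum ?M ?Es \<xi> = w r \<xi>" .
    qed
    also have "u (w r) = Idt C n \<cdot> r" using uw[OF r] comp_id_left[OF r] by simp
    finally show "?s \<cdot> r = Idt C n \<cdot> r" .
  qed
  have "copower C V x n j p"
    unfolding copower_def using x n vV jl pl pj L id by blast
  then show ?thesis by blast
qed

lemma tensoring_exists: "\<exists>\<Theta> :: ('k, 'v, 'o, 'm) tensoring. is_tensoring C \<Theta>"
  by (rule tensoring_if_copowers[OF copower_exists])

text \<open>Since \<open>P\<close> is a generator, a natural family is determined by its component
  at \<open>P\<close>, which is a linear map from the dual of \<open>Hom(c, P)\<close> to
  \<open>Hom(P, d)\<close> compatible with \<open>End(P)\<close>. If the dual is identified with
  \<open>Hom(P, n)\<close>, such maps are the arrows from \<open>n\<close> to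
  \<open>d\<close>.\<close>

lemma nak_univ_exists:
  assumes c: "c \<in> Obj C"
  shows "\<exists>n \<iota>. nak_univ C c n \<iota>"
proof -
  let ?H = "\<lambda>a. hom_space C c a" and ?D = "\<lambda>a. dual_space (hom_space C c a)"
  note vH = hom_vectorspace[OF c]
  define act where "act \<xi> h = dual_map (?H P) (\<lambda>k. h \<cdot> k) \<xi>" for \<xi> :: "'m \<Rightarrow> 'k" and h
  have dm: "dual_map (?H a) (\<lambda>k. h \<cdot> k) \<in> linear_maps (?D b) (?D a)" if "h \<in> Hom C a b" for h a b
    by (rule dual_map_lin[OF vH[OF hom_dom[OF that]] comp_linear_right[OF c that]])
  have dmc: "dual_map (?H a) (\<lambda>k. h \<cdot> k) \<xi> \<in> carrier (?D a)" if "h \<in> Hom C a b" "\<xi> \<in> carrier (?D b)" for h a b \<xi>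
    by (rule lin_closed[OF dm[OF that(1)] that(2)])
  have dd: "dual_map (?H a) (\<lambda>k. h \<cdot> k) (dual_map (?H b) (\<lambda>k. h' \<cdot> k) \<xi>) = dual_map (?H a) (\<lambda>k. (h' \<cdot> h) \<cdot> k) \<xi>"
    if "h \<in> Hom C a b" "h' \<in> Hom C b d" for a b d h h' \<xi>
    by (rule dual_map_comp) (use that comp_in_hom comp_assoc in auto)
  have dlin: "(\<lambda>r. dual_map (?H a) (\<lambda>k. r \<cdot> k) \<xi>) \<in> linear_maps (hom_space C a b) (?D a)"
    if a: "a \<in> Obj C" and b: "b \<in> Obj C" and \<xi>: "\<xi> \<in> carrier (?D b)" for a b \<xi>
  proof (rule lin_mapI)
    show "dual_map (?H a) (\<lambda>k. r \<cdot> k) \<xi> \<in> carrier (?D a)" if "r \<in> carrier (hom_space C a b)" for r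
      using dmc[OF _ \<xi>] that by simp
    show "dual_map (?H a) (\<lambda>k. (r \<oplus>\<^bsub>hom_space C a b\<^esub> r') \<cdot> k) \<xi> =
      dual_map (?H a) (\<lambda>k. r \<cdot> k) \<xi> \<oplus>\<^bsub>?D a\<^esub> dual_map (?H a) (\<lambda>k. r' \<cdot> k) \<xi>"
      if r: "r \<in> carrier (hom_space C a b)" "r' \<in> carrier (hom_space C a b)" for r r'
    proof -
      have "\<xi> ((r \<oplus>\<^bsub>hom_space C a b\<^esub> r') \<cdot> k) = \<xi> (r \<cdot> k) + \<xi> (r' \<cdot> k)" if k: "k \<in> Hom C c a" for k
        using lin_add[OF comp_linear_left[OF b k] r] lin_add[OF dual_lin[OF \<xi>], of "r \<cdot> k" "r' \<cdot> k"]
          comp_in_hom[OF k] r by simp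
      then show ?thesis by (auto simp: dual_map_def dual_space_simps(3) intro!: restrict_ext)
    qed
    show "dual_map (?H a) (\<lambda>k. (s \<odot>\<^bsub>hom_space C a b\<^esub> r) \<cdot> k) \<xi> = s \<odot>\<^bsub>?D a\<^esub> dual_map (?H a) (\<lambda>k. r \<cdot> k) \<xi>"
      if r: "r \<in> carrier (hom_space C a b)" for r s
    proof -
      have "\<xi> ((s \<odot>\<^bsub>hom_space C a b\<^esub> r) \<cdot> k) = s * \<xi> (r \<cdot> k)" if k: "k \<in> Hom C c a" for k
        using comp_scale_left[OF k, of r b s] lin_smult[OF dual_lin[OF \<xi>], of "r \<cdot> k" s] comp_in_hom[OF k] r by simp
      then show ?thesis by (auto simp: dual_map_def dual_space_simps(4) intro!: restrict_ext)
    qed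
  qed
  have fM: "fd_space (?D P)" by (rule dual_space_fd[OF hom_fd[OF c P_obj]])
  note vM = fd_vs[OF fM]
  obtain n u where n: "n \<in> Obj C" and u: "u \<in> linear_maps (?D P) (hom_space C P n)"
    "bij_betw u (carrier (?D P)) (Hom C P n)"
    "\<And>m h. m \<in> carrier (?D P) \<Longrightarrow> h \<in> Hom C P P \<Longrightarrow> u (act m h) = u m \<cdot> h"
  proof (rule hom_P_ess[OF fM, of act])
    show "(\<lambda>m. act m h) \<in> linear_maps (?D P) (?D P)" if "h \<in> Hom C P P" for h
      unfolding act_def by (rule dm[OF that])
    show "act m \<in> linear_maps (hom_space C P P) (?D P)" if "m \<in> carrier (?D P)" for m
      unfolding act_def[abs_def] by (rule dlin[OF P_obj P_obj that])
    show "act m (h \<cdot> h') = act (act m h) h'" if "h \<in> Hom C P P" "h' \<in> Hom C P P" for m h h'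
      unfolding act_def by (rule dd[OF that(2,1), symmetric])
    show "act m (Idt C P) = m" if "m \<in> carrier (?D P)" for m
      unfolding act_def by (rule dual_map_id[OF vH[OF P_obj] that]) (simp add: comp_id_left)
  qed blast
  have ub: "bij_betw u (carrier (?D P)) (carrier (hom_space C P n))" using u(2) by simp
  define w where "w = inv_into (carrier (?D P)) u"
  have wl: "w \<in> linear_maps (hom_space C P n) (?D P)" unfolding w_def by (rule lin_inv[OF vM u(1) ub])
  have uw: "u (w r) = r" if "r \<in> Hom C P n" for r
    unfolding w_def by (rule f_inv_into_f[where f = u]) (use u(2) that in \<open>simp add: bij_betw_def\<close>)
  have wu: "w (u m) = m" if "m \<in> carrier (?D P)" for m
    unfolding w_def using u(2) that by (intro inv_into_f_f) (simp_all add: bij_betw_def)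
  have wc: "w r \<in> carrier (?D P)" if "r \<in> Hom C P n" for r using lin_closed[OF wl] that by simp
  have uc: "u m \<in> Hom C P n" if "m \<in> carrier (?D P)" for m using lin_closed[OF u(1) that] by simp
  \<comment> \<open>Naturality along \<open>r\<close> leaves no choice: the composite of the
    component at \<open>\<xi>\<close> with \<open>r\<close> has to be the component at
    \<open>P\<close> of \<open>\<xi>\<close> pulled back along \<open>r\<close>.\<close>
  have "\<exists>f\<in>Hom C a n. \<forall>r\<in>Hom C P a. f \<cdot> r = u (dual_map (?H P) (\<lambda>k. r \<cdot> k) \<xi>)"
    if a: "a \<in> Obj C" and \<xi>: "\<xi> \<in> carrier (?D a)" for a \<xi>
  proof (rule hom_P_full[OF a n lin_comp[OF dlin[OF P_obj a \<xi>] u(1)]])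
    fix r h assume r: "r \<in> Hom C P a" and h: "h \<in> Hom C P P"
    show "u (dual_map (?H P) (\<lambda>k. (r \<cdot> h) \<cdot> k) \<xi>) = u (dual_map (?H P) (\<lambda>k. r \<cdot> k) \<xi>) \<cdot> h"
      unfolding u(3)[OF dmc[OF r \<xi>] h, symmetric] act_def dd[OF h r] ..
  qed
  then obtain \<iota> where \<iota>: "\<And>a \<xi>. a \<in> Obj C \<Longrightarrow> \<xi> \<in> carrier (?D a) \<Longrightarrow> \<iota> a \<xi> \<in> Hom C a n"
    and \<iota>r: "\<And>a \<xi> r. a \<in> Obj C \<Longrightarrow> \<xi> \<in> carrier (?D a) \<Longrightarrow> r \<in> Hom C P a \<Longrightarrow>
      \<iota> a \<xi> \<cdot> r = u (dual_map (?H P) (\<lambda>k. r \<cdot> k) \<xi>)"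
    by metis
  have fam: "nak_family C c n \<iota>"
    unfolding nak_family_def
  proof (intro conjI ballI n)
    fix a assume a: "a \<in> Obj C"
    note vD = dual_space_vs[OF vH[OF a]]
    show "\<iota> a \<in> linear_maps (?D a) (hom_space C a n)"
    proof (rule lin_mapI)
      show "\<iota> a \<xi> \<in> carrier (hom_space C a n)" if "\<xi> \<in> carrier (?D a)" for \<xi> using \<iota>[OF a that] by simp
      show "\<iota> a (\<xi> \<oplus>\<^bsub>?D a\<^esub> \<zeta>) = \<iota> a \<xi> \<oplus>\<^bsub>hom_space C a n\<^esub> \<iota> a \<zeta>"
        if v: "\<xi> \<in> carrier (?D a)" "\<zeta> \<in> carrier (?D a)" for \<xi> \<zeta>
      proof (rule hom_P_faithful[OF \<iota>[OF a]])
        show "\<iota> a \<xi> \<oplus>\<^bsub>hom_space C a n\<^esub> \<iota> a \<zeta> \<in> Hom C a n"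
          using vs_add[OF hom_vectorspace[OF a n]] \<iota>[OF a] v by simp
        fix r assume r: "r \<in> Hom C P a"
        show "\<iota> a (\<xi> \<oplus>\<^bsub>?D a\<^esub> \<zeta>) \<cdot> r = (\<iota> a \<xi> \<oplus>\<^bsub>hom_space C a n\<^esub> \<iota> a \<zeta>) \<cdot> r"
          using lin_add[OF comp_linear_left[OF n r], of "\<iota> a \<xi>" "\<iota> a \<zeta>"] \<iota>[OF a] v \<iota>r[OF a _ r] vs_add[OF vD v]
            lin_add[OF lin_comp[OF dm[OF r] u(1)] v] by simp
      qed (rule vs_add[OF vD v])
      show "\<iota> a (s \<odot>\<^bsub>?D a\<^esub> \<xi>) = s \<odot>\<^bsub>hom_space C a n\<^esub> \<iota> a \<xi>" if v: "\<xi> \<in> carrier (?D a)" for s \<xi>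
      proof (rule hom_P_faithful[OF \<iota>[OF a]])
        show "s \<odot>\<^bsub>hom_space C a n\<^esub> \<iota> a \<xi> \<in> Hom C a n" using scale_hom \<iota>[OF a v] by simp
        fix r assume r: "r \<in> Hom C P a"
        show "\<iota> a (s \<odot>\<^bsub>?D a\<^esub> \<xi>) \<cdot> r = (s \<odot>\<^bsub>hom_space C a n\<^esub> \<iota> a \<xi>) \<cdot> r"
          using comp_scale_left[OF r \<iota>[OF a v]] \<iota>r[OF a _ r] vs_smult[OF vD v] v
            lin_smult[OF lin_comp[OF dm[OF r] u(1)] v] by simp
      qed (rule vs_smult[OF vD v])
    qed
    fix b h \<xi> assume b: "b \<in> Obj C" and h: "h \<in> Hom C a b" and \<xi>: "\<xi> \<in> carrier (?D b)"
    show "\<iota> a (dual_map (?H a) (\<lambda>k. h \<cdot> k) \<xi>) = \<iota> b \<xi> \<cdot> h"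
    proof (rule hom_P_faithful[OF \<iota>[OF a dmc[OF h \<xi>]] comp_in_hom[OF h \<iota>[OF b \<xi>]]])
      fix r assume r: "r \<in> Hom C P a"
      show "\<iota> a (dual_map (?H a) (\<lambda>k. h \<cdot> k) \<xi>) \<cdot> r = (\<iota> b \<xi> \<cdot> h) \<cdot> r"
        using \<iota>r[OF a dmc[OF h \<xi>] r] dd[OF r h] comp_assoc[OF r h \<iota>[OF b \<xi>]] \<iota>r[OF b \<xi> comp_in_hom[OF r h]] by simp
    qed
  qed
  \<comment> \<open>Hence every arrow from \<open>P\<close> to \<open>n\<close> has the form
    \<open>\<iota> P \<xi>\<close>, which gives uniqueness of the factorisation below.\<close>
  have \<iota>P: "\<iota> P \<xi> = u \<xi>" if \<xi>: "\<xi> \<in> carrier (?D P)" for \<xi>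
  proof -
    have "\<iota> P \<xi> = \<iota> P \<xi> \<cdot> Idt C P" using comp_id_right[OF \<iota>[OF P_obj \<xi>]] by simp
    also have "\<dots> = u (dual_map (?H P) (\<lambda>k. Idt C P \<cdot> k) \<xi>)" by (rule \<iota>r[OF P_obj \<xi> id_in_hom[OF P_obj]])
    also have "dual_map (?H P) (\<lambda>k. Idt C P \<cdot> k) \<xi> = \<xi>"
      by (rule dual_map_id[OF vH[OF P_obj] \<xi>]) (simp add: comp_id_left)
    finally show ?thesis .
  qed
  have "nak_univ C c n \<iota>"
    unfolding nak_univ_def
  proof (intro conjI fam allI impI)
    fix d \<sigma> assume \<sigma>: "nak_family C c d \<sigma>"
    have d: "d \<in> Obj C" using \<sigma> by (simp add: nak_family_def)
    obtain t where t: "t \<in> Hom C n d" "\<And>r. r \<in> Hom C P n \<Longrightarrow> t \<cdot> r = \<sigma> P (w r)"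
    proof -
      have "\<exists>t\<in>Hom C n d. \<forall>r\<in>Hom C P n. t \<cdot> r = \<sigma> P (w r)"
      proof (rule hom_P_full[OF n d lin_comp[OF wl nak_family_lin[OF \<sigma> P_obj]]])
        fix r h assume r: "r \<in> Hom C P n" and h: "h \<in> Hom C P P"
        have "w (r \<cdot> h) = act (w r) h"
          using wu[OF dmc[OF h wc[OF r]]] u(3)[OF wc[OF r] h] uw[OF r] by (simp add: act_def)
        then show "\<sigma> P (w (r \<cdot> h)) = \<sigma> P (w r) \<cdot> h"
          using nak_family_nat[OF \<sigma> h wc[OF r]] by (simp add: act_def)
      qed
      then show ?thesis using that by blast
    qed
    show "\<exists>!t. t \<in> Hom C n d \<and> (\<forall>a\<in>Obj C. \<forall>\<xi>\<in>carrier (?D a). t \<cdot> \<iota> a \<xi> = \<sigma> a \<xi>)"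
    proof (rule ex1I[of _ t], intro conjI ballI t(1))
      fix a \<xi> assume a: "a \<in> Obj C" and \<xi>: "\<xi> \<in> carrier (?D a)"
      show "t \<cdot> \<iota> a \<xi> = \<sigma> a \<xi>"
      proof (rule hom_P_faithful[OF comp_in_hom[OF \<iota>[OF a \<xi>] t(1)] nak_family_hom[OF \<sigma> a \<xi>]])
        fix r assume r: "r \<in> Hom C P a"
        show "(t \<cdot> \<iota> a \<xi>) \<cdot> r = \<sigma> a \<xi> \<cdot> r"
          using comp_assoc[OF r \<iota>[OF a \<xi>] t(1)] \<iota>r[OF a \<xi> r] t(2)[OF uc[OF dmc[OF r \<xi>]]] wu[OF dmc[OF r \<xi>]]
            nak_family_nat[OF \<sigma> r \<xi>] by simp
      qed
    next
      fix t' assume t': "t' \<in> Hom C n d \<and> (\<forall>a\<in>Obj C. \<forall>\<xi>\<in>carrier (?D a). t' \<cdot> \<iota> a \<xi> = \<sigma> a \<xi>)"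
      show "t' = t"
      proof (rule hom_P_faithful[OF _ t(1)])
        show "t' \<in> Hom C n d" using t' by simp
        fix r assume r: "r \<in> Hom C P n"
        have "\<iota> P (w r) = r" using \<iota>P[OF wc[OF r]] uw[OF r] by simp
        then show "t' \<cdot> r = t \<cdot> r" using t' P_obj wc[OF r] t(2)[OF r] by metis
      qed
    qed
  qed
  then show ?thesis by blast
qed

text \<open>The universal property at each object fixes the action on arrows, and both functor laws
  follow from uniqueness of factorisations.\<close>

lemma nakayama_exists: "\<exists>N. nakayama C N"
proof -
  obtain n \<iota> where \<iota>: "\<And>c. c \<in> Obj C \<Longrightarrow> nak_univ C c (n c) (\<iota> c)"
    using nak_univ_exists by metis
  note fam = nak_univ_family[OF \<iota>]
  let ?dm = "\<lambda>c' a f. dual_map (hom_space C c' a) (\<lambda>k. k \<cdot> f)"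
  have dmc: "?dm c' a f \<xi> \<in> carrier (dual_space (hom_space C c' a))"
    if "f \<in> Hom C c c'" "a \<in> Obj C" "\<xi> \<in> carrier (dual_space (hom_space C c a))" for c c' f a \<xi>
    by (rule dual_map_closed[OF hom_vectorspace[OF hom_cod[OF that(1)] that(2)] comp_linear_left[OF that(2,1)] that(3)])
  define Q where "Q c c' f t \<longleftrightarrow> t \<in> Hom C (n c) (n c') \<and>
    (\<forall>a\<in>Obj C. \<forall>\<xi>\<in>carrier (dual_space (hom_space C c a)). t \<cdot> \<iota> c a \<xi> = \<iota> c' a (?dm c' a f \<xi>))" for c c' f t
  have Q: "\<exists>t. Q c c' f t" if f: "f \<in> Hom C c c'" for f c c'
  proof -
    note c = hom_dom[OF f] and c' = hom_cod[OF f]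
    have "nak_family C c (n c') (\<lambda>a \<xi>. \<iota> c' a (?dm c' a f \<xi>))"
      unfolding nak_family_def
    proof (intro conjI ballI)
      show "n c' \<in> Obj C" using fam[OF c'] by (simp add: nak_family_def)
      fix a assume a: "a \<in> Obj C"
      show "(\<lambda>\<xi>. \<iota> c' a (?dm c' a f \<xi>)) \<in> linear_maps (dual_space (hom_space C c a)) (hom_space C a (n c'))"
        by (rule lin_comp[OF dual_map_lin[OF hom_vectorspace[OF c' a] comp_linear_left[OF a f]] nak_family_lin[OF fam[OF c'] a]])
      fix b h \<xi> assume b: "b \<in> Obj C" and h: "h \<in> Hom C a b" and \<xi>: "\<xi> \<in> carrier (dual_space (hom_space C c b))"
      have "?dm c' a f (dual_map (hom_space C c a) (\<lambda>k. h \<cdot> k) \<xi>) = dual_map (hom_space C c' a) (\<lambda>k. h \<cdot> k) (?dm c' b f \<xi>)"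
        by (rule trans[OF dual_map_comp[where \<chi> = "\<lambda>k. h \<cdot> (k \<cdot> f)"] dual_map_comp[symmetric]])
          (use comp_in_hom[OF f] comp_in_hom[OF _ h] comp_assoc[OF f _ h] in auto)
      then show "\<iota> c' a (?dm c' a f (dual_map (hom_space C c a) (\<lambda>k. h \<cdot> k) \<xi>)) = \<iota> c' b (?dm c' b f \<xi>) \<cdot> h"
        using nak_family_nat[OF fam[OF c'] h dmc[OF f b \<xi>]] by simp
    qed
    then show ?thesis unfolding Q_def by (rule nak_univ_ex[OF \<iota>[OF c]]) (intro exI conjI ballI)
  qed
  \<comment> \<open>Source and target are read off from the arrow, so one choice serves all
    Hom-sets.\<close>
  define T where "T f = (SOME t. Q (Dom C f) (Cod C f) f t)" for f
  have T_Q: "Q c c' f (T f)" if f: "f \<in> Hom C c c'" for f c c'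
  proof -
    have "Dom C f = c" "Cod C f = c'" using f by (simp_all add: Hom_def)
    then show ?thesis unfolding T_def using someI_ex[OF Q[OF f]] by simp
  qed
  have T: "T f \<in> Hom C (n c) (n c')" if "f \<in> Hom C c c'" for f c c'
    using T_Q[OF that] by (simp add: Q_def)
  have T\<iota>: "T f \<cdot> \<iota> c a \<xi> = \<iota> c' a (?dm c' a f \<xi>)"
    if f: "f \<in> Hom C c c'" and a: "a \<in> Obj C" and \<xi>: "\<xi> \<in> carrier (dual_space (hom_space C c a))" for f c c' a \<xi>
    using T_Q[OF f] a \<xi> by (simp add: Q_def)
  let ?N = "\<lparr>on_obj = n, on_arr = T\<rparr>"
  have nO: "n c \<in> Obj C" if "c \<in> Obj C" for c using fam[OF that] by (simp add: nak_family_def)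
  have F: "is_functor C C ?N"
  proof (unfold_locales, goal_cases)
    case (1 c) then show ?case using nO by simp
  next
    case (2 f c c') then show ?case using T by simp
  next
    case (3 c)
    have "T (Idt C c) = Idt C (n c)"
    proof (rule nak_univ_eqI[OF \<iota>[OF 3] T[OF id_in_hom[OF 3]] id_in_hom[OF nO[OF 3]]])
      fix a \<xi> assume a: "a \<in> Obj C" and \<xi>: "\<xi> \<in> carrier (dual_space (hom_space C c a))"
      have "?dm c a (Idt C c) \<xi> = \<xi>"
        by (rule dual_map_id[OF hom_vectorspace[OF 3 a] \<xi>]) (simp add: comp_id_right)
      then show "T (Idt C c) \<cdot> \<iota> c a \<xi> = Idt C (n c) \<cdot> \<iota> c a \<xi>"
        using T\<iota>[OF id_in_hom[OF 3] a \<xi>] comp_id_left[OF nak_family_hom[OF fam[OF 3] a \<xi>]] by simp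
    qed
    then show ?case by simp
  next
    case (4 f b c g d)
    note f = 4(1) and g = 4(2)
    have "T (g \<cdot> f) = T g \<cdot> T f"
    proof (rule nak_univ_eqI[OF \<iota>[OF hom_dom[OF f]] T[OF comp_in_hom[OF f g]] comp_in_hom[OF T[OF f] T[OF g]]])
      fix a \<xi> assume a: "a \<in> Obj C" and \<xi>: "\<xi> \<in> carrier (dual_space (hom_space C b a))"
      have "?dm d a g (?dm c a f \<xi>) = ?dm d a (g \<cdot> f) \<xi>"
        by (rule dual_map_comp) (use comp_in_hom[OF g] comp_assoc[OF f g] in auto)
      then show "T (g \<cdot> f) \<cdot> \<iota> b a \<xi> = (T g \<cdot> T f) \<cdot> \<iota> b a \<xi>"
        using T\<iota>[OF comp_in_hom[OF f g] a \<xi>] T\<iota>[OF f a \<xi>] T\<iota>[OF g a dmc[OF f a \<xi>]]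
          comp_assoc[OF nak_family_hom[OF fam[OF hom_dom[OF f]] a \<xi>] T[OF f] T[OF g]] by simp
    qed
    then show ?case by simp
  qed
  have "nakayama C ?N"
    unfolding nakayama_def using F \<iota> T\<iota> by (intro conjI exI[of _ \<iota>]) auto
  then show ?thesis by blast
qed

end


text \<open>The functor \<open>G\<close> of an equivalence is faithful because conjugation by
  \<open>\<epsilon>\<close> undoes \<open>F\<close> after \<open>G\<close>, and essentially
  surjective by \<open>\<eta>\<close>. Fullness also uses faithfulness of \<open>F\<close>.\<close>

lemma module_equivalence_if_finite_linear:
  fixes A :: "('k::field, 'o, 'm, 'z) lin_cat_scheme"
  assumes "finite_linear_category A"
  shows "\<exists>B G. module_equivalence A B G"
proof -
  obtain B :: "('k, 'k vec) module" where lin: "linear_category A" and B: "fd_algebra B"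
    and eqv: "linearly_equivalent A (module_cat B :: ('k, ('k, 'k vec) amod, ('k, 'k vec) amod \<times> ('k vec \<Rightarrow> 'k vec) \<times> ('k, 'k vec) amod) lin_cat)"
    using assms unfolding finite_linear_category_def by blast
  let ?M = "module_cat B :: ('k, ('k, 'k vec) amod, ('k, 'k vec) amod \<times> ('k vec \<Rightarrow> 'k vec) \<times> ('k, 'k vec) amod) lin_cat"
  obtain F G \<eta> \<epsilon> where F: "linear_functor A ?M F" and G: "linear_functor ?M A G"
    and \<eta>: "natural_isomorphism A A (comp_functor G F) id_functor \<eta>"
    and \<epsilon>: "natural_isomorphism ?M ?M (comp_functor F G) id_functor \<epsilon>"
    using eqv unfolding linearly_equivalent_def isomorphic_functors_def by blast
  interpret A: linear_category A by (rule lin)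
  interpret F: is_functor A ?M F using F by (simp add: linear_functor_def)
  interpret G: is_functor ?M A G using G by (simp add: linear_functor_def)
  have \<eta>a: "\<eta> a \<in> Hom A (on_obj G (on_obj F a)) a" "iso_arrow A (\<eta> a)" if "a \<in> Obj A" for a
    using \<eta> that by (auto simp: natural_isomorphism_def comp_functor_def id_functor_def)
  have \<eta>n: "\<eta> b \<cdot>\<^bsub>A\<^esub> on_arr G (on_arr F f) = f \<cdot>\<^bsub>A\<^esub> \<eta> a" if "f \<in> Hom A a b" for f a b
    using \<eta> that A.hom_dom[OF that] A.hom_cod[OF that]
    by (simp add: natural_isomorphism_def comp_functor_def id_functor_def)
  have \<epsilon>a: "\<epsilon> X \<in> Hom ?M (on_obj F (on_obj G X)) X" "iso_arrow ?M (\<epsilon> X)" if "X \<in> Obj ?M" for X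
    using \<epsilon> that by (auto simp: natural_isomorphism_def comp_functor_def id_functor_def)
  have \<epsilon>n: "\<epsilon> Y \<cdot>\<^bsub>?M\<^esub> on_arr F (on_arr G f) = f \<cdot>\<^bsub>?M\<^esub> \<epsilon> X" if "f \<in> Hom ?M X Y" for f X Y
    using \<epsilon> that F.D.hom_dom[OF that] F.D.hom_cod[OF that]
    by (simp add: natural_isomorphism_def comp_functor_def id_functor_def)
  have F_faithful: "f = f'" if f: "f \<in> Hom A a b" "f' \<in> Hom A a b" "on_arr F f = on_arr F f'" for f f' a b
    by (rule A.iso_cancel_right[OF \<eta>a(2)[OF A.hom_dom[OF f(1)]]])
      (use \<eta>n[OF f(1)] \<eta>n[OF f(2)] f \<eta>a(1)[OF A.hom_dom[OF f(1)]] in \<open>auto simp: Hom_def\<close>)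
  have "module_equivalence A B G"
  proof (rule module_equivalence.intro[OF lin], rule module_equivalence_axioms.intro[OF B G])
    fix X Y g assume X: "X \<in> Obj ?M" and Y: "Y \<in> Obj ?M" and g: "g \<in> Hom A (on_obj G X) (on_obj G Y)"
    note e = \<epsilon>a[OF X] and e' = \<epsilon>a[OF Y] and Fg = F.arr_map[OF g]
    note i = F.D.inv_arrow[OF e]
    let ?k = "\<epsilon> Y \<cdot>\<^bsub>?M\<^esub> on_arr F g"
    \<comment> \<open>The preimage of \<open>g\<close> is \<open>F g\<close> conjugated by
      \<open>\<epsilon>\<close>. Naturality of \<open>\<epsilon>\<close> shows that \<open>F\<close>
      maps \<open>G ?f\<close> and \<open>g\<close> to the same arrow, and \<open>F\<close> is
      faithful.\<close>
    let ?f = "?k \<cdot>\<^bsub>?M\<^esub> inv_arrow ?M (\<epsilon> X)"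
    have k: "?k \<in> Hom ?M (on_obj F (on_obj G X)) Y" by (rule F.D.comp_in_hom[OF Fg e'(1)])
    have f: "?f \<in> Hom ?M X Y" by (rule F.D.comp_in_hom[OF i(1) k])
    note Gf = G.arr_map[OF f]
    have "\<epsilon> Y \<cdot>\<^bsub>?M\<^esub> on_arr F (on_arr G ?f) = ?f \<cdot>\<^bsub>?M\<^esub> \<epsilon> X" by (rule \<epsilon>n[OF f])
    also have "\<dots> = ?k \<cdot>\<^bsub>?M\<^esub> Idt ?M (on_obj F (on_obj G X))"
      unfolding F.D.comp_assoc[OF e(1) i(1) k] i(2) ..
    also have "\<dots> = ?k" by (rule F.D.comp_id_right[OF k])
    finally have eq: "\<epsilon> Y \<cdot>\<^bsub>?M\<^esub> on_arr F (on_arr G ?f) = ?k" .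
    have "on_arr F (on_arr G ?f) = on_arr F g"
      by (rule F.D.iso_cancel_left[OF e'(2) _ _ _ _ _ eq])
        (use e'(1) Fg F.arr_map[OF Gf] in \<open>simp_all only: Hom_def mem_Collect_eq\<close>)
    then have "on_arr G ?f = g" by (rule F_faithful[OF Gf g])
    then show "\<exists>f\<in>Hom ?M X Y. on_arr G f = g" using f by blast
  next
    fix f f' X Y assume f: "f \<in> Hom ?M X Y" "f' \<in> Hom ?M X Y" and eq: "on_arr G f = on_arr G f'"
    note e = \<epsilon>a[OF F.D.hom_dom[OF f(1)]]
    have "f \<cdot>\<^bsub>?M\<^esub> \<epsilon> X = f' \<cdot>\<^bsub>?M\<^esub> \<epsilon> X"
      unfolding \<epsilon>n[OF f(1), symmetric] \<epsilon>n[OF f(2), symmetric] eq ..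
    then show "f = f'"
      by (rule F.D.iso_cancel_right[OF e(2), rotated 5])
        (use e(1) f in \<open>simp_all only: Hom_def mem_Collect_eq\<close>)
  next
    fix c assume c: "c \<in> Obj A"
    show "\<exists>X\<in>Obj ?M. \<exists>s\<in>Hom A (on_obj G X) c. iso_arrow A s"
      using F.obj_map[OF c] \<eta>a[OF c] by blast
  qed
  then show ?thesis by blast
qed


subsection \<open>Duality as an equivalence with the opposite category\<close>

text \<open>Both evaluations are universal pairings with \<open>d\<close>, so each factors through
  the other, and the two comparison arrows are mutually inverse by uniqueness. It serves to identify
  \<open>c\<close> with the left dual of its right dual.\<close>

lemma (in linear_monoidal_category) duality_unique:
  assumes 1: "duality A c d ev coev" and 2: "duality A c' d ev' coev'"
  shows "\<exists>k\<in>Hom A c c'. iso_arrow A k"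
proof -
  have ex: "\<exists>k\<in>Hom A x c. ev \<cdot> (idt d \<otimes>\<^sub>a k) = e" if dual: "duality A c d ev coev" and x: "x \<in> Obj A" and e: "e \<in> Hom A (d \<otimes>\<^sub>o x) \<I>"
    for x c ev coev e
  proof
    have "e \<in> Arr A" "Dom A e = d \<otimes>\<^sub>o x" "Cod A e = \<I>" using e by (auto simp: Hom_def)
    then show "ru c \<cdot> ltrans c d coev x e \<in> Hom A x c" using x ltrans_simps[OF dual x] ds[OF dual] by (simp add: Hom_def)
  qed (rule dual_transpose[OF dual x e])
  have eqI: "k = k'" if dual: "duality A c d ev coev" and k: "k \<in> Hom A x c" "k' \<in> Hom A x c"
    and eq: "ev \<cdot> (idt d \<otimes>\<^sub>a k) = ev \<cdot> (idt d \<otimes>\<^sub>a k')" for x c ev coev k k'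
    by (rule trans[OF dual_transpose_unique[OF dual k(1), unfolded eq, symmetric] dual_transpose_unique[OF dual k(2)]])
  have inv: "h \<cdot> k = idt c" if 1: "duality A c d ev coev" and 2: "duality A c' d ev' coev'"
    and k: "k \<in> Hom A c c'" "ev' \<cdot> (idt d \<otimes>\<^sub>a k) = ev" and h: "h \<in> Hom A c' c" "ev \<cdot> (idt d \<otimes>\<^sub>a h) = ev'"
    for c c' ev ev' coev coev' h k
  proof (rule eqI[OF 1 comp_in_hom[OF k(1) h(1)] id_in_hom])
    have a: "k \<in> Arr A" "Dom A k = c" "Cod A k = c'" "h \<in> Arr A" "Dom A h = c'" "Cod A h = c"
      using h k by (auto simp: Hom_def)
    have "ev \<cdot> (idt d \<otimes>\<^sub>a (h \<cdot> k)) = ev \<cdot> ((idt d \<otimes>\<^sub>a h) \<cdot> (idt d \<otimes>\<^sub>a k))"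
      using a ds[OF 1] by (simp add: interchange)
    also have "\<dots> = ev' \<cdot> (idt d \<otimes>\<^sub>a k)" using a ds[OF 1] by (intro comp_reassoc h(2)) simp_all
    finally show "ev \<cdot> (idt d \<otimes>\<^sub>a (h \<cdot> k)) = ev \<cdot> (idt d \<otimes>\<^sub>a idt c)" using k(2) ds[OF 1] by simp
  qed (simp add: ds[OF 1])
  have hom: "ev \<in> Hom A (d \<otimes>\<^sub>o c) \<I>" "ev' \<in> Hom A (d \<otimes>\<^sub>o c') \<I>" "c \<in> Obj A" "c' \<in> Obj A"
    using ds[OF 1] ds[OF 2] by (auto simp: Hom_def)
  obtain k h where k: "k \<in> Hom A c c'" "ev' \<cdot> (idt d \<otimes>\<^sub>a k) = ev" and h: "h \<in> Hom A c' c" "ev \<cdot> (idt d \<otimes>\<^sub>a h) = ev'"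
    using ex[OF 2 hom(3) hom(1)] ex[OF 1 hom(4) hom(2)] by blast
  have "iso_arrow A k" by (rule iso_arrowI[OF k(1) h(1) inv[OF 1 2 k h] inv[OF 2 1 h k]])
  then show ?thesis using k(1) by blast
qed

context rigid_linear_monoidal_category
begin

lemma ldual_hom: "f \<in> Hom A a b \<Longrightarrow> ldual_arr A f \<in> Hom A (ld b) (ld a)"
  by (auto simp: Hom_def)

lemma ldual_lin:
  assumes a: "a \<in> Obj A" and b: "b \<in> Obj A"
  shows "ldual_arr A \<in> linear_maps (hom_space A a b) (hom_space A (ld b) (ld a))"
proof (rule lin_cong)
  have i: "idt (ld b) \<in> Hom A (ld b) (ld b)" "lev b \<in> Hom A (b \<otimes>\<^sub>o ld b) \<I>" "idt (ld a) \<in> Hom A (ld a) (ld a)"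
    "uu a (ld b) \<in> Hom A (ld b) (ld a \<otimes>\<^sub>o (a \<otimes>\<^sub>o ld b))" "ru (ld a) \<in> Hom A (ld a \<otimes>\<^sub>o \<I>) (ld a)"
    using a b by (auto simp: Hom_def)
  have o: "a \<otimes>\<^sub>o ld b \<in> Obj A" "ld a \<otimes>\<^sub>o \<I> \<in> Obj A" "ld b \<in> Obj A" using a b by simp_all
  show "(\<lambda>f. ru (ld a) \<cdot> ((idt (ld a) \<otimes>\<^sub>a (lev b \<cdot> (f \<otimes>\<^sub>a idt (ld b)))) \<cdot> uu a (ld b)))
    \<in> linear_maps (hom_space A a b) (hom_space A (ld b) (ld a))"
    by (rule lin_comp[OF tensor_linear_left[OF a b i(1)] lin_comp[OF comp_linear_right[OF o(1) i(2)]
        lin_comp[OF tensor_linear_right[OF o(1) unit_obj i(3)]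
        lin_comp[OF comp_linear_left[OF o(2) i(4)] comp_linear_right[OF o(3) i(5)]]]]])
  show "ru (ld a) \<cdot> ((idt (ld a) \<otimes>\<^sub>a (lev b \<cdot> (f \<otimes>\<^sub>a idt (ld b)))) \<cdot> uu a (ld b)) = ldual_arr A f"
    if "f \<in> carrier (hom_space A a b)" for f
    using that a ldual_arr_eq[of f] by (simp add: Hom_def tr_def)
qed (rule hom_vectorspace[OF a b])

text \<open>By \<open>ldual_mate\<close> the dual arrow determines the pairing of \<open>a\<close>
  with \<open>ld b\<close> given by \<open>f\<close>. In the reversed category \<open>lev b\<close>
  is universal among such pairings, so \<open>f\<close> can be recovered.\<close>

lemma ldual_faithful:
  assumes f: "f \<in> Hom A a b" "f' \<in> Hom A a b" and eq: "ldual_arr A f = ldual_arr A f'"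
  shows "f = f'"
proof -
  note b = hom_cod[OF f(1)]
  have e: "lev b \<cdot> (f \<otimes>\<^sub>a idt (ld b)) = lev b \<cdot> (f' \<otimes>\<^sub>a idt (ld b))"
    using f ldual_mate[of f] ldual_mate[of f'] by (simp add: Hom_def eq)
  have d: "duality (rev_mon A) b (ld b) (lev b) (lcoev b)"
    unfolding duality_rev by (rule left_dual[OF b])
  interpret R: linear_monoidal_category "rev_mon A" by (rule rev_mon_monoidal)
  show ?thesis
    by (rule trans[OF R.dual_transpose_unique[OF d, simplified, OF f(1), unfolded e, symmetric]
        R.dual_transpose_unique[OF d, simplified, OF f(2)]])
qed

text \<open>The pairing of \<open>a\<close> with \<open>ld b\<close> defined by \<open>g\<close> is
  solved for an arrow on the other tensor factor, by the universal pairing \<open>lev b\<close> in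
  the reversed category.\<close>

lemma ldual_full:
  assumes a: "a \<in> Obj A" and b: "b \<in> Obj A" and g: "g \<in> Hom A (ld b) (ld a)"
  shows "\<exists>f\<in>Hom A a b. ldual_arr A f = g"
proof -
  let ?e = "lev a \<cdot> (idt a \<otimes>\<^sub>a g)"
  have e: "?e \<in> Hom A (a \<otimes>\<^sub>o ld b) \<I>" using a b g by (simp add: Hom_def)
  have d: "duality (rev_mon A) b (ld b) (lev b) (lcoev b)"
    unfolding duality_rev by (rule left_dual[OF b])
  interpret R: linear_monoidal_category "rev_mon A" by (rule rev_mon_monoidal)
  let ?f = "lu b \<cdot> R.ltrans b (ld b) (lcoev b) a ?e"
  have "R.ltrans b (ld b) (lcoev b) a ?e \<in> Hom A a (\<I> \<otimes>\<^sub>o b)"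
    using R.ltrans_simps[OF d, of a ?e] a e by (simp add: Hom_def)
  then have f: "?f \<in> Hom A a b" using b by (simp add: Hom_def)
  have t: "lev b \<cdot> (?f \<otimes>\<^sub>a idt (ld b)) = ?e"
    using R.dual_transpose[OF d, of a ?e] a e by simp
  have "ldual_arr A ?f = g"
  proof (rule ldual_eqI[OF a ldual_hom[OF f] g])
    show "lev a \<cdot> (idt a \<otimes>\<^sub>a ldual_arr A ?f) = ?e"
      using ldual_mate[of ?f] f t by (simp add: Hom_def)
  qed
  then show ?thesis using f by blast
qed

lemma ldual_iso:
  assumes s: "s \<in> Hom A a b" "iso_arrow A s"
  shows "iso_arrow A (ldual_arr A s)"
proof -
  note i = inv_arrow[OF s]
  show ?thesis
  proof (rule iso_arrowI[OF ldual_hom[OF s(1)] ldual_hom[OF i(1)]])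
    show "ldual_arr A (inv_arrow A s) \<cdot> ldual_arr A s = idt (ld b)"
      using ldual_comp[of "inv_arrow A s" s] s(1) i hom_cod[OF s(1)] by (simp add: Hom_def ldual_id)
    show "ldual_arr A s \<cdot> ldual_arr A (inv_arrow A s) = idt (ld a)"
      using ldual_comp[of s "inv_arrow A s"] s(1) i hom_dom[OF s(1)] by (simp add: Hom_def ldual_id)
  qed
qed

text \<open>Taking left duals is a fully faithful linear functor to the opposite category, and
  composing it with \<open>G\<close> leaves the algebra unchanged. This replaces the usual passage
  to the opposite algebra by linear duality of modules.\<close>

lemma module_equivalence_op:
  assumes "module_equivalence A B G"
  shows "module_equivalence (op_mon A) B \<lparr>on_obj = (\<lambda>X. ld (on_obj G X)), on_arr = (\<lambda>f. ldual_arr A (on_arr G f))\<rparr>"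
    (is "module_equivalence _ _ ?G")
proof -
  interpret E: module_equivalence A B G by (rule assms)
  interpret G: is_functor E.MB A G using E.G by (simp add: linear_functor_def)
  have "linear_category A" by unfold_locales
  then have op: "linear_category (op_mon A)" by (rule op_mon_linear)
  have "category A" by unfold_locales
  then have cop: "category (op_mon A)" by (rule category_op_mon)
  have fG: "is_functor E.MB (op_mon A) ?G"
  proof (rule is_functor.intro[OF G.C.category_axioms cop], rule is_functor_axioms.intro, goal_cases)
    case (1 X) then show ?case using G.obj_map by simp
  next
    case (2 f X Y) then show ?case using ldual_hom[OF G.arr_map] by simp
  next
    case (3 X) then show ?case using G.obj_map by (simp add: G.id_map ldual_id)
  next
    case (4 f X Y g Z)
    then show ?case using G.arr_map[OF 4(1)] G.arr_map[OF 4(2)] by (simp add: G.comp_map[OF 4] ldual_comp Hom_def)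
  qed
  show ?thesis
  proof (rule module_equivalence.intro[OF op], rule module_equivalence_axioms.intro[OF E.algebra])
    show "linear_functor E.MB (op_mon A) ?G"
      unfolding linear_functor_def
    proof (intro conjI fG ballI)
      fix X Y assume X: "X \<in> Obj E.MB" and Y: "Y \<in> Obj E.MB"
      show "on_arr ?G \<in> linear_maps (hom_space E.MB X Y) (hom_space (op_mon A) (on_obj ?G X) (on_obj ?G Y))"
        using lin_comp[OF E.G_lin[OF X Y] ldual_lin[OF G.obj_map[OF X] G.obj_map[OF Y]]] by simp
    qed
  next
    fix X Y g assume X: "X \<in> Obj E.MB" and Y: "Y \<in> Obj E.MB"
      and g: "g \<in> Hom (op_mon A) (on_obj ?G X) (on_obj ?G Y)"
    then obtain h where "h \<in> Hom A (on_obj G X) (on_obj G Y)" "ldual_arr A h = g"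
      using ldual_full[OF G.obj_map[OF X] G.obj_map[OF Y]] by auto
    then show "\<exists>f\<in>Hom E.MB X Y. on_arr ?G f = g" using E.G_full[OF X Y] by fastforce
  next
    fix f f' X Y assume f: "f \<in> Hom E.MB X Y" "f' \<in> Hom E.MB X Y" and eq: "on_arr ?G f = on_arr ?G f'"
    have "on_arr G f = on_arr G f'"
      by (rule ldual_faithful[OF G.arr_map[OF f(1)] G.arr_map[OF f(2)]]) (use eq in simp)
    then show "f = f'" by (rule E.G_faithful[OF f])
  next
    fix c assume "c \<in> Obj (op_mon A)"
    then have c: "c \<in> Obj A" unfolding op_mon_simps .
    \<comment> \<open>Every \<open>c\<close> is isomorphic to the left dual of its right dual, and
      the right dual lies in the essential image of \<open>G\<close>.\<close>
    note r = right_dual[OF c]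
    have rd: "rdual A c \<in> Obj A" by (rule dual_obj(2)[OF r])
    obtain k where k: "k \<in> Hom A c (ld (rdual A c))" "iso_arrow A k"
      by (rule bexE[OF duality_unique[OF r left_dual[OF rd]]])
    obtain X s where X: "X \<in> Obj E.MB" and s: "s \<in> Hom A (on_obj G X) (rdual A c)" "iso_arrow A s"
      by (rule bexE[OF E.G_ess[OF rd]], erule bexE)
    note sk = comp_in_hom[OF k(1) ldual_hom[OF s(1)]] iso_comp[OF k ldual_hom[OF s(1)] ldual_iso[OF s]]
    show "\<exists>X\<in>Obj E.MB. \<exists>s\<in>Hom (op_mon A) (on_obj ?G X) c. iso_arrow (op_mon A) s"
      using X sk by auto
  qed
qed

end


subsection \<open>Reversed and opposite categories\<close>

lemma nakayama_rev_mon: "nakayama (rev_mon A) N \<longleftrightarrow> nakayama A N"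
  by (simp add: nakayama_def nak_univ_def nak_family_def)

lemma isomorphic_functors_rev_mon:
  "isomorphic_functors (rev_mon A) (rev_mon A) F G \<longleftrightarrow> isomorphic_functors A A F G"
  by (simp add: isomorphic_functors_def natural_isomorphism_def)

lemma is_functor_op_op: "is_functor (op_mon A) (op_mon A) N \<longleftrightarrow> is_functor (op_lin A) (op_lin A) N"
  by (simp add: is_functor_def is_functor_axioms_def category_def)

lemma nakayama_op_lin: "nakayama (op_mon A) N \<longleftrightarrow> nakayama (op_lin A) N"
  unfolding nakayama_op_mon is_functor_op_op by (simp add: nakayama_def)

lemma (in linear_monoidal_category) is_functor_op_monD:
  assumes "is_functor (op_mon A) (op_mon A) N"
  shows "is_functor A A N"
proof -
  interpret N: is_functor "op_mon A" "op_mon A" N by (rule assms)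
  show ?thesis
    by unfold_locales (use N.obj_map N.arr_map N.id_map N.comp_map in auto)
qed

lemma (in linear_monoidal_category) isomorphic_functors_op_mon:
  assumes "isomorphic_functors (op_mon A) (op_mon A) F G"
  shows "isomorphic_functors A A F G"
proof -
  obtain \<eta> where "natural_isomorphism (op_mon A) (op_mon A) F G \<eta>" using assms by (auto simp: isomorphic_functors_def)
  \<comment> \<open>Read in \<open>A\<close>, the components point the other way, so symmetry of
    isomorphism is used at the end.\<close>
  then have "natural_isomorphism A A G F \<eta>"
    by (simp add: natural_isomorphism_def is_functor_op_monD)
  then have "isomorphic_functors A A G F" by (auto simp: isomorphic_functors_def)
  then show ?thesis by (rule isomorphic_functors_sym)
qed

lemma ldual_arr_rev_mon: "ldual_arr (rev_mon A) = rdual_arr A"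
  by (simp add: ldual_arr_def rdual_arr_def fun_eq_iff)

lemma left_double_dual_rev_mon: "left_double_dual (rev_mon A) = right_double_dual A"
  by (simp add: left_double_dual_def right_double_dual_def ldual_arr_rev_mon)

context rigid_linear_monoidal_category
begin

lemma nakayama_iso_left:
  assumes "nakayama A N"
  shows "isomorphic_functors A A N (tensor_on_left A (on_obj N \<I>) (right_double_dual A))"
proof -
  have "isomorphic_functors (rev_mon A) (rev_mon A) N
    (tensor_on_right (rev_mon A) (left_double_dual (rev_mon A)) (on_obj N \<I>\<^bsub>rev_mon A\<^esub>))"
    using assms by (intro rigid_linear_monoidal_category.nakayama_iso[OF rev_mon_rigid]) (simp add: nakayama_rev_mon)
  then show ?thesis
    by (simp add: isomorphic_functors_rev_mon left_double_dual_rev_mon tensor_on_right_def tensor_on_left_def)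
qed

lemma rdual_simps [simp]:
  assumes "c \<in> Obj A"
  shows "rdual A c \<in> Obj A" "rev_arr A c \<in> Arr A" "Dom A (rev_arr A c) = rdual A c \<otimes>\<^sub>o c" "Cod A (rev_arr A c) = \<I>"
    "rcoev_arr A c \<in> Arr A" "Dom A (rcoev_arr A c) = \<I>" "Cod A (rcoev_arr A c) = c \<otimes>\<^sub>o rdual A c"
  using ds[OF right_dual[OF assms]] by auto

lemma rdual_arr_simps [simp]:
  assumes "f \<in> Arr A"
  shows "rdual_arr A f \<in> Arr A" "Dom A (rdual_arr A f) = rdual A (Cod A f)" "Cod A (rdual_arr A f) = rdual A (Dom A f)"
  using rigid_linear_monoidal_category.ldual_arr_simps[OF rev_mon_rigid, of f] assms
  by (simp_all add: ldual_arr_rev_mon)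

text \<open>Both composites use the same evaluation and coevaluation; they differ in whether the
  associator is applied before or after \<open>f\<close>, which its naturality repairs.\<close>

lemma ldual_arr_op_mon:
  assumes f: "f \<in> Arr A"
  shows "ldual_arr (op_mon A) f = rdual_arr A f"
proof -
  let ?c = "rdual A (Dom A f)" and ?d = "rdual A (Cod A f)"
  have n: "\<alpha>i ?d (Cod A f) ?c \<cdot> (idt ?d \<otimes>\<^sub>a (f \<otimes>\<^sub>a idt ?c)) = ((idt ?d \<otimes>\<^sub>a f) \<otimes>\<^sub>a idt ?c) \<cdot> \<alpha>i ?d (Dom A f) ?c"
    using associ_nat[of "idt ?d" f "idt ?c"] f by simp
  have "rdual_arr A f = lu ?c \<cdot> ((rev_arr A (Cod A f) \<otimes>\<^sub>a idt ?c) \<cdot> (\<alpha>i ?d (Cod A f) ?c \<cdot>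
    ((idt ?d \<otimes>\<^sub>a (f \<otimes>\<^sub>a idt ?c)) \<cdot> ((idt ?d \<otimes>\<^sub>a rcoev_arr A (Dom A f)) \<cdot> rui ?d))))"
    unfolding rdual_arr_def Let_def by (subst comp_ass6) (use f in simp_all)
  also have "\<dots> = lu ?c \<cdot> ((rev_arr A (Cod A f) \<otimes>\<^sub>a idt ?c) \<cdot> (((idt ?d \<otimes>\<^sub>a f) \<otimes>\<^sub>a idt ?c) \<cdot>
    (\<alpha>i ?d (Dom A f) ?c \<cdot> ((idt ?d \<otimes>\<^sub>a rcoev_arr A (Dom A f)) \<cdot> rui ?d))))"
  proof -
    let ?u = "(idt ?d \<otimes>\<^sub>a rcoev_arr A (Dom A f)) \<cdot> rui ?d"
    have u: "?u \<in> Arr A" "Cod A ?u = ?d \<otimes>\<^sub>o (Dom A f \<otimes>\<^sub>o ?c)" using f by simp_all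
    have "\<alpha>i ?d (Cod A f) ?c \<cdot> ((idt ?d \<otimes>\<^sub>a (f \<otimes>\<^sub>a idt ?c)) \<cdot> ?u) = (((idt ?d \<otimes>\<^sub>a f) \<otimes>\<^sub>a idt ?c) \<cdot> \<alpha>i ?d (Dom A f) ?c) \<cdot> ?u"
      by (rule comp_reassoc[OF n]) (use f u in simp_all)
    also have "\<dots> = ((idt ?d \<otimes>\<^sub>a f) \<otimes>\<^sub>a idt ?c) \<cdot> (\<alpha>i ?d (Dom A f) ?c \<cdot> ?u)"
      by (rule comp_ass) (use f u in simp_all)
    finally show ?thesis by (rule arg_cong)
  qed
  also have "\<dots> = ldual_arr (op_mon A) f"
  proof -
    have "inv_arrow A (lui ?c) = lu ?c" by (rule inv_inv) (use f in simp_all)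
    then show ?thesis by (simp only: ldual_arr_def Let_def op_mon_simps op_mon_cat)
  qed
  finally show ?thesis by simp
qed

lemma left_double_dual_op_mon:
  "on_obj (left_double_dual (op_mon A)) = on_obj (right_double_dual A)"
  "f \<in> Arr A \<Longrightarrow> on_arr (left_double_dual (op_mon A)) f = on_arr (right_double_dual A) f"
  by (simp_all add: left_double_dual_def right_double_dual_def ldual_arr_op_mon)

text \<open>Obtained from \<open>ldual_arr_op_mon\<close> for the reversed category, in which the
  two kinds of duals of arrows are exchanged.\<close>

lemma rdual_arr_op_mon:
  assumes f: "f \<in> Arr A"
  shows "rdual_arr (op_mon A) f = ldual_arr A f"
proof -
  have "rdual_arr (op_mon A) f = ldual_arr (op_mon (rev_mon A)) f"
    by (simp only: ldual_arr_def rdual_arr_def Let_def op_mon_simps op_mon_cat rev_mon_simps rev_mon_cat)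
  also have "\<dots> = rdual_arr (rev_mon A) f"
    using rigid_linear_monoidal_category.ldual_arr_op_mon[OF rev_mon_rigid] f by simp
  also have "\<dots> = ldual_arr A f"
  proof -
    let ?c = "ld (Dom A f)" and ?d = "ld (Cod A f)"
    have "inv_arrow A (\<alpha>i ?c (Cod A f) ?d) = \<alpha> ?c (Cod A f) ?d" by (rule inv_inv) (use f in simp_all)
    then show ?thesis by (simp only: ldual_arr_def rdual_arr_def Let_def rev_mon_simps rev_mon_cat)
  qed
  finally show ?thesis .
qed

lemma right_double_dual_op_mon:
  "on_obj (right_double_dual (op_mon A)) = on_obj (left_double_dual A)"
  "f \<in> Arr A \<Longrightarrow> on_arr (right_double_dual (op_mon A)) f = on_arr (left_double_dual A) f"
  by (simp_all add: left_double_dual_def right_double_dual_def rdual_arr_op_mon)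

lemma nakayama_op_iso_right:
  assumes N: "nakayama (op_mon A) N"
  shows "isomorphic_functors A A N (tensor_on_right A (right_double_dual A) (on_obj N \<I>))"
proof -
  let ?F = "tensor_on_right (op_mon A) (left_double_dual (op_mon A)) (on_obj N \<I>)"
  have 1: "isomorphic_functors A A N ?F"
    by (rule isomorphic_functors_op_mon)
      (use rigid_linear_monoidal_category.nakayama_iso[OF op_mon_rigid N] in simp)
  then have F: "is_functor A A ?F" by (auto simp: isomorphic_functors_def natural_isomorphism_def)
  \<comment> \<open>The double duals of \<open>A\<close> and of its opposite agree only on arrows of
    \<open>A\<close>, so the functor records are isomorphic but need not be equal.\<close>
  have "isomorphic_functors A A ?F (tensor_on_right A (right_double_dual A) (on_obj N \<I>))"
    by (rule isomorphic_functors_cong[OF F]) (simp_all add: tensor_on_right_def left_double_dual_op_mon)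
  with 1 show ?thesis by (rule isomorphic_functors_trans)
qed

lemma nakayama_op_iso_left:
  assumes N: "nakayama (op_mon A) N"
  shows "isomorphic_functors A A N (tensor_on_left A (on_obj N \<I>) (left_double_dual A))"
proof -
  let ?F = "tensor_on_left (op_mon A) (on_obj N \<I>) (right_double_dual (op_mon A))"
  have 1: "isomorphic_functors A A N ?F"
    by (rule isomorphic_functors_op_mon)
      (use rigid_linear_monoidal_category.nakayama_iso_left[OF op_mon_rigid N] in simp)
  then have F: "is_functor A A ?F" by (auto simp: isomorphic_functors_def natural_isomorphism_def)
  have "isomorphic_functors A A ?F (tensor_on_left A (on_obj N \<I>) (left_double_dual A))"
    by (rule isomorphic_functors_cong[OF F]) (simp_all add: tensor_on_left_def right_double_dual_op_mon)
  with 1 show ?thesis by (rule isomorphic_functors_trans)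
qed

end


theorem lemma4p10:
  fixes A :: "('k::alg_closed_field, 'o, 'm) rigid_cat"
  assumes "finite_multitensor_category A"
  shows
    "(\<exists>N. left_nakayama A N) \<and>
     (\<exists>N. right_nakayama A N) \<and>
     (\<forall>N. left_nakayama A N \<longrightarrow>
       (let D = on_obj N (unit_obj A) in
          isomorphic_functors A A N (tensor_on_left A D (left_double_dual A)) \<and>
          isomorphic_functors A A (tensor_on_left A D (left_double_dual A))
            (tensor_on_right A (right_double_dual A) D))) \<and>
     (\<forall>N. right_nakayama A N \<longrightarrow>
       (let D = on_obj N (unit_obj A) in
          isomorphic_functors A A N (tensor_on_left A D (right_double_dual A)) \<and>
          isomorphic_functors A A (tensor_on_left A D (right_double_dual A))
            (tensor_on_right A (left_double_dual A) D)))"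
proof -
  interpret rigid_linear_monoidal_category A using assms by (simp add: finite_multitensor_category_def)
  obtain B G where E: "module_equivalence A B G"
    using module_equivalence_if_finite_linear[of A] assms unfolding finite_multitensor_category_def by blast
  interpret E: module_equivalence A B G by (rule E)
  \<comment> \<open>Kept polymorphic in the vectors: the end needs a tensoring by Hom-spaces, the
    coend one by spaces of functionals on them.\<close>
  note tensoring = module_equivalence.tensoring_exists[OF E]
  have "\<exists>N. left_nakayama A N"
  proof -
    obtain \<Theta> :: "('k, 'm, 'o, 'm) tensoring" where \<Theta>: "is_tensoring A \<Theta>" using tensoring by blast
    \<comment> \<open>The universal families come from the opposite category, which is again
      equivalent to modules over \<open>B\<close>, while the tensoring remains that of
      \<open>A\<close>.\<close>
    obtain N where N: "nakayama (op_mon A) N"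
      using module_equivalence.nakayama_exists[OF module_equivalence_op[OF E]] by blast
    have "left_nakayama A N"
    proof (rule E.nakayama_op_imp_left[OF \<Theta>])
      show "nakayama (op_lin A) N" using N by (simp add: nakayama_op_lin)
      show "is_functor A A N" by (rule is_functor_op_monD) (use N in \<open>simp add: nakayama_op_mon\<close>)
    qed
    then show ?thesis by blast
  qed
  moreover have "\<exists>N. right_nakayama A N"
  proof -
    obtain \<Theta> :: "('k, 'm \<Rightarrow> 'k, 'o, 'm) tensoring" where \<Theta>: "is_tensoring A \<Theta>" using tensoring by blast
    obtain N where "nakayama A N" using E.nakayama_exists by blast
    then show ?thesis using E.nakayama_imp_right[OF \<Theta>] by blast
  qed
  moreover have "isomorphic_functors A A N (tensor_on_left A (on_obj N \<I>\<^bsub>A\<^esub>) (left_double_dual A)) \<and>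
      isomorphic_functors A A (tensor_on_left A (on_obj N \<I>\<^bsub>A\<^esub>) (left_double_dual A))
        (tensor_on_right A (right_double_dual A) (on_obj N \<I>\<^bsub>A\<^esub>))" if "left_nakayama A N" for N
  proof -
    have N: "nakayama (op_mon A) N" using E.left_imp_nakayama_op[OF that] by (simp add: nakayama_op_lin)
    note l = nakayama_op_iso_left[OF N]
    show ?thesis
      using l isomorphic_functors_trans[OF isomorphic_functors_sym[OF l] nakayama_op_iso_right[OF N]] by blast
  qed
  moreover have "isomorphic_functors A A N (tensor_on_left A (on_obj N \<I>\<^bsub>A\<^esub>) (right_double_dual A)) \<and>
      isomorphic_functors A A (tensor_on_left A (on_obj N \<I>\<^bsub>A\<^esub>) (right_double_dual A))
        (tensor_on_right A (left_double_dual A) (on_obj N \<I>\<^bsub>A\<^esub>))" if "right_nakayama A N" for N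
  proof -
    note N = E.right_imp_nakayama[OF that]
    note l = nakayama_iso_left[OF N]
    show ?thesis
      using l isomorphic_functors_trans[OF isomorphic_functors_sym[OF l] nakayama_iso[OF N]] by blast
  qed
  ultimately show ?thesis by (simp add: Let_def)
qed

end
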